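(* Consider the general coding structure (described in the context), with $C_{\infty,n}=C_{\infty,n}(\mathcal P)$ the infinite-horizon information capacity with encoder dimension $n+1$. (i) $C_{\infty,n}$ is increasing (i.e. non-decreasing) in $n$; (ii) For a channel $\mathcal F$ of order $m\ge1$, $C_{\infty,n}=C_\infty$ for all $n\ge m-1$.
   Context: Conventions. $'$ denotes transpose, $x^T$ denotes the stacked column vector of $x_0,\dots,x_T$, $\log$ is to base 2; $\mathcal P>0$ is the power budget. Channel. $\mathcal Z(z)$ is a single-input single-output finite-dimensional LTI transfer function, stable and minimum phase, with $\mathcal Z(\infty)=1$. $\mathcal Z^{-1}$ has minimal realization $(F,G,H,1)$ with $F\in\mathbb R^{m\times m}$ stable; $m$ is the order of the channel. $\{N_t\}$ is white Gaussian noise, zero mean, unit variance. The channel $\mathcal F$ is $s_{t+1}=Fs_t+Gu_t$, $y_t=Hs_t+u_t+N_t$, $s_0=0$. Feedback capacity. $C_\infty=C_\infty(\mathcal P)$ is the supremum of $\lim_{T\to\infty}\frac1{T+1}I(u^T\to y^T)$, where $I(u^T\to y^T)=\sum_{t=0}^TI(u^t;y_t\mid y^{t-1})$, over (asymptotically) stationary inputs $u_t=\gamma_tu^{t-1}+\eta_ty^{t-1}+\xi_t$ ($\gamma_t,\eta_t\in\mathbb R^{1\times t}$, $\xi_t$ zero-mean Gaussian independent of $u^{t-1},y^{t-1}$) with $\lim_{T\to\infty}\frac1{T+1}\mathbf E(u^T)'u^T\le\mathcal P$. General coding structure. $W\sim\mathcal N(0,I_{n+1})$ independent of the noise; $x_0=W$,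 $x_{t+1}=Ax_t$, $r_t=Cx_t$, $u_t=r_t-\hat r_t$, with $A\in\mathbb R^{(n+1)\times(n+1)}$, $C\in\mathbb R^{1\times(n+1)}$, $(A,C)$ observable, and no eigenvalue of $A$ on the unit circle or equal to an eigenvalue of $F$. Feedback: $-\hat r^T=\mathcal G_Ty^T$ for every $T$, where $\mathcal G_T\in\mathbb R^{(T+1)\times(T+1)}$ is strictly lower triangular; $\mathcal G_\infty$ denotes such a strictly causal linear feedback generator over the infinite horizon. $$C_{\infty,n}(\mathcal P):=\sup_{A\in\mathbb R^{(n+1)\times(n+1)},\,C,\,\mathcal G_\infty}\ \lim_{T\to\infty}\frac1{T+1}I(W;y^T)\quad\text{subject to}\quad \lim_{T\to\infty}\frac1{T+1}\mathbf E(u^T)'u^T\le\mathcal P .$$ *)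

theory Defs
  imports "HOL-Probability.Probability" "Jordan_Normal_Form.Gauss_Jordan_Elimination"
    "Jordan_Normal_Form.Char_Poly"
begin

type_synonym rvec = "real Matrix.vec"
type_synonym rmat = "real Matrix.mat"

abbreviation cmat :: "rmat \<Rightarrow> complex Matrix.mat" where
  "cmat \<equiv> map_mat complex_of_real"

abbreviation cvec :: "rvec \<Rightarrow> complex Matrix.vec" where
  "cvec \<equiv> map_vec complex_of_real"

abbreviation cpoly :: "real poly \<Rightarrow> complex \<Rightarrow> complex" where
  "cpoly p \<equiv> poly (map_poly complex_of_real p)"

text \<open>A single-input single-output finite-dimensional discrete-time transfer function is a real
  rational function \<open>num / den\<close>.\<close>

definition rational_tf :: "real poly \<Rightarrow> real poly \<Rightarrow> complex \<Rightarrow> complex" where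
  "rational_tf num den z = cpoly num z / cpoly den z"

text \<open>For coprime \<open>num\<close> and \<open>den\<close> the poles and zeros are the roots of \<open>den\<close> and of \<open>num\<close>.\<close>

definition stable_min_phase :: "real poly \<Rightarrow> real poly \<Rightarrow> bool" where
  "stable_min_phase num den \<longleftrightarrow>
     num \<noteq> 0 \<and> den \<noteq> 0 \<and> coprime num den \<and>
     (\<forall>z. cpoly den z = 0 \<longrightarrow> cmod z < 1) \<and>
     (\<forall>z. cpoly num z = 0 \<longrightarrow> cmod z < 1)"

definition stable_mat :: "rmat \<Rightarrow> bool" where
  "stable_mat F \<longleftrightarrow> (\<forall>z. eigenvalue (cmat F) z \<longrightarrow> cmod z < 1)"

definition state_space_dims :: "nat \<Rightarrow> rmat \<Rightarrow> rvec \<Rightarrow> rvec \<Rightarrow> bool" where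
  "state_space_dims m F G H \<longleftrightarrow>
     F \<in> carrier_mat m m \<and> G \<in> carrier_vec m \<and> H \<in> carrier_vec m"

text \<open>\<open>H (z I - F)\<^sup>-\<^sup>1 G + 1\<close>, meaningful when \<open>z\<close> is not an eigenvalue of \<open>F\<close>; the column
  \<open>G\<close> and the row \<open>H\<close> are represented by vectors.\<close>

definition state_space_tf :: "nat \<Rightarrow> rmat \<Rightarrow> rvec \<Rightarrow> rvec \<Rightarrow> complex \<Rightarrow> complex" where
  "state_space_tf m F G H z =
     scalar_prod (cvec H) (the (mat_inverse (z \<cdot>\<^sub>m 1\<^sub>m m - cmat F)) *\<^sub>v cvec G) + 1"

definition realizes :: "nat \<Rightarrow> rmat \<Rightarrow> rvec \<Rightarrow> rvec \<Rightarrow> real poly \<Rightarrow> real poly \<Rightarrow> bool" where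
  "realizes m F G H num den \<longleftrightarrow>
     state_space_dims m F G H \<and>
     (\<forall>z. \<not> eigenvalue (cmat F) z \<longrightarrow> cpoly den z \<noteq> 0 \<longrightarrow>
        state_space_tf m F G H z = rational_tf num den z)"

definition minimal_realization ::
    "nat \<Rightarrow> rmat \<Rightarrow> rvec \<Rightarrow> rvec \<Rightarrow> real poly \<Rightarrow> real poly \<Rightarrow> bool" where
  "minimal_realization m F G H num den \<longleftrightarrow>
     realizes m F G H num den \<and>
     (\<forall>m' F' G' H'. realizes m' F' G' H' num den \<longrightarrow> m \<le> m')"

primrec channel_state :: "rmat \<Rightarrow> rvec \<Rightarrow> (nat \<Rightarrow> real) \<Rightarrow> nat \<Rightarrow> rvec" where
  "channel_state F G u 0 = 0\<^sub>v (dim_vec G)"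
| "channel_state F G u (Suc t) = F *\<^sub>v channel_state F G u t + u t \<cdot>\<^sub>v G"

text \<open>All processes live on one space carrying two independent sequences of independent standard
  normal variables. The first is the channel noise; the second supplies the messages and leaves
  room for the randomization of the inputs. Only joint laws matter below, and every
  joint law admitted by the definitions below is realized on this space.\<close>

definition gauss_space :: "(nat + nat \<Rightarrow> real) measure" where
  "gauss_space = PiM UNIV (\<lambda>_. std_normal_distribution)"

type_synonym process = "nat \<Rightarrow> (nat + nat \<Rightarrow> real) \<Rightarrow> real"

definition noise :: process where
  "noise t \<omega> = \<omega> (Inl t)"

definition message :: process where
  "message i \<omega> = \<omega> (Inr i)"

definition stacked :: "process \<Rightarrow> nat set \<Rightarrow> (nat + nat \<Rightarrow> real) \<Rightarrow> nat \<Rightarrow> real" where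
  "stacked X I \<omega> = (\<lambda>i\<in>I. X i \<omega>)"

abbreviation stacked_space :: "nat set \<Rightarrow> (nat \<Rightarrow> real) measure" where
  "stacked_space I \<equiv> PiM I (\<lambda>_. borel)"

definition channel_output :: "rmat \<Rightarrow> rvec \<Rightarrow> rvec \<Rightarrow> process \<Rightarrow> process" where
  "channel_output F G H u t \<omega> =
     scalar_prod H (channel_state F G (\<lambda>i. u i \<omega>) t) + u t \<omega> + noise t \<omega>"

text \<open>As \<open>indep_var\<close> of the library, but for random variables of different types.\<close>

definition independent ::
    "'a measure \<Rightarrow> ((nat + nat \<Rightarrow> real) \<Rightarrow> 'a) \<Rightarrow> 'b measure \<Rightarrow> ((nat + nat \<Rightarrow> real) \<Rightarrow> 'b) \<Rightarrow> bool"
where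
  "independent S X T Y \<longleftrightarrow>
     X \<in> measurable gauss_space S \<and> Y \<in> measurable gauss_space T \<and>
     prob_space.indep_set gauss_space
       {X -` A \<inter> space gauss_space | A. A \<in> sets S}
       {Y -` B \<inter> space gauss_space | B. B \<in> sets T}"

text \<open>Degenerate (constant zero) variables are included as \<open>\<sigma> = 0\<close>.\<close>

definition centered_gaussian :: "((nat + nat \<Rightarrow> real) \<Rightarrow> real) \<Rightarrow> bool" where
  "centered_gaussian X \<longleftrightarrow> X \<in> borel_measurable gauss_space \<and>
     (\<exists>\<sigma>. distr gauss_space borel X = distr std_normal_distribution borel (\<lambda>x. \<sigma> * x))"

definition average_power :: "process \<Rightarrow> nat \<Rightarrow> real" where
  "average_power u T = 1 / real (T + 1) * (\<integral>\<omega>. (\<Sum>t\<le>T. (u t \<omega>)\<^sup>2) \<partial>gauss_space)"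

definition power_constraint :: "real \<Rightarrow> process \<Rightarrow> bool" where
  "power_constraint P u \<longleftrightarrow> (\<exists>p\<le>P. average_power u \<longlonglongrightarrow> p)"

text \<open>The summand is \<open>I(u\<^sup>t; y\<^sub>t | y\<^sup>t\<^sup>-\<^sup>1)\<close>. The library defines conditional mutual information by
  the chain rule \<open>I(X; Y | Z) = I(X; (Y, Z)) - I(X; Z)\<close>. Conditional mutual information is symmetric
  in \<open>X\<close> and \<open>Y\<close>, and \<open>y\<^sub>t\<close> is put first because both terms are then finite: \<open>y\<^sub>t\<close> contains the
  fresh noise sample. With \<open>u\<^sup>t\<close> first, both would be infinite for an input such as
  \<open>u\<^sub>t = y\<^sub>t\<^sub>-\<^sub>1\<close>.\<close>

definition directed_information :: "process \<Rightarrow> process \<Rightarrow> nat \<Rightarrow> real" where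
  "directed_information u y T =
     (\<Sum>t\<le>T. prob_space.conditional_mutual_information gauss_space 2
        borel (stacked_space {..t}) (stacked_space {..<t})
        (y t) (stacked u {..t}) (stacked y {..<t}))"

text \<open>Independence of \<open>\<xi>\<^sub>t\<close> from the past alone would let \<open>\<xi>\<^sub>t\<close> anticipate the noise; that the
  channel is driven causally is expressed by the independence of \<open>N\<^sub>t\<close> from \<open>(u\<^sup>t, y\<^sup>t\<^sup>-\<^sup>1)\<close>.\<close>

definition feedback_input ::
    "rmat \<Rightarrow> rvec \<Rightarrow> rvec \<Rightarrow> (nat \<Rightarrow> nat \<Rightarrow> real) \<Rightarrow> (nat \<Rightarrow> nat \<Rightarrow> real) \<Rightarrow> process
      \<Rightarrow> process \<Rightarrow> process \<Rightarrow> bool" where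
  "feedback_input F G H \<gamma> \<eta> \<xi> u y \<longleftrightarrow>
     y = channel_output F G H u \<and>
     (\<forall>t \<omega>. u t \<omega> = (\<Sum>j<t. \<gamma> t j * u j \<omega>) + (\<Sum>j<t. \<eta> t j * y j \<omega>) + \<xi> t \<omega>) \<and>
     (\<forall>t. centered_gaussian (\<xi> t)) \<and>
     (\<forall>t. independent
        borel (\<xi> t)
        (stacked_space {..<t} \<Otimes>\<^sub>M stacked_space {..<t})
        (\<lambda>\<omega>. (stacked u {..<t} \<omega>, stacked y {..<t} \<omega>))) \<and>
     (\<forall>t. independent
        borel (noise t)
        (stacked_space {..t} \<Otimes>\<^sub>M stacked_space {..<t})
        (\<lambda>\<omega>. (stacked u {..t} \<omega>, stacked y {..<t} \<omega>)))"

text \<open>The inputs are zero-mean Gaussian processes, so convergence of the autocovariances is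
  convergence of all finite-dimensional laws of the shifted process to those of a stationary one.\<close>

definition asymptotically_stationary :: "process \<Rightarrow> bool" where
  "asymptotically_stationary u \<longleftrightarrow>
     (\<forall>k. convergent (\<lambda>t. \<integral>\<omega>. u t \<omega> * u (t + k) \<omega> \<partial>gauss_space))"

definition feedback_capacity :: "rmat \<Rightarrow> rvec \<Rightarrow> rvec \<Rightarrow> real \<Rightarrow> ereal" where
  "feedback_capacity F G H P = Sup {R. \<exists>\<gamma> \<eta> \<xi> u y.
     feedback_input F G H \<gamma> \<eta> \<xi> u y \<and>
     asymptotically_stationary u \<and>
     power_constraint P u \<and>
     (\<lambda>T. ereal (1 / real (T + 1) * directed_information u y T)) \<longlonglongrightarrow> R}"

text \<open>The message is \<open>W = (message 0, \<dots>, message n)\<close>.\<close>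

primrec encoder_state :: "nat \<Rightarrow> rmat \<Rightarrow> (nat + nat \<Rightarrow> real) \<Rightarrow> nat \<Rightarrow> rvec" where
  "encoder_state n A \<omega> 0 = Matrix.vec (n + 1) (\<lambda>i. message i \<omega>)"
| "encoder_state n A \<omega> (Suc t) = A *\<^sub>v encoder_state n A \<omega> t"

definition observable :: "nat \<Rightarrow> rmat \<Rightarrow> rvec \<Rightarrow> bool" where
  "observable d A C \<longleftrightarrow>
     (\<forall>x\<in>carrier_vec d. (\<forall>k. scalar_prod C ((A ^\<^sub>m k) *\<^sub>v x) = 0) \<longrightarrow> x = 0\<^sub>v d)"

definition admissible_encoder :: "rmat \<Rightarrow> nat \<Rightarrow> rmat \<Rightarrow> rvec \<Rightarrow> bool" where
  "admissible_encoder F n A C \<longleftrightarrow>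
     A \<in> carrier_mat (n + 1) (n + 1) \<and> C \<in> carrier_vec (n + 1) \<and>
     observable (n + 1) A C \<and>
     (\<forall>z. eigenvalue (cmat A) z \<longrightarrow> cmod z \<noteq> 1 \<and> \<not> eigenvalue (cmat F) z)"

text \<open>A strictly causal generator over the infinite horizon is an infinite matrix \<open>g\<close>
  of which only the strictly lower triangular entries matter; \<open>\<G>\<^sub>T\<close> is its leading
  \<open>(T + 1) \<times> (T + 1)\<close> block, and \<open>r_hat\<close> is the feedback signal.\<close>

definition coding_structure ::
    "rmat \<Rightarrow> rvec \<Rightarrow> rvec \<Rightarrow> nat \<Rightarrow> rmat \<Rightarrow> rvec \<Rightarrow> (nat \<Rightarrow> nat \<Rightarrow> real)
      \<Rightarrow> process \<Rightarrow> process \<Rightarrow> bool" where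
  "coding_structure F G H n A C g u y \<longleftrightarrow>
     y = channel_output F G H u \<and>
     (\<exists>r r_hat :: process.
        (\<forall>t \<omega>. r t \<omega> = scalar_prod C (encoder_state n A \<omega> t)) \<and>
        (\<forall>t \<omega>. - r_hat t \<omega> = (\<Sum>j<t. g t j * y j \<omega>)) \<and>
        (\<forall>t \<omega>. u t \<omega> = r t \<omega> - r_hat t \<omega>))"

definition coding_information :: "nat \<Rightarrow> process \<Rightarrow> nat \<Rightarrow> real" where
  "coding_information n y T =
     prob_space.mutual_information gauss_space 2
       (stacked_space {..n}) (stacked_space {..T})
       (stacked message {..n}) (stacked y {..T})"

definition coding_capacity :: "rmat \<Rightarrow> rvec \<Rightarrow> rvec \<Rightarrow> real \<Rightarrow> nat \<Rightarrow> ereal" where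
  "coding_capacity F G H P n = Sup {R. \<exists>A C g u y.
     admissible_encoder F n A C \<and>
     coding_structure F G H n A C g u y \<and>
     power_constraint P u \<and>
     (\<lambda>T. ereal (1 / real (T + 1) * coding_information n y T)) \<longlonglongrightarrow> R}"

end

theory Submission
  imports Defs "HOL-Library.Function_Algebras" "Jordan_Normal_Form.Spectral_Radius"
begin

text \<open>All signals are jointly Gaussian, so both kinds of information up to time \<open>T\<close> equal half the sum of
  \<open>log \<rho>\<^sub>t\<close>, where \<open>\<rho>\<^sub>t\<close> is the variance of the \<open>t\<close>-th innovation of the output.

  The time averages of the error covariance of the channel state given the past outputs, of its covariance
  with the error of the channel output, and of \<open>\<rho>\<^sub>t - 1\<close> form a triple \<open>(\<sigma>, \<gamma>, \<kappa>)\<close> that satisfies a system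
  of linear inequalities: positivity, a Riccati inequality for the zero dynamics of the channel, and the
  power constraint. As the logarithm is concave, no scheme has a rate above \<open>1/2 log (1 + \<kappa>)\<close> for
  the largest feasible \<open>\<kappa>\<close>.

  At an optimum with \<open>\<sigma>\<close> of largest trace the Riccati inequality is an equality and no part of the input is fresh
  noise. The optimum is then the stationary regime of an encoder that acts on the space of the channel states modulo the
  kernel of \<open>\<sigma>\<close>, which has dimension at most \<open>m\<close>; its eigenvalues lie outside the unit disc because the zero
  dynamics are stable. So \<open>m\<close> message coordinates suffice to attain the bound, with feedback inputs as well.

  For the monotonicity in \<open>n\<close>, a stable mode that carries a further message coordinate is added to a given
  scheme. By Bessel's inequality its effect on the innovations is square summable, so that
  the mean power and the mean information do not change in the limit.\<close>

text \<open>Gains may vary with time and error covariances need not converge, so no stationary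
  filter is available for the converse. Averaging conditions that are linear in the covariances
  avoids any limit of a Riccati recursion. Attaining the bound meets the opposite obstacle: an
  encoder with eigenvalues outside the disc emits an exploding signal, and nothing can be passed to
  the limit before feedback has cancelled the growth. The scheme is therefore rewritten through the
  inverse of the encoder matrix, which is stable, and its innovation variance is bounded from below
  by one explicit test variable. Monotonicity is not a matter of padding with zeros, since
  observability forces a new mode to show in the transmitted signal. As the mean power is required
  to converge, the modified scheme has to follow the power of the given one and not merely stay
  below it. Bilinear forms may be degenerate throughout, so that covariances of dependent signals
  and averaged error covariances with a kernel are handled by the same projection algebra.\<close>

hide_const (open) VectorSpace.subspace
hide_fact (open) VectorSpace.subspace_def

section \<open>Projections in semi-inner product spaces\<close>

instantiation "fun" :: (type, real_vector) real_vector
begin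

definition scaleR_fun_def: "scaleR c f = (\<lambda>x. c *\<^sub>R f x)"

instance
  by standard (auto simp: scaleR_fun_def plus_fun_def scaleR_right_distrib scaleR_left_distrib fun_eq_iff)

end

lemma scaleR_fun_apply [simp]: "(c *\<^sub>R f) x = c *\<^sub>R f x"
  by (simp add: scaleR_fun_def)

lemma sum_fun_apply [simp]: "(\<Sum>i\<in>I. f i) x = (\<Sum>i\<in>I. f i x)"
  by (induction I rule: infinite_finite_induct) auto

text \<open>The family \<open>y\<close> may repeat values, so coefficients are indexed by time and
  not by the elements of the image.\<close>

lemma in_span_image_lessThan:
  fixes y :: "nat \<Rightarrow> 'a::real_vector"
  assumes "x \<in> span (y ` {..<t})"
  obtains c where "x = (\<Sum>s<t. c s *\<^sub>R y s)"
proof -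
  have "\<exists>c. x = (\<Sum>s<t. c s *\<^sub>R y s)"
    using assms
  proof (induction rule: span_induct_alt)
    case base
    show ?case by (rule exI[of _ "\<lambda>_. 0"]) simp
  next
    case (step a x z)
    then obtain s c where s: "s < t" "x = y s" and z: "z = (\<Sum>s<t. c s *\<^sub>R y s)" by auto
    have "a *\<^sub>R y s = (\<Sum>j<t. (if j = s then a else 0) *\<^sub>R y j)"
      using s(1) by (simp add: if_distrib[of "\<lambda>c. c *\<^sub>R _"] sum.delta cong: if_cong)
    then have "a *\<^sub>R x + z = (\<Sum>j<t. ((if j = s then a else 0) + c j) *\<^sub>R y j)"
      by (simp add: s z sum.distrib scaleR_left_distrib)
    then show ?case by (intro exI[of _ "\<lambda>j. (if j = s then a else 0) + c j"])
  qed
  then show ?thesis using that by blast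
qed

lemma sum_in_span_lessThan:
  fixes y :: "nat \<Rightarrow> 'a::real_vector"
  shows "(\<Sum>s<t. c s *\<^sub>R y s) \<in> span (y ` {..<t})"
  by (intro span_sum span_scale span_base) auto

locale semi_inner =
  fixes S :: "'a::real_vector set" and B :: "'a \<Rightarrow> 'a \<Rightarrow> real"
  assumes sub: "subspace S"
    and add_left: "\<And>x y z. x \<in> S \<Longrightarrow> y \<in> S \<Longrightarrow> z \<in> S \<Longrightarrow> B (x + y) z = B x z + B y z"
    and scale_left: "\<And>c x y. x \<in> S \<Longrightarrow> y \<in> S \<Longrightarrow> B (c *\<^sub>R x) y = c * B x y"
    and sym: "\<And>x y. B x y = B y x"
    and nonneg: "\<And>x. x \<in> S \<Longrightarrow> 0 \<le> B x x"
begin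

lemma mem [intro, simp]:
  "0 \<in> S" "x \<in> S \<Longrightarrow> y \<in> S \<Longrightarrow> x + y \<in> S" "x \<in> S \<Longrightarrow> y \<in> S \<Longrightarrow> x - y \<in> S"
  "x \<in> S \<Longrightarrow> c *\<^sub>R x \<in> S" "(\<And>i. i \<in> I \<Longrightarrow> f i \<in> S) \<Longrightarrow> (\<Sum>i\<in>I. f i) \<in> S"
  using sub by (auto simp: subspace_0 subspace_add subspace_diff subspace_scale intro: subspace_sum)

lemma span_mem: "Y \<subseteq> S \<Longrightarrow> x \<in> span Y \<Longrightarrow> x \<in> S"
  using span_minimal[OF _ sub] by auto

lemma add_right: "x \<in> S \<Longrightarrow> y \<in> S \<Longrightarrow> z \<in> S \<Longrightarrow> B z (x + y) = B z x + B z y"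
  by (metis add_left sym)

lemma scale_right: "x \<in> S \<Longrightarrow> y \<in> S \<Longrightarrow> B y (c *\<^sub>R x) = c * B y x"
  by (metis scale_left sym)

lemma zero_left: "x \<in> S \<Longrightarrow> B 0 x = 0"
  using scale_left[of 0 x 0] by simp

lemma zero_right: "x \<in> S \<Longrightarrow> B x 0 = 0"
  by (metis sym zero_left)

lemma diff_left: "x \<in> S \<Longrightarrow> y \<in> S \<Longrightarrow> z \<in> S \<Longrightarrow> B (x - y) z = B x z - B y z"
  using add_left[of x "(-1) *\<^sub>R y" z] scale_left[of y z "-1"] mem(4)[of y "-1"] by simp

lemma diff_right: "x \<in> S \<Longrightarrow> y \<in> S \<Longrightarrow> z \<in> S \<Longrightarrow> B z (x - y) = B z x - B z y"
  by (metis diff_left sym)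

lemma sum_left:
  "(\<And>i. i \<in> I \<Longrightarrow> f i \<in> S) \<Longrightarrow> z \<in> S \<Longrightarrow> B (\<Sum>i\<in>I. f i) z = (\<Sum>i\<in>I. B (f i) z)"
  by (induction I rule: infinite_finite_induct) (auto simp: zero_left add_left)

lemma sum_right:
  "(\<And>i. i \<in> I \<Longrightarrow> f i \<in> S) \<Longrightarrow> z \<in> S \<Longrightarrow> B z (\<Sum>i\<in>I. f i) = (\<Sum>i\<in>I. B z (f i))"
  by (induction I rule: infinite_finite_induct) (auto simp: zero_right add_right)

lemmas bilinear = add_left add_right diff_left diff_right scale_left scale_right zero_left zero_right

lemma Cauchy_Schwarz:
  assumes "x \<in> S" "y \<in> S"
  shows "(B x y)\<^sup>2 \<le> B x x * B y y"
proof -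
  have *: "0 \<le> B x x - 2 * c * B x y + c\<^sup>2 * B y y" for c
    using nonneg[of "x - c *\<^sub>R y"] assms
    by (simp add: bilinear sym[of y x] power2_eq_square algebra_simps)
  show ?thesis
  proof (cases "B y y = 0")
    case True
    have "B x y = 0"
    proof (rule ccontr)
      assume "B x y \<noteq> 0"
      \<comment> \<open>With \<open>B y y = 0\<close> the bound is affine in \<open>c\<close>; this
        \<open>c\<close> gives it the value -1.\<close>
      then show False
        using *[of "(B x x + 1) / (2 * B x y)"] True by simp
    qed
    then show ?thesis using True by simp
  next
    case False
    then have "B y y > 0" using nonneg[OF assms(2)] by simp
    then show ?thesis
      using *[of "B x y / B y y"] by (simp add: power2_eq_square field_simps)
  qed
qed

text \<open>Substitute for definiteness wherever a vector of norm zero is discarded.\<close>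

lemma null_right: "x \<in> S \<Longrightarrow> y \<in> S \<Longrightarrow> B y y = 0 \<Longrightarrow> B x y = 0"
  using Cauchy_Schwarz[of x y] by simp

end

text \<open>\<open>residual B y t X\<close> is what remains of \<open>X\<close> after projection onto \<open>y\<^sub>0, \<dots>, y\<^sub>t\<^sub>-\<^sub>1\<close>. Directions of
  norm zero are skipped because division by zero gives zero.\<close>

primrec residual :: "('a::real_vector \<Rightarrow> 'a \<Rightarrow> real) \<Rightarrow> (nat \<Rightarrow> 'a) \<Rightarrow> nat \<Rightarrow> 'a \<Rightarrow> 'a" where
  "residual B y 0 X = X"
| "residual B y (Suc t) X = residual B y t X -
     (B (residual B y t X) (residual B y t (y t)) / B (residual B y t (y t)) (residual B y t (y t)))
       *\<^sub>R residual B y t (y t)"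

abbreviation innovation :: "('a::real_vector \<Rightarrow> 'a \<Rightarrow> real) \<Rightarrow> (nat \<Rightarrow> 'a) \<Rightarrow> nat \<Rightarrow> 'a" where
  "innovation B y t \<equiv> residual B y t (y t)"

abbreviation innovation_var :: "('a::real_vector \<Rightarrow> 'a \<Rightarrow> real) \<Rightarrow> (nat \<Rightarrow> 'a) \<Rightarrow> nat \<Rightarrow> real" where
  "innovation_var B y t \<equiv> B (innovation B y t) (innovation B y t)"

locale residual_family = semi_inner S B
  for S :: "'a::real_vector set" and B :: "'a \<Rightarrow> 'a \<Rightarrow> real" +
  fixes y :: "nat \<Rightarrow> 'a"
  assumes y_mem [simp, intro]: "\<And>t. y t \<in> S"
begin

abbreviation R where "R \<equiv> residual B y"

lemma residual_mem [simp, intro]: "X \<in> S \<Longrightarrow> R t X \<in> S"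
  by (induction t arbitrary: X) auto

lemma residual_add: "X \<in> S \<Longrightarrow> X' \<in> S \<Longrightarrow> R t (X + X') = R t X + R t X'"
  by (induction t arbitrary: X X')
     (simp_all add: bilinear add_divide_distrib scaleR_left_distrib algebra_simps)

lemma residual_scale: "X \<in> S \<Longrightarrow> R t (c *\<^sub>R X) = c *\<^sub>R R t X"
  by (induction t arbitrary: X) (simp_all add: bilinear algebra_simps)

lemma residual_diff: "X \<in> S \<Longrightarrow> X' \<in> S \<Longrightarrow> R t (X - X') = R t X - R t X'"
  using residual_add[of X "(-1) *\<^sub>R X'" t] residual_scale[of X' t "-1"] mem(4)[of X' "-1"]
  by simp

lemma diff_residual_span: "X - R t X \<in> span (y ` {..<t})"
proof (induction t arbitrary: X)
  case 0
  show ?case by (simp add: span_zero)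
next
  case (Suc t)
  have sub: "span (y ` {..<t}) \<subseteq> span (y ` {..<Suc t})" by (intro span_mono) auto
  have "y t \<in> span (y ` {..<Suc t})" by (intro span_base) auto
  moreover have "y t - R t (y t) \<in> span (y ` {..<Suc t})" using Suc[of "y t"] sub by blast
  ultimately have "R t (y t) \<in> span (y ` {..<Suc t})" using span_diff by fastforce
  moreover have "X - R t X \<in> span (y ` {..<Suc t})" using Suc[of X] sub by blast
  ultimately have "(X - R t X) + c *\<^sub>R R t (y t) \<in> span (y ` {..<Suc t})" for c
    by (intro span_add span_scale)
  then show ?case by (simp add: algebra_simps)
qed

lemma innovation_span: "R t (y t) \<in> span (y ` {..<Suc t})"
proof -
  have mono: "span (y ` {..<t}) \<subseteq> span (y ` {..<Suc t})" by (intro span_mono) auto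
  have "y t \<in> span (y ` {..<Suc t})" by (rule span_base) simp
  then have "y t - (y t - R t (y t)) \<in> span (y ` {..<Suc t})"
    by (rule span_diff[OF _ subsetD[OF mono diff_residual_span]])
  then show ?thesis by simp
qed

lemma residual_orth: "X \<in> S \<Longrightarrow> s < t \<Longrightarrow> B (R t X) (y s) = 0"
proof (induction t arbitrary: X s)
  case (Suc t)
  have e: "R t (y t) \<in> S" by simp
  show ?case
  proof (cases "s = t")
    case False
    then have "s < t" using Suc by simp
    then show ?thesis using Suc.IH Suc.prems by (simp add: bilinear)
  next
    case True
    \<comment> \<open>Stated for all \<open>U\<close>, since the induction hypothesis is needed for
      \<open>X\<close> and for \<open>y t\<close> alike: \<open>y t\<close> and its residual differ
      by an element of the past span.\<close>
    have "span (y ` {..<t}) \<subseteq> {Z \<in> S. B (R t U) Z = 0}" if "U \<in> S" for U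
    proof (rule span_minimal)
      show "y ` {..<t} \<subseteq> {Z \<in> S. B (R t U) Z = 0}" using Suc.IH that by auto
      show "subspace {Z \<in> S. B (R t U) Z = 0}"
        using that by (auto simp: subspace_def bilinear)
    qed
    then have "B (R t U) (y t - R t (y t)) = 0" if "U \<in> S" for U
      using diff_residual_span[of "y t" t] that by blast
    then have *: "B (R t U) (y t) = B (R t U) (R t (y t))" if "U \<in> S" for U
      using that by (simp add: bilinear)
    show ?thesis
    proof (cases "B (R t (y t)) (R t (y t)) = 0")
      \<comment> \<open>A null innovation subtracts nothing, and nothing has to be subtracted
        because it is orthogonal to all of \<open>S\<close>.\<close>
      case True
      then show ?thesis using *[OF Suc.prems(1)] null_right[of "R t X" "R t (y t)"] Suc.prems \<open>s = t\<close>
        by (simp add: bilinear)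
    next
      case False
      then show ?thesis using * Suc.prems \<open>s = t\<close> by (simp add: bilinear)
    qed
  qed
qed simp

lemma residual_orth_span:
  assumes "X \<in> S" "Z \<in> span (y ` {..<t})"
  shows "B (R t X) Z = 0"
proof -
  have "span (y ` {..<t}) \<subseteq> {Z \<in> S. B (R t X) Z = 0}"
  proof (rule span_minimal)
    show "y ` {..<t} \<subseteq> {Z \<in> S. B (R t X) Z = 0}" using residual_orth assms by auto
    show "subspace {Z \<in> S. B (R t X) Z = 0}"
      using assms by (auto simp: subspace_def bilinear)
  qed
  then show ?thesis using assms by auto
qed

lemma span_y_mem: "Z \<in> span (y ` {..<t}) \<Longrightarrow> Z \<in> S"
  using span_mem[of "y ` {..<t}"] by auto

lemma B_residual_right:
  assumes "X \<in> S" "X' \<in> S"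
  shows "B (R t X) (R t X') = B (R t X) X'"
proof -
  have "B (R t X) (X' - R t X') = 0"
    by (rule residual_orth_span[OF assms(1) diff_residual_span])
  then show ?thesis using assms by (simp add: bilinear)
qed

lemma B_residual_left: "X \<in> S \<Longrightarrow> X' \<in> S \<Longrightarrow> B (R t X) (R t X') = B X (R t X')"
  by (metis B_residual_right sym)

lemma Pythagoras:
  assumes "X \<in> S" "Z \<in> span (y ` {..<t})"
  shows "B (R t X + Z) (R t X + Z) = B (R t X) (R t X) + B Z Z"
  using assms residual_orth_span[OF assms] span_y_mem[OF assms(2)] sym[of Z "R t X"]
  by (simp add: bilinear)

text \<open>Optimality of the projection. Upper bounds on error variances are obtained by inserting
  a convenient predictor \<open>Z\<close>.\<close>

lemma residual_minimal:
  assumes "X \<in> S" "Z \<in> span (y ` {..<t})"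
  shows "B (R t X) (R t X) \<le> B (X - Z) (X - Z)"
proof -
  have "(X - R t X) - Z \<in> span (y ` {..<t})"
    by (rule span_diff[OF diff_residual_span assms(2)])
  from Pythagoras[OF assms(1) this] nonneg[OF span_y_mem[OF this]]
  show ?thesis by (simp add: algebra_simps)
qed

lemma residual_in_span:
  assumes "Z \<in> span (y ` {..<t})"
  shows "B (R t Z) (R t Z) = 0"
  using residual_minimal[OF span_y_mem[OF assms] assms] nonneg[of "R t Z"] span_y_mem[OF assms]
  by (simp add: bilinear)

lemma residual_in_span_left:
  assumes "Z \<in> span (y ` {..<t})" "X \<in> S"
  shows "B (R t Z) X = 0"
  using residual_in_span[OF assms(1)] null_right[of X "R t Z"] assms span_y_mem[OF assms(1)] sym
  by auto

lemma B_residual_Suc: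
  assumes "X \<in> S" "X' \<in> S"
  shows "B (R (Suc t) X) (R (Suc t) X') = B (R t X) (R t X') -
    B (R t X) (R t (y t)) * B (R t X') (R t (y t)) / B (R t (y t)) (R t (y t))"
  using assms
  by (cases "B (R t (y t)) (R t (y t)) = 0")
     (simp_all add: bilinear sym[of "R t (y t)" "R t X'"] divide_simps power2_eq_square)

text \<open>The recursion telescopes because a covariance with a residual may be taken before or
  after projecting the other argument. Its diagonal case gives Bessel's inequality.\<close>

lemma B_residual_expand:
  assumes "X \<in> S" "X' \<in> S"
  shows "B (R t X) (R t X') = B X X' -
    (\<Sum>s<t. B X (R s (y s)) * B X' (R s (y s)) / B (R s (y s)) (R s (y s)))"
proof (induction t)
  case (Suc t)
  have "B (R t X) (R t (y t)) = B X (R t (y t))" "B (R t X') (R t (y t)) = B X' (R t (y t))"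
    using assms by (simp_all add: B_residual_left)
  then show ?case using Suc by (simp add: B_residual_Suc[OF assms] del: residual.simps)
qed simp

lemma Bessel:
  assumes "X \<in> S"
  shows "(\<Sum>s<t. (B X (R s (y s)))\<^sup>2 / B (R s (y s)) (R s (y s))) \<le> B X X"
  using B_residual_expand[OF assms assms, of t] nonneg[of "R t X"] assms
  by (simp add: power2_eq_square)

end

text \<open>Feedback adds functions of past outputs to the current output and so leaves innovation
  variances unchanged. Each inequality uses minimality for one family, with the predictor of the
  other shifted by \<open>X' - X\<close> as competitor.\<close>

lemma (in semi_inner) innovation_var_cong:
  assumes "\<And>t. y t \<in> S" "\<And>t. y' t \<in> S" "span (y ` {..<t}) = span (y' ` {..<t})"
    and "X \<in> S" "X' - X \<in> span (y ` {..<t})"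
  shows "B (residual B y t X) (residual B y t X) = B (residual B y' t X') (residual B y' t X')"
proof -
  interpret a: residual_family S B y by unfold_locales (use assms in auto)
  interpret b: residual_family S B y' by unfold_locales (use assms in auto)
  have X': "X' \<in> S"
    using a.span_y_mem[OF assms(5)] assms(4) mem(2)[of X "X' - X"] by simp
  show ?thesis
  proof (rule antisym)
    have "(X' - a.R t X) - (X' - X) \<in> span (y ` {..<t})"
      using a.diff_residual_span by simp
    have "(X' - b.R t X') - (X' - X) \<in> span (y ` {..<t})"
      unfolding assms(3) by (rule span_diff[OF b.diff_residual_span]) (use assms in simp)
    from a.residual_minimal[OF assms(4) this]
    show "B (a.R t X) (a.R t X) \<le> B (b.R t X') (b.R t X')" by simp
    have "(X - a.R t X) + (X' - X) \<in> span (y' ` {..<t})"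
      using a.diff_residual_span assms by (metis span_add)
    from b.residual_minimal[OF X' this]
    show "B (b.R t X') (b.R t X') \<le> B (a.R t X) (a.R t X)" by simp
  qed
qed

section \<open>Uniqueness of characteristic functions\<close>

text \<open>Normalizing the weight into a probability density reduces the claim to Levy's theorem.
  The weight is there to carry the remaining coordinates when several variables are treated one at a
  time.\<close>

lemma weighted_char_unique:
  fixes X1 :: "'a \<Rightarrow> real" and X2 :: "'b \<Rightarrow> real"
  assumes "prob_space P1" "prob_space P2"
    and [measurable]: "X1 \<in> borel_measurable P1" "X2 \<in> borel_measurable P2"
      "W1 \<in> borel_measurable P1" "W2 \<in> borel_measurable P2"
    and W1: "\<And>\<omega>. 0 \<le> W1 \<omega>" "\<And>\<omega>. W1 \<omega> \<le> (C::real)"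
    and W2: "\<And>\<omega>. 0 \<le> W2 \<omega>" "\<And>\<omega>. W2 \<omega> \<le> (C::real)"
    and eq: "\<And>s. (CLINT \<omega>|P1. W1 \<omega> * iexp (s * X1 \<omega>)) = (CLINT \<omega>|P2. W2 \<omega> * iexp (s * X2 \<omega>))"
    and A: "A \<in> sets borel"
  shows "(LINT \<omega>|P1. W1 \<omega> * indicator A (X1 \<omega>)) = (LINT \<omega>|P2. W2 \<omega> * indicator A (X2 \<omega>))"
proof -
  interpret P1: prob_space P1 by fact
  interpret P2: prob_space P2 by fact
  have [measurable]: "A \<in> sets borel" by fact
  define c where "c = (LINT \<omega>|P1. W1 \<omega>)"
  have int: "integrable P1 W1" "integrable P2 W2"
    by (auto intro!: P1.integrable_const_bound[where B=C] P2.integrable_const_bound[where B=C]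
        simp: W1 W2)
  have c2: "c = (LINT \<omega>|P2. W2 \<omega>)"
    using eq[of 0] by (simp add: c_def)
  have intA: "integrable P1 (\<lambda>\<omega>. W1 \<omega> * indicator A (X1 \<omega>))"
      "integrable P2 (\<lambda>\<omega>. W2 \<omega> * indicator A (X2 \<omega>))"
    by (rule Bochner_Integration.integrable_bound[OF int(1)]; auto simp: indicator_def)
       (rule Bochner_Integration.integrable_bound[OF int(2)]; auto simp: indicator_def)
  have c0: "0 \<le> c" unfolding c_def by (intro integral_nonneg_AE) (simp add: W1)
  show ?thesis
  proof (cases "c = 0")
    \<comment> \<open>A weight of total mass zero cannot be normalized, but then both sides
      vanish.\<close>
    case True
    have "(LINT \<omega>|P1. W1 \<omega> * indicator A (X1 \<omega>)) \<le> c"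
      unfolding c_def using intA int by (intro integral_mono) (auto simp: W1 indicator_def)
    moreover have "(LINT \<omega>|P2. W2 \<omega> * indicator A (X2 \<omega>)) \<le> c"
      unfolding c2 using intA int by (intro integral_mono) (auto simp: W2 indicator_def)
    moreover have "0 \<le> (LINT \<omega>|P1. W1 \<omega> * indicator A (X1 \<omega>))"
      "0 \<le> (LINT \<omega>|P2. W2 \<omega> * indicator A (X2 \<omega>))"
      by (auto intro!: integral_nonneg_AE simp: W1 W2)
    ultimately show ?thesis using True by simp
  next
    case False
    with c0 have c: "c > 0" by simp
    define D1 where "D1 = density P1 (\<lambda>\<omega>. W1 \<omega> / c)"
    define D2 where "D2 = density P2 (\<lambda>\<omega>. W2 \<omega> / c)"
    have [measurable_cong]: "sets D1 = sets P1" "sets D2 = sets P2"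
      by (auto simp: D1_def D2_def)
    have D1: "prob_space D1"
    proof
      show "emeasure D1 (space D1) = 1"
        using int(1) c by (simp add: D1_def emeasure_density nn_integral_eq_integral W1 c_def)
    qed
    have D2: "prob_space D2"
    proof
      show "emeasure D2 (space D2) = 1"
        using int(2) c by (simp add: D2_def emeasure_density nn_integral_eq_integral W2 c2)
    qed
    interpret D1: prob_space D1 by fact
    interpret D2: prob_space D2 by fact
    have [measurable]: "X1 \<in> borel_measurable D1" "X2 \<in> borel_measurable D2" by measurable
    have "char (distr D1 borel X1) = char (distr D2 borel X2)"
    proof
      fix s
      have "char (distr D1 borel X1) s = (CLINT \<omega>|P1. (W1 \<omega> / c) *\<^sub>R iexp (s * X1 \<omega>))"
        unfolding char_def using c
        by (subst integral_distr) (auto simp: D1_def W1 intro!: integral_density)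
      also have "\<dots> = (CLINT \<omega>|P1. W1 \<omega> * iexp (s * X1 \<omega>)) / c"
        by (simp add: scaleR_conv_of_real)
      also have "\<dots> = (CLINT \<omega>|P2. (W2 \<omega> / c) *\<^sub>R iexp (s * X2 \<omega>))"
        unfolding eq by (simp add: scaleR_conv_of_real)
      also have "\<dots> = char (distr D2 borel X2) s"
        unfolding char_def using c
        by (subst integral_distr) (auto simp: D2_def W2 intro!: integral_density[symmetric])
      finally show "char (distr D1 borel X1) s = char (distr D2 borel X2) s" .
    qed
    then have "distr D1 borel X1 = distr D2 borel X2"
      by (intro Levy_uniqueness) (auto simp: real_distribution_def real_distribution_axioms_def
          intro!: D1.prob_space_distr D2.prob_space_distr)
    then have "measure (distr D1 borel X1) A = measure (distr D2 borel X2) A" by simp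
    moreover have "measure (distr D1 borel X1) A = (LINT \<omega>|D1. indicator A (X1 \<omega>))"
      by (subst integral_distr[symmetric, where N=borel]) (auto simp: measure_distr)
    moreover have "\<dots> = (LINT \<omega>|P1. W1 \<omega> * indicator A (X1 \<omega>)) / c"
      unfolding D1_def using c by (subst integral_density) (auto simp: W1)
    moreover have "measure (distr D2 borel X2) A = (LINT \<omega>|D2. indicator A (X2 \<omega>))"
      by (subst integral_distr[symmetric, where N=borel]) (auto simp: measure_distr)
    moreover have "\<dots> = (LINT \<omega>|P2. W2 \<omega> * indicator A (X2 \<omega>)) / c"
      unfolding D2_def using c by (subst integral_density) (auto simp: W2)
    ultimately show ?thesis using c by simp
  qed
qed

text \<open>Induction on the set \<open>I\<close> of coordinates whose exponential has already been
  traded for an indicator.\<close>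

lemma multivariate_char_unique:
  fixes X1 :: "'i \<Rightarrow> 'a \<Rightarrow> real" and X2 :: "'i \<Rightarrow> 'b \<Rightarrow> real"
  assumes P: "prob_space P1" "prob_space P2" and K: "finite K"
    and X1: "\<And>i. i \<in> K \<Longrightarrow> X1 i \<in> borel_measurable P1"
    and X2: "\<And>i. i \<in> K \<Longrightarrow> X2 i \<in> borel_measurable P2"
    and eq: "\<And>t. (CLINT \<omega>|P1. iexp (\<Sum>i\<in>K. t i * X1 i \<omega>)) = (CLINT \<omega>|P2. iexp (\<Sum>i\<in>K. t i * X2 i \<omega>))"
    and A: "\<And>i. i \<in> K \<Longrightarrow> A i \<in> sets borel"
  shows "measure P1 {\<omega>\<in>space P1. \<forall>i\<in>K. X1 i \<omega> \<in> A i} = measure P2 {\<omega>\<in>space P2. \<forall>i\<in>K. X2 i \<omega> \<in> A i}"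
proof -
  interpret P1: prob_space P1 by fact
  interpret P2: prob_space P2 by fact
  define Q1 where "Q1 I \<omega> = (\<Prod>i\<in>I. indicator (A i) (X1 i \<omega>) :: real)" for I \<omega>
  define Q2 where "Q2 I \<omega> = (\<Prod>i\<in>I. indicator (A i) (X2 i \<omega>) :: real)" for I \<omega>
  have Q: "0 \<le> Q1 I \<omega>" "Q1 I \<omega> \<le> 1" "0 \<le> Q2 I \<omega>'" "Q2 I \<omega>' \<le> 1" for I \<omega> \<omega>'
    by (auto simp: Q1_def Q2_def intro!: prod_nonneg prod_le_1)
  have mQ [measurable]: "Q1 I \<in> borel_measurable P1" "Q2 I \<in> borel_measurable P2" if "I \<subseteq> K" for I
  proof -
    have "(\<lambda>\<omega>. indicator (A i) (X1 i \<omega>) :: real) \<in> borel_measurable P1"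
      "(\<lambda>\<omega>. indicator (A i) (X2 i \<omega>) :: real) \<in> borel_measurable P2" if "i \<in> I" for i
      using that \<open>I \<subseteq> K\<close> X1[of i] X2[of i] A[of i]
      by (auto intro!: measurable_compose[OF _ borel_measurable_indicator])
    then show "Q1 I \<in> borel_measurable P1" "Q2 I \<in> borel_measurable P2"
      unfolding Q1_def Q2_def by (auto intro!: borel_measurable_prod)
  qed
  have "\<forall>t. (CLINT \<omega>|P1. Q1 I \<omega> * iexp (\<Sum>i\<in>K - I. t i * X1 i \<omega>)) =
            (CLINT \<omega>|P2. Q2 I \<omega> * iexp (\<Sum>i\<in>K - I. t i * X2 i \<omega>))" if "I \<subseteq> K" for I
    using finite_subset[OF that K] that
  proof (induction I rule: finite_induct)
    case empty
    then show ?case using eq by (simp add: Q1_def Q2_def)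
  next
    case (insert j I)
    then have j: "j \<in> K" "j \<notin> I" and IK: "I \<subseteq> K" by auto
    have [measurable]: "X1 j \<in> borel_measurable P1" "X2 j \<in> borel_measurable P2" "A j \<in> sets borel"
      using X1 X2 A j by auto
    have [measurable]: "Q1 I \<in> borel_measurable P1" "Q2 I \<in> borel_measurable P2"
      using mQ IK by auto
    define L where "L = K - insert j I"
    have KI: "K - I = insert j L" "j \<notin> L" "finite L" using j K by (auto simp: L_def)
    have mL [measurable]: "(\<lambda>\<omega>. \<Sum>i\<in>L. t i * X1 i \<omega>) \<in> borel_measurable P1"
      "(\<lambda>\<omega>. \<Sum>i\<in>L. t i * X2 i \<omega>) \<in> borel_measurable P2" for t
      using X1 X2 by (auto simp: L_def intro!: borel_measurable_sum borel_measurable_times)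
    have IH: "(CLINT \<omega>|P1. Q1 I \<omega> * iexp (s * X1 j \<omega> + (\<Sum>i\<in>L. t i * X1 i \<omega>))) =
        (CLINT \<omega>|P2. Q2 I \<omega> * iexp (s * X2 j \<omega> + (\<Sum>i\<in>L. t i * X2 i \<omega>)))" for s t
    proof -
      have "(\<Sum>i\<in>L. (t(j := s)) i * X1 i \<omega>) = (\<Sum>i\<in>L. t i * X1 i \<omega>)"
        "(\<Sum>i\<in>L. (t(j := s)) i * X2 i \<omega>') = (\<Sum>i\<in>L. t i * X2 i \<omega>')" for \<omega> \<omega>'
        using KI by (auto intro!: sum.cong)
      then show ?thesis
        using insert.IH[OF IK, THEN spec, of "t(j := s)"] unfolding KI(1)
        by (subst (asm) (1 2) sum.insert) (use KI in \<open>auto simp del: of_real_add of_real_sum\<close>)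
    qed
    show ?case
    proof
      fix t
      define S1 where "S1 \<omega> = (\<Sum>i\<in>L. t i * X1 i \<omega>)" for \<omega>
      define S2 where "S2 \<omega> = (\<Sum>i\<in>L. t i * X2 i \<omega>)" for \<omega>
      have [measurable]: "S1 \<in> borel_measurable P1" "S2 \<in> borel_measurable P2"
        using mL[of t] by (simp_all add: S1_def[abs_def] S2_def[abs_def])
      define f1 where "f1 s c \<omega> = Q1 I \<omega> * iexp (s * X1 j \<omega> + c * S1 \<omega>)" for s c \<omega>
      define f2 where "f2 s c \<omega> = Q2 I \<omega> * iexp (s * X2 j \<omega> + c * S2 \<omega>)" for s c \<omega>
      have i1: "integrable P1 (f1 s c)" for s c
        unfolding f1_def by (rule P1.integrable_const_bound[where B=1]) (auto simp: norm_mult Q)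
      have i2: "integrable P2 (f2 s c)" for s c
        unfolding f2_def by (rule P2.integrable_const_bound[where B=1]) (auto simp: norm_mult Q)
      have e: "(CLINT \<omega>|P1. f1 s c \<omega>) = (CLINT \<omega>|P2. f2 s c \<omega>)" for s c
        using IH[of s "\<lambda>i. c * t i"] by (simp add: f1_def f2_def S1_def S2_def sum_distrib_left mult.assoc)
      have tr: "complex_of_real (cos S) = (iexp S + iexp (- S)) / 2"
        "complex_of_real (sin S) = (iexp S - iexp (- S)) / (2 * \<i>)" for S
        by (simp_all add: cos_of_real[symmetric] sin_of_real[symmetric] cos_exp_eq sin_exp_eq
            del: cos_of_real sin_of_real)
      have sp: "iexp (x + c * S) = iexp x * iexp (c * S)" for x c S :: real
        by (simp add: exp_add ring_distribs)
      \<comment> \<open>The one-dimensional statement asks for real nonnegative weights, while the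
        remaining factor \<open>iexp S\<close> is complex. The weights \<open>Q\<close>,
        \<open>Q (1 + cos S)\<close> and \<open>Q (1 + sin S)\<close> are nonnegative, determine the
        integral against \<open>iexp S\<close>, and are combinations of exponentials with
        \<open>S\<close> multiplied by 0, 1 and -1.\<close>
      have cos_eq1: "complex_of_real (Q1 I \<omega> * (1 + cos (S1 \<omega>))) * iexp (s * X1 j \<omega>) =
          f1 s 0 \<omega> + (f1 s 1 \<omega> + f1 s (-1) \<omega>) / 2" for s \<omega>
        unfolding f1_def sp of_real_mult of_real_add tr by (simp add: exp_add exp_diff exp_minus field_simps)
      have cos_eq2: "complex_of_real (Q2 I \<omega> * (1 + cos (S2 \<omega>))) * iexp (s * X2 j \<omega>) =
          f2 s 0 \<omega> + (f2 s 1 \<omega> + f2 s (-1) \<omega>) / 2" for s \<omega>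
        unfolding f2_def sp of_real_mult of_real_add tr by (simp add: exp_add exp_diff exp_minus field_simps)
      have sin_eq1: "complex_of_real (Q1 I \<omega> * (1 + sin (S1 \<omega>))) * iexp (s * X1 j \<omega>) =
          f1 s 0 \<omega> + (f1 s 1 \<omega> - f1 s (-1) \<omega>) / (2 * \<i>)" for s \<omega>
        unfolding f1_def sp of_real_mult of_real_add tr by (simp add: exp_add exp_diff exp_minus field_simps)
      have sin_eq2: "complex_of_real (Q2 I \<omega> * (1 + sin (S2 \<omega>))) * iexp (s * X2 j \<omega>) =
          f2 s 0 \<omega> + (f2 s 1 \<omega> - f2 s (-1) \<omega>) / (2 * \<i>)" for s \<omega>
        unfolding f2_def sp of_real_mult of_real_add tr by (simp add: exp_add exp_diff exp_minus field_simps)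
      have bq: "q * (1 + x) \<le> 2" "0 \<le> q * (1 + x)" if "0 \<le> q" "q \<le> 1" "-1 \<le> x" "x \<le> 1" for q x :: real
        using mult_mono[of q 1 "1 + x" 2] that by simp_all
      have a: "(LINT \<omega>|P1. Q1 I \<omega> * indicator (A j) (X1 j \<omega>)) = (LINT \<omega>|P2. Q2 I \<omega> * indicator (A j) (X2 j \<omega>))"
        using e[of _ 0] by (intro weighted_char_unique[where C=1, OF P]) (auto simp: Q f1_def f2_def)
      have b: "(LINT \<omega>|P1. (Q1 I \<omega> * (1 + cos (S1 \<omega>))) * indicator (A j) (X1 j \<omega>)) =
               (LINT \<omega>|P2. (Q2 I \<omega> * (1 + cos (S2 \<omega>))) * indicator (A j) (X2 j \<omega>))"
      proof (rule weighted_char_unique[where C=2, OF P])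
        show "(CLINT \<omega>|P1. complex_of_real (Q1 I \<omega> * (1 + cos (S1 \<omega>))) * iexp (s * X1 j \<omega>)) =
              (CLINT \<omega>|P2. complex_of_real (Q2 I \<omega> * (1 + cos (S2 \<omega>))) * iexp (s * X2 j \<omega>))" for s
          unfolding cos_eq1 cos_eq2 using i1 i2 e by simp
        show "Q1 I \<omega> * (1 + cos (S1 \<omega>)) \<le> 2" for \<omega>
          by (intro bq Q) auto
        show "Q2 I \<omega> * (1 + cos (S2 \<omega>)) \<le> 2" for \<omega>
          by (intro bq Q) auto
        show "0 \<le> Q1 I \<omega> * (1 + cos (S1 \<omega>))" for \<omega>
          by (intro bq Q) auto
        show "0 \<le> Q2 I \<omega> * (1 + cos (S2 \<omega>))" for \<omega>
          by (intro bq Q) auto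
      qed measurable
      have c: "(LINT \<omega>|P1. (Q1 I \<omega> * (1 + sin (S1 \<omega>))) * indicator (A j) (X1 j \<omega>)) =
               (LINT \<omega>|P2. (Q2 I \<omega> * (1 + sin (S2 \<omega>))) * indicator (A j) (X2 j \<omega>))"
      proof (rule weighted_char_unique[where C=2, OF P])
        show "(CLINT \<omega>|P1. complex_of_real (Q1 I \<omega> * (1 + sin (S1 \<omega>))) * iexp (s * X1 j \<omega>)) =
              (CLINT \<omega>|P2. complex_of_real (Q2 I \<omega> * (1 + sin (S2 \<omega>))) * iexp (s * X2 j \<omega>))" for s
          unfolding sin_eq1 sin_eq2 using i1 i2 e by simp
        show "Q1 I \<omega> * (1 + sin (S1 \<omega>)) \<le> 2" for \<omega>
          by (intro bq Q) auto
        show "Q2 I \<omega> * (1 + sin (S2 \<omega>)) \<le> 2" for \<omega>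
          by (intro bq Q) auto
        show "0 \<le> Q1 I \<omega> * (1 + sin (S1 \<omega>))" for \<omega>
          by (intro bq Q) auto
        show "0 \<le> Q2 I \<omega> * (1 + sin (S2 \<omega>))" for \<omega>
          by (intro bq Q) auto
      qed measurable
      define J1 where "J1 \<omega> = Q1 I \<omega> * indicator (A j) (X1 j \<omega>)" for \<omega>
      define J2 where "J2 \<omega> = Q2 I \<omega> * indicator (A j) (X2 j \<omega>)" for \<omega>
      have [measurable]: "J1 \<in> borel_measurable P1" "J2 \<in> borel_measurable P2"
        unfolding J1_def[abs_def] J2_def[abs_def] by measurable
      have J: "0 \<le> J1 \<omega>" "J1 \<omega> \<le> 1" "0 \<le> J2 \<omega>'" "J2 \<omega>' \<le> 1" for \<omega> \<omega>'
        using Q by (auto simp: J1_def J2_def indicator_def)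
      have bd: "\<bar>x * y\<bar> \<le> 1" if "0 \<le> x" "x \<le> 1" "\<bar>y\<bar> \<le> 1" for x y :: real
        using mult_mono[of x 1 "\<bar>y\<bar>" 1] that by (simp add: abs_mult)
      have I1: "integrable P1 J1" "integrable P1 (\<lambda>\<omega>. J1 \<omega> * cos (S1 \<omega>))" "integrable P1 (\<lambda>\<omega>. J1 \<omega> * sin (S1 \<omega>))"
        by (auto intro!: P1.integrable_const_bound[where B=1] AE_I2 bd simp: J)
      have I2: "integrable P2 J2" "integrable P2 (\<lambda>\<omega>. J2 \<omega> * cos (S2 \<omega>))" "integrable P2 (\<lambda>\<omega>. J2 \<omega> * sin (S2 \<omega>))"
        by (auto intro!: P2.integrable_const_bound[where B=1] AE_I2 bd simp: J)
      have cs: "(LINT \<omega>|P1. J1 \<omega> * cos (S1 \<omega>)) = (LINT \<omega>|P2. J2 \<omega> * cos (S2 \<omega>))"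
        "(LINT \<omega>|P1. J1 \<omega> * sin (S1 \<omega>)) = (LINT \<omega>|P2. J2 \<omega> * sin (S2 \<omega>))"
      proof -
        have "(Q1 I \<omega> * (1 + x)) * indicator (A j) (X1 j \<omega>) = J1 \<omega> + J1 \<omega> * x" for \<omega> x
          by (simp add: J1_def algebra_simps)
        moreover have "(Q2 I \<omega> * (1 + x)) * indicator (A j) (X2 j \<omega>) = J2 \<omega> + J2 \<omega> * x" for \<omega> x
          by (simp add: J2_def algebra_simps)
        ultimately show "(LINT \<omega>|P1. J1 \<omega> * cos (S1 \<omega>)) = (LINT \<omega>|P2. J2 \<omega> * cos (S2 \<omega>))"
        "(LINT \<omega>|P1. J1 \<omega> * sin (S1 \<omega>)) = (LINT \<omega>|P2. J2 \<omega> * sin (S2 \<omega>))"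
          using a b c I1 I2 by (simp_all add: J1_def[symmetric] J2_def[symmetric])
      qed
      have ie: "complex_of_real q * iexp x = complex_of_real (q * cos x) + \<i> * complex_of_real (q * sin x)" for q x
        by (simp add: exp_Euler algebra_simps cos_of_real sin_of_real)
      have "(CLINT \<omega>|P1. complex_of_real (J1 \<omega>) * iexp (S1 \<omega>)) = (CLINT \<omega>|P2. complex_of_real (J2 \<omega>) * iexp (S2 \<omega>))"
        unfolding ie using I1 I2 cs by (simp del: of_real_mult)
      moreover have "Q1 (insert j I) \<omega> = J1 \<omega>" "Q2 (insert j I) \<omega>' = J2 \<omega>'" for \<omega> \<omega>'
        using insert.hyps by (simp_all add: Q1_def Q2_def J1_def J2_def)
      ultimately show "(CLINT \<omega>|P1. Q1 (insert j I) \<omega> * iexp (\<Sum>i\<in>K - insert j I. t i * X1 i \<omega>)) =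
            (CLINT \<omega>|P2. Q2 (insert j I) \<omega> * iexp (\<Sum>i\<in>K - insert j I. t i * X2 i \<omega>))"
        by (simp add: L_def[symmetric] S1_def[symmetric] S2_def[symmetric])
    qed
  qed
  from this[of K] have "(CLINT \<omega>|P1. complex_of_real (Q1 K \<omega>)) = (CLINT \<omega>|P2. complex_of_real (Q2 K \<omega>))"
    by simp
  then have e: "(LINT \<omega>|P1. Q1 K \<omega>) = (LINT \<omega>|P2. Q2 K \<omega>)"
    by (simp del: of_real_prod)
  have "Q1 K \<omega> = indicator {\<omega>\<in>space P1. \<forall>i\<in>K. X1 i \<omega> \<in> A i} \<omega>" if "\<omega> \<in> space P1" for \<omega>
    using K that by (auto simp: Q1_def indicator_def)
  then have "(LINT \<omega>|P1. Q1 K \<omega>) = measure P1 {\<omega>\<in>space P1. \<forall>i\<in>K. X1 i \<omega> \<in> A i}"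
    by (subst Bochner_Integration.integral_cong[OF refl]) (auto intro!: arg_cong[where f="measure _"])
  moreover have "Q2 K \<omega> = indicator {\<omega>\<in>space P2. \<forall>i\<in>K. X2 i \<omega> \<in> A i} \<omega>" if "\<omega> \<in> space P2" for \<omega>
    using K that by (auto simp: Q2_def indicator_def)
  then have "(LINT \<omega>|P2. Q2 K \<omega>) = measure P2 {\<omega>\<in>space P2. \<forall>i\<in>K. X2 i \<omega> \<in> A i}"
    by (subst Bochner_Integration.integral_cong[OF refl]) (auto intro!: arg_cong[where f="measure _"])
  ultimately show ?thesis using e by simp
qed

section \<open>Gaussian subspaces\<close>

lemma prob_space_gauss_space: "prob_space gauss_space"
  unfolding gauss_space_def
  by (intro prob_space_PiM) (auto simp: prob_space_normal_density)

interpretation gauss: information_space gauss_space 2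
  by (simp add: information_space_def information_space_axioms_def prob_space_gauss_space)

interpretation gauss_pair: pair_prob_space gauss_space gauss_space
  by unfold_locales

section \<open>Independence and Gaussian laws\<close>

lemma independent_iff_distr:
  "independent A X B Y \<longleftrightarrow> X \<in> measurable gauss_space A \<and> Y \<in> measurable gauss_space B \<and>
     distr gauss_space (A \<Otimes>\<^sub>M B) (\<lambda>\<omega>. (X \<omega>, Y \<omega>)) = distr gauss_space A X \<Otimes>\<^sub>M distr gauss_space B Y"
    (is "?L \<longleftrightarrow> ?R")
proof
  assume L: ?L
  then have [measurable]: "X \<in> measurable gauss_space A" "Y \<in> measurable gauss_space B"
    by (auto simp: independent_def)
  interpret X: prob_space "distr gauss_space A X" by (rule gauss.prob_space_distr) simp
  interpret Y: prob_space "distr gauss_space B Y" by (rule gauss.prob_space_distr) simp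
  have "distr gauss_space A X \<Otimes>\<^sub>M distr gauss_space B Y =
      distr gauss_space (A \<Otimes>\<^sub>M B) (\<lambda>\<omega>. (X \<omega>, Y \<omega>))"
  proof (rule pair_measure_eqI)
    fix S T assume "S \<in> sets (distr gauss_space A X)" "T \<in> sets (distr gauss_space B Y)"
    then have [measurable]: "S \<in> sets A" "T \<in> sets B" by auto
    have "gauss.prob ((X -` S \<inter> space gauss_space) \<inter> (Y -` T \<inter> space gauss_space)) =
        gauss.prob (X -` S \<inter> space gauss_space) * gauss.prob (Y -` T \<inter> space gauss_space)"
      using L \<open>S \<in> sets A\<close> \<open>T \<in> sets B\<close> unfolding independent_def gauss.indep_sets2_eq by blast
    moreover have "(\<lambda>\<omega>. (X \<omega>, Y \<omega>)) -` (S \<times> T) \<inter> space gauss_space =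
        (X -` S \<inter> space gauss_space) \<inter> (Y -` T \<inter> space gauss_space)" by auto
    ultimately show "emeasure (distr gauss_space A X) S * emeasure (distr gauss_space B Y) T =
        emeasure (distr gauss_space (A \<Otimes>\<^sub>M B) (\<lambda>\<omega>. (X \<omega>, Y \<omega>))) (S \<times> T)"
      by (subst (1 2 3) emeasure_distr) (auto simp: gauss.emeasure_eq_measure ennreal_mult')
  qed (auto intro: X.sigma_finite_measure_axioms Y.sigma_finite_measure_axioms)
  then show ?R by simp
next
  assume R: ?R
  then have [measurable]: "X \<in> measurable gauss_space A" "Y \<in> measurable gauss_space B"
    by auto
  interpret X: prob_space "distr gauss_space A X" by (rule gauss.prob_space_distr) simp
  interpret Y: prob_space "distr gauss_space B Y" by (rule gauss.prob_space_distr) simp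
  have "gauss.prob ((X -` S \<inter> space gauss_space) \<inter> (Y -` T \<inter> space gauss_space)) =
      gauss.prob (X -` S \<inter> space gauss_space) * gauss.prob (Y -` T \<inter> space gauss_space)"
    if [measurable]: "S \<in> sets A" "T \<in> sets B" for S T
  proof -
    have "emeasure (distr gauss_space (A \<Otimes>\<^sub>M B) (\<lambda>\<omega>. (X \<omega>, Y \<omega>))) (S \<times> T) =
        emeasure (distr gauss_space A X) S * emeasure (distr gauss_space B Y) T"
      using R that by (simp add: Y.emeasure_pair_measure_Times)
    moreover have "(\<lambda>\<omega>. (X \<omega>, Y \<omega>)) -` (S \<times> T) \<inter> space gauss_space =
        (X -` S \<inter> space gauss_space) \<inter> (Y -` T \<inter> space gauss_space)" by auto
    ultimately show ?thesis
      by (simp add: emeasure_distr gauss.emeasure_eq_measure flip: ennreal_mult')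
  qed
  then show ?L unfolding independent_def gauss.indep_sets2_eq by auto
qed

lemma independent_compose:
  assumes XY: "independent A X B Y" and f: "f \<in> measurable A A'" and g: "g \<in> measurable B B'"
  shows "independent A' (\<lambda>\<omega>. f (X \<omega>)) B' (\<lambda>\<omega>. g (Y \<omega>))"
proof -
  have X: "X \<in> measurable gauss_space A" and Y: "Y \<in> measurable gauss_space B"
    using XY by (simp_all add: independent_def)
  have fX: "(\<lambda>\<omega>. f (X \<omega>)) \<in> measurable gauss_space A'"
    and gY: "(\<lambda>\<omega>. g (Y \<omega>)) \<in> measurable gauss_space B'"
    using measurable_compose[OF X f] measurable_compose[OF Y g] by simp_all
  have "{(\<lambda>\<omega>. f (X \<omega>)) -` S \<inter> space gauss_space |S. S \<in> sets A'} \<subseteq>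
      {X -` S \<inter> space gauss_space |S. S \<in> sets A}"
  proof clarify
    fix S assume "S \<in> sets A'"
    moreover have "(\<lambda>\<omega>. f (X \<omega>)) -` S \<inter> space gauss_space = X -` (f -` S \<inter> space A) \<inter> space gauss_space"
      using measurable_space[OF X] by blast
    ultimately show "\<exists>T. (\<lambda>\<omega>. f (X \<omega>)) -` S \<inter> space gauss_space = X -` T \<inter> space gauss_space \<and> T \<in> sets A"
      using measurable_sets[OF f] by blast
  qed
  moreover have "{(\<lambda>\<omega>. g (Y \<omega>)) -` S \<inter> space gauss_space |S. S \<in> sets B'} \<subseteq>
      {Y -` S \<inter> space gauss_space |S. S \<in> sets B}"
  proof clarify
    fix S assume "S \<in> sets B'"
    moreover have "(\<lambda>\<omega>. g (Y \<omega>)) -` S \<inter> space gauss_space = Y -` (g -` S \<inter> space B) \<inter> space gauss_space"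
      using measurable_space[OF Y] by blast
    ultimately show "\<exists>T. (\<lambda>\<omega>. g (Y \<omega>)) -` S \<inter> space gauss_space = Y -` T \<inter> space gauss_space \<and> T \<in> sets B"
      using measurable_sets[OF g] by blast
  qed
  ultimately show ?thesis
    using XY fX gY unfolding independent_def gauss.indep_sets2_eq by (meson subsetD subset_trans)
qed

lemma independent_imp_indep_var:
  "independent A X A Y \<Longrightarrow> gauss.indep_var A X A Y"
  by (simp add: independent_iff_distr gauss.indep_var_distribution_eq)

definition cov :: "((nat + nat \<Rightarrow> real) \<Rightarrow> real) \<Rightarrow> ((nat + nat \<Rightarrow> real) \<Rightarrow> real) \<Rightarrow> real" where
  "cov X Y = (\<integral>\<omega>. X \<omega> * Y \<omega> \<partial>gauss_space)"

lemma centered_gaussian_measurable [measurable_dest]: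
  "centered_gaussian X \<Longrightarrow> X \<in> borel_measurable gauss_space"
  by (simp add: centered_gaussian_def)

lemma centered_gaussian_facts:
  assumes "centered_gaussian X"
  shows centered_gaussian_integrable_square: "integrable gauss_space (\<lambda>\<omega>. X \<omega> * X \<omega>)"
    and centered_gaussian_char: "(CLINT \<omega>|gauss_space. iexp (t * X \<omega>)) = exp (- (t\<^sup>2 * cov X X) / 2)"
    and centered_gaussian_distr: "distr gauss_space borel X =
      distr std_normal_distribution borel (\<lambda>x. sqrt (cov X X) * x)"
proof -
  obtain \<sigma> where \<sigma>: "distr gauss_space borel X = distr std_normal_distribution borel (\<lambda>x. \<sigma> * x)"
    using assms by (auto simp: centered_gaussian_def)
  have [measurable]: "X \<in> borel_measurable gauss_space" using assms by measurable
  have "integrable (distr gauss_space borel X) (\<lambda>x. x * x)"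
  proof -
    have "integrable std_normal_distribution (\<lambda>x. \<sigma>\<^sup>2 * x ^ 2)"
      by (intro integrable_mult_right integrable_std_normal_distribution_moment)
    moreover have "(\<lambda>x. \<sigma>\<^sup>2 * x ^ 2) = (\<lambda>x. \<sigma> * x * (\<sigma> * x))"
      by (simp add: fun_eq_iff power2_eq_square)
    ultimately show ?thesis unfolding \<sigma> by (subst integrable_distr_eq) simp_all
  qed
  then show "integrable gauss_space (\<lambda>\<omega>. X \<omega> * X \<omega>)"
    by (subst (asm) integrable_distr_eq) auto
  have "cov X X = (\<integral>x. x * x \<partial>distr gauss_space borel X)"
    unfolding cov_def by (subst integral_distr) auto
  also have "\<dots> = (\<integral>x. \<sigma> * x * (\<sigma> * x) \<partial>std_normal_distribution)"
    unfolding \<sigma> by (subst integral_distr) auto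
  also have "\<dots> = (\<integral>x. \<sigma>\<^sup>2 * x ^ 2 \<partial>std_normal_distribution)"
    by (intro Bochner_Integration.integral_cong) (auto simp: power2_eq_square)
  also have "\<dots> = \<sigma>\<^sup>2"
    using std_normal_distribution_even_moments(1)[of 1] by simp
  finally have v: "cov X X = \<sigma>\<^sup>2" .
  have ch: "char (distr std_normal_distribution borel (\<lambda>x. s * x)) t = exp (- (t\<^sup>2 * s\<^sup>2) / 2)" for s t
  proof -
    have "char (distr std_normal_distribution borel (\<lambda>x. s * x)) t = char std_normal_distribution (t * s)"
      unfolding char_def by (subst integral_distr) (auto simp: mult_ac)
    then show ?thesis by (simp add: char_std_normal_distribution power_mult_distrib)
  qed
  have "(CLINT \<omega>|gauss_space. iexp (t * X \<omega>)) = char (distr gauss_space borel X) t"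
    unfolding char_def by (subst integral_distr) auto
  then show "(CLINT \<omega>|gauss_space. iexp (t * X \<omega>)) = exp (- (t\<^sup>2 * cov X X) / 2)"
    unfolding \<sigma> v ch by simp
  interpret std: real_distribution std_normal_distribution by (rule real_dist_normal_dist)
  have rd: "real_distribution (distr std_normal_distribution borel (\<lambda>x. s * x))" for s
    by (auto simp: real_distribution_def real_distribution_axioms_def intro!: std.prob_space_distr)
  \<comment> \<open>\<open>\<sigma>\<close> may be negative and \<open>sqrt (cov X X)\<close> is its
    absolute value; by symmetry the law is the same.\<close>
  show "distr gauss_space borel X = distr std_normal_distribution borel (\<lambda>x. sqrt (cov X X) * x)"
    unfolding \<sigma> v by (intro Levy_uniqueness rd) (auto simp: ch)
qed

lemma centered_gaussianI:
  assumes [measurable]: "X \<in> borel_measurable gauss_space" and "0 \<le> v"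
    and "\<And>t. (CLINT \<omega>|gauss_space. iexp (t * X \<omega>)) = exp (- (t\<^sup>2 * v) / 2)"
  shows "centered_gaussian X"
  unfolding centered_gaussian_def
proof (intro conjI exI)
  interpret std: real_distribution std_normal_distribution by (rule real_dist_normal_dist)
  show "distr gauss_space borel X = distr std_normal_distribution borel (\<lambda>x. sqrt v * x)"
  proof (rule Levy_uniqueness)
    show "real_distribution (distr gauss_space borel X)"
      by (auto simp: real_distribution_def real_distribution_axioms_def intro!: gauss.prob_space_distr)
    show "real_distribution (distr std_normal_distribution borel (\<lambda>x. sqrt v * x))"
      by (auto simp: real_distribution_def real_distribution_axioms_def intro!: std.prob_space_distr)
    show "char (distr gauss_space borel X) = char (distr std_normal_distribution borel (\<lambda>x. sqrt v * x))"
    proof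
      fix t
      have "char (distr gauss_space borel X) t = exp (- (t\<^sup>2 * v) / 2)"
        unfolding char_def using assms(3) by (subst integral_distr) auto
      also have "\<dots> = char std_normal_distribution (t * sqrt v)"
        using assms(2) by (simp add: char_std_normal_distribution power_mult_distrib)
      also have "\<dots> = char (distr std_normal_distribution borel (\<lambda>x. sqrt v * x)) t"
        unfolding char_def by (subst integral_distr) (auto simp: mult_ac)
      finally show "char (distr gauss_space borel X) t = char (distr std_normal_distribution borel (\<lambda>x. sqrt v * x)) t" .
    qed
  qed
qed fact

lemma centered_gaussian_scale:
  assumes "centered_gaussian X"
  shows "centered_gaussian (c *\<^sub>R X)"
proof (rule centered_gaussianI)
  have [measurable]: "X \<in> borel_measurable gauss_space" using assms by measurable
  show "c *\<^sub>R X \<in> borel_measurable gauss_space" by (simp add: scaleR_fun_def)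
  have "0 \<le> cov X X" unfolding cov_def by (intro integral_nonneg_AE) auto
  then show "0 \<le> c\<^sup>2 * cov X X" by simp
  show "(CLINT \<omega>|gauss_space. iexp (t * (c *\<^sub>R X) \<omega>)) = exp (- (t\<^sup>2 * (c\<^sup>2 * cov X X)) / 2)" for t
    using centered_gaussian_char[OF assms, of "t * c"] by (simp add: power_mult_distrib mult_ac)
qed

lemma centered_gaussian_add:
  assumes X: "centered_gaussian X" and Y: "centered_gaussian Y" and "independent borel X borel Y"
  shows "centered_gaussian (X + Y)"
proof (rule centered_gaussianI)
  have [measurable]: "X \<in> borel_measurable gauss_space" "Y \<in> borel_measurable gauss_space"
    using assms by measurable
  show "X + Y \<in> borel_measurable gauss_space" by (simp add: plus_fun_def)
  have "0 \<le> cov X X" "0 \<le> cov Y Y" unfolding cov_def by (intro integral_nonneg_AE, auto)+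
  then show "0 \<le> cov X X + cov Y Y" by simp
  have c: "(CLINT \<omega>|gauss_space. iexp (t * Z \<omega>)) = char (distr gauss_space borel Z) t"
    if "Z \<in> borel_measurable gauss_space" for t Z
    using that unfolding char_def by (subst integral_distr) auto
  show "(CLINT \<omega>|gauss_space. iexp (t * (X + Y) \<omega>)) = exp (- (t\<^sup>2 * (cov X X + cov Y Y)) / 2)" for t
  proof -
    have "(CLINT \<omega>|gauss_space. iexp (t * (X + Y) \<omega>)) =
        complex_of_real (exp (- (t\<^sup>2 * cov X X) / 2)) * complex_of_real (exp (- (t\<^sup>2 * cov Y Y) / 2))"
      using gauss.char_distr_add[OF independent_imp_indep_var[OF assms(3)], of t]
      unfolding c[symmetric, OF \<open>X \<in> _\<close>] c[symmetric, OF \<open>Y \<in> _\<close>] centered_gaussian_char[OF X] centered_gaussian_char[OF Y]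
      by (subst c) (simp_all add: plus_fun_def)
    also have "\<dots> = complex_of_real (exp (- (t\<^sup>2 * cov X X) / 2 + - (t\<^sup>2 * cov Y Y) / 2))"
      by (simp only: exp_add of_real_mult)
    also have "- (t\<^sup>2 * cov X X) / 2 + - (t\<^sup>2 * cov Y Y) / 2 = - (t\<^sup>2 * (cov X X + cov Y Y)) / 2"
      by (simp add: field_simps)
    finally show ?thesis .
  qed
qed

text \<open>Joint Gaussianity is encoded as the Gaussianity of all linear combinations.\<close>

definition gaussian_subspace :: "((nat + nat \<Rightarrow> real) \<Rightarrow> real) set \<Rightarrow> bool" where
  "gaussian_subspace S \<longleftrightarrow> subspace S \<and> (\<forall>X\<in>S. centered_gaussian X)"

lemma gaussian_subspaceD:
  assumes "gaussian_subspace S"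
  shows "subspace S" "X \<in> S \<Longrightarrow> centered_gaussian X" "X \<in> S \<Longrightarrow> X \<in> borel_measurable gauss_space"
  using assms by (auto simp: gaussian_subspace_def intro: centered_gaussian_measurable)

lemma integrable_mult_of_squares:
  fixes X Y :: "'a \<Rightarrow> real"
  assumes [measurable]: "X \<in> borel_measurable M" "Y \<in> borel_measurable M"
    and "integrable M (\<lambda>\<omega>. X \<omega> * X \<omega>)" "integrable M (\<lambda>\<omega>. Y \<omega> * Y \<omega>)"
  shows "integrable M (\<lambda>\<omega>. X \<omega> * Y \<omega>)"
proof (rule Bochner_Integration.integrable_bound)
  show "integrable M (\<lambda>\<omega>. X \<omega> * X \<omega> + Y \<omega> * Y \<omega>)" using assms by simp
  have "\<bar>a * b\<bar> \<le> a * a + b * b" for a b :: real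
  proof -
    have "0 \<le> (\<bar>a\<bar> - \<bar>b\<bar>)\<^sup>2" by simp
    then have "2 * \<bar>a * b\<bar> \<le> a * a + b * b" by (simp add: power2_diff abs_mult power2_eq_square[symmetric])
    moreover have "0 \<le> \<bar>a * b\<bar>" by simp
    ultimately show ?thesis by linarith
  qed
  then show "AE \<omega> in M. norm (X \<omega> * Y \<omega>) \<le> norm (X \<omega> * X \<omega> + Y \<omega> * Y \<omega>)" by auto
qed simp

lemma gaussian_subspace_integrable:
  assumes "gaussian_subspace S" "X \<in> S" "Y \<in> S"
  shows "integrable gauss_space (\<lambda>\<omega>. X \<omega> * Y \<omega>)"
  by (rule integrable_mult_of_squares[OF gaussian_subspaceD(3)[OF assms(1,2)] gaussian_subspaceD(3)[OF assms(1,3)]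
        centered_gaussian_integrable_square[OF gaussian_subspaceD(2)[OF assms(1,2)]]
        centered_gaussian_integrable_square[OF gaussian_subspaceD(2)[OF assms(1,3)]]])

lemma semi_inner_cov: "gaussian_subspace S \<Longrightarrow> semi_inner S cov"
proof
  assume S: "gaussian_subspace S"
  show "subspace S" using gaussian_subspaceD(1)[OF S] .
  show "cov (x + y) z = cov x z + cov y z" if "x \<in> S" "y \<in> S" "z \<in> S" for x y z
    using gaussian_subspace_integrable[OF S] that by (simp add: cov_def distrib_right)
  show "cov (c *\<^sub>R x) y = c * cov x y" for c x y
    by (simp add: cov_def mult.assoc)
  show "cov x y = cov y x" for x y by (simp add: cov_def mult.commute)
  show "0 \<le> cov x x" for x unfolding cov_def by (intro integral_nonneg_AE) auto
qed

text \<open>A generator fitted to the independence proof below: one measurable factor per index,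
  closed under intersections.\<close>

lemma sets_PiM_boxes:
  assumes "finite I"
  shows "sets (PiM I M) = sigma_sets (PiE I (\<lambda>i. space (M i))) {PiE I B |B. \<forall>i\<in>I. B i \<in> sets (M i)}"
proof -
  have "{PiE I X |X. (\<forall>i. X i \<in> sets (M i)) \<and> finite {i. X i \<noteq> space (M i)}} =
      {PiE I B |B. \<forall>i\<in>I. B i \<in> sets (M i)}" (is "?A = ?B")
  proof (intro equalityI subsetI)
    fix D assume "D \<in> ?B"
    then obtain B where D: "D = PiE I B" and B: "\<And>i. i \<in> I \<Longrightarrow> B i \<in> sets (M i)" by blast
    define X where "X i = (if i \<in> I then B i else space (M i))" for i
    have "finite {i. X i \<noteq> space (M i)}"
      by (rule finite_subset[OF _ assms]) (auto simp: X_def split: if_splits)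
    moreover have "D = PiE I X" unfolding D by (intro PiE_cong) (simp add: X_def)
    moreover have "X i \<in> sets (M i)" for i using B by (simp add: X_def)
    ultimately show "D \<in> ?A" by blast
  qed blast
  then show ?thesis unfolding sets_PiM_finite by simp
qed

text \<open>The characteristic function of a jointly Gaussian vector depends on the covariances only, so
  orthogonality is independence.\<close>

lemma gaussian_orthogonal_independent:
  fixes Y :: "'i \<Rightarrow> (nat + nat \<Rightarrow> real) \<Rightarrow> real"
  assumes S: "gaussian_subspace S" and I: "finite I" and E: "E \<in> S" and Y: "\<And>i. i \<in> I \<Longrightarrow> Y i \<in> S"
    and orth: "\<And>i. i \<in> I \<Longrightarrow> cov E (Y i) = 0"
  shows "independent borel E (PiM I (\<lambda>_. borel)) (\<lambda>\<omega>. \<lambda>i\<in>I. Y i \<omega>)"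
proof -
  interpret semi_inner S cov by (rule semi_inner_cov[OF S])
  have [measurable]: "E \<in> borel_measurable gauss_space" using gaussian_subspaceD(3)[OF S] E by auto
  have Ym [measurable]: "i \<in> I \<Longrightarrow> Y i \<in> borel_measurable gauss_space" for i
    using gaussian_subspaceD(3)[OF S] Y by auto
  have YI [measurable]: "(\<lambda>\<omega>. \<lambda>i\<in>I. Y i \<omega>) \<in> measurable gauss_space (PiM I (\<lambda>_. borel))"
    by (intro measurable_restrict) auto
  \<comment> \<open>\<open>None\<close> stands for \<open>E\<close> and \<open>Some i\<close> for
    \<open>Y i\<close>. The family \<open>X2\<close> is an independent copy on a product space, with
    \<open>E\<close> and the \<open>Y i\<close> read off different components; equal characteristic
    functions make both joint laws agree on boxes.\<close>
  define K where "K = insert None (Some ` I)"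
  define X1 where "X1 k = (case k of None \<Rightarrow> E | Some i \<Rightarrow> Y i)" for k
  define X2 :: "'i option \<Rightarrow> (nat + nat \<Rightarrow> real) \<times> (nat + nat \<Rightarrow> real) \<Rightarrow> real"
    where "X2 k z = (case k of None \<Rightarrow> E (fst z) | Some i \<Rightarrow> Y i (snd z))" for k z
  let ?P2 = "gauss_space \<Otimes>\<^sub>M gauss_space"
  have ball: "(\<forall>k\<in>K. X1 k \<omega> \<in> A k) \<longleftrightarrow> E \<omega> \<in> A None \<and> (\<forall>i\<in>I. Y i \<omega> \<in> A (Some i))" for A \<omega>
    by (simp add: K_def X1_def)
  have ball2: "(\<forall>k\<in>K. X2 k z \<in> A k) \<longleftrightarrow> E (fst z) \<in> A None \<and> (\<forall>i\<in>I. Y i (snd z) \<in> A (Some i))" for A z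
    by (simp add: K_def X2_def)
  have sum1: "(\<Sum>k\<in>K. t k * X1 k \<omega>) = t None * E \<omega> + (\<Sum>i\<in>I. t (Some i) * Y i \<omega>)" for t \<omega>
    using I by (simp add: K_def X1_def sum.reindex)
  have sum2: "(\<Sum>k\<in>K. t k * X2 k z) = t None * E (fst z) + (\<Sum>i\<in>I. t (Some i) * Y i (snd z))" for t z
    using I by (simp add: K_def X2_def sum.reindex)
  have prod: "gauss.prob {\<omega>\<in>space gauss_space. E \<omega> \<in> A None \<and> (\<forall>i\<in>I. Y i \<omega> \<in> A (Some i))} =
      gauss.prob {\<omega>\<in>space gauss_space. E \<omega> \<in> A None} *
      gauss.prob {\<omega>\<in>space gauss_space. \<forall>i\<in>I. Y i \<omega> \<in> A (Some i)}"
    if A: "\<And>k. k \<in> K \<Longrightarrow> A k \<in> sets borel" for A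
  proof -
    have [measurable]: "A None \<in> sets borel" using A by (auto simp: K_def)
    have [measurable]: "i \<in> I \<Longrightarrow> A (Some i) \<in> sets borel" for i using A by (auto simp: K_def)
    have "gauss.prob {\<omega>\<in>space gauss_space. \<forall>k\<in>K. X1 k \<omega> \<in> A k} =
      measure ?P2 {z\<in>space ?P2. \<forall>k\<in>K. X2 k z \<in> A k}"
    proof (rule multivariate_char_unique[where K=K and A=A and ?X1.0=X1 and ?X2.0=X2])
      show "prob_space gauss_space" "prob_space ?P2" by unfold_locales
      show "finite K" using I by (simp add: K_def)
      show "k \<in> K \<Longrightarrow> X1 k \<in> borel_measurable gauss_space" for k
        by (auto simp: K_def X1_def)
      show "k \<in> K \<Longrightarrow> X2 k \<in> borel_measurable ?P2" for k
        by (auto simp: K_def X2_def[abs_def])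
      show "A k \<in> sets borel" if "k \<in> K" for k using A that .
      fix t :: "'i option \<Rightarrow> real"
      define U where "U = t None *\<^sub>R E"
      define V where "V = (\<Sum>i\<in>I. t (Some i) *\<^sub>R Y i)"
      have UV: "U \<in> S" "V \<in> S" using E Y by (auto simp: U_def V_def intro!: mem)
      then have UVg: "centered_gaussian U" "centered_gaussian V" "centered_gaussian (U + V)"
        using gaussian_subspaceD(2)[OF S] mem(2)[OF UV] by auto
      note [measurable] = UVg[THEN centered_gaussian_measurable]
      have "cov U V = (\<Sum>i\<in>I. t None * (t (Some i) * cov E (Y i)))"
        using E Y by (simp add: U_def V_def sum_right bilinear sum_distrib_left mult.left_commute)
      then have "cov U V = 0" using orth by simp
      then have cv: "cov (U + V) (U + V) = cov U U + cov V V"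
        using UV by (simp add: bilinear sym[of V U])
      have "(CLINT \<omega>|gauss_space. iexp (\<Sum>k\<in>K. t k * X1 k \<omega>)) = (CLINT \<omega>|gauss_space. iexp (1 * (U + V) \<omega>))"
        unfolding sum1 U_def V_def by simp
      also have "\<dots> = complex_of_real (exp (- (cov U U) / 2 + - (cov V V) / 2))"
        unfolding centered_gaussian_char[OF UVg(3)] cv by (simp add: add_divide_distrib)
      also have "\<dots> = complex_of_real (exp (- (cov U U) / 2)) * complex_of_real (exp (- (cov V V) / 2))"
        unfolding exp_add by simp
      also have "\<dots> = (CLINT \<omega>|gauss_space. iexp (U \<omega>)) * (CLINT \<omega>|gauss_space. iexp (V \<omega>))"
        using centered_gaussian_char[OF UVg(1), of 1] centered_gaussian_char[OF UVg(2), of 1] by simp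
      also have "\<dots> = (CLINT \<omega>|gauss_space. CLINT \<omega>'|gauss_space. iexp (U \<omega>) * iexp (V \<omega>'))"
        by simp
      also have "\<dots> = (CLINT z|?P2. iexp (U (fst z)) * iexp (V (snd z)))"
      proof -
        have "integrable ?P2 (\<lambda>z. iexp (U (fst z)) * iexp (V (snd z)))"
          by (rule gauss_pair.P.integrable_const_bound[where B=1]) (auto simp: norm_mult)
        from gauss_pair.integral_fst'[OF this] show ?thesis by simp
      qed
      also have "\<dots> = (CLINT z|?P2. iexp (\<Sum>k\<in>K. t k * X2 k z))"
        unfolding sum2 U_def V_def by (simp add: exp_add[symmetric] ring_distribs)
      finally show "(CLINT \<omega>|gauss_space. iexp (\<Sum>k\<in>K. t k * X1 k \<omega>)) =
          (CLINT z|?P2. iexp (\<Sum>k\<in>K. t k * X2 k z))" .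
    qed
    also have "measure ?P2 {z\<in>space ?P2. \<forall>k\<in>K. X2 k z \<in> A k} = gauss.prob {\<omega>\<in>space gauss_space. E \<omega> \<in> A None} *
        gauss.prob {\<omega>\<in>space gauss_space. \<forall>i\<in>I. Y i \<omega> \<in> A (Some i)}"
    proof -
      have "{z\<in>space ?P2. \<forall>k\<in>K. X2 k z \<in> A k} =
          {\<omega>\<in>space gauss_space. E \<omega> \<in> A None} \<times> {\<omega>\<in>space gauss_space. \<forall>i\<in>I. Y i \<omega> \<in> A (Some i)}"
        unfolding ball2 by (auto simp: space_pair_measure)
      moreover have "{\<omega>\<in>space gauss_space. E \<omega> \<in> A None} \<in> gauss.events" by measurable
      moreover have "{\<omega>\<in>space gauss_space. \<forall>i\<in>I. Y i \<omega> \<in> A (Some i)} \<in> gauss.events"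
        by (rule sets.sets_Collect_finite_All[OF _ I]) measurable
      ultimately show ?thesis
        by (simp add: measure_def gauss.emeasure_pair_measure_Times enn2real_mult)
    qed
    finally show ?thesis unfolding ball .
  qed
  have box: "(\<lambda>\<omega>. \<lambda>i\<in>I. Y i \<omega>) -` (PiE I B) \<inter> space gauss_space = {\<omega>\<in>space gauss_space. \<forall>i\<in>I. Y i \<omega> \<in> B i}" for B
    by (auto simp: PiE_iff)
  \<comment> \<open>Boxes pull back to an intersection-stable generator, so independence on
    \<open>G\<close> extends to the whole sigma-algebra.\<close>
  define G where "G = {{\<omega>\<in>space gauss_space. \<forall>i\<in>I. Y i \<omega> \<in> B i} | B. \<forall>i\<in>I. B i \<in> sets borel}"
  have "gauss.indep_set {E -` A \<inter> space gauss_space |A. A \<in> sets borel} G"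
    unfolding gauss.indep_sets2_eq
  proof (intro conjI ballI)
    show "{E -` A \<inter> space gauss_space |A. A \<in> sets borel} \<subseteq> gauss.events" by auto
    show "G \<subseteq> gauss.events"
    proof
      fix b assume "b \<in> G"
      then obtain B where b: "b = {\<omega>\<in>space gauss_space. \<forall>i\<in>I. Y i \<omega> \<in> B i}" and B: "\<And>i. i \<in> I \<Longrightarrow> B i \<in> sets borel"
        unfolding G_def by blast
      have "PiE I B \<in> sets (PiM I (\<lambda>_. borel))" using I B by (rule sets_PiM_I_finite)
      from measurable_sets[OF YI this] show "b \<in> gauss.events" unfolding b box .
    qed
    fix a b assume "a \<in> {E -` A \<inter> space gauss_space |A. A \<in> sets borel}" "b \<in> G"
    then obtain A B where a: "a = E -` A \<inter> space gauss_space" and A: "A \<in> sets borel"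
      and b: "b = {\<omega>\<in>space gauss_space. \<forall>i\<in>I. Y i \<omega> \<in> B i}" and B: "\<And>i. i \<in> I \<Longrightarrow> B i \<in> sets borel"
      unfolding G_def by blast
    have "case_option A B k \<in> sets borel" if "k \<in> K" for k
      using that A B by (auto simp: K_def)
    from prod[of "case_option A B", OF this]
    have "gauss.prob {\<omega>\<in>space gauss_space. E \<omega> \<in> A \<and> (\<forall>i\<in>I. Y i \<omega> \<in> B i)} =
        gauss.prob {\<omega>\<in>space gauss_space. E \<omega> \<in> A} * gauss.prob b"
      by (simp add: b)
    moreover have "a = {\<omega>\<in>space gauss_space. E \<omega> \<in> A}" unfolding a by blast
    moreover have "a \<inter> b = {\<omega>\<in>space gauss_space. E \<omega> \<in> A \<and> (\<forall>i\<in>I. Y i \<omega> \<in> B i)}"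
      unfolding a b by blast
    ultimately show "gauss.prob (a \<inter> b) = gauss.prob a * gauss.prob b" by simp
  qed
  moreover have "Int_stable {E -` A \<inter> space gauss_space |A. A \<in> sets borel}"
  proof (rule Int_stableI)
    fix a b assume "a \<in> {E -` A \<inter> space gauss_space |A. A \<in> sets borel}" "b \<in> {E -` A \<inter> space gauss_space |A. A \<in> sets borel}"
    then obtain A B where "a = E -` A \<inter> space gauss_space" and A: "A \<in> sets borel"
      and "b = E -` B \<inter> space gauss_space" and B: "B \<in> sets borel" by blast
    then have "a \<inter> b = E -` (A \<inter> B) \<inter> space gauss_space" by blast
    then show "a \<inter> b \<in> {E -` A \<inter> space gauss_space |A. A \<in> sets borel}"
      using sets.Int[OF A B] by blast
  qed
  moreover have "Int_stable G"
  proof (rule Int_stableI)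
    fix a b assume "a \<in> G" "b \<in> G"
    then obtain A B where a: "a = {\<omega>\<in>space gauss_space. \<forall>i\<in>I. Y i \<omega> \<in> A i}" and A: "\<And>i. i \<in> I \<Longrightarrow> A i \<in> sets borel"
      and b: "b = {\<omega>\<in>space gauss_space. \<forall>i\<in>I. Y i \<omega> \<in> B i}" and B: "\<And>i. i \<in> I \<Longrightarrow> B i \<in> sets borel"
      unfolding G_def by blast
    have "a \<inter> b = {\<omega>\<in>space gauss_space. \<forall>i\<in>I. Y i \<omega> \<in> A i \<inter> B i}"
      unfolding a b by blast
    moreover have "\<forall>i\<in>I. A i \<inter> B i \<in> sets borel"
    proof
      fix i assume "i \<in> I"
      show "A i \<inter> B i \<in> sets borel"
        by (rule sets.Int[OF A[OF \<open>i \<in> I\<close>] B[OF \<open>i \<in> I\<close>]])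
    qed
    ultimately show "a \<inter> b \<in> G"
      unfolding G_def by (intro CollectI exI[of _ "\<lambda>i. A i \<inter> B i"] conjI)
  qed
  ultimately have ind: "gauss.indep_set (sigma_sets (space gauss_space) {E -` A \<inter> space gauss_space |A. A \<in> sets borel})
      (sigma_sets (space gauss_space) G)"
    by (rule gauss.indep_set_sigma_sets)
  let ?YI = "\<lambda>\<omega>. \<lambda>i\<in>I. Y i \<omega>"
  have "{?YI -` D \<inter> space gauss_space |D. D \<in> {PiE I B |B. \<forall>i\<in>I. B i \<in> sets borel}} =
      {?YI -` (PiE I B) \<inter> space gauss_space |B. \<forall>i\<in>I. B i \<in> sets borel}" by blast
  also have "\<dots> = G" unfolding G_def box ..
  finally have "{?YI -` D \<inter> space gauss_space |D. D \<in> {PiE I B |B. \<forall>i\<in>I. B i \<in> sets borel}} = G" .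
  moreover have "?YI \<in> space gauss_space \<rightarrow> PiE I (\<lambda>i. space (borel :: real measure))" by simp
  ultimately have gen: "{?YI -` D \<inter> space gauss_space |D. D \<in> sets (PiM I (\<lambda>_. borel))} = sigma_sets (space gauss_space) G"
    unfolding sets_PiM_boxes[OF I] by (subst sigma_sets_vimage_commute) auto
  have "gauss.prob (a \<inter> b) = gauss.prob a * gauss.prob b"
    if a: "a \<in> {E -` A \<inter> space gauss_space |A. A \<in> sets borel}"
      and b: "b \<in> {?YI -` D \<inter> space gauss_space |D. D \<in> sets (PiM I (\<lambda>_. borel))}" for a b
    using ind sigma_sets.Basic[OF a] b unfolding gauss.indep_sets2_eq gen by blast
  moreover have "{E -` A \<inter> space gauss_space |A. A \<in> sets borel} \<subseteq> gauss.events"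
    using measurable_sets[OF \<open>E \<in> borel_measurable gauss_space\<close>] by blast
  moreover have "{?YI -` D \<inter> space gauss_space |D. D \<in> sets (PiM I (\<lambda>_. borel))} \<subseteq> gauss.events"
    using measurable_sets[OF YI] by blast
  ultimately have "gauss.indep_set {E -` A \<inter> space gauss_space |A. A \<in> sets borel}
      {?YI -` D \<inter> space gauss_space |D. D \<in> sets (PiM I (\<lambda>_. borel))}"
    unfolding gauss.indep_sets2_eq by blast
  then show ?thesis
    using \<open>E \<in> borel_measurable gauss_space\<close> YI unfolding independent_def by simp
qed

section \<open>Mutual information of Gaussian vectors\<close>

lemma centered_gaussian_distr_density:
  assumes "centered_gaussian X" "cov X X > 0"
  shows "distr gauss_space borel X = density lborel (normal_density 0 (sqrt (cov X X)))"
proof -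
  interpret std: prob_space std_normal_distribution
    using real_dist_normal_dist by (simp add: real_distribution_def)
  have "distributed std_normal_distribution lborel (\<lambda>x. x) std_normal_density"
    by (simp add: distributed_def distr_id2)
  from std.normal_density_affine[OF this, of "sqrt (cov X X)" 0] assms(2)
  have "distributed std_normal_distribution lborel (\<lambda>x. sqrt (cov X X) * x) (normal_density 0 (sqrt (cov X X)))"
    by simp
  then have "distr std_normal_distribution lborel (\<lambda>x. sqrt (cov X X) * x) = density lborel (normal_density 0 (sqrt (cov X X)))"
    by (rule distributed_distr_eq_density)
  moreover have "distr std_normal_distribution lborel (\<lambda>x. sqrt (cov X X) * x) =
      distr std_normal_distribution borel (\<lambda>x. sqrt (cov X X) * x)"
    by (rule distr_cong) auto
  ultimately show ?thesis unfolding centered_gaussian_distr[OF assms(1)] by simp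
qed

text \<open>Disintegration: given \<open>Z\<close>, the variable
  \<open>g (Z \<omega>) + E \<omega>\<close> is normal around \<open>g (Z \<omega>)\<close>. The law
  of \<open>Z\<close> itself serves as reference measure, so \<open>Z\<close> may be
  degenerate.\<close>

lemma nn_integral_shifted_gaussian:
  assumes E: "centered_gaussian E" "cov E E > 0" and ind: "independent borel E T Z"
    and g: "g \<in> borel_measurable T" and h: "h \<in> borel_measurable (T \<Otimes>\<^sub>M borel)"
  shows "(\<integral>\<^sup>+\<omega>. h (Z \<omega>, g (Z \<omega>) + E \<omega>) \<partial>gauss_space) =
    (\<integral>\<^sup>+z. \<integral>\<^sup>+x. ennreal (normal_density 0 (sqrt (cov E E)) (x - g z)) * h (z, x) \<partial>lborel \<partial>distr gauss_space T Z)"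
proof -
  note [measurable] = g h
  have [measurable]: "E \<in> borel_measurable gauss_space" "Z \<in> measurable gauss_space T"
    using ind by (simp_all add: independent_def)
  let ?\<phi> = "normal_density 0 (sqrt (cov E E))"
  interpret PZ: prob_space "distr gauss_space T Z" by (rule gauss.prob_space_distr) simp
  interpret PE: prob_space "distr gauss_space borel E" by (rule gauss.prob_space_distr) simp
  interpret PP: pair_sigma_finite "distr gauss_space borel E" "distr gauss_space T Z" by unfold_locales
  have "(\<integral>\<^sup>+\<omega>. h (Z \<omega>, g (Z \<omega>) + E \<omega>) \<partial>gauss_space) =
      (\<integral>\<^sup>+p. h (snd p, g (snd p) + fst p) \<partial>distr gauss_space (borel \<Otimes>\<^sub>M T) (\<lambda>\<omega>. (E \<omega>, Z \<omega>)))"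
    by (subst nn_integral_distr) simp_all
  also have "\<dots> = (\<integral>\<^sup>+p. h (snd p, g (snd p) + fst p) \<partial>(distr gauss_space borel E \<Otimes>\<^sub>M distr gauss_space T Z))"
    using ind by (simp add: independent_iff_distr)
  also have "\<dots> = (\<integral>\<^sup>+z. \<integral>\<^sup>+e. h (z, g z + e) \<partial>distr gauss_space borel E \<partial>distr gauss_space T Z)"
    by (subst PP.nn_integral_snd[symmetric]) simp_all
  also have "\<dots> = (\<integral>\<^sup>+z. \<integral>\<^sup>+x. ennreal (?\<phi> (x - g z)) * h (z, x) \<partial>lborel \<partial>distr gauss_space T Z)"
  proof (rule nn_integral_cong)
    fix z assume "z \<in> space (distr gauss_space T Z)"
    then have z [measurable]: "z \<in> space T" by simp
    have "(\<integral>\<^sup>+e. h (z, g z + e) \<partial>distr gauss_space borel E) = (\<integral>\<^sup>+e. ennreal (?\<phi> e) * h (z, g z + e) \<partial>lborel)"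
      unfolding centered_gaussian_distr_density[OF E] by (subst nn_integral_density) simp_all
    also have "\<dots> = (\<integral>\<^sup>+x. ennreal (?\<phi> (x - g z)) * h (z, x) \<partial>lborel)"
      by (subst nn_integral_real_affine[of _ 1 "g z"]) simp_all
    finally show "(\<integral>\<^sup>+e. h (z, g z + e) \<partial>distr gauss_space borel E) =
        (\<integral>\<^sup>+x. ennreal (?\<phi> (x - g z)) * h (z, x) \<partial>lborel)" .
  qed
  finally show ?thesis .
qed

lemma log_normal_density_ratio:
  assumes "v > 0" "w > 0"
  shows "log 2 (normal_density 0 (sqrt v) a / normal_density 0 (sqrt w) b) =
    1 / 2 * log 2 (w / v) + (b\<^sup>2 / (2 * w) - a\<^sup>2 / (2 * v)) / ln 2"
proof -
  have *: "ln (normal_density 0 (sqrt u) c) = - (1 / 2) * ln (2 * pi * u) - c\<^sup>2 / (2 * u)" if "u > 0" for u c :: real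
    using that by (simp add: normal_density_def ln_mult ln_div ln_sqrt)
  have "normal_density 0 (sqrt v) a > 0" "normal_density 0 (sqrt w) b > 0"
    using assms by (simp_all add: normal_density_pos)
  then have "ln (normal_density 0 (sqrt v) a / normal_density 0 (sqrt w) b) =
      1 / 2 * ln (w / v) + (b\<^sup>2 / (2 * w) - a\<^sup>2 / (2 * v))"
    using assms by (simp add: ln_div * ln_mult field_simps)
  then show ?thesis by (simp add: log_def add_divide_distrib)
qed

lemma mutual_information_cong_sets:
  assumes "sets S = sets S'" "sets T = sets T'"
  shows "gauss.mutual_information b S T X Y = gauss.mutual_information b S' T' X Y"
proof -
  have "distr gauss_space S X = distr gauss_space S' X" "distr gauss_space T Y = distr gauss_space T' Y"
    "distr gauss_space (S \<Otimes>\<^sub>M T) (\<lambda>\<omega>. (X \<omega>, Y \<omega>)) = distr gauss_space (S' \<Otimes>\<^sub>M T') (\<lambda>\<omega>. (X \<omega>, Y \<omega>))"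
    using assms by (auto intro!: distr_cong sets_pair_measure_cong)
  then show ?thesis by (simp add: gauss.mutual_information_def)
qed

lemma expectation_centered_square:
  "centered_gaussian X \<Longrightarrow> (\<integral>\<omega>. (X \<omega>)\<^sup>2 \<partial>gauss_space) = cov X X"
  "centered_gaussian X \<Longrightarrow> integrable gauss_space (\<lambda>\<omega>. (X \<omega>)\<^sup>2)"
  using centered_gaussian_integrable_square[of X] by (simp_all add: cov_def power2_eq_square)

lemma expectation_log_density_ratio:
  assumes "centered_gaussian E" "centered_gaussian X" "cov E E > 0" "cov X X > 0"
  shows "integrable gauss_space (\<lambda>\<omega>. log 2 (normal_density 0 (sqrt (cov E E)) (E \<omega>) / normal_density 0 (sqrt (cov X X)) (X \<omega>)))"
    and "(\<integral>\<omega>. log 2 (normal_density 0 (sqrt (cov E E)) (E \<omega>) / normal_density 0 (sqrt (cov X X)) (X \<omega>)) \<partial>gauss_space) =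
      1 / 2 * log 2 (cov X X / cov E E)"
  using assms expectation_centered_square[OF assms(1)] expectation_centered_square[OF assms(2)]
  by (simp_all add: log_normal_density_ratio gauss.prob_space)

text \<open>Against Lebesgue measure times the law of \<open>Z\<close>, the variable
  \<open>Z\<close> has density 1, and the information is the mean log-ratio of two normal densities.
  The quadratic terms cancel because both normalized squares have mean 1.\<close>

lemma mutual_information_additive_gaussian:
  assumes E: "centered_gaussian E" "cov E E > 0" and X: "centered_gaussian X" "cov X X > 0"
    and ind: "independent borel E T Z" and g: "g \<in> borel_measurable T"
    and eq: "\<And>\<omega>. X \<omega> = g (Z \<omega>) + E \<omega>"
  shows "gauss.mutual_information 2 borel T X Z = 1 / 2 * log 2 (cov X X / cov E E)"
proof -
  note [measurable] = g
  have [measurable]: "E \<in> borel_measurable gauss_space" "Z \<in> measurable gauss_space T"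
    using ind by (simp_all add: independent_def)
  have Xm [measurable]: "X \<in> borel_measurable gauss_space" using X by measurable
  define T' where "T' = distr gauss_space T Z"
  have T' [measurable_cong]: "sets T' = sets T" by (simp add: T'_def)
  interpret T': prob_space T' unfolding T'_def by (rule gauss.prob_space_distr) simp
  interpret P: pair_sigma_finite lborel T' by unfold_locales
  define Px where "Px = normal_density 0 (sqrt (cov X X))"
  define Pxy where "Pxy p = normal_density 0 (sqrt (cov E E)) (fst p - g (snd p))" for p
  have [measurable]: "Px \<in> borel_measurable borel" "Pxy \<in> borel_measurable (borel \<Otimes>\<^sub>M T)"
    unfolding Px_def Pxy_def[abs_def] by measurable
  have dX: "distributed gauss_space lborel X Px"
    unfolding distributed_def
  proof (intro conjI)
    have "distr gauss_space lborel X = distr gauss_space borel X" by (rule distr_cong) auto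
    then show "distr gauss_space lborel X = density lborel Px"
      unfolding Px_def centered_gaussian_distr_density[OF X, symmetric] .
  qed simp_all
  have dZ: "distributed gauss_space T' Z (\<lambda>_. ennreal 1)"
    unfolding distributed_def T'_def using density_1[of "distr gauss_space T Z"]
    by (auto intro: distr_cong)
  have dXZ: "distributed gauss_space (lborel \<Otimes>\<^sub>M T') (\<lambda>\<omega>. (X \<omega>, Z \<omega>)) Pxy"
    unfolding distributed_def
  proof (intro conjI)
    show "distr gauss_space (lborel \<Otimes>\<^sub>M T') (\<lambda>\<omega>. (X \<omega>, Z \<omega>)) = density (lborel \<Otimes>\<^sub>M T') Pxy"
    proof (rule measure_eqI)
      fix A assume "A \<in> sets (distr gauss_space (lborel \<Otimes>\<^sub>M T') (\<lambda>\<omega>. (X \<omega>, Z \<omega>)))"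
      then have A: "A \<in> sets (lborel \<Otimes>\<^sub>M T')" by simp
      have sets_eq: "sets (lborel \<Otimes>\<^sub>M T') = sets (borel \<Otimes>\<^sub>M T)" by (auto intro!: sets_pair_measure_cong simp: T')
      from A have A' [measurable]: "A \<in> sets (borel \<Otimes>\<^sub>M T)" unfolding sets_eq .
      define h where "h p = (indicator A (snd p, fst p) :: ennreal)" for p
      have h [measurable]: "h \<in> borel_measurable (T \<Otimes>\<^sub>M borel)" unfolding h_def[abs_def] by measurable
      have "emeasure (distr gauss_space (lborel \<Otimes>\<^sub>M T') (\<lambda>\<omega>. (X \<omega>, Z \<omega>))) A =
          (\<integral>\<^sup>+\<omega>. indicator A (X \<omega>, Z \<omega>) \<partial>gauss_space)"
        unfolding nn_integral_indicator[symmetric, OF \<open>A \<in> sets (distr _ _ _)\<close>]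
        by (subst nn_integral_distr) simp_all
      also have "\<dots> = (\<integral>\<^sup>+\<omega>. h (Z \<omega>, g (Z \<omega>) + E \<omega>) \<partial>gauss_space)"
        by (simp add: h_def eq)
      also have "\<dots> = (\<integral>\<^sup>+z. \<integral>\<^sup>+x. ennreal (Pxy (x, z)) * indicator A (x, z) \<partial>lborel \<partial>T')"
        unfolding nn_integral_shifted_gaussian[OF E ind g h] by (simp add: T'_def h_def Pxy_def)
      also have "\<dots> = (\<integral>\<^sup>+p. ennreal (Pxy p) * indicator A p \<partial>(lborel \<Otimes>\<^sub>M T'))"
        by (subst P.nn_integral_snd[symmetric]) simp_all
      also have "\<dots> = emeasure (density (lborel \<Otimes>\<^sub>M T') Pxy) A"
        using A by (subst emeasure_density) simp_all
      finally show "emeasure (distr gauss_space (lborel \<Otimes>\<^sub>M T') (\<lambda>\<omega>. (X \<omega>, Z \<omega>))) A =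
        emeasure (density (lborel \<Otimes>\<^sub>M T') Pxy) A" .
    qed simp
  qed (simp_all)
  have "gauss.mutual_information 2 borel T X Z = gauss.mutual_information 2 lborel T' X Z"
    by (rule mutual_information_cong_sets) (simp_all add: T')
  also have "\<dots> = (\<integral>p. Pxy p * log 2 (Pxy p / (Px (fst p) * 1)) \<partial>(lborel \<Otimes>\<^sub>M T'))"
    by (rule gauss.mutual_information_distr[OF _ _ dX _ dZ _ dXZ])
       (auto simp: Px_def Pxy_def T'.sigma_finite_measure_axioms lborel.sigma_finite_measure_axioms)
  also have "\<dots> = (\<integral>\<omega>. log 2 (Pxy (X \<omega>, Z \<omega>) / Px (X \<omega>)) \<partial>gauss_space)"
    using distributed_integral[OF dXZ, of "\<lambda>p. log 2 (Pxy p / Px (fst p))"] by (simp add: Pxy_def)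
  also have "\<dots> = 1 / 2 * log 2 (cov X X / cov E E)"
    unfolding expectation_log_density_ratio(2)[OF E(1) X(1) E(2) X(2), symmetric]
    by (simp add: Px_def Pxy_def eq)
  finally show ?thesis .
qed

text \<open>Each coordinate is a shifted Gaussian given the earlier ones, so the joint density is a product
  of one-dimensional densities.\<close>

lemma nn_integral_triangular_gaussian:
  assumes X: "X \<in> measurable gauss_space T"
    and E: "\<And>t. t < n \<Longrightarrow> centered_gaussian (E t)" "\<And>t. t < n \<Longrightarrow> cov (E t) (E t) > 0"
    and ind: "\<And>t. t < n \<Longrightarrow> independent borel (E t) (T \<Otimes>\<^sub>M stacked_space {..<t}) (\<lambda>\<omega>. (X \<omega>, stacked y {..<t} \<omega>))"
    and g: "\<And>t. t < n \<Longrightarrow> g t \<in> borel_measurable (T \<Otimes>\<^sub>M stacked_space {..<t})"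
    and eq: "\<And>t \<omega>. t < n \<Longrightarrow> y t \<omega> = g t (X \<omega>, stacked y {..<t} \<omega>) + E t \<omega>"
    and h: "h \<in> borel_measurable (T \<Otimes>\<^sub>M stacked_space {..<n})"
  shows "(\<integral>\<^sup>+\<omega>. h (X \<omega>, stacked y {..<n} \<omega>) \<partial>gauss_space) =
    (\<integral>\<^sup>+x. \<integral>\<^sup>+z. ennreal (\<Prod>t<n. normal_density 0 (sqrt (cov (E t) (E t))) (z t - g t (x, restrict z {..<t}))) * h (x, z)
      \<partial>PiM {..<n} (\<lambda>_. lborel) \<partial>distr gauss_space T X)"
  using E ind g eq h
proof (induction n arbitrary: h)
  case 0
  interpret product_sigma_finite "\<lambda>_. lborel :: real measure" by unfold_locales
  have h0: "h \<in> borel_measurable (T \<Otimes>\<^sub>M stacked_space {})" using 0(6) unfolding lessThan_0 .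
  have u: "(\<lambda>_. undefined) \<in> space (stacked_space {})" by (simp add: space_PiM)
  have hx: "(\<lambda>x. h (x, \<lambda>_. undefined)) \<in> borel_measurable T"
    by (rule measurable_compose[OF measurable_Pair2'[OF u] h0])
  have "(\<integral>\<^sup>+\<omega>. h (X \<omega>, stacked y {..<0} \<omega>) \<partial>gauss_space) = (\<integral>\<^sup>+\<omega>. h (X \<omega>, \<lambda>_. undefined) \<partial>gauss_space)"
    by (simp add: stacked_def restrict_def)
  also have "\<dots> = (\<integral>\<^sup>+x. h (x, \<lambda>_. undefined) \<partial>distr gauss_space T X)"
    using hx X by (subst nn_integral_distr) simp_all
  finally show ?case
    by (simp add: nn_integral_empty)
next
  case (Suc n)
  interpret product_sigma_finite "\<lambda>_. lborel :: real measure" by unfold_locales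
  have ins: "{..<Suc n} = insert n {..<n}" "n \<notin> {..<n}" "finite {..<n}" by auto
  have sets_ins: "sets (PiM {..<k} (\<lambda>_. lborel)) = sets (stacked_space {..<k})" for k :: nat
    by (rule sets_PiM_cong) auto
  have g' [measurable]: "g t \<in> borel_measurable (T \<Otimes>\<^sub>M stacked_space {..<t})" if "t < Suc n" for t
    using Suc.prems(4)[OF that] .
  have h [measurable]: "h \<in> borel_measurable (T \<Otimes>\<^sub>M stacked_space (insert n {..<n}))"
    using Suc.prems(6) by (simp add: ins)
  let ?\<phi> = "\<lambda>t. normal_density 0 (sqrt (cov (E t) (E t)))"
  define h' where "h' p = h (fst (fst p), (snd (fst p))(n := snd p))" for p
  have h' [measurable]: "h' \<in> borel_measurable ((T \<Otimes>\<^sub>M stacked_space {..<n}) \<Otimes>\<^sub>M borel)"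
  proof -
    have "(\<lambda>p. (snd (fst p))(n := snd p)) \<in> measurable ((T \<Otimes>\<^sub>M stacked_space {..<n}) \<Otimes>\<^sub>M borel) (stacked_space (insert n {..<n}))"
      by (rule measurable_fun_upd[where J="{..<n}"]) auto
    then show ?thesis unfolding h'_def[abs_def] by measurable
  qed
  \<comment> \<open>Integrating out the last coordinate leaves an instance of the induction
    hypothesis with \<open>k\<close> in place of \<open>h\<close>.\<close>
  define k where "k p = (\<integral>\<^sup>+x. ennreal (?\<phi> n (x - g n p)) * h' (p, x) \<partial>lborel)" for p
  have gn [measurable]: "g n \<in> borel_measurable (T \<Otimes>\<^sub>M stacked_space {..<n})" by (rule g') simp
  have k [measurable]: "k \<in> borel_measurable (T \<Otimes>\<^sub>M stacked_space {..<n})"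
    unfolding k_def[abs_def] by measurable
  have st: "stacked y {..<Suc n} \<omega> = (stacked y {..<n} \<omega>)(n := y n \<omega>)" for \<omega>
    by (auto simp: stacked_def fun_eq_iff restrict_def)
  have Z: "(\<lambda>\<omega>. (X \<omega>, stacked y {..<n} \<omega>)) \<in> measurable gauss_space (T \<Otimes>\<^sub>M stacked_space {..<n})"
    using Suc.prems(3)[of n] by (simp add: independent_def)
  have "(\<integral>\<^sup>+\<omega>. h (X \<omega>, stacked y {..<Suc n} \<omega>) \<partial>gauss_space) =
      (\<integral>\<^sup>+\<omega>. h' ((X \<omega>, stacked y {..<n} \<omega>), g n (X \<omega>, stacked y {..<n} \<omega>) + E n \<omega>) \<partial>gauss_space)"
    using Suc.prems(5)[of n] by (simp add: h'_def st[unfolded Suc.prems(5)[OF lessI]] del: fun_upd_apply)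
  also have "\<dots> = (\<integral>\<^sup>+p. k p \<partial>distr gauss_space (T \<Otimes>\<^sub>M stacked_space {..<n}) (\<lambda>\<omega>. (X \<omega>, stacked y {..<n} \<omega>)))"
    unfolding k_def by (rule nn_integral_shifted_gaussian) (use Suc.prems h' gn in simp_all)
  also have "\<dots> = (\<integral>\<^sup>+\<omega>. k (X \<omega>, stacked y {..<n} \<omega>) \<partial>gauss_space)"
    using Z k by (subst nn_integral_distr) simp_all
  also have "\<dots> = (\<integral>\<^sup>+x. \<integral>\<^sup>+z. ennreal (\<Prod>t<n. ?\<phi> t (z t - g t (x, restrict z {..<t}))) * k (x, z)
      \<partial>PiM {..<n} (\<lambda>_. lborel) \<partial>distr gauss_space T X)"
    using Suc.prems k by (intro Suc.IH) simp_all
  also have "\<dots> = (\<integral>\<^sup>+x. \<integral>\<^sup>+z. ennreal (\<Prod>t<Suc n. ?\<phi> t (z t - g t (x, restrict z {..<t}))) * h (x, z)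
      \<partial>PiM {..<Suc n} (\<lambda>_. lborel) \<partial>distr gauss_space T X)"
  proof (rule nn_integral_cong)
    fix x assume "x \<in> space (distr gauss_space T X)"
    then have x [measurable]: "x \<in> space T" by simp
    define D where "D m z = (\<Prod>t<m. ?\<phi> t (z t - g t (x, restrict z {..<t})))" for m :: nat and z :: "nat \<Rightarrow> real"
    have D: "D m \<in> borel_measurable (stacked_space {..<m'})" if "m \<le> Suc n" "m \<le> m'" for m m'
      unfolding D_def
    proof (rule borel_measurable_prod)
      fix t assume "t \<in> {..<m}"
      then have t: "t < m'" "t < Suc n" using that by auto
      have [measurable]: "(\<lambda>z. z t) \<in> measurable (stacked_space {..<m'}) borel"
        using t by (intro measurable_component_singleton) simp
      have [measurable]: "(\<lambda>z. restrict z {..<t}) \<in> measurable (stacked_space {..<m'}) (stacked_space {..<t})"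
        using t by (intro measurable_restrict_subset) auto
      note [measurable] = g'[OF t(2)]
      show "(\<lambda>z. ?\<phi> t (z t - g t (x, restrict z {..<t}))) \<in> borel_measurable (stacked_space {..<m'})"
        by measurable
    qed
    have D0: "0 \<le> D m z" for m z unfolding D_def by (intro prod_nonneg) simp
    have "restrict (z(n := r)) {..<t} = restrict z {..<t}" if "t < n" for z :: "nat \<Rightarrow> real" and r t
      using that by (auto simp: fun_eq_iff restrict_def)
    then have D_upd: "D n (z(n := r)) = D n z" for z r
      unfolding D_def by (intro prod.cong refl) simp
    have D_Suc: "D (Suc n) (z(n := r)) = D n z * ?\<phi> n (r - g n (x, z))" if "z \<in> space (stacked_space {..<n})" for z r
    proof -
      have "restrict (z(n := r)) {..<n} = z"
        using that by (auto simp: space_PiM fun_eq_iff PiE_def extensional_def)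
      then show ?thesis
        using D_upd[of z r] by (simp add: D_def del: fun_upd_apply) (simp add: D_def)
    qed
    have hx [measurable]: "(\<lambda>z. h (x, z)) \<in> borel_measurable (stacked_space {..<Suc n})"
      using measurable_compose[OF measurable_Pair1'[OF x] h] by (simp add: ins)
    have DS [measurable]: "D (Suc n) \<in> borel_measurable (stacked_space {..<Suc n})" by (rule D) auto
    have "(\<integral>\<^sup>+z. ennreal (D (Suc n) z) * h (x, z) \<partial>PiM {..<Suc n} (\<lambda>_. lborel)) =
        (\<integral>\<^sup>+z. \<integral>\<^sup>+r. ennreal (D (Suc n) (z(n := r))) * h (x, z(n := r)) \<partial>lborel \<partial>PiM {..<n} (\<lambda>_. lborel))"
    proof -
      have "(\<lambda>z. ennreal (D (Suc n) z) * h (x, z)) \<in> borel_measurable (stacked_space {..<Suc n})"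
        by measurable
      then have "(\<lambda>z. ennreal (D (Suc n) z) * h (x, z)) \<in> borel_measurable (PiM (insert n {..<n}) (\<lambda>_. lborel))"
        unfolding ins(1)[symmetric] by (subst measurable_cong_sets[OF sets_ins refl])
      from product_nn_integral_insert[OF ins(3,2) this] show ?thesis unfolding ins(1) .
    qed
    also have "\<dots> = (\<integral>\<^sup>+z. ennreal (D n z) * k (x, z) \<partial>PiM {..<n} (\<lambda>_. lborel))"
    proof (rule nn_integral_cong)
      fix z assume "z \<in> space (PiM {..<n} (\<lambda>_. lborel :: real measure))"
      then have z [measurable]: "z \<in> space (stacked_space {..<n})" by (simp add: space_PiM)
      have "(x, z) \<in> space (T \<Otimes>\<^sub>M stacked_space {..<n})" using x z by (simp add: space_pair_measure)
      then have [measurable]: "(\<lambda>r. h' ((x, z), r)) \<in> borel_measurable borel" by measurable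
      have "(\<integral>\<^sup>+r. ennreal (D (Suc n) (z(n := r))) * h (x, z(n := r)) \<partial>lborel) =
          (\<integral>\<^sup>+r. ennreal (D n z) * (ennreal (?\<phi> n (r - g n (x, z))) * h' ((x, z), r)) \<partial>lborel)"
        by (intro nn_integral_cong) (simp add: D_Suc[OF z] h'_def ennreal_mult D0 mult.assoc)
      also have "\<dots> = ennreal (D n z) * k (x, z)"
        unfolding k_def by (subst nn_integral_cmult) simp_all
      finally show "(\<integral>\<^sup>+r. ennreal (D (Suc n) (z(n := r))) * h (x, z(n := r)) \<partial>lborel) = ennreal (D n z) * k (x, z)" .
    qed
    finally show "(\<integral>\<^sup>+z. ennreal (\<Prod>t<n. ?\<phi> t (z t - g t (x, restrict z {..<t}))) * k (x, z) \<partial>PiM {..<n} (\<lambda>_. lborel)) =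
      (\<integral>\<^sup>+z. ennreal (\<Prod>t<Suc n. ?\<phi> t (z t - g t (x, restrict z {..<t}))) * h (x, z) \<partial>PiM {..<Suc n} (\<lambda>_. lborel))"
      by (simp add: D_def)
  qed
  finally show ?case .
qed

text \<open>The outputs have two triangular descriptions: errors \<open>E\<close> given message and
  past, errors \<open>D\<close> given the past alone. The ratio of the joint density to the marginal
  one is a product over time, so the information is a sum.\<close>

lemma mutual_information_triangular_gaussian:
  assumes X: "X \<in> measurable gauss_space T"
    and E: "\<And>t. t < n \<Longrightarrow> centered_gaussian (E t)" "\<And>t. t < n \<Longrightarrow> cov (E t) (E t) > 0"
    and indE: "\<And>t. t < n \<Longrightarrow> independent borel (E t) (T \<Otimes>\<^sub>M stacked_space {..<t}) (\<lambda>\<omega>. (X \<omega>, stacked y {..<t} \<omega>))"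
    and g: "\<And>t. t < n \<Longrightarrow> g t \<in> borel_measurable (T \<Otimes>\<^sub>M stacked_space {..<t})"
    and eqE: "\<And>t \<omega>. t < n \<Longrightarrow> y t \<omega> = g t (X \<omega>, stacked y {..<t} \<omega>) + E t \<omega>"
    and D: "\<And>t. t < n \<Longrightarrow> centered_gaussian (D t)" "\<And>t. t < n \<Longrightarrow> cov (D t) (D t) > 0"
    and indD: "\<And>t. t < n \<Longrightarrow> independent borel (D t) (stacked_space {..<t}) (stacked y {..<t})"
    and l: "\<And>t. t < n \<Longrightarrow> l t \<in> borel_measurable (stacked_space {..<t})"
    and eqD: "\<And>t \<omega>. t < n \<Longrightarrow> y t \<omega> = l t (stacked y {..<t} \<omega>) + D t \<omega>"
  shows "gauss.mutual_information 2 T (stacked_space {..<n}) X (stacked y {..<n}) =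
    (\<Sum>t<n. 1 / 2 * log 2 (cov (D t) (D t) / cov (E t) (E t)))"
proof -
  define S where "S = distr gauss_space T X"
  have S [measurable_cong]: "sets S = sets T" by (simp add: S_def)
  interpret S: prob_space S unfolding S_def by (rule gauss.prob_space_distr[OF X])
  interpret product_sigma_finite "\<lambda>_. lborel :: real measure" by unfold_locales
  define L where "L = PiM {..<n} (\<lambda>_. lborel :: real measure)"
  have L [measurable_cong]: "sets L = sets (stacked_space {..<n})"
    unfolding L_def by (rule sets_PiM_cong) auto
  interpret L: sigma_finite_measure L unfolding L_def by (rule sigma_finite) simp
  interpret P: pair_sigma_finite S L by unfold_locales
  have XS: "X \<in> measurable gauss_space S" using X by (simp cong: measurable_cong_sets)
  have yt: "y t \<in> borel_measurable gauss_space" if "t < n" for t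
  proof -
    have "y t = (\<lambda>\<omega>. l t (stacked y {..<t} \<omega>) + D t \<omega>)" using eqD[OF that] by auto
    moreover have "stacked y {..<t} \<in> measurable gauss_space (stacked_space {..<t})"
      using indD[OF that] by (simp add: independent_def)
    ultimately show ?thesis
      using l[OF that] D(1)[OF that] by simp
  qed
  have ys: "stacked y {..<m} \<in> measurable gauss_space (stacked_space {..<m})" if "m \<le> n" for m
    unfolding stacked_def[abs_def] using yt that by (intro measurable_restrict) auto
  have yL: "stacked y {..<n} \<in> measurable gauss_space L"
    using ys[of n] by (simp cong: measurable_cong_sets)
  have comp: "(\<lambda>z. z t) \<in> borel_measurable (stacked_space {..<n})" if "t < n" for t
    using that by (intro measurable_component_singleton) simp
  have restr: "(\<lambda>z. restrict z {..<t}) \<in> measurable (stacked_space {..<n}) (stacked_space {..<t})" if "t < n" for t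
    using that by (intro measurable_restrict_subset) auto
  define Pxy where "Pxy p = (\<Prod>t<n. normal_density 0 (sqrt (cov (E t) (E t))) (snd p t - g t (fst p, restrict (snd p) {..<t})))" for p
  define Py where "Py z = (\<Prod>t<n. normal_density 0 (sqrt (cov (D t) (D t))) (z t - l t (restrict z {..<t})))" for z
  have Pxy: "Pxy \<in> borel_measurable (T \<Otimes>\<^sub>M stacked_space {..<n})"
    unfolding Pxy_def[abs_def]
  proof (rule borel_measurable_prod)
    fix t assume "t \<in> {..<n}"
    then have t: "t < n" by simp
    note [measurable] = comp[OF t] restr[OF t] g[OF t]
    show "(\<lambda>p. normal_density 0 (sqrt (cov (E t) (E t))) (snd p t - g t (fst p, restrict (snd p) {..<t}))) \<in>
        borel_measurable (T \<Otimes>\<^sub>M stacked_space {..<n})"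
      by measurable
  qed
  have Py: "Py \<in> borel_measurable (stacked_space {..<n})"
    unfolding Py_def[abs_def]
  proof (rule borel_measurable_prod)
    fix t assume "t \<in> {..<n}"
    then have t: "t < n" by simp
    note [measurable] = comp[OF t] restr[OF t] l[OF t]
    show "(\<lambda>z. normal_density 0 (sqrt (cov (D t) (D t))) (z t - l t (restrict z {..<t}))) \<in>
        borel_measurable (stacked_space {..<n})"
      by measurable
  qed
  have sets_SL: "sets (S \<Otimes>\<^sub>M L) = sets (T \<Otimes>\<^sub>M stacked_space {..<n})"
    by (rule sets_pair_measure_cong[OF S L])
  have Pxy' [measurable]: "Pxy \<in> borel_measurable (S \<Otimes>\<^sub>M L)"
    using Pxy unfolding measurable_cong_sets[OF sets_SL refl] .
  have Py' [measurable]: "Py \<in> borel_measurable L"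
    using Py unfolding measurable_cong_sets[OF L refl] .
  have dX: "distributed gauss_space S X (\<lambda>_. ennreal 1)"
    unfolding distributed_def using density_1[of S] XS
    by (auto simp: S_def intro!: distr_cong)
  have dXY: "distributed gauss_space (S \<Otimes>\<^sub>M L) (\<lambda>\<omega>. (X \<omega>, stacked y {..<n} \<omega>)) Pxy"
    unfolding distributed_def
  proof (intro conjI)
    show "distr gauss_space (S \<Otimes>\<^sub>M L) (\<lambda>\<omega>. (X \<omega>, stacked y {..<n} \<omega>)) = density (S \<Otimes>\<^sub>M L) Pxy"
    proof (rule measure_eqI)
      fix A assume "A \<in> sets (distr gauss_space (S \<Otimes>\<^sub>M L) (\<lambda>\<omega>. (X \<omega>, stacked y {..<n} \<omega>)))"
      then have A [measurable]: "A \<in> sets (S \<Otimes>\<^sub>M L)" by simp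
      have h: "indicator A \<in> borel_measurable (T \<Otimes>\<^sub>M stacked_space {..<n})"
        using A unfolding sets_SL by simp
      have "emeasure (distr gauss_space (S \<Otimes>\<^sub>M L) (\<lambda>\<omega>. (X \<omega>, stacked y {..<n} \<omega>))) A =
          (\<integral>\<^sup>+\<omega>. indicator A (X \<omega>, stacked y {..<n} \<omega>) \<partial>gauss_space)"
        unfolding nn_integral_indicator[symmetric, OF \<open>A \<in> sets (distr _ _ _)\<close>]
        using XS yL by (subst nn_integral_distr) simp_all
      also have "\<dots> = (\<integral>\<^sup>+x. \<integral>\<^sup>+z. ennreal (Pxy (x, z)) * indicator A (x, z) \<partial>L \<partial>S)"
        using nn_integral_triangular_gaussian[where X=X and E=E and y=y and g=g and n=n, OF X E indE g eqE h]
        by (simp add: S_def L_def Pxy_def)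
      also have "\<dots> = (\<integral>\<^sup>+p. ennreal (Pxy p) * indicator A p \<partial>(S \<Otimes>\<^sub>M L))"
        by (subst L.nn_integral_fst[symmetric]) simp_all
      also have "\<dots> = emeasure (density (S \<Otimes>\<^sub>M L) Pxy) A"
        by (subst emeasure_density) simp_all
      finally show "emeasure (distr gauss_space (S \<Otimes>\<^sub>M L) (\<lambda>\<omega>. (X \<omega>, stacked y {..<n} \<omega>))) A =
        emeasure (density (S \<Otimes>\<^sub>M L) Pxy) A" .
    qed simp
  qed (use XS yL in simp_all)
  \<comment> \<open>The marginal density is the joint formula with a trivial message on a one-point
    space.\<close>
  define U :: "unit measure" where "U = count_space UNIV"
  have dY: "distributed gauss_space L (stacked y {..<n}) Py"
    unfolding distributed_def
  proof (intro conjI)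
    show "distr gauss_space L (stacked y {..<n}) = density L Py"
    proof (rule measure_eqI)
      fix A assume "A \<in> sets (distr gauss_space L (stacked y {..<n}))"
      then have A [measurable]: "A \<in> sets L" by simp
      define h :: "unit \<times> (nat \<Rightarrow> real) \<Rightarrow> ennreal" where "h p = indicator A (snd p)" for p
      have "(indicator A :: _ \<Rightarrow> ennreal) \<in> borel_measurable (stacked_space {..<n})"
        using A unfolding L by simp
      then have h: "h \<in> borel_measurable (U \<Otimes>\<^sub>M stacked_space {..<n})"
        unfolding h_def[abs_def] by (intro measurable_compose[OF measurable_snd])
      have UX: "(\<lambda>_. ()) \<in> measurable gauss_space U" by (simp add: U_def)
      interpret DU: prob_space "distr gauss_space U (\<lambda>_. ())" by (rule gauss.prob_space_distr[OF UX])
      have ind: "independent borel (D t) (U \<Otimes>\<^sub>M stacked_space {..<t}) (\<lambda>\<omega>. ((), stacked y {..<t} \<omega>))" if "t < n" for t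
        using independent_compose[OF indD[OF that] measurable_ident, of "\<lambda>z. ((), z)" "U \<Otimes>\<^sub>M stacked_space {..<t}"]
        by (simp add: U_def)
      have g': "(\<lambda>p. l t (snd p)) \<in> borel_measurable (U \<Otimes>\<^sub>M stacked_space {..<t})" if "t < n" for t
        by (rule measurable_compose[OF measurable_snd l[OF that]])
      have "emeasure (distr gauss_space L (stacked y {..<n})) A =
          (\<integral>\<^sup>+\<omega>. h ((), stacked y {..<n} \<omega>) \<partial>gauss_space)"
        unfolding nn_integral_indicator[symmetric, OF \<open>A \<in> sets (distr _ _ _)\<close>]
        using yL by (subst nn_integral_distr) (simp_all add: h_def)
      also have "\<dots> = (\<integral>\<^sup>+x. \<integral>\<^sup>+z. ennreal (Py z) * indicator A z \<partial>L \<partial>distr gauss_space U (\<lambda>_. ()))"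
        by (subst nn_integral_triangular_gaussian[OF UX D ind g' _ h]) (simp_all add: eqD L_def Py_def h_def)
      also have "\<dots> = (\<integral>\<^sup>+z. ennreal (Py z) * indicator A z \<partial>L)"
        using DU.emeasure_space_1 by simp
      also have "\<dots> = emeasure (density L Py) A"
        by (subst emeasure_density) simp_all
      finally show "emeasure (distr gauss_space L (stacked y {..<n})) A = emeasure (density L Py) A" .
    qed simp
  qed (use yL in simp_all)
  have pos: "0 < Pxy p" "0 < Py z" for p z
    unfolding Pxy_def Py_def using E(2) D(2) by (auto intro!: prod_pos normal_density_pos)
  have "gauss.mutual_information 2 T (stacked_space {..<n}) X (stacked y {..<n}) =
      gauss.mutual_information 2 S L X (stacked y {..<n})"
    by (rule mutual_information_cong_sets) (simp_all add: S L)
  also have "\<dots> = (\<integral>p. Pxy p * log 2 (Pxy p / (1 * Py (snd p))) \<partial>(S \<Otimes>\<^sub>M L))"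
    by (rule gauss.mutual_information_distr[OF _ _ dX _ dY _ dXY])
       (auto simp: S.sigma_finite_measure_axioms L.sigma_finite_measure_axioms less_imp_le[OF pos(1)] less_imp_le[OF pos(2)])
  also have "\<dots> = (\<integral>\<omega>. log 2 (Pxy (X \<omega>, stacked y {..<n} \<omega>) / Py (stacked y {..<n} \<omega>)) \<partial>gauss_space)"
    using distributed_integral[OF dXY, of "\<lambda>p. log 2 (Pxy p / Py (snd p))"]
    by (simp add: less_imp_le[OF pos(1)])
  also have "\<dots> = (\<integral>\<omega>. (\<Sum>t<n. log 2 (normal_density 0 (sqrt (cov (E t) (E t))) (E t \<omega>) /
      normal_density 0 (sqrt (cov (D t) (D t))) (D t \<omega>))) \<partial>gauss_space)"
  proof (rule Bochner_Integration.integral_cong[OF refl])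
    fix \<omega>
    have st: "restrict (stacked y {..<n} \<omega>) {..<t} = stacked y {..<t} \<omega>" "stacked y {..<n} \<omega> t = y t \<omega>" if "t < n" for t
      using that by (auto simp: stacked_def fun_eq_iff restrict_def)
    have "Pxy (X \<omega>, stacked y {..<n} \<omega>) = (\<Prod>t<n. normal_density 0 (sqrt (cov (E t) (E t))) (E t \<omega>))"
      unfolding Pxy_def using eqE by (intro prod.cong) (simp_all add: st)
    moreover have "Py (stacked y {..<n} \<omega>) = (\<Prod>t<n. normal_density 0 (sqrt (cov (D t) (D t))) (D t \<omega>))"
      unfolding Py_def using eqD by (intro prod.cong) (simp_all add: st)
    ultimately have "Pxy (X \<omega>, stacked y {..<n} \<omega>) / Py (stacked y {..<n} \<omega>) =
        (\<Prod>t<n. normal_density 0 (sqrt (cov (E t) (E t))) (E t \<omega>) / normal_density 0 (sqrt (cov (D t) (D t))) (D t \<omega>))"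
      by (simp add: prod_dividef)
    moreover have "normal_density 0 (sqrt (cov (E t) (E t))) (E t \<omega>) / normal_density 0 (sqrt (cov (D t) (D t))) (D t \<omega>) \<noteq> 0"
      if "t < n" for t
      using E(2)[OF that] D(2)[OF that] normal_density_pos[of "sqrt (cov (E t) (E t))" 0 "E t \<omega>"]
        normal_density_pos[of "sqrt (cov (D t) (D t))" 0 "D t \<omega>"] by simp
    ultimately show "log 2 (Pxy (X \<omega>, stacked y {..<n} \<omega>) / Py (stacked y {..<n} \<omega>)) =
        (\<Sum>t<n. log 2 (normal_density 0 (sqrt (cov (E t) (E t))) (E t \<omega>) / normal_density 0 (sqrt (cov (D t) (D t))) (D t \<omega>)))"
      by (simp only: log_def sum_divide_distrib[symmetric], subst ln_prod) auto
  qed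
  also have "\<dots> = (\<Sum>t<n. 1 / 2 * log 2 (cov (D t) (D t) / cov (E t) (E t)))"
    using expectation_log_density_ratio[OF E(1) D(1) E(2) D(2)]
    by (subst Bochner_Integration.integral_sum) (auto intro!: sum.cong)
  finally show ?thesis .
qed

lemma innovation_decomposition:
  assumes S: "gaussian_subspace S" and y: "\<And>t. y t \<in> S"
  obtains c where "\<And>\<omega>. y t \<omega> = (\<Sum>s<t. c s * stacked y {..<t} \<omega> s) + innovation cov y t \<omega>"
    "(\<lambda>z. \<Sum>s<t. c s * z s) \<in> borel_measurable (stacked_space {..<t})"
    "independent borel (innovation cov y t) (stacked_space {..<t}) (stacked y {..<t})"
    "innovation cov y t \<in> S"
proof -
  interpret semi_inner S cov by (rule semi_inner_cov[OF S])
  interpret residual_family S cov y by unfold_locales (rule y)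
  obtain c where c: "y t - R t (y t) = (\<Sum>s<t. c s *\<^sub>R y s)"
    using in_span_image_lessThan[OF diff_residual_span] by blast
  show thesis
  proof (rule that[of c])
    have "y t \<omega> = (\<Sum>s<t. c s * y s \<omega>) + innovation cov y t \<omega>" for \<omega>
      using fun_cong[OF c, of \<omega>] by simp
    then show "y t \<omega> = (\<Sum>s<t. c s * stacked y {..<t} \<omega> s) + innovation cov y t \<omega>" for \<omega>
      by (simp add: stacked_def)
    show "(\<lambda>z. \<Sum>s<t. c s * z s) \<in> borel_measurable (stacked_space {..<t})"
    proof (rule borel_measurable_sum)
      fix s assume "s \<in> {..<t}"
      then have [measurable]: "(\<lambda>z. z s) \<in> borel_measurable (stacked_space {..<t})"
        by (intro measurable_component_singleton) simp
      show "(\<lambda>z. c s * z s) \<in> borel_measurable (stacked_space {..<t})" by measurable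
    qed
    show "innovation cov y t \<in> S" by simp
    show "independent borel (innovation cov y t) (stacked_space {..<t}) (stacked y {..<t})"
      unfolding stacked_def[abs_def]
      by (rule gaussian_orthogonal_independent[OF S]) (auto intro: residual_orth)
  qed
qed

section \<open>The channel in Gaussian coordinates\<close>

text \<open>\<open>w\<close> is the noiseless channel output. Orthogonality of the noise to
  \<open>w\<close> up to and including the same time expresses that the channel is driven
  causally.\<close>

locale noisy_output = semi_inner S B
  for S :: "'a::real_vector set" and B :: "'a \<Rightarrow> 'a \<Rightarrow> real" +
  fixes w N :: "nat \<Rightarrow> 'a"
  assumes w_mem [simp, intro]: "\<And>t. w t \<in> S" and N_mem [simp, intro]: "\<And>t. N t \<in> S"
    and N_norm [simp]: "\<And>t. B (N t) (N t) = 1"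
    and N_orth_w: "\<And>s t. s \<le> t \<Longrightarrow> B (N t) (w s) = 0"
    and N_orth: "\<And>s t. s < t \<Longrightarrow> B (N t) (N s) = 0"
begin

definition y where "y t = w t + N t"

sublocale residual_family S B y
  by unfold_locales (simp add: y_def)

lemma N_orth_y: "s < t \<Longrightarrow> B (N t) (y s) = 0"
  by (simp add: y_def bilinear N_orth_w N_orth)

lemma N_orth_span:
  assumes "Z \<in> span (y ` {..<t})"
  shows "B (N t) Z = 0"
proof -
  have "span (y ` {..<t}) \<subseteq> {Z \<in> S. B (N t) Z = 0}"
    by (rule span_minimal) (auto simp: N_orth_y subspace_def bilinear)
  then show ?thesis using assms by auto
qed

lemma B_residual_N: "X \<in> S \<Longrightarrow> B (R t X) (N t) = B X (N t)"
  using N_orth_span[OF diff_residual_span[of X t]] sym[of "N t"] by (simp add: bilinear)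

lemma innovation_eq: "R t (y t) = R t (w t) + R t (N t)"
  by (simp add: y_def residual_add)

lemma B_innovation: "X \<in> S \<Longrightarrow> B (R t X) (R t (y t)) = B (R t X) (R t (w t)) + B X (N t)"
  by (simp add: innovation_eq bilinear B_residual_right B_residual_N)

text \<open>The fresh noise is orthogonal to the prediction error of \<open>w\<close>. The excess
  over 1 is thus the error variance of the noiseless output, whose time average becomes
  \<open>\<kappa>\<close> in the converse.\<close>

lemma innovation_var_eq: "B (R t (y t)) (R t (y t)) = B (R t (w t)) (R t (w t)) + 1"
proof -
  have "B (R t (y t)) (R t (y t)) = B (R t (y t)) (R t (w t)) + B (y t) (N t)"
    by (rule B_innovation) simp
  also have "B (R t (y t)) (R t (w t)) = B (R t (w t)) (R t (w t)) + B (w t) (N t)"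
    using B_innovation[of "w t" t] sym by simp
  also have "B (w t) (N t) = 0" using N_orth_w[of t t] sym by simp
  also have "B (y t) (N t) = 1" using N_orth_w[of t t] sym[of "w t"] by (simp add: y_def bilinear)
  finally show ?thesis by simp
qed

lemma innovation_var_ge_1: "1 \<le> B (R t (y t)) (R t (y t))"
  using nonneg[of "R t (w t)"] by (simp add: innovation_var_eq)

end

section \<open>The Gaussian space spanned by the coordinates\<close>

definition coordinate :: "nat + nat \<Rightarrow> (nat + nat \<Rightarrow> real) \<Rightarrow> real" where
  "coordinate i \<omega> = \<omega> i"

definition coordinate_space :: "((nat + nat \<Rightarrow> real) \<Rightarrow> real) set" where
  "coordinate_space = span (range coordinate)"

lemma noise_coordinate: "noise t = coordinate (Inl t)"
  and message_coordinate: "message t = coordinate (Inr t)"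
  by (simp_all add: fun_eq_iff noise_def message_def coordinate_def)

lemma coordinate_measurable [measurable]: "coordinate i \<in> borel_measurable gauss_space"
proof -
  have "(\<lambda>\<omega>. \<omega> i) \<in> measurable gauss_space std_normal_distribution"
    unfolding gauss_space_def by (rule measurable_component_singleton) simp
  then show ?thesis unfolding coordinate_def[abs_def] by (simp cong: measurable_cong_sets)
qed

lemma distr_coordinate: "distr gauss_space borel (coordinate i) = std_normal_distribution"
proof -
  have "distr gauss_space borel (coordinate i) = distr gauss_space std_normal_distribution (\<lambda>\<omega>. \<omega> i)"
    by (rule distr_cong) (auto simp: coordinate_def)
  also have "\<dots> = std_normal_distribution"
    unfolding gauss_space_def by (rule distr_PiM_component) (auto simp: prob_space_normal_density)
  finally show ?thesis .
qed

lemma centered_gaussian_coordinate: "centered_gaussian (coordinate i)"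
  unfolding centered_gaussian_def
proof (intro conjI exI)
  have "distr std_normal_distribution borel (\<lambda>x. x) = std_normal_distribution"
    by (subst distr_cong[OF refl _ refl, where L=std_normal_distribution]) (simp_all add: distr_id2)
  then show "distr gauss_space borel (coordinate i) = distr std_normal_distribution borel (\<lambda>x. 1 * x)"
    by (simp add: distr_coordinate)
qed simp

lemma indep_vars_coordinate: "gauss.indep_vars (\<lambda>_. borel) coordinate UNIV"
proof (subst gauss.indep_vars_iff_distr_eq_PiM')
  have sets: "sets gauss_space = sets (PiM UNIV (\<lambda>_. borel))"
    unfolding gauss_space_def by (rule sets_PiM_cong) auto
  have "distr gauss_space (PiM UNIV (\<lambda>_. borel)) (\<lambda>x. \<lambda>i\<in>UNIV. coordinate i x) = distr gauss_space gauss_space (\<lambda>x. x)"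
    by (rule distr_cong) (auto simp: sets coordinate_def)
  also have "\<dots> = PiM UNIV (\<lambda>i. distr gauss_space borel (coordinate i))"
    unfolding distr_coordinate by (simp add: distr_id2) (simp add: gauss_space_def)
  finally show "distr gauss_space (PiM UNIV (\<lambda>_. borel)) (\<lambda>x. \<lambda>i\<in>UNIV. coordinate i x) =
      PiM UNIV (\<lambda>i. distr gauss_space borel (coordinate i))" .
qed simp_all

lemma gaussian_coordinate_space: "gaussian_subspace coordinate_space"
  unfolding gaussian_subspace_def
proof (intro conjI ballI)
  show "subspace coordinate_space" by (simp add: coordinate_space_def subspace_span)
  fix X assume "X \<in> coordinate_space"
  then obtain A c where A: "finite A" "A \<subseteq> range coordinate" and X: "X = (\<Sum>a\<in>A. c a *\<^sub>R a)"
    unfolding coordinate_space_def span_explicit by auto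
  from A obtain I where I: "finite I" "inj_on coordinate I" "A = coordinate ` I"
    by (metis finite_subset_image inj_on_image_set_diff subset_image_inj finite_imageD)
  define d where "d i = c (coordinate i)" for i
  have X: "X = (\<Sum>i\<in>I. d i *\<^sub>R coordinate i)"
    unfolding X I(3) d_def by (subst sum.reindex[OF I(2)]) simp
  show "centered_gaussian X"
  proof (rule centered_gaussianI)
    show "X \<in> borel_measurable gauss_space"
    proof -
      have "(\<lambda>\<omega>. \<Sum>i\<in>I. d i * coordinate i \<omega>) \<in> borel_measurable gauss_space" by measurable
      moreover have "X = (\<lambda>\<omega>. \<Sum>i\<in>I. d i * coordinate i \<omega>)" unfolding X by (simp add: fun_eq_iff)
      ultimately show ?thesis by simp
    qed
    show "0 \<le> (\<Sum>i\<in>I. (d i)\<^sup>2)" by (simp add: sum_nonneg)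
    fix t
    have ind: "gauss.indep_vars (\<lambda>_. borel) (\<lambda>i \<omega>. d i * coordinate i \<omega>) I"
      using gauss.indep_vars_compose2[OF gauss.indep_vars_subset[OF indep_vars_coordinate], of I "\<lambda>i x. d i * x" "\<lambda>_. borel"]
      by simp
    have "(CLINT \<omega>|gauss_space. iexp (t * X \<omega>)) =
        char (distr gauss_space borel (\<lambda>\<omega>. \<Sum>i\<in>I. d i * coordinate i \<omega>)) t"
      unfolding char_def by (subst integral_distr) (simp_all add: X)
    also have "\<dots> = (\<Prod>i\<in>I. char (distr gauss_space borel (\<lambda>\<omega>. d i * coordinate i \<omega>)) t)"
      by (rule gauss.char_distr_sum[OF ind])
    also have "\<dots> = (\<Prod>i\<in>I. complex_of_real (exp (- (t\<^sup>2 * (d i)\<^sup>2) / 2)))"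
    proof (rule prod.cong[OF refl])
      fix i
      have "char (distr gauss_space borel (\<lambda>\<omega>. d i * coordinate i \<omega>)) t =
          char (distr gauss_space borel (coordinate i)) (t * d i)"
        unfolding char_def by (subst (1 2) integral_distr) (simp_all add: mult.assoc)
      also have "\<dots> = complex_of_real (exp (- (t\<^sup>2 * (d i)\<^sup>2) / 2))"
        unfolding distr_coordinate char_std_normal_distribution by (simp add: power_mult_distrib)
      finally show "char (distr gauss_space borel (\<lambda>\<omega>. d i * coordinate i \<omega>)) t =
          complex_of_real (exp (- (t\<^sup>2 * (d i)\<^sup>2) / 2))" .
    qed
    also have "\<dots> = complex_of_real (exp (\<Sum>i\<in>I. - (t\<^sup>2 * (d i)\<^sup>2) / 2))"
      using I(1) by (simp add: exp_sum)
    also have "(\<Sum>i\<in>I. - (t\<^sup>2 * (d i)\<^sup>2) / 2) = - (t\<^sup>2 * (\<Sum>i\<in>I. (d i)\<^sup>2)) / 2"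
      by (simp add: sum_distrib_left sum_negf sum_divide_distrib)
    finally show "(CLINT \<omega>|gauss_space. iexp (t * X \<omega>)) = exp (- (t\<^sup>2 * (\<Sum>i\<in>I. (d i)\<^sup>2)) / 2)" .
  qed
qed

lemma integrable_coordinate: "integrable gauss_space (coordinate k)"
  and expectation_coordinate: "integral\<^sup>L gauss_space (coordinate k) = 0"
proof -
  have "integrable (distr gauss_space borel (coordinate k)) (\<lambda>x. x)"
    using integrable_std_normal_distribution_moment[of 1] by (simp add: distr_coordinate)
  then show "integrable gauss_space (coordinate k)"
    by (subst (asm) integrable_distr_eq) simp_all
  have "integral\<^sup>L gauss_space (coordinate k) = (\<integral>x. x \<partial>distr gauss_space borel (coordinate k))"
    by (subst integral_distr) simp_all
  also have "\<dots> = 0"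
    using integral_std_normal_distribution_moment_odd[of 1] by (simp add: distr_coordinate)
  finally show "integral\<^sup>L gauss_space (coordinate k) = 0" .
qed

lemma cov_coordinate: "cov (coordinate i) (coordinate j) = (if i = j then 1 else 0)"
proof (cases "i = j")
  case True
  have "cov (coordinate i) (coordinate i) = (\<integral>x. x * x \<partial>distr gauss_space borel (coordinate i))"
    unfolding cov_def by (subst integral_distr) simp_all
  also have "\<dots> = 1"
    using std_normal_distribution_even_moments(1)[of 1] by (simp add: distr_coordinate power2_eq_square)
  finally show ?thesis using True by simp
next
  case False
  have "gauss.indep_vars (\<lambda>_. borel) coordinate {i, j}"
    by (rule gauss.indep_vars_subset[OF indep_vars_coordinate]) simp
  then have "(\<integral>\<omega>. (\<Prod>k\<in>{i, j}. coordinate k \<omega>) \<partial>gauss_space) = (\<Prod>k\<in>{i, j}. integral\<^sup>L gauss_space (coordinate k))"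
    by (intro gauss.indep_vars_lebesgue_integral) (auto simp: integrable_coordinate)
  then show ?thesis using False by (simp add: cov_def expectation_coordinate)
qed

interpretation coord: semi_inner coordinate_space cov
  by (rule semi_inner_cov[OF gaussian_coordinate_space])

lemma coordinate_mem [simp, intro]: "coordinate i \<in> coordinate_space"
  by (simp add: coordinate_space_def span_base)

lemma cov_noise [simp]: "cov (noise s) (noise t) = (if s = t then 1 else 0)"
  and cov_message [simp]: "cov (message s) (message t) = (if s = t then 1 else 0)"
  and cov_noise_message [simp]: "cov (noise s) (message t) = 0" "cov (message s) (noise t) = 0"
  and noise_mem [simp, intro]: "noise t \<in> coordinate_space"
  and message_mem [simp, intro]: "message t \<in> coordinate_space"
  by (simp_all add: noise_coordinate message_coordinate cov_coordinate)

text \<open>Turns the independence assumed of feedback inputs into the orthogonality that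
  \<open>noisy_output\<close> asks for.\<close>

lemma cov_noise_independent:
  assumes "independent borel (noise t) borel X" "centered_gaussian X"
  shows "cov (noise t) X = 0"
proof -
  have "integrable gauss_space X"
    by (rule gauss.square_integrable_imp_integrable[OF centered_gaussian_measurable[OF assms(2)]
          expectation_centered_square(2)[OF assms(2)]])
  then have "cov (noise t) X = integral\<^sup>L gauss_space (noise t) * integral\<^sup>L gauss_space X"
    unfolding cov_def
    by (intro gauss.indep_var_lebesgue_integral independent_imp_indep_var[OF assms(1)])
       (simp_all add: noise_coordinate integrable_coordinate)
  then show ?thesis by (simp add: noise_coordinate expectation_coordinate)
qed

text \<open>The state of a linear system driven by \<open>u\<close>, seen through a linear functional \<open>x\<close> of the state:
  \<open>\<Phi>\<close> is the transposed state matrix and \<open>g x\<close> the pairing of \<open>x\<close> with the input vector.\<close>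

primrec state_functional :: "('x \<Rightarrow> 'x) \<Rightarrow> ('x \<Rightarrow> real) \<Rightarrow> (nat \<Rightarrow> 'a::real_vector) \<Rightarrow> nat \<Rightarrow> 'x \<Rightarrow> 'a" where
  "state_functional \<Phi> g u 0 x = 0"
| "state_functional \<Phi> g u (Suc t) x = state_functional \<Phi> g u t (\<Phi> x) + g x *\<^sub>R u t"

lemma state_functional_sum:
  "state_functional \<Phi> g u t x = (\<Sum>s<t. g ((\<Phi> ^^ (t - 1 - s)) x) *\<^sub>R u s)"
proof (induction t arbitrary: x)
  case (Suc t)
  have "g ((\<Phi> ^^ (t - 1 - s)) (\<Phi> x)) = g ((\<Phi> ^^ (t - s)) x)" if "s < t" for s
  proof -
    have "t - s = Suc (t - 1 - s)" using that by simp
    then show ?thesis by (simp only: funpow_Suc_right comp_def)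
  qed
  then show ?case by (simp add: Suc)
qed simp

lemma state_functional_span: "state_functional \<Phi> g u t x \<in> span (u ` {..<t})"
  unfolding state_functional_sum by (rule sum_in_span_lessThan)

lemma state_functional_add:
  "state_functional \<Phi> g (\<lambda>t. u t + v t) t x = state_functional \<Phi> g u t x + state_functional \<Phi> g v t x"
  by (simp add: state_functional_sum scaleR_right_distrib sum.distrib)

lemma state_functional_apply: "state_functional \<Phi> g u t x \<omega> = state_functional \<Phi> g (\<lambda>t. u t \<omega>) t x"
  by (simp add: state_functional_sum)

lemma linear_state_functional:
  assumes "linear \<Phi>" "linear g"
  shows "linear (state_functional \<Phi> g u t)"
proof (rule linearI)
  have P: "linear (\<Phi> ^^ k)" for k
  proof (induction k)
    case (Suc k)
    then show ?case using linear_compose[OF Suc assms(1)] by (simp add: comp_def)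
  qed (simp add: linear_ident)
  show "state_functional \<Phi> g u t (x + x') = state_functional \<Phi> g u t x + state_functional \<Phi> g u t x'" for x x'
    by (simp add: state_functional_sum linear_add[OF P] linear_add[OF assms(2)] scaleR_left_distrib sum.distrib)
  show "state_functional \<Phi> g u t (c *\<^sub>R x) = c *\<^sub>R state_functional \<Phi> g u t x" for c x
    by (simp add: state_functional_sum linear_cmul[OF P] linear_cmul[OF assms(2)] scaleR_sum_right)
qed

text \<open>Row vectors are functions on all naturals, so that a single type serves every dimension;
  entries beyond the dimension are ignored on input and 0 on output.\<close>

definition dual_map :: "rmat \<Rightarrow> (nat \<Rightarrow> real) \<Rightarrow> nat \<Rightarrow> real" where
  "dual_map F x = (\<lambda>j. if j < dim_col F then \<Sum>i<dim_row F. x i * F $$ (i, j) else 0)"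

definition dual_vec :: "rvec \<Rightarrow> (nat \<Rightarrow> real) \<Rightarrow> real" where
  "dual_vec G x = (\<Sum>i<dim_vec G. x i * G $ i)"

definition vec_fun :: "rvec \<Rightarrow> nat \<Rightarrow> real" where
  "vec_fun H = (\<lambda>i. if i < dim_vec H then H $ i else 0)"

lemma linear_dual_map: "linear (dual_map F)"
  by (rule linearI) (auto simp: dual_map_def fun_eq_iff sum.distrib distrib_right sum_distrib_left mult.assoc)

lemma linear_dual_vec: "linear (dual_vec G)"
  by (rule linearI) (auto simp: dual_vec_def sum.distrib distrib_right sum_distrib_left mult.assoc)

lemma dual_vec_eq_scalar_prod: "dim_vec G = dim_vec H \<Longrightarrow> dual_vec G (vec_fun H) = scalar_prod H G"
  by (simp add: dual_vec_def vec_fun_def scalar_prod_def atLeast0LessThan)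

lemma dual_vec_mult_mat_vec:
  assumes "dim_row F = m" "dim_col F = dim_vec v"
  shows "dual_vec (F *\<^sub>v v) x = dual_vec v (dual_map F x)"
proof -
  have "dual_vec (F *\<^sub>v v) x = (\<Sum>i<m. \<Sum>j<dim_vec v. x i * (F $$ (i, j) * v $ j))"
    using assms by (simp add: dual_vec_def scalar_prod_def sum_distrib_left atLeast0LessThan)
  also have "\<dots> = (\<Sum>j<dim_vec v. \<Sum>i<m. x i * (F $$ (i, j) * v $ j))" by (rule sum.swap)
  also have "\<dots> = dual_vec v (dual_map F x)"
    using assms by (simp add: dual_vec_def dual_map_def sum_distrib_right mult.assoc)
  finally show ?thesis .
qed

lemma channel_state_dual:
  assumes "F \<in> carrier_mat m m" "G \<in> carrier_vec m"
  shows "channel_state F G u t \<in> carrier_vec m"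
    and "dual_vec (channel_state F G u t) x = state_functional (dual_map F) (dual_vec G) u t x"
proof (induction t arbitrary: x)
  case 0
  { case 1 then show ?case using assms by simp }
  { case 2 then show ?case using assms by (simp add: dual_vec_def) }
next
  case (Suc t)
  { case 1 then show ?case using assms Suc by simp }
  { case 2
    have c: "channel_state F G u t \<in> carrier_vec m" by (rule Suc)
    have "dual_vec (channel_state F G u (Suc t)) x =
        dual_vec (F *\<^sub>v channel_state F G u t) x + u t * dual_vec G x"
      using assms c by (simp add: dual_vec_def sum.distrib distrib_left sum_distrib_left mult_ac)
    then show ?case
      using assms c by (subst (asm) dual_vec_mult_mat_vec[of _ m]) (simp_all add: Suc(2) mult.commute) }
qed

lemma channel_output_eq:
  assumes "state_space_dims m F G H"
  shows "channel_output F G H u t = state_functional (dual_map F) (dual_vec G) u t (vec_fun H) + u t + noise t"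
proof
  fix \<omega>
  have FG: "F \<in> carrier_mat m m" "G \<in> carrier_vec m" "H \<in> carrier_vec m"
    using assms by (auto simp: state_space_dims_def)
  have c: "channel_state F G (\<lambda>i. u i \<omega>) t \<in> carrier_vec m" by (rule channel_state_dual(1)[OF FG(1,2)])
  have "scalar_prod H (channel_state F G (\<lambda>i. u i \<omega>) t) = dual_vec (channel_state F G (\<lambda>i. u i \<omega>) t) (vec_fun H)"
    using c FG by (subst dual_vec_eq_scalar_prod) auto
  then show "channel_output F G H u t \<omega> =
      (state_functional (dual_map F) (dual_vec G) u t (vec_fun H) + u t + noise t) \<omega>"
    by (simp add: channel_output_def channel_state_dual(2)[OF FG(1,2)] state_functional_apply)
qed

lemma encoder_state_dual:
  assumes "A \<in> carrier_mat (n + 1) (n + 1)"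
  shows "encoder_state n A \<omega> t \<in> carrier_vec (n + 1)"
    and "dual_vec (encoder_state n A \<omega> t) x = (\<Sum>i<n + 1. (dual_map A ^^ t) x i * message i \<omega>)"
proof (induction t arbitrary: x)
  case 0
  { case 1 then show ?case by simp }
  { case 2 then show ?case by (simp add: dual_vec_def) }
next
  case (Suc t)
  { case 1 then show ?case using assms Suc by simp }
  { case 2
    have c: "encoder_state n A \<omega> t \<in> carrier_vec (n + 1)" by (rule Suc)
    show ?case
      using assms c by (simp add: dual_vec_mult_mat_vec[of _ "n + 1"] Suc(2) funpow_swap1) }
qed

definition encoder_signal :: "nat \<Rightarrow> rmat \<Rightarrow> rvec \<Rightarrow> process" where
  "encoder_signal n A C t = (\<Sum>i<n + 1. (dual_map A ^^ t) (vec_fun C) i *\<^sub>R message i)"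

lemma encoder_signal_eq:
  assumes "A \<in> carrier_mat (n + 1) (n + 1)" "C \<in> carrier_vec (n + 1)"
  shows "scalar_prod C (encoder_state n A \<omega> t) = encoder_signal n A C t \<omega>"
proof -
  have "scalar_prod C (encoder_state n A \<omega> t) = dual_vec (encoder_state n A \<omega> t) (vec_fun C)"
    using assms encoder_state_dual(1)[OF assms(1)] by (subst dual_vec_eq_scalar_prod) auto
  then show ?thesis by (simp add: encoder_state_dual(2)[OF assms(1)] encoder_signal_def)
qed

lemma measurable_linear_PiM:
  "(\<lambda>z. \<Sum>i\<in>J. c i * z i) \<in> borel_measurable (PiM J (\<lambda>_. borel :: real measure))"
proof (rule borel_measurable_sum)
  fix i assume "i \<in> J"
  then have [measurable]: "(\<lambda>z. z i) \<in> borel_measurable (PiM J (\<lambda>_. borel :: real measure))"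
    by (rule measurable_component_singleton)
  show "(\<lambda>z. c i * z i) \<in> borel_measurable (PiM J (\<lambda>_. borel :: real measure))" by measurable
qed

lemma measurable_linear_pair:
  "(\<lambda>p. (\<Sum>i\<in>I. a i * fst p i) + (\<Sum>j\<in>J. b j * snd p j)) \<in> borel_measurable (stacked_space I \<Otimes>\<^sub>M stacked_space J)"
  by (intro borel_measurable_add measurable_compose[OF measurable_fst measurable_linear_PiM]
      measurable_compose[OF measurable_snd measurable_linear_PiM])

lemma ex_span_image_lessThan:
  fixes y :: "nat \<Rightarrow> 'a::real_vector"
  shows "x \<in> span (y ` {..<t}) \<Longrightarrow> \<exists>c. x = (\<Sum>s<t. c s *\<^sub>R y s)"
  using in_span_image_lessThan by blast

lemma centered_gaussian_noise: "centered_gaussian (noise t)"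
  by (simp add: noise_coordinate centered_gaussian_coordinate)

lemma gaussian_pair_independent:
  fixes X Y :: "nat \<Rightarrow> (nat + nat \<Rightarrow> real) \<Rightarrow> real"
  assumes S: "gaussian_subspace S" and E: "E \<in> S" and I: "finite I" "finite J"
    and X: "\<And>i. i \<in> I \<Longrightarrow> X i \<in> S" "\<And>i. i \<in> I \<Longrightarrow> cov E (X i) = 0"
    and Y: "\<And>j. j \<in> J \<Longrightarrow> Y j \<in> S" "\<And>j. j \<in> J \<Longrightarrow> cov E (Y j) = 0"
  shows "independent borel E (stacked_space I \<Otimes>\<^sub>M stacked_space J) (\<lambda>\<omega>. (stacked X I \<omega>, stacked Y J \<omega>))"
proof -
  define K where "K = Inl ` I \<union> Inr ` J"
  define Z where "Z = case_sum X Y"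
  let ?M = "PiM K (\<lambda>_. borel :: real measure)"
  have Z: "k \<in> K \<Longrightarrow> Z k \<in> S" "k \<in> K \<Longrightarrow> cov E (Z k) = 0" for k
    using X Y by (auto simp: K_def Z_def)
  have "finite K" using I by (simp add: K_def)
  from gaussian_orthogonal_independent[OF S this E Z]
  have ind: "independent borel E ?M (\<lambda>\<omega>. \<lambda>k\<in>K. Z k \<omega>)" .
  have m1: "(\<lambda>z. \<lambda>i\<in>I. z (Inl i)) \<in> measurable ?M (stacked_space I)"
    by (intro measurable_restrict measurable_component_singleton) (simp add: K_def)
  have m2: "(\<lambda>z. \<lambda>j\<in>J. z (Inr j)) \<in> measurable ?M (stacked_space J)"
    by (intro measurable_restrict measurable_component_singleton) (simp add: K_def)
  have "independent borel (\<lambda>\<omega>. E \<omega>) (stacked_space I \<Otimes>\<^sub>M stacked_space J)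
      (\<lambda>\<omega>. (\<lambda>i\<in>I. (\<lambda>k\<in>K. Z k \<omega>) (Inl i), \<lambda>j\<in>J. (\<lambda>k\<in>K. Z k \<omega>) (Inr j)))"
    using independent_compose[OF ind measurable_ident measurable_Pair[OF m1 m2]] by simp
  moreover have "(\<lambda>i\<in>I. (\<lambda>k\<in>K. Z k \<omega>) (Inl i)) = stacked X I \<omega>"
    "(\<lambda>j\<in>J. (\<lambda>k\<in>K. Z k \<omega>) (Inr j)) = stacked Y J \<omega>" for \<omega>
    by (auto simp: stacked_def fun_eq_iff restrict_def K_def Z_def)
  ultimately show ?thesis by simp
qed

text \<open>Once the message and the past outputs are known, only the current noise of variance 1 is
  uncertain. So the denominators of the log-ratios are 1.\<close>

lemma coding_information_eq:
  assumes "noisy_output coordinate_space cov w noise"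
    and w: "\<And>t. w t = U t + V t" "\<And>t. U t \<in> span (message ` {..n})" "\<And>t. V t \<in> span (y ` {..<t})"
    and y: "\<And>t. y t = w t + noise t"
    and orth: "\<And>t i. cov (noise t) (message i) = 0"
  shows "coding_information n y T = (\<Sum>t\<le>T. 1 / 2 * log 2 (innovation_var cov y t))"
proof -
  interpret noisy_output coordinate_space cov w noise by fact
  have y_eq: "noisy_output.y w noise = y"
    by (simp add: fun_eq_iff y y_def)
  have yS: "y t \<in> coordinate_space" for t
    using y_mem[of t] unfolding y_eq .
  have "\<forall>t. \<exists>a. U t = (\<Sum>i<Suc n. a i *\<^sub>R message i)"
    using w(2) unfolding lessThan_Suc_atMost[symmetric] by (blast intro: ex_span_image_lessThan)
  from choice[OF this] obtain a where a: "U t = (\<Sum>i<Suc n. a t i *\<^sub>R message i)" for t by blast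
  have "\<forall>t. \<exists>b. V t = (\<Sum>s<t. b s *\<^sub>R y s)"
    using w(3) by (blast intro: ex_span_image_lessThan)
  from choice[OF this] obtain b where b: "V t = (\<Sum>s<t. b t s *\<^sub>R y s)" for t by blast
  have dec: "\<exists>c. (\<forall>\<omega>. y t \<omega> = (\<Sum>s<t. c s * stacked y {..<t} \<omega> s) + innovation cov y t \<omega>) \<and>
      independent borel (innovation cov y t) (stacked_space {..<t}) (stacked y {..<t}) \<and>
      innovation cov y t \<in> coordinate_space" for t
    by (rule innovation_decomposition[where y=y and t=t, OF gaussian_coordinate_space yS]) blast
  then have "\<forall>t. \<exists>c. \<forall>\<omega>. y t \<omega> = (\<Sum>s<t. c s * stacked y {..<t} \<omega> s) + innovation cov y t \<omega>" by blast
  from choice[OF this] obtain c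
    where c: "y t \<omega> = (\<Sum>s<t. c t s * stacked y {..<t} \<omega> s) + innovation cov y t \<omega>" for t \<omega> by blast
  define g where "g t p = (\<Sum>i\<in>{..n}. a t i * fst p i) + (\<Sum>s\<in>{..<t}. b t s * snd p s)"
    for t and p :: "(nat \<Rightarrow> real) \<times> (nat \<Rightarrow> real)"
  have "coding_information n y T = gauss.mutual_information 2 (stacked_space {..n}) (stacked_space {..<Suc T})
      (stacked message {..n}) (stacked y {..<Suc T})"
    by (simp add: coding_information_def lessThan_Suc_atMost)
  also have "\<dots> = (\<Sum>t<Suc T. 1 / 2 * log 2 (innovation_var cov y t / cov (noise t) (noise t)))"
  proof (rule mutual_information_triangular_gaussian[where g=g and l="\<lambda>t z. \<Sum>s<t. c t s * z s"])
    show "stacked message {..n} \<in> measurable gauss_space (stacked_space {..n})"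
      unfolding stacked_def[abs_def] message_coordinate by (intro measurable_restrict) simp
    show "centered_gaussian (noise t)" for t by (rule centered_gaussian_noise)
    show "cov (noise t) (noise t) > 0" for t by simp
    show "independent borel (noise t) (stacked_space {..n} \<Otimes>\<^sub>M stacked_space {..<t})
        (\<lambda>\<omega>. (stacked message {..n} \<omega>, stacked y {..<t} \<omega>))" for t
      by (rule gaussian_pair_independent[OF gaussian_coordinate_space])
         (use N_orth_y[unfolded y_eq] yS in auto)
    show "g t \<in> borel_measurable (stacked_space {..n} \<Otimes>\<^sub>M stacked_space {..<t})" for t
      unfolding g_def by (rule measurable_linear_pair)
    show "y t \<omega> = g t (stacked message {..n} \<omega>, stacked y {..<t} \<omega>) + noise t \<omega>" for t \<omega>
    proof -
      have "y t \<omega> = (U t + V t + noise t) \<omega>" using y[of t] w(1)[of t] by simp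
      then show ?thesis
        unfolding a b by (simp add: g_def stacked_def lessThan_Suc_atMost del: sum.lessThan_Suc)
    qed
    show "centered_gaussian (innovation cov y t)" for t
      using dec[of t] gaussian_subspaceD(2)[OF gaussian_coordinate_space] by blast
    show "0 < innovation_var cov y t" for t
      using innovation_var_ge_1[of t] unfolding y_eq by simp
    show "independent borel (innovation cov y t) (stacked_space {..<t}) (stacked y {..<t})" for t
      using dec[of t] by blast
    show "(\<lambda>z. \<Sum>s<t. c t s * z s) \<in> borel_measurable (stacked_space {..<t})" for t
      using measurable_linear_PiM[of "c t" "{..<t}"] .
    show "y t \<omega> = (\<Sum>s<t. c t s * stacked y {..<t} \<omega> s) + innovation cov y t \<omega>" for t \<omega> by (rule c)
  qed
  also have "\<dots> = (\<Sum>t\<le>T. 1 / 2 * log 2 (innovation_var cov y t))"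
    by (simp add: lessThan_Suc_atMost del: sum.lessThan_Suc)
  finally show ?thesis .
qed

section \<open>Directed information of feedback inputs\<close>

lemma ex_span_two_families:
  fixes u y :: "nat \<Rightarrow> 'a::real_vector"
  assumes "X \<in> span (u ` {..<s} \<union> y ` {..<t})"
  shows "\<exists>a b. X = (\<Sum>j<s. a j *\<^sub>R u j) + (\<Sum>j<t. b j *\<^sub>R y j)"
proof -
  obtain p q where pq: "X = p + q" and p: "p \<in> span (u ` {..<s})" and q: "q \<in> span (y ` {..<t})"
    using assms unfolding span_Un by auto
  show ?thesis
    using ex_span_image_lessThan[OF p] ex_span_image_lessThan[OF q] pq by blast
qed

text \<open>Every combination splits into a multiple of \<open>E\<close> and an element of the old
  span, which are independent Gaussians.\<close>

lemma gaussian_subspace_insert: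
  assumes V: "gaussian_subspace (span V)" and E: "centered_gaussian E"
    and ind: "\<And>X. X \<in> span V \<Longrightarrow> independent borel E borel X"
  shows "gaussian_subspace (span (insert E V))"
  unfolding gaussian_subspace_def
proof (intro conjI ballI)
  fix X assume "X \<in> span (insert E V)"
  then obtain k where k: "X - k *\<^sub>R E \<in> span V" using span_breakdown_eq by blast
  have "independent borel (\<lambda>\<omega>. k * E \<omega>) borel (X - k *\<^sub>R E)"
    by (rule independent_compose[OF ind[OF k], of "\<lambda>e. k * e" borel "\<lambda>x. x" borel]) simp_all
  moreover have "(\<lambda>\<omega>. k * E \<omega>) = k *\<^sub>R E" by (simp add: fun_eq_iff)
  ultimately have "independent borel (k *\<^sub>R E) borel (X - k *\<^sub>R E)" by (simp only:)
  then have "centered_gaussian (k *\<^sub>R E + (X - k *\<^sub>R E))"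
    using gaussian_subspaceD(2)[OF V k] by (intro centered_gaussian_add centered_gaussian_scale E) simp_all
  then show "centered_gaussian X" by simp
qed (rule subspace_span)

text \<open>Nothing places a feedback input inside \<open>coordinate_space\<close>, so joint
  Gaussianity is built up in time: modulo the past, \<open>\<xi> t\<close> generates the same span
  as \<open>u t\<close>, and then \<open>noise t\<close> the same as \<open>y t\<close>; each is
  independent of what came before.\<close>

lemma feedback_gaussian:
  assumes dims: "state_space_dims m F G H" and fb: "feedback_input F G H \<gamma> \<eta> \<xi> u y"
  defines "w \<equiv> \<lambda>t. state_functional (dual_map F) (dual_vec G) u t (vec_fun H) + u t"
  shows "gaussian_subspace (span (range u \<union> range y))"
    and "noisy_output (span (range u \<union> range y)) cov w noise" and "y t = w t + noise t"
    and "directed_information u y T = (\<Sum>t\<le>T. 1 / 2 * log 2 (innovation_var cov y t))"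
proof -
  define V where "V t = u ` {..<t} \<union> y ` {..<t}" for t
  let ?S = "span (range u \<union> range y)"
  have fb1: "y = channel_output F G H u"
    and fb2: "u t \<omega> = (\<Sum>j<t. \<gamma> t j * u j \<omega>) + (\<Sum>j<t. \<eta> t j * y j \<omega>) + \<xi> t \<omega>"
    and \<xi>: "centered_gaussian (\<xi> t)"
    and fb4: "independent borel (\<xi> t) (stacked_space {..<t} \<Otimes>\<^sub>M stacked_space {..<t})
        (\<lambda>\<omega>. (stacked u {..<t} \<omega>, stacked y {..<t} \<omega>))"
    and fb5: "independent borel (noise t) (stacked_space {..t} \<Otimes>\<^sub>M stacked_space {..<t})
        (\<lambda>\<omega>. (stacked u {..t} \<omega>, stacked y {..<t} \<omega>))" for t \<omega>
  proof -
    note * = fb[unfolded feedback_input_def]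
    show "y = channel_output F G H u" by (rule *[THEN conjunct1])
    show "u t \<omega> = (\<Sum>j<t. \<gamma> t j * u j \<omega>) + (\<Sum>j<t. \<eta> t j * y j \<omega>) + \<xi> t \<omega>"
      by (rule *[THEN conjunct2, THEN conjunct1, rule_format])
    show "centered_gaussian (\<xi> t)" by (rule *[THEN conjunct2, THEN conjunct2, THEN conjunct1, rule_format])
    show "independent borel (\<xi> t) (stacked_space {..<t} \<Otimes>\<^sub>M stacked_space {..<t})
        (\<lambda>\<omega>. (stacked u {..<t} \<omega>, stacked y {..<t} \<omega>))"
      by (rule *[THEN conjunct2, THEN conjunct2, THEN conjunct2, THEN conjunct1, rule_format])
    show "independent borel (noise t) (stacked_space {..t} \<Otimes>\<^sub>M stacked_space {..<t})
        (\<lambda>\<omega>. (stacked u {..t} \<omega>, stacked y {..<t} \<omega>))"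
      by (rule *[THEN conjunct2, THEN conjunct2, THEN conjunct2, THEN conjunct2, rule_format])
  qed
  have y: "y t = w t + noise t" for t
    using channel_output_eq[OF dims, of u t] unfolding fb1[symmetric] w_def .
  then show "y t = w t + noise t" .
  have V_Suc: "V (Suc t) = insert (y t) (insert (u t) (V t))" for t
    by (auto simp: V_def lessThan_Suc)
  have V_mono: "span (V s) \<subseteq> span (V t)" if "s \<le> t" for s t
    using that unfolding V_def by (intro span_mono Un_mono image_mono) auto
  have u_eq: "u t - \<xi> t \<in> span (V t)" for t
  proof -
    have "u t - \<xi> t = (\<Sum>j<t. \<gamma> t j *\<^sub>R u j) + (\<Sum>j<t. \<eta> t j *\<^sub>R y j)"
      by (simp add: fun_eq_iff fb2[of t])
    then show ?thesis
      unfolding V_def span_Un using sum_in_span_lessThan by blast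
  qed
  have w_u: "w t - u t \<in> span (V t)" for t
    using subsetD[OF span_mono state_functional_span, of u t "V t" "dual_map F" "dual_vec G" "vec_fun H"]
    by (simp add: w_def V_def)
  have ind\<xi>: "independent borel (\<xi> t) borel X" if X: "X \<in> span (V t)" for t X
  proof -
    obtain a b where ab: "X = (\<Sum>s<t. a s *\<^sub>R u s) + (\<Sum>s<t. b s *\<^sub>R y s)"
      using ex_span_two_families[OF X[unfolded V_def]] by blast
    have "independent borel (\<xi> t) borel (\<lambda>\<omega>. (\<Sum>s<t. a s * stacked u {..<t} \<omega> s) + (\<Sum>s<t. b s * stacked y {..<t} \<omega> s))"
      using independent_compose[OF fb4 measurable_ident measurable_linear_pair] by simp
    moreover have "X = (\<lambda>\<omega>. (\<Sum>s<t. a s * stacked u {..<t} \<omega> s) + (\<Sum>s<t. b s * stacked y {..<t} \<omega> s))"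
      unfolding ab by (simp add: fun_eq_iff stacked_def)
    ultimately show ?thesis by simp
  qed
  have indN: "independent borel (noise t) borel X" if X: "X \<in> span (insert (u t) (V t))" for t X
  proof -
    have "insert (u t) (V t) = u ` {..<Suc t} \<union> y ` {..<t}" by (auto simp: V_def lessThan_Suc)
    with X have "X \<in> span (u ` {..<Suc t} \<union> y ` {..<t})" by (simp only:)
    then obtain a b where ab: "X = (\<Sum>s<Suc t. a s *\<^sub>R u s) + (\<Sum>s<t. b s *\<^sub>R y s)"
      using ex_span_two_families by blast
    have "independent borel (noise t) borel (\<lambda>\<omega>. (\<Sum>s\<in>{..t}. a s * stacked u {..t} \<omega> s) + (\<Sum>s<t. b s * stacked y {..<t} \<omega> s))"
      using independent_compose[OF fb5 measurable_ident measurable_linear_pair] by simp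
    moreover have "X = (\<lambda>\<omega>. (\<Sum>s\<in>{..t}. a s * stacked u {..t} \<omega> s) + (\<Sum>s<t. b s * stacked y {..<t} \<omega> s))"
      unfolding ab by (simp add: fun_eq_iff stacked_def lessThan_Suc_atMost del: sum.lessThan_Suc)
    ultimately show ?thesis by simp
  qed
  have span_u: "span (insert (u t) (V t)) = span (insert (\<xi> t) (V t))" for t
    by (rule eq_span_insert_eq[OF u_eq])
  have wS: "w t \<in> span (insert (u t) (V t))" for t
  proof -
    have "w t - u t \<in> span (insert (u t) (V t))" using w_u span_mono[of "V t" "insert (u t) (V t)"] by blast
    from span_add[OF this span_base[of "u t"]] show ?thesis by simp
  qed
  have span_y: "span (V (Suc t)) = span (insert (noise t) (insert (u t) (V t)))" for t
    unfolding V_Suc by (rule eq_span_insert_eq) (use wS y in simp)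
  have gV: "gaussian_subspace (span (V t))" and gU: "gaussian_subspace (span (insert (u t) (V t)))" for t
  proof -
    have step: "gaussian_subspace (span (insert (u t) (V t)))" if "gaussian_subspace (span (V t))" for t
      unfolding span_u by (rule gaussian_subspace_insert[OF that \<xi> ind\<xi>])
    show gV: "gaussian_subspace (span (V t))" for t
    proof (induction t)
      case 0
      have "centered_gaussian (0 *\<^sub>R noise 0)"
        by (rule centered_gaussian_scale[OF centered_gaussian_noise])
      then show ?case by (simp add: V_def gaussian_subspace_def)
    next
      case (Suc t)
      show ?case
        unfolding span_y by (rule gaussian_subspace_insert[OF step[OF Suc] centered_gaussian_noise indN])
    qed
    show "gaussian_subspace (span (insert (u t) (V t)))" by (rule step[OF gV])
  qed
  \<comment> \<open>The spans increase with \<open>t\<close>, so their union is a subspace and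
    exhausts \<open>?S\<close>.\<close>
  have dir: "X \<in> ?S \<Longrightarrow> \<exists>t. X \<in> span (V t)" for X
  proof -
    have "subspace {X. \<exists>t. X \<in> span (V t)}"
      unfolding subspace_def
    proof (intro conjI allI ballI)
      show "0 \<in> {X. \<exists>t. X \<in> span (V t)}" using span_zero by blast
      fix X Y c assume X: "X \<in> {X. \<exists>t. X \<in> span (V t)}"
      then obtain t where t: "X \<in> span (V t)" by blast
      then show "c *\<^sub>R X \<in> {X. \<exists>t. X \<in> span (V t)}" using span_scale by blast
      assume "Y \<in> {X. \<exists>t. X \<in> span (V t)}"
      then obtain t' where t': "Y \<in> span (V t')" by blast
      have "X \<in> span (V (max t t'))" "Y \<in> span (V (max t t'))"
        using t t' V_mono[of t "max t t'"] V_mono[of t' "max t t'"] by auto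
      then show "X + Y \<in> {X. \<exists>t. X \<in> span (V t)}" using span_add by blast
    qed
    moreover have "range u \<union> range y \<subseteq> {X. \<exists>t. X \<in> span (V t)}"
    proof
      fix X assume "X \<in> range u \<union> range y"
      then obtain t where "X = u t \<or> X = y t" by blast
      then have "X \<in> V (Suc t)" by (auto simp: V_Suc)
      then show "X \<in> {X. \<exists>t. X \<in> span (V t)}" using span_base by blast
    qed
    ultimately show "X \<in> ?S \<Longrightarrow> \<exists>t. X \<in> span (V t)" for X
      using span_minimal by blast
  qed
  show gS: "gaussian_subspace ?S"
    unfolding gaussian_subspace_def
    using dir gaussian_subspaceD(2)[OF gV] subspace_span by blast
  have uS: "u t \<in> ?S" and yS: "y t \<in> ?S" for t by (auto intro: span_base)
  have wS': "w t \<in> ?S" for t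
    using wS[of t] span_mono[of "insert (u t) (V t)" "range u \<union> range y"] by (auto simp: V_def)
  have NS: "noise t \<in> ?S" for t
    using span_diff[OF yS[of t] wS'[of t]] by (simp add: y)
  have N_orth: "cov (noise t) X = 0" if "X \<in> span (insert (u t) (V t))" for t X
    by (rule cov_noise_independent[OF indN[OF that] gaussian_subspaceD(2)[OF gU that]])
  have w_past: "w s \<in> span (insert (u t) (V t))" if "s \<le> t" for s t
  proof -
    have "insert (u s) (V s) \<subseteq> insert (u t) (V t)"
      using that by (cases "s = t") (auto simp: V_def)
    then show ?thesis using wS[of s] span_mono by blast
  qed
  show no: "noisy_output ?S cov w noise"
  proof -
    interpret semi_inner ?S cov by (rule semi_inner_cov[OF gS])
    show ?thesis
    proof
      show "cov (noise t) (w s) = 0" if "s \<le> t" for s t by (rule N_orth[OF w_past[OF that]])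
    qed (use wS' NS in auto)
  qed
  interpret noisy_output ?S cov w noise by (rule no)
  have y_eq: "noisy_output.y w noise = y" by (simp add: fun_eq_iff y y_def)
  \<comment> \<open>Both terms of the chain rule contain the variance of \<open>y t\<close>, which
    cancels. In the first one \<open>u\<close> up to time \<open>t\<close> determines
    \<open>w t\<close> and leaves the noise; in the second one the past leaves the
    innovation.\<close>
  have cmi: "gauss.conditional_mutual_information 2 borel (stacked_space {..t}) (stacked_space {..<t})
      (y t) (stacked u {..t}) (stacked y {..<t}) = 1 / 2 * log 2 (innovation_var cov y t)" for t
  proof -
    have yt: "centered_gaussian (y t)" by (rule gaussian_subspaceD(2)[OF gS yS])
    have "cov (y t) (y t) = cov (w t) (w t) + 1"
      using N_orth_w[of t t] sym[of "w t" "noise t"] wS'[of t] NS[of t] mem(2)[OF wS' NS, of t t]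
        add_left[of "w t" "noise t" "w t + noise t"] add_right[of "w t" "noise t" "w t"] add_right[of "w t" "noise t" "noise t"]
      unfolding y by simp
    then have vy: "cov (y t) (y t) > 0" using nonneg[of "w t"] by simp
    obtain a where a: "w t = (\<Sum>s<Suc t. a s *\<^sub>R u s)"
    proof -
      have "w t \<in> span (u ` {..<Suc t})"
        unfolding w_def by (intro span_add subsetD[OF span_mono state_functional_span] span_base) auto
      then show thesis using that in_span_image_lessThan by blast
    qed
    have "gauss.mutual_information 2 borel (stacked_space {..t} \<Otimes>\<^sub>M stacked_space {..<t}) (y t)
        (\<lambda>\<omega>. (stacked u {..t} \<omega>, stacked y {..<t} \<omega>)) = 1 / 2 * log 2 (cov (y t) (y t) / cov (noise t) (noise t))"
    proof (rule mutual_information_additive_gaussian[where g="\<lambda>p. \<Sum>s\<in>{..t}. a s * fst p s"])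
      show "independent borel (noise t) (stacked_space {..t} \<Otimes>\<^sub>M stacked_space {..<t})
          (\<lambda>\<omega>. (stacked u {..t} \<omega>, stacked y {..<t} \<omega>))" by (rule fb5)
      show "(\<lambda>p. \<Sum>s\<in>{..t}. a s * fst p s) \<in> borel_measurable (stacked_space {..t} \<Otimes>\<^sub>M stacked_space {..<t})"
        by (rule measurable_compose[OF measurable_fst measurable_linear_PiM])
      show "y t \<omega> = (\<Sum>s\<in>{..t}. a s * fst (stacked u {..t} \<omega>, stacked y {..<t} \<omega>) s) + noise t \<omega>" for \<omega>
        unfolding y a by (simp add: stacked_def lessThan_Suc_atMost del: sum.lessThan_Suc)
    qed (use yt vy centered_gaussian_noise in simp_all)
    moreover have "gauss.mutual_information 2 borel (stacked_space {..<t}) (y t) (stacked y {..<t}) =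
        1 / 2 * log 2 (cov (y t) (y t) / innovation_var cov y t)"
    proof (rule innovation_decomposition[where y=y and t=t, OF gS yS])
      fix c assume c: "\<And>\<omega>. y t \<omega> = (\<Sum>s<t. c s * stacked y {..<t} \<omega> s) + innovation cov y t \<omega>"
        "(\<lambda>z. \<Sum>s<t. c s * z s) \<in> borel_measurable (stacked_space {..<t})"
        "independent borel (innovation cov y t) (stacked_space {..<t}) (stacked y {..<t})"
        "innovation cov y t \<in> ?S"
      show ?thesis
      proof (rule mutual_information_additive_gaussian[where g="\<lambda>z. \<Sum>s<t. c s * z s", OF _ _ yt vy])
        show "centered_gaussian (innovation cov y t)" by (rule gaussian_subspaceD(2)[OF gS c(4)])
        show "0 < innovation_var cov y t" using innovation_var_ge_1[of t] unfolding y_eq by simp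
      qed (rule c)+
    qed
    moreover have "innovation_var cov y t > 0" using innovation_var_ge_1[of t] unfolding y_eq by simp
    ultimately show ?thesis
      using vy by (simp add: gauss.conditional_mutual_information_def log_divide)
  qed
  show "directed_information u y T = (\<Sum>t\<le>T. 1 / 2 * log 2 (innovation_var cov y t))"
    unfolding directed_information_def cmi ..
qed

section \<open>Feasible error covariances\<close>

definition unit_fun :: "nat \<Rightarrow> nat \<Rightarrow> real" where
  "unit_fun i = (\<lambda>j. if j = i then 1 else 0)"

lemma geometric_null:
  fixes f :: "nat \<Rightarrow> real"
  assumes "\<And>j. \<bar>f j\<bar> \<le> c * \<theta> ^ j" "0 < \<theta>" "\<theta> < 1"
  shows "f \<longlonglongrightarrow> 0"
proof (rule Lim_null_comparison)
  show "(\<lambda>j. c * \<theta> ^ j) \<longlonglongrightarrow> 0"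
    using tendsto_mult_right_zero[OF LIMSEQ_power_zero[of \<theta>], of c] assms by simp
  show "eventually (\<lambda>j. norm (f j) \<le> c * \<theta> ^ j) sequentially"
    using assms(1) by simp
qed

lemma linear_functional_decay:
  fixes h :: "(nat \<Rightarrow> real) \<Rightarrow> real"
  assumes h: "linear h" and h_cong: "\<And>x x'. (\<And>i. i < m \<Longrightarrow> x i = x' i) \<Longrightarrow> h x = h x'"
    and decay: "\<exists>c\<ge>0. \<forall>j. \<forall>i<m. \<bar>z j i\<bar> \<le> c * \<theta> ^ j"
  shows "\<exists>c\<ge>0. \<forall>j :: nat. \<bar>h (z j)\<bar> \<le> c * \<theta> ^ j"
proof -
  obtain c where c0: "0 \<le> c" and c: "\<And>j i. i < m \<Longrightarrow> \<bar>z j i\<bar> \<le> c * \<theta> ^ j" using decay by blast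
  have "\<bar>h (z j)\<bar> \<le> (c * (\<Sum>i<m. \<bar>h (unit_fun i)\<bar>)) * \<theta> ^ j" for j
  proof -
    have "(\<Sum>i<m. z j i *\<^sub>R unit_fun i) k = z j k" if "k < m" for k
      using that by (simp add: unit_fun_def if_distrib sum.delta cong: if_cong)
    then have "h (z j) = h (\<Sum>i<m. z j i *\<^sub>R unit_fun i)" by (intro h_cong) simp
    also have "\<dots> = (\<Sum>i<m. z j i * h (unit_fun i))"
      by (simp add: linear_sum[OF h] linear_cmul[OF h])
    finally have "\<bar>h (z j)\<bar> \<le> (\<Sum>i<m. \<bar>z j i\<bar> * \<bar>h (unit_fun i)\<bar>)"
      using sum_abs[of "\<lambda>i. z j i * h (unit_fun i)" "{..<m}"] by (simp add: abs_mult)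
    also have "\<dots> \<le> (\<Sum>i<m. (c * \<theta> ^ j) * \<bar>h (unit_fun i)\<bar>)"
      using c by (intro sum_mono mult_right_mono) auto
    finally show ?thesis by (simp add: sum_distrib_left mult_ac)
  qed
  moreover have "0 \<le> c * (\<Sum>i<m. \<bar>h (unit_fun i)\<bar>)"
    using c0 by (intro mult_nonneg_nonneg sum_nonneg) auto
  ultimately show ?thesis by blast
qed

text \<open>The vectors \<open>x\<close> are linear functionals of the channel state, of which only the first \<open>m\<close> entries matter.
  \<open>\<Phi>\<close> is the transpose of the zero dynamics, that is, of the state matrix of the inverse of the channel.\<close>

locale dual_system =
  fixes m :: nat and \<Phi> :: "(nat \<Rightarrow> real) \<Rightarrow> nat \<Rightarrow> real" and G :: "(nat \<Rightarrow> real) \<Rightarrow> real"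
    and H :: "nat \<Rightarrow> real" and \<theta> :: real
  assumes linear_\<Phi>: "linear \<Phi>" and linear_G: "linear G"
    and \<Phi>_cong: "\<And>x x'. (\<And>i. i < m \<Longrightarrow> x i = x' i) \<Longrightarrow> \<Phi> x = \<Phi> x'"
    and G_cong: "\<And>x x'. (\<And>i. i < m \<Longrightarrow> x i = x' i) \<Longrightarrow> G x = G x'"
    and \<theta>: "0 < \<theta>" "\<theta> < 1"
    and \<Phi>_decay: "\<And>x. \<exists>c\<ge>0. \<forall>j. \<forall>i<m. \<bar>(\<Phi> ^^ j) x i\<bar> \<le> c * \<theta> ^ j"
begin

lemma linear_\<Phi>_pow: "linear (\<Phi> ^^ j)"
proof (induction j)
  case (Suc k)
  then show ?case using linear_compose[OF Suc linear_\<Phi>] by (simp add: comp_def)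
qed (simp add: linear_ident)

lemmas lin = linear_add[OF linear_\<Phi>] linear_cmul[OF linear_\<Phi>] linear_diff[OF linear_\<Phi>] linear_0[OF linear_\<Phi>]
  linear_add[OF linear_G] linear_cmul[OF linear_G] linear_diff[OF linear_G] linear_0[OF linear_G]

lemma G_decay: "\<exists>c\<ge>0. \<forall>j. \<bar>G ((\<Phi> ^^ j) x)\<bar> \<le> c * \<theta> ^ j"
  by (rule linear_functional_decay[OF linear_G G_cong \<Phi>_decay])

text \<open>The Riccati inequality minimizes over the filter gain. Keeping the gain \<open>l\<close> universally quantified makes all
  conditions linear in \<open>(\<sigma>, \<gamma>, \<kappa>)\<close>, so that they survive averaging over time.\<close>

definition feasible :: "real \<Rightarrow> ((nat \<Rightarrow> real) \<Rightarrow> (nat \<Rightarrow> real) \<Rightarrow> real) \<Rightarrow> ((nat \<Rightarrow> real) \<Rightarrow> real) \<Rightarrow> real \<Rightarrow> bool" where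
  "feasible P \<sigma> \<gamma> \<kappa> \<longleftrightarrow> semi_inner UNIV \<sigma> \<and> linear \<gamma> \<and>
     (\<forall>x t. 0 \<le> \<sigma> x x + 2 * t * \<gamma> x + t\<^sup>2 * \<kappa>) \<and>
     (\<forall>x l. \<sigma> x x \<le> \<sigma> (\<Phi> x) (\<Phi> x) + 2 * (G x - l) * \<gamma> (\<Phi> x) + (G x - l)\<^sup>2 * \<kappa> + l\<^sup>2) \<and>
     \<sigma> H H - 2 * \<gamma> H + \<kappa> \<le> P"

text \<open>The conditions are homogeneous except for \<open>l\<^sup>2\<close>, the contribution of
  the channel noise, and that term may be enlarged. This serves horizons whose average power still
  exceeds the budget.\<close>

lemma feasible_scale:
  assumes f: "feasible P \<sigma> \<gamma> \<kappa>" and a: "0 \<le> a" "a \<le> 1"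
  shows "feasible (a * P) (\<lambda>x y. a * \<sigma> x y) (\<lambda>x. a * \<gamma> x) (a * \<kappa>)"
  unfolding feasible_def
proof (intro conjI allI)
  have sg: "semi_inner UNIV \<sigma>" and lg: "linear \<gamma>" using f by (simp_all add: feasible_def)
  interpret semi_inner UNIV \<sigma> by (rule sg)
  show "semi_inner UNIV (\<lambda>x y. a * \<sigma> x y)"
    by unfold_locales (use a sym nonneg in \<open>simp_all add: bilinear ring_distribs\<close>)
  show "linear (\<lambda>x. a * \<gamma> x)"
    using linear_add[OF lg] linear_cmul[OF lg] by (intro linearI) (simp_all add: ring_distribs)
  fix x t l
  have "0 \<le> a * (\<sigma> x x + 2 * t * \<gamma> x + t\<^sup>2 * \<kappa>)"
    using f a by (intro mult_nonneg_nonneg) (auto simp: feasible_def)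
  then show "0 \<le> a * \<sigma> x x + 2 * t * (a * \<gamma> x) + t\<^sup>2 * (a * \<kappa>)" by (simp add: algebra_simps)
  have "a * \<sigma> x x \<le> a * (\<sigma> (\<Phi> x) (\<Phi> x) + 2 * (G x - l) * \<gamma> (\<Phi> x) + (G x - l)\<^sup>2 * \<kappa> + l\<^sup>2)"
    using f a by (intro mult_left_mono) (auto simp: feasible_def)
  moreover have "a * l\<^sup>2 \<le> 1 * l\<^sup>2" using a by (intro mult_right_mono) auto
  ultimately show "a * \<sigma> x x \<le> a * \<sigma> (\<Phi> x) (\<Phi> x) + 2 * (G x - l) * (a * \<gamma> (\<Phi> x)) + (G x - l)\<^sup>2 * (a * \<kappa>) + l\<^sup>2"
    by (simp add: algebra_simps)
  have "a * (\<sigma> H H - 2 * \<gamma> H + \<kappa>) \<le> a * P"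
    using f a by (intro mult_left_mono) (auto simp: feasible_def)
  then show "a * \<sigma> H H - 2 * (a * \<gamma> H) + a * \<kappa> \<le> a * P" by (simp add: algebra_simps)
qed

lemma feasible_mono: "feasible P \<sigma> \<gamma> \<kappa> \<Longrightarrow> P \<le> P' \<Longrightarrow> feasible P' \<sigma> \<gamma> \<kappa>"
  by (auto simp: feasible_def)

text \<open>The Riccati condition only bounds \<open>\<sigma>\<close> from above, so the state
  errors may be set to zero. The point shows that the optimal \<open>\<kappa>\<close> is at least
  \<open>P\<close>.\<close>

lemma feasible_white: "0 \<le> P \<Longrightarrow> feasible P (\<lambda>_ _. 0) (\<lambda>_. 0) P"
  by (auto simp: feasible_def semi_inner_def subspace_UNIV intro!: linearI)

text \<open>Controllability Gramian of the zero dynamics driven by the noiseless output, evaluated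
  on functionals of the state.\<close>

definition gramian :: "(nat \<Rightarrow> real) \<Rightarrow> (nat \<Rightarrow> real) \<Rightarrow> real" where
  "gramian x y = (\<Sum>j. G ((\<Phi> ^^ j) x) * G ((\<Phi> ^^ j) y))"

lemma summable_gramian: "summable (\<lambda>j. G ((\<Phi> ^^ j) x) * G ((\<Phi> ^^ j) y))"
proof -
  obtain c d where c0: "0 \<le> c" and c: "\<And>j. \<bar>G ((\<Phi> ^^ j) x)\<bar> \<le> c * \<theta> ^ j"
      and d: "\<And>j. \<bar>G ((\<Phi> ^^ j) y)\<bar> \<le> d * \<theta> ^ j"
    using G_decay by meson
  have "norm (G ((\<Phi> ^^ j) x) * G ((\<Phi> ^^ j) y)) \<le> c * d * (\<theta>\<^sup>2) ^ j" for j
  proof -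
    have "\<bar>G ((\<Phi> ^^ j) x)\<bar> * \<bar>G ((\<Phi> ^^ j) y)\<bar> \<le> (c * \<theta> ^ j) * (d * \<theta> ^ j)"
      using c d c0 \<theta> by (intro mult_mono) auto
    then show ?thesis by (simp add: abs_mult power2_eq_square power_mult_distrib mult_ac)
  qed
  moreover have "summable (\<lambda>j. c * d * (\<theta>\<^sup>2) ^ j)"
    using \<theta> power_strict_mono[of \<theta> 1 2] by (intro summable_mult summable_geometric) simp
  ultimately show ?thesis by (rule summable_comparison_test'[rotated])
qed

lemma semi_inner_gramian: "semi_inner UNIV gramian"
proof
  show "gramian (x + y) z = gramian x z + gramian y z" for x y z
    using summable_gramian[of x z] summable_gramian[of y z]
    by (simp add: gramian_def suminf_add linear_add[OF linear_\<Phi>_pow] linear_add[OF linear_G] distrib_right)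
  show "gramian (c *\<^sub>R x) y = c * gramian x y" for c x y
    using summable_gramian[of x y]
    by (simp add: gramian_def suminf_mult[symmetric] linear_cmul[OF linear_\<Phi>_pow] linear_cmul[OF linear_G] mult.assoc)
  show "gramian x y = gramian y x" for x y by (simp add: gramian_def mult.commute)
  show "0 \<le> gramian x x" for x
    unfolding gramian_def by (intro suminf_nonneg summable_gramian) simp
qed (simp add: subspace_UNIV)

lemma gramian_step: "gramian x x = gramian (\<Phi> x) (\<Phi> x) + (G x)\<^sup>2"
proof -
  have "gramian x x = (\<Sum>j. G ((\<Phi> ^^ Suc j) x) * G ((\<Phi> ^^ Suc j) x)) + G x * G x"
    unfolding gramian_def using suminf_split_head[OF summable_gramian[of x x]] by simp
  then show ?thesis unfolding gramian_def funpow_Suc_right by (simp add: power2_eq_square)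
qed

context
  fixes P \<sigma> \<gamma> \<kappa>
  assumes feas: "feasible P \<sigma> \<gamma> \<kappa>"
begin

interpretation sg: semi_inner UNIV \<sigma>
  using feas by (simp add: feasible_def)

lemma feasible_linear: "linear \<gamma>"
  using feas by (simp add: feasible_def)

lemma feasible_psd: "0 \<le> \<sigma> x x + 2 * t * \<gamma> x + t\<^sup>2 * \<kappa>"
  using feas by (simp add: feasible_def)

lemma feasible_riccati: "\<sigma> x x \<le> \<sigma> (\<Phi> x) (\<Phi> x) + 2 * (G x - l) * \<gamma> (\<Phi> x) + (G x - l)\<^sup>2 * \<kappa> + l\<^sup>2"
  using feas by (simp add: feasible_def)

lemma feasible_power: "\<sigma> H H - 2 * \<gamma> H + \<kappa> \<le> P"
  using feas by (simp add: feasible_def)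

lemma feasible_kappa_nonneg: "0 \<le> \<kappa>"
  using feasible_psd[of 0 1] feasible_linear by (simp add: linear_0 sg.bilinear)

text \<open>Discriminant of the positivity condition, read as a quadratic in \<open>t\<close>. In
  particular \<open>\<gamma>\<close> vanishes on the kernel of \<open>\<sigma>\<close>.\<close>

lemma feasible_cross: "(\<gamma> x)\<^sup>2 \<le> \<kappa> * \<sigma> x x"
proof (cases "\<kappa> = 0")
  case True
  have "\<gamma> x = 0"
  proof (rule ccontr)
    assume "\<gamma> x \<noteq> 0"
    then show False using feasible_psd[of x "- (\<sigma> x x + 1) / (2 * \<gamma> x)"] True by (simp add: field_simps)
  qed
  then show ?thesis using True by simp
next
  case False
  then have "\<kappa> > 0" using feasible_kappa_nonneg by simp
  then show ?thesis
    using feasible_psd[of x "- \<gamma> x / \<kappa>"] by (simp add: power2_eq_square field_simps)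
qed

lemma feasible_null: "\<sigma> x x = 0 \<Longrightarrow> \<gamma> x = 0"
  using feasible_cross[of x] by simp

text \<open>Entries beyond \<open>m\<close> are invisible to \<open>\<Phi>\<close> and
  \<open>G\<close>, and the Riccati inequality with gain 0 passes this on to
  \<open>\<sigma>\<close>. So \<open>\<sigma>\<close> is in effect a form on a space of dimension
  \<open>m\<close>.\<close>

lemma feasible_tail_null:
  assumes "\<And>i. i < m \<Longrightarrow> x i = 0"
  shows "\<sigma> x x = 0"
proof -
  have "\<Phi> x = \<Phi> 0" "G x = G 0"
    using assms by (auto intro!: \<Phi>_cong G_cong simp: zero_fun_def)
  then have "\<Phi> x = 0" "G x = 0" by (simp_all add: lin)
  then show ?thesis
    using feasible_riccati[of x 0] sg.nonneg[of x] feasible_linear by (simp add: linear_0 sg.bilinear)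
qed

lemma feasible_coordinates: "\<sigma> z z = (\<Sum>i<m. \<Sum>k<m. z i * z k * \<sigma> (unit_fun i) (unit_fun k))"
proof -
  let ?z = "\<Sum>i<m. z i *\<^sub>R unit_fun i"
  have z: "?z k = z k" if "k < m" for k
    using that by (simp add: unit_fun_def if_distrib sum.delta cong: if_cong)
  have "\<sigma> (z - ?z) (z - ?z) = 0"
    by (rule feasible_tail_null) (simp only: minus_apply z diff_self)
  then have n: "\<sigma> y (z - ?z) = 0" for y by (rule sg.null_right[OF UNIV_I UNIV_I])
  have "\<sigma> z z = \<sigma> z ?z" using n[of z] sg.diff_right[of z ?z z] by simp
  also have "\<dots> = \<sigma> ?z z" by (rule sg.sym)
  also have "\<dots> = \<sigma> ?z ?z" using n[of ?z] sg.diff_right[of z ?z ?z] by simp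
  also have "\<dots> = (\<Sum>i<m. \<Sum>k<m. z i * z k * \<sigma> (unit_fun i) (unit_fun k))"
    by (subst sg.sum_left) (simp_all add: sg.sum_right sg.bilinear sum_distrib_left mult_ac)
  finally show ?thesis .
qed

text \<open>The gain \<open>l = G x\<close> removes \<open>\<gamma>\<close> and
  \<open>\<kappa>\<close> from the Riccati inequality. Iterating compares \<open>\<sigma>\<close>
  with the Gramian, up to a remainder that vanishes by stability of \<open>\<Phi>\<close>.\<close>

lemma feasible_le_gramian: "\<sigma> x x \<le> gramian x x"
proof -
  interpret gr: semi_inner UNIV gramian by (rule semi_inner_gramian)
  have step: "\<sigma> x x \<le> \<sigma> (\<Phi> x) (\<Phi> x) + (G x)\<^sup>2" for x
    using feasible_riccati[of x "G x"] by simp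
  have "\<sigma> x x - gramian x x \<le> \<sigma> ((\<Phi> ^^ j) x) ((\<Phi> ^^ j) x)" for j
  proof (induction j)
    case (Suc j)
    have "\<sigma> x x - gramian x x \<le> \<sigma> ((\<Phi> ^^ j) x) ((\<Phi> ^^ j) x) - gramian ((\<Phi> ^^ j) x) ((\<Phi> ^^ j) x)" for j
    proof (induction j)
      case (Suc j)
      then show ?case using step[of "(\<Phi> ^^ j) x"] gramian_step[of "(\<Phi> ^^ j) x"] by simp
    qed simp
    from this[of "Suc j"] show ?case using gr.nonneg[of "(\<Phi> ^^ Suc j) x"] by simp
  qed (use gr.nonneg[of x] in simp)
  moreover have "(\<lambda>j. \<sigma> ((\<Phi> ^^ j) x) ((\<Phi> ^^ j) x)) \<longlonglongrightarrow> 0"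
  proof -
    obtain c where c0: "0 \<le> c" and c: "\<And>j i. i < m \<Longrightarrow> \<bar>(\<Phi> ^^ j) x i\<bar> \<le> c * \<theta> ^ j" using \<Phi>_decay by blast
    have "\<bar>\<sigma> ((\<Phi> ^^ j) x) ((\<Phi> ^^ j) x)\<bar> \<le> (\<Sum>i<m. \<Sum>k<m. c * c * \<bar>\<sigma> (unit_fun i) (unit_fun k)\<bar>) * \<theta> ^ j" for j
    proof -
      have th: "\<theta> ^ j * \<theta> ^ j \<le> \<theta> ^ j" using \<theta> by (intro mult_left_le) (auto intro: power_le_one)
      have b: "\<bar>(\<Phi> ^^ j) x i * (\<Phi> ^^ j) x k * \<sigma> (unit_fun i) (unit_fun k)\<bar> \<le> c * c * \<bar>\<sigma> (unit_fun i) (unit_fun k)\<bar> * \<theta> ^ j" if "i < m" "k < m" for i k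
      proof -
        have "\<bar>(\<Phi> ^^ j) x i * (\<Phi> ^^ j) x k\<bar> \<le> (c * \<theta> ^ j) * (c * \<theta> ^ j)"
          unfolding abs_mult using c[OF that(1)] c[OF that(2)] c0 \<theta> by (intro mult_mono) auto
        also have "\<dots> = c * c * (\<theta> ^ j * \<theta> ^ j)" by simp
        also have "\<dots> \<le> c * c * \<theta> ^ j" using th c0 by (intro mult_left_mono) auto
        finally have "\<bar>(\<Phi> ^^ j) x i * (\<Phi> ^^ j) x k\<bar> * \<bar>\<sigma> (unit_fun i) (unit_fun k)\<bar> \<le>
            c * c * \<theta> ^ j * \<bar>\<sigma> (unit_fun i) (unit_fun k)\<bar>"
          by (rule mult_right_mono) simp
        then show ?thesis by (simp add: abs_mult mult_ac)
      qed
      have "\<bar>\<sigma> ((\<Phi> ^^ j) x) ((\<Phi> ^^ j) x)\<bar> \<le> (\<Sum>i<m. \<Sum>k<m. c * c * \<bar>\<sigma> (unit_fun i) (unit_fun k)\<bar> * \<theta> ^ j)"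
        unfolding feasible_coordinates[of "(\<Phi> ^^ j) x"]
        by (intro order.trans[OF sum_abs] sum_mono order.trans[OF sum_abs] b) simp_all
      then show ?thesis by (simp add: sum_distrib_right)
    qed
    from geometric_null[OF this \<theta>] show ?thesis .
  qed
  ultimately have "\<sigma> x x - gramian x x \<le> 0"
    by (intro LIMSEQ_le_const[of _ 0]) auto
  then show ?thesis by simp
qed

text \<open>Positivity at \<open>t = - (1 / 2)\<close> bounds \<open>2 * \<gamma> H\<close> by
  \<open>2 * \<sigma> H H + \<kappa> / 2\<close>, so half of \<open>\<kappa>\<close> survives in the
  power constraint.\<close>

lemma feasible_kappa_le: "\<kappa> \<le> 2 * P + 2 * gramian H H"
  using feasible_psd[of H "- (1 / 2)"] feasible_power feasible_le_gramian[of H]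
  by (simp add: power2_eq_square)

lemma feasible_trunc:
  assumes "\<And>i. i < m \<Longrightarrow> x i = x' i"
  shows "\<sigma> x y = \<sigma> x' y" "\<gamma> x = \<gamma> x'"
proof -
  have "\<sigma> (x - x') (x - x') = 0" using assms by (intro feasible_tail_null) simp
  then have "\<sigma> y (x - x') = 0" "\<gamma> (x - x') = 0" by (auto intro: sg.null_right feasible_null)
  then show "\<sigma> x y = \<sigma> x' y" "\<gamma> x = \<gamma> x'"
    using sg.sym[of y] feasible_linear by (simp_all add: sg.bilinear linear_diff)
qed

end

end

section \<open>The optimal error covariance\<close>

text \<open>Gram-Schmidt on the unit functionals, dropping those of norm zero. The count
  \<open>r\<close> becomes the dimension of the encoder.\<close>

lemma orthonormal_system:
  fixes m :: nat
  assumes "semi_inner UNIV \<sigma>" and tail: "\<And>x. (\<And>i. i < m \<Longrightarrow> x i = 0) \<Longrightarrow> \<sigma> x x = (0::real)"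
  shows "\<exists>r\<le>m. \<exists>l. (\<forall>i<r. \<forall>j<r. \<sigma> (l i) (l j) = (if i = j then 1 else 0)) \<and>
    (\<forall>x y :: nat \<Rightarrow> real. \<sigma> x y = (\<Sum>i<r. \<sigma> x (l i) * \<sigma> y (l i)))"
proof -
  interpret semi_inner UNIV \<sigma> by fact
  interpret residual_family UNIV \<sigma> unit_fun by unfold_locales simp
  define e where "e s = R s (unit_fun s)" for s
  define v where "v s = \<sigma> (e s) (e s)" for s
  have v0: "0 \<le> v s" for s by (simp add: v_def nonneg)
  have e_span: "e s \<in> span (unit_fun ` {..<t})" if "s < t" for s t
  proof -
    have "span (unit_fun ` {..<s}) \<subseteq> span (unit_fun ` {..<t})" using that by (intro span_mono) auto
    then have "unit_fun s - e s \<in> span (unit_fun ` {..<t})"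
      using diff_residual_span[of "unit_fun s" s] unfolding e_def by (rule subsetD)
    moreover have "unit_fun s \<in> span (unit_fun ` {..<t})" using that by (intro span_base) auto
    ultimately have "unit_fun s - (unit_fun s - e s) \<in> span (unit_fun ` {..<t})" by (rule span_diff[rotated])
    then show ?thesis by simp
  qed
  have orth: "\<sigma> (e s) (e t) = 0" if "s \<noteq> t" for s t
  proof (cases "s < t")
    case True
    then show ?thesis
      using residual_orth_span[OF UNIV_I e_span[OF True], of "unit_fun t"] sym[of "e s"] by (simp add: e_def)
  next
    case False
    then have "t < s" using that by simp
    then show ?thesis
      using residual_orth_span[OF UNIV_I e_span, of t s "unit_fun s"] by (simp add: e_def)
  qed
  have expand: "\<sigma> x y = (\<Sum>s<m. \<sigma> x (e s) * \<sigma> y (e s) / v s)" for x y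
  proof -
    let ?x = "\<Sum>i<m. x i *\<^sub>R unit_fun i"
    have xk: "?x k = x k" if "k < m" for k
      using that by (simp add: unit_fun_def if_distrib sum.delta cong: if_cong)
    \<comment> \<open>\<open>x\<close> differs from its truncation to \<open>m\<close> entries by a
      null vector, so nothing is left after projecting onto the first \<open>m\<close> unit
      functionals.\<close>
    have "\<sigma> (x - ?x) (x - ?x) = 0" by (rule tail) (simp only: minus_apply xk diff_self)
    then have "\<sigma> (R m x) (R m x) \<le> 0"
      using residual_minimal[where X=x and t=m and Z="?x", OF UNIV_I sum_in_span_lessThan] by simp
    then have "\<sigma> (R m x) (R m x) = 0" using nonneg[of "R m x"] by simp
    then have "\<sigma> (R m y) (R m x) = 0" by (rule null_right[OF UNIV_I UNIV_I])
    then show ?thesis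
      using B_residual_expand[OF UNIV_I UNIV_I, of m x y] sym[of "R m y"] by (simp add: e_def v_def)
  qed
  define I where "I = {s. s < m \<and> v s \<noteq> 0}"
  define r where "r = card I"
  have I: "finite I" "I \<subseteq> {..<m}" by (auto simp: I_def)
  have rm: "r \<le> m" using card_mono[OF finite_lessThan I(2)] by (simp add: r_def)
  obtain h where h: "bij_betw h {..<r} I"
    using ex_bij_betw_nat_finite[OF I(1)] unfolding r_def atLeast0LessThan ..
  have hI: "h i \<in> I" if "i < r" for i
    by (rule bij_betwE[OF h, rule_format]) (simp add: that)
  have hinj: "h i = h j \<longleftrightarrow> i = j" if "i < r" "j < r" for i j
    using inj_on_eq_iff[OF bij_betw_imp_inj_on[OF h], of i j] that by simp
  define l where "l i = (1 / sqrt (v (h i))) *\<^sub>R e (h i)" for i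
  have vpos: "v (h i) > 0" if "i < r" for i using hI[OF that] v0[of "h i"] by (auto simp: I_def)
  have "\<sigma> (l i) (l j) = (if i = j then 1 else 0)" if "i < r" "j < r" for i j
  proof (cases "i = j")
    case True
    have "\<sigma> (l i) (l i) = v (h i) / (sqrt (v (h i)) * sqrt (v (h i)))"
      by (simp add: l_def bilinear v_def)
    then show ?thesis using True vpos[OF that(1)] by simp
  next
    case False
    then show ?thesis using orth[of "h i" "h j"] hinj[OF that] by (simp add: l_def bilinear)
  qed
  moreover have "\<sigma> x y = (\<Sum>i<r. \<sigma> x (l i) * \<sigma> y (l i))" for x y
  proof -
    have "\<sigma> x y = (\<Sum>s\<in>I. \<sigma> x (e s) * \<sigma> y (e s) / v s)"
      unfolding expand[of x y] by (rule sum.mono_neutral_right) (simp_all add: I_def subset_eq)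
    also have "\<dots> = (\<Sum>i<r. \<sigma> x (e (h i)) * \<sigma> y (e (h i)) / v (h i))"
      by (rule sum.reindex_bij_betw[OF h, symmetric])
    also have "\<dots> = (\<Sum>i<r. \<sigma> x (l i) * \<sigma> y (l i))"
    proof (rule sum.cong[OF refl])
      fix i assume "i \<in> {..<r}"
      then have "v (h i) = sqrt (v (h i)) * sqrt (v (h i))" using vpos[of i] by simp
      then show "\<sigma> x (e (h i)) * \<sigma> y (e (h i)) / v (h i) = \<sigma> x (l i) * \<sigma> y (l i)"
        by (simp add: l_def bilinear)
    qed
    finally show ?thesis .
  qed
  ultimately show ?thesis using rm by blast
qed

lemma (in semi_inner) sum_square_le:
  assumes "\<And>i. i \<in> I \<Longrightarrow> f i \<in> S"
  shows "B (\<Sum>i\<in>I. f i) (\<Sum>i\<in>I. f i) \<le> real (card I) * (\<Sum>i\<in>I. B (f i) (f i))"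
proof -
  have p: "2 * B x y \<le> B x x + B y y" if "x \<in> S" "y \<in> S" for x y
    using nonneg[of "x - y"] that sym[of y x] by (simp add: bilinear)
  have "B (\<Sum>i\<in>I. f i) (\<Sum>i\<in>I. f i) = (\<Sum>j\<in>I. \<Sum>i\<in>I. B (f i) (f j))"
    using assms by (simp add: sum_left sum_right)
  also have "\<dots> \<le> (\<Sum>j\<in>I. \<Sum>i\<in>I. (B (f i) (f i) + B (f j) (f j)) / 2)"
  proof (intro sum_mono)
    fix i j assume "i \<in> I" "j \<in> I"
    then show "B (f i) (f j) \<le> (B (f i) (f i) + B (f j) (f j)) / 2"
      using p[OF assms assms, of i j] by simp
  qed
  also have "\<dots> = real (card I) * (\<Sum>i\<in>I. B (f i) (f i))"
    by (simp add: add_divide_distrib sum.distrib sum_divide_distrib[symmetric] sum_distrib_left[symmetric])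
  finally show ?thesis .
qed

context dual_system
begin

text \<open>Secondary objective: a positive semidefinite increment without trace vanishes, which is
  how slack in the Riccati inequality gets excluded.\<close>

definition trace_form :: "((nat \<Rightarrow> real) \<Rightarrow> (nat \<Rightarrow> real) \<Rightarrow> real) \<Rightarrow> real" where
  "trace_form \<sigma> = (\<Sum>i<m. \<sigma> (unit_fun i) (unit_fun i))"

text \<open>A feasible triple is encoded by the symmetric matrix with blocks \<open>\<sigma>\<close>, \<open>\<gamma>\<close> and \<open>\<kappa>\<close>.\<close>

definition sig :: "(nat \<times> nat \<Rightarrow> real) \<Rightarrow> (nat \<Rightarrow> real) \<Rightarrow> (nat \<Rightarrow> real) \<Rightarrow> real" where
  "sig z x y = (\<Sum>i<m. \<Sum>j<m. x i * y j * z (i, j))"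

definition gam :: "(nat \<times> nat \<Rightarrow> real) \<Rightarrow> (nat \<Rightarrow> real) \<Rightarrow> real" where
  "gam z x = (\<Sum>i<m. x i * z (i, m))"

lemma semi_inner_sig:
  assumes "\<And>i j. z (i, j) = z (j, i)" "\<And>x. 0 \<le> sig z x x"
  shows "semi_inner UNIV (sig z)"
proof
  show "sig z (x + y) w = sig z x w + sig z y w" for x y w
    by (simp add: sig_def ring_distribs sum.distrib)
  show "sig z (c *\<^sub>R x) y = c * sig z x y" for c x y
    by (simp add: sig_def sum_distrib_left mult_ac)
  show "sig z x y = sig z y x" for x y
    unfolding sig_def by (subst sum.swap, intro sum.cong refl) (subst assms(1), simp)
qed (use assms(2) in \<open>simp_all add: subspace_UNIV\<close>)

lemma linear_gam: "linear (gam z)"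
  by (rule linearI) (simp_all add: gam_def ring_distribs sum.distrib sum_distrib_left mult_ac)

lemma continuous_sig [continuous_intros]: "continuous_on UNIV (\<lambda>z. sig z x y)"
  and continuous_gam [continuous_intros]: "continuous_on UNIV (\<lambda>z. gam z x)"
  unfolding sig_def gam_def by (intro continuous_intros continuous_on_product_coordinates)+

text \<open>Lexicographic maximization over a compact set, first of \<open>\<kappa>\<close>, then of
  the trace. In the product topology each single condition is closed because it reads finitely many
  entries, although there are infinitely many conditions.\<close>

lemma exists_optimum:
  assumes P: "0 \<le> P"
  shows "\<exists>\<sigma> \<gamma> \<kappa>. feasible P \<sigma> \<gamma> \<kappa> \<and> (\<forall>\<sigma>' \<gamma>' \<kappa>'. feasible P \<sigma>' \<gamma>' \<kappa>' \<longrightarrow> \<kappa>' \<le> \<kappa>) \<and>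
    (\<forall>\<sigma>' \<gamma>'. feasible P \<sigma>' \<gamma>' \<kappa> \<longrightarrow> trace_form \<sigma>' \<le> trace_form \<sigma>)"
proof -
  interpret gr: semi_inner UNIV gramian by (rule semi_inner_gramian)
  \<comment> \<open>\<open>b\<close> bounds the diagonal of \<open>\<sigma>\<close> and
    \<open>k\<close> bounds \<open>\<kappa>\<close>; by Cauchy-Schwarz and
    \<open>feasible_cross\<close> their sum bounds every entry.\<close>
  define b where "b = (\<Sum>i<m. gramian (unit_fun i) (unit_fun i))"
  define k where "k = 2 * P + 2 * gramian H H"
  define c where "c = b + k"
  have bk: "0 \<le> b" "0 \<le> k"
    unfolding b_def k_def using P by (auto intro!: sum_nonneg gr.nonneg add_nonneg_nonneg)
  define K where "K = {z. (\<forall>p. z p \<in> {- c..c}) \<and> (\<forall>i j. z (i, j) = z (j, i)) \<and>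
     (\<forall>x t. 0 \<le> sig z x x + 2 * t * gam z x + t\<^sup>2 * z (m, m)) \<and>
     (\<forall>x l. sig z x x \<le> sig z (\<Phi> x) (\<Phi> x) + 2 * (G x - l) * gam z (\<Phi> x) + (G x - l)\<^sup>2 * z (m, m) + l\<^sup>2) \<and>
     sig z H H - 2 * gam z H + z (m, m) \<le> P}"
  have "compact (PiE UNIV (\<lambda>_ :: nat \<times> nat. {- c..c}))"
  proof -
    have "compactin (product_topology (\<lambda>_ :: nat \<times> nat. euclidean) UNIV) (PiE UNIV (\<lambda>_. {- c..c}))"
      unfolding compactin_PiE by (simp add: compactin_euclidean_iff)
    then show ?thesis unfolding euclidean_product_topology compactin_euclidean_iff .
  qed
  moreover have "PiE UNIV (\<lambda>_ :: nat \<times> nat. {- c..c}) = {z. \<forall>p. z p \<in> {- c..c}}" by auto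
  ultimately have box: "compact {z :: nat \<times> nat \<Rightarrow> real. \<forall>p. z p \<in> {- c..c}}" by simp
  have cl: "closed {z. (\<forall>i j. z (i, j) = z (j, i)) \<and>
     (\<forall>x t. 0 \<le> sig z x x + 2 * t * gam z x + t\<^sup>2 * z (m, m)) \<and>
     (\<forall>x l. sig z x x \<le> sig z (\<Phi> x) (\<Phi> x) + 2 * (G x - l) * gam z (\<Phi> x) + (G x - l)\<^sup>2 * z (m, m) + l\<^sup>2) \<and>
     sig z H H - 2 * gam z H + z (m, m) \<le> P}"
    by (intro closed_Collect_conj closed_Collect_all closed_Collect_eq closed_Collect_le continuous_intros
        continuous_on_product_coordinates)
  have K: "compact K"
    using compact_Int_closed[OF box cl] unfolding K_def by (simp add: Collect_conj_eq Int_assoc)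
  have decode: "feasible P (sig z) (gam z) (z (m, m))" if "z \<in> K" for z
  proof -
    have "0 \<le> sig z x x" for x
    proof -
      have "\<forall>x t. 0 \<le> sig z x x + 2 * t * gam z x + t\<^sup>2 * z (m, m)"
        using that unfolding K_def by blast
      from this[THEN spec, THEN spec, of x 0] show ?thesis by simp
    qed
    then show ?thesis
      using that unfolding K_def feasible_def by (auto intro!: semi_inner_sig linear_gam)
  qed
  have encode: "\<exists>z\<in>K. z (m, m) = \<kappa> \<and> (\<Sum>i<m. z (i, i)) = trace_form \<sigma>" if f: "feasible P \<sigma> \<gamma> \<kappa>" for \<sigma> \<gamma> \<kappa>
  proof -
    interpret sg: semi_inner UNIV \<sigma> using f by (simp add: feasible_def)
    \<comment> \<open>Entries outside the block of size \<open>m + 1\<close> are 0, which keeps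
      \<open>z\<close> in the box and does not affect the decoded triple.\<close>
    define z where "z p = (let i = fst p; j = snd p in if i < m \<and> j < m then \<sigma> (unit_fun i) (unit_fun j)
      else if i < m \<and> j = m then \<gamma> (unit_fun i) else if i = m \<and> j < m then \<gamma> (unit_fun j)
      else if i = m \<and> j = m then \<kappa> else 0)" for p
    have sig: "sig z x x = \<sigma> x x" for x
      unfolding feasible_coordinates[OF f, of x] sig_def by (intro sum.cong refl) (simp add: z_def)
    have gam: "gam z x = \<gamma> x" for x
    proof -
      have "\<gamma> x = \<gamma> (\<Sum>i<m. x i *\<^sub>R unit_fun i)"
        by (rule feasible_trunc(2)[OF f]) (simp add: unit_fun_def if_distrib sum.delta cong: if_cong)
      also have "\<dots> = gam z x"
        using feasible_linear[OF f] by (simp add: linear_sum linear_cmul gam_def z_def)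
      finally show ?thesis ..
    qed
    have diag: "\<sigma> (unit_fun i) (unit_fun i) \<le> b" if "i < m" for i
    proof -
      have "gramian (unit_fun i) (unit_fun i) \<le> b"
        unfolding b_def using that by (intro member_le_sum) (auto intro: gr.nonneg)
      then show ?thesis using feasible_le_gramian[OF f, of "unit_fun i"] by simp
    qed
    have kk: "0 \<le> \<kappa>" "\<kappa> \<le> k"
      using feasible_kappa_nonneg[OF f] feasible_kappa_le[OF f] by (simp_all add: k_def)
    have s: "\<bar>\<sigma> (unit_fun i) (unit_fun j)\<bar> \<le> c" if "i < m" "j < m" for i j
    proof -
      have "(\<sigma> (unit_fun i) (unit_fun j))\<^sup>2 \<le> \<sigma> (unit_fun i) (unit_fun i) * \<sigma> (unit_fun j) (unit_fun j)"
        by (rule sg.Cauchy_Schwarz) simp_all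
      also have "\<dots> \<le> b * b" using diag that bk by (intro mult_mono) (auto intro: sg.nonneg)
      finally have "\<bar>\<sigma> (unit_fun i) (unit_fun j)\<bar> \<le> b"
        using bk by (simp add: power2_eq_square[symmetric] abs_le_square_iff[symmetric])
      then show ?thesis using bk by (simp add: c_def)
    qed
    have g: "\<bar>\<gamma> (unit_fun i)\<bar> \<le> c" if "i < m" for i
    proof -
      have "(\<gamma> (unit_fun i))\<^sup>2 \<le> \<kappa> * \<sigma> (unit_fun i) (unit_fun i)"
        by (rule feasible_cross[OF f])
      also have "\<dots> \<le> k * b" using diag that bk kk by (intro mult_mono) (auto intro: sg.nonneg)
      also have "\<dots> \<le> c\<^sup>2" using bk by (simp add: c_def power2_eq_square algebra_simps)
      finally show ?thesis using bk by (simp add: abs_le_square_iff[symmetric] c_def)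
    qed
    have "\<bar>z p\<bar> \<le> c" for p
      using s g kk bk by (simp add: z_def Let_def c_def)
    then have "z p \<in> {- c..c}" for p by (simp add: abs_le_iff minus_le_iff)
    moreover have "z (i, j) = z (j, i)" for i j
      by (cases "i < m"; cases "j < m"; cases "i = m"; cases "j = m")
         (simp_all add: z_def Let_def sg.sym[of "unit_fun i" "unit_fun j"])
    moreover have zm: "z (m, m) = \<kappa>" by (simp add: z_def)
    ultimately have "z \<in> K"
      unfolding K_def mem_Collect_eq sig gam zm
      using feasible_psd[OF f] feasible_riccati[OF f] feasible_power[OF f] by blast
    moreover have "(\<Sum>i<m. z (i, i)) = trace_form \<sigma>" by (simp add: z_def trace_form_def)
    ultimately show ?thesis using zm by blast
  qed
  have ne: "K \<noteq> {}" using encode[OF feasible_white[OF P]] by blast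
  have "continuous_on K (\<lambda>z. z (m, m))"
    by (rule continuous_on_subset[OF continuous_on_product_coordinates]) simp
  from continuous_attains_sup[OF K ne this] obtain z1 where z1: "z1 \<in> K" "\<And>z. z \<in> K \<Longrightarrow> z (m, m) \<le> z1 (m, m)"
    by blast
  define K2 where "K2 = K \<inter> {z. z (m, m) = z1 (m, m)}"
  have "compact K2"
    unfolding K2_def by (intro compact_Int_closed K closed_Collect_eq continuous_intros continuous_on_product_coordinates)
  moreover have "K2 \<noteq> {}" using z1(1) by (auto simp: K2_def)
  moreover have "continuous_on K2 (\<lambda>z. \<Sum>i<m. z (i, i))"
  proof -
    have "continuous_on UNIV (\<lambda>z :: nat \<times> nat \<Rightarrow> real. \<Sum>i<m. z (i, i))"
      by (intro continuous_on_sum continuous_on_product_coordinates)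
    then show ?thesis by (rule continuous_on_subset) simp
  qed
  ultimately have "\<exists>z2\<in>K2. \<forall>z\<in>K2. (\<Sum>i<m. z (i, i)) \<le> (\<Sum>i<m. z2 (i, i))"
    by (rule continuous_attains_sup)
  then obtain z2 where z2: "z2 \<in> K2" "\<And>z. z \<in> K2 \<Longrightarrow> (\<Sum>i<m. z (i, i)) \<le> (\<Sum>i<m. z2 (i, i))"
    by blast
  have z2K: "z2 \<in> K" and z2m: "z2 (m, m) = z1 (m, m)" using z2(1) by (auto simp: K2_def)
  have tr: "trace_form (sig z2) = (\<Sum>i<m. z2 (i, i))"
  proof -
    have "sig z2 (unit_fun i) (unit_fun i) = z2 (i, i)" if "i < m" for i
    proof -
      have "sig z2 (unit_fun i) (unit_fun i) = (\<Sum>a<m. \<Sum>b<m. if b = i then if a = i then z2 (a, b) else 0 else 0)"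
        unfolding sig_def by (intro sum.cong refl) (simp add: unit_fun_def)
      then show ?thesis using that by (simp add: sum.delta)
    qed
    then show ?thesis by (simp add: trace_form_def)
  qed
  show ?thesis
  proof (intro exI[of _ "sig z2"] exI[of _ "gam z2"] exI[of _ "z2 (m, m)"] conjI allI impI)
    show "feasible P (sig z2) (gam z2) (z2 (m, m))" by (rule decode[OF z2K])
    show "\<kappa>' \<le> z2 (m, m)" if f: "feasible P \<sigma>' \<gamma>' \<kappa>'" for \<sigma>' \<gamma>' \<kappa>'
      using encode[OF f] z1(2) z2m by auto
    show "trace_form \<sigma>' \<le> trace_form (sig z2)" if f: "feasible P \<sigma>' \<gamma>' (z2 (m, m))" for \<sigma>' \<gamma>'
    proof -
      obtain z where "z \<in> K" "z (m, m) = z2 (m, m)" "(\<Sum>i<m. z (i, i)) = trace_form \<sigma>'"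
        using encode[OF f] by blast
      then show ?thesis using z2(2)[of z] z2m tr by (simp add: K2_def)
    qed
  qed
qed

text \<open>Completes the square in the gain \<open>l\<close>. The minimizer is
  \<open>(a + c * \<kappa>) / (\<kappa> + 1)\<close>, and the terms free of \<open>l\<close> are the
  Riccati map.\<close>

lemma riccati_min:
  fixes a b c :: real
  assumes "0 \<le> \<kappa>"
  shows "b + 2 * (c - l) * a + (c - l)\<^sup>2 * \<kappa> + l\<^sup>2 =
    b + c\<^sup>2 - (c - a)\<^sup>2 / (\<kappa> + 1) + (\<kappa> + 1) * (l - (a + c * \<kappa>) / (\<kappa> + 1))\<^sup>2"
proof -
  have "(\<kappa> + 1) * (b + 2 * (c - l) * a + (c - l)\<^sup>2 * \<kappa> + l\<^sup>2) =
      (\<kappa> + 1) * (b + c\<^sup>2) - (c - a)\<^sup>2 + ((\<kappa> + 1) * l - (a + c * \<kappa>))\<^sup>2"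
    by (simp add: power2_eq_square algebra_simps)
  also have "\<dots> = (\<kappa> + 1) * (b + c\<^sup>2 - (c - a)\<^sup>2 / (\<kappa> + 1) + (\<kappa> + 1) * (l - (a + c * \<kappa>) / (\<kappa> + 1))\<^sup>2)"
    using assms by (simp add: power2_eq_square divide_simps) (simp add: algebra_simps)
  finally show ?thesis using assms by simp
qed

text \<open>At an optimum the Riccati inequality is an equality: the slack \<open>\<delta>\<close> could be added to the error
  covariance at fixed input, which keeps the power and does not decrease the rate.\<close>

lemma optimum_riccati_eq:
  assumes f: "feasible P \<sigma> \<gamma> \<kappa>"
    and opt: "\<And>\<sigma>' \<gamma>' \<kappa>'. feasible P \<sigma>' \<gamma>' \<kappa>' \<Longrightarrow> \<kappa>' \<le> \<kappa>"
    and tr: "\<And>\<sigma>' \<gamma>'. feasible P \<sigma>' \<gamma>' \<kappa> \<Longrightarrow> trace_form \<sigma>' \<le> trace_form \<sigma>"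
  shows "\<sigma> x x = \<sigma> (\<Phi> x) (\<Phi> x) + (G x)\<^sup>2 - (G x - \<gamma> (\<Phi> x))\<^sup>2 / (\<kappa> + 1)"
proof -
  interpret sg: semi_inner UNIV \<sigma> using f by (simp add: feasible_def)
  have k0: "0 \<le> \<kappa>" by (rule feasible_kappa_nonneg[OF f])
  have lg: "linear \<gamma>" by (rule feasible_linear[OF f])
  note lins = lin linear_add[OF lg] linear_cmul[OF lg] linear_diff[OF lg] linear_0[OF lg]
  \<comment> \<open>Polarized slack of the Riccati inequality at the best gain.\<close>
  define \<delta> where "\<delta> x y = \<sigma> (\<Phi> x) (\<Phi> y) + G x * G y - (G x - \<gamma> (\<Phi> x)) * (G y - \<gamma> (\<Phi> y)) / (\<kappa> + 1) - \<sigma> x y" for x y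
  have dd: "\<sigma> x x + \<delta> x x = \<sigma> (\<Phi> x) (\<Phi> x) + (G x)\<^sup>2 - (G x - \<gamma> (\<Phi> x))\<^sup>2 / (\<kappa> + 1)" for x
    by (simp add: \<delta>_def power2_eq_square)
  have d0: "0 \<le> \<delta> x x" for x
  proof -
    define l where "l = (\<gamma> (\<Phi> x) + G x * \<kappa>) / (\<kappa> + 1)"
    have "\<sigma> x x \<le> \<sigma> x x + \<delta> x x"
      using feasible_riccati[OF f, of x l] unfolding riccati_min[OF k0] dd by (simp add: l_def)
    then show ?thesis by simp
  qed
  interpret dl: semi_inner UNIV \<delta>
  proof
    show "\<delta> (x + y) z = \<delta> x z + \<delta> y z" for x y z
      unfolding \<delta>_def lins by (simp add: sg.bilinear add_divide_distrib diff_divide_distrib ring_distribs)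
    show "\<delta> (c *\<^sub>R x) y = c * \<delta> x y" for c x y
      unfolding \<delta>_def lins by (simp add: sg.bilinear diff_divide_distrib ring_distribs)
    show "\<delta> x y = \<delta> y x" for x y
      unfolding \<delta>_def by (simp add: sg.sym[of x y] sg.sym[of "\<Phi> x"] mult.commute)
  qed (use d0 in \<open>simp_all add: subspace_UNIV\<close>)
  have sum_dl: "\<delta> x x + 2 * t * \<delta> x H + t\<^sup>2 * \<delta> H H = \<delta> (x + t *\<^sub>R H) (x + t *\<^sub>R H)" for x t
    by (simp add: dl.bilinear dl.sym[of H x] power2_eq_square algebra_simps)
  \<comment> \<open>An additional state error of covariance \<open>\<delta>\<close> with the input
    kept: the noiseless output contains the state through \<open>H\<close>, so
    \<open>\<gamma>\<close> and \<open>\<kappa>\<close> move along with \<open>\<sigma>\<close>, and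
    the increments cancel in the power.\<close>
  have f': "feasible P (\<lambda>x y. \<sigma> x y + \<delta> x y) (\<lambda>x. \<gamma> x + \<delta> x H) (\<kappa> + \<delta> H H)"
    unfolding feasible_def
  proof (intro conjI allI)
    show "semi_inner UNIV (\<lambda>x y. \<sigma> x y + \<delta> x y)"
    proof
      show "\<sigma> (x + y) z + \<delta> (x + y) z = \<sigma> x z + \<delta> x z + (\<sigma> y z + \<delta> y z)" for x y z
        by (simp add: sg.bilinear dl.bilinear)
      show "\<sigma> (c *\<^sub>R x) y + \<delta> (c *\<^sub>R x) y = c * (\<sigma> x y + \<delta> x y)" for c x y
        by (simp add: sg.bilinear dl.bilinear ring_distribs)
      show "\<sigma> x y + \<delta> x y = \<sigma> y x + \<delta> y x" for x y
        by (simp add: sg.sym[of x y] dl.sym[of x y])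
      show "0 \<le> \<sigma> x x + \<delta> x x" for x using sg.nonneg[of x] d0[of x] by simp
    qed (simp add: subspace_UNIV)
    show "linear (\<lambda>x. \<gamma> x + \<delta> x H)"
      by (rule linearI) (simp_all add: lins dl.bilinear ring_distribs)
    fix x t l
    show "0 \<le> \<sigma> x x + \<delta> x x + 2 * t * (\<gamma> x + \<delta> x H) + t\<^sup>2 * (\<kappa> + \<delta> H H)"
      using feasible_psd[OF f, of x t] sum_dl[of x t] d0[of "x + t *\<^sub>R H"] by (simp add: algebra_simps)
    let ?t = "G x - l"
    have "\<sigma> x x + \<delta> x x \<le> \<sigma> (\<Phi> x) (\<Phi> x) + 2 * ?t * \<gamma> (\<Phi> x) + ?t\<^sup>2 * \<kappa> + l\<^sup>2"
      unfolding dd riccati_min[OF k0] using k0 by simp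
    also have "\<dots> \<le> \<sigma> (\<Phi> x) (\<Phi> x) + 2 * ?t * \<gamma> (\<Phi> x) + ?t\<^sup>2 * \<kappa> + l\<^sup>2 +
        (\<delta> (\<Phi> x) (\<Phi> x) + 2 * ?t * \<delta> (\<Phi> x) H + ?t\<^sup>2 * \<delta> H H)"
      unfolding sum_dl using d0 by simp
    also have "\<dots> = \<sigma> (\<Phi> x) (\<Phi> x) + \<delta> (\<Phi> x) (\<Phi> x) + 2 * ?t * (\<gamma> (\<Phi> x) + \<delta> (\<Phi> x) H) + ?t\<^sup>2 * (\<kappa> + \<delta> H H) + l\<^sup>2"
      by (simp add: distrib_left)
    finally show "\<sigma> x x + \<delta> x x \<le> \<sigma> (\<Phi> x) (\<Phi> x) + \<delta> (\<Phi> x) (\<Phi> x) + 2 * ?t * (\<gamma> (\<Phi> x) + \<delta> (\<Phi> x) H) + ?t\<^sup>2 * (\<kappa> + \<delta> H H) + l\<^sup>2" .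
    show "\<sigma> H H + \<delta> H H - 2 * (\<gamma> H + \<delta> H H) + (\<kappa> + \<delta> H H) \<le> P"
      using feasible_power[OF f] by simp
  qed
  \<comment> \<open>The first objective forces \<open>\<delta> H H = 0\<close>, so the enlarged
    triple has the same \<open>\<kappa>\<close> and competes for the trace.\<close>
  from opt[OF f'] d0[of H] have dH: "\<delta> H H = 0" by simp
  with f' have "feasible P (\<lambda>x y. \<sigma> x y + \<delta> x y) (\<lambda>x. \<gamma> x + \<delta> x H) \<kappa>" by simp
  from tr[OF this] have "(\<Sum>i<m. \<delta> (unit_fun i) (unit_fun i)) \<le> 0"
    by (simp add: trace_form_def sum.distrib)
  then have du: "\<delta> (unit_fun i) (unit_fun i) = 0" if "i < m" for i
    using that sum_nonneg_eq_0_iff[of "{..<m}" "\<lambda>i. \<delta> (unit_fun i) (unit_fun i)"] d0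
      sum_nonneg[of "{..<m}" "\<lambda>i. \<delta> (unit_fun i) (unit_fun i)"] by auto
  have dnull: "\<delta> y (unit_fun i) = 0" if "i < m" for i y
    by (rule dl.null_right[OF UNIV_I UNIV_I du[OF that]])
  let ?x = "\<Sum>i<m. x i *\<^sub>R unit_fun i"
  have x: "?x k = x k" if "k < m" for k
    using that by (simp add: unit_fun_def if_distrib sum.delta cong: if_cong)
  have "\<delta> ?x ?x = 0"
    by (subst dl.sum_right) (simp_all add: dl.bilinear dnull)
  moreover have "\<delta> x x = \<delta> ?x ?x"
  proof -
    have "\<Phi> x = \<Phi> ?x" "G x = G ?x" by (auto intro!: \<Phi>_cong G_cong simp only: x)
    moreover have "\<sigma> x x = \<sigma> ?x ?x"
      using feasible_trunc(1)[where x="?x" and x'=x and y=x, OF f x] feasible_trunc(1)[where x="?x" and x'=x and y="?x", OF f x]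
      by (simp only: sg.sym[of x ?x])
    ultimately show ?thesis unfolding \<delta>_def by simp
  qed
  ultimately have "\<delta> x x = 0" by simp
  then show ?thesis using dd[of x] by simp
qed

end

context dual_system
begin

text \<open>At an optimum the input carries no fresh randomness. Otherwise the positive definite part of the
  error covariance could be lowered along the Gramian of the zero dynamics, and the power saved in
  this way could be spent on increasing the rate.\<close>

lemma optimum_no_fresh_noise:
  fixes r :: nat
  assumes f: "feasible P \<sigma> \<gamma> \<kappa>"
    and opt: "\<And>\<sigma>' \<gamma>' \<kappa>'. feasible P \<sigma>' \<gamma>' \<kappa>' \<Longrightarrow> \<kappa>' \<le> \<kappa>"
    and eq: "\<And>x. \<sigma> x x = \<sigma> (\<Phi> x) (\<Phi> x) + (G x)\<^sup>2 - (G x - \<gamma> (\<Phi> x))\<^sup>2 / (\<kappa> + 1)"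
    and orth: "\<And>i j. i < r \<Longrightarrow> j < r \<Longrightarrow> \<sigma> (l i) (l j) = (if i = j then 1 else 0)"
    and parseval: "\<And>x y. \<sigma> x y = (\<Sum>i<r. \<sigma> x (l i) * \<sigma> y (l i))"
    and nontrivial: "G ((\<Phi> ^^ j0) H) \<noteq> 0"
  shows "(\<Sum>i<r. (\<gamma> (l i))\<^sup>2) = \<kappa>"
    and "\<gamma> x = (\<Sum>i<r. \<sigma> x (l i) * \<gamma> (l i))"
proof -
  interpret sg: semi_inner UNIV \<sigma> using f by (simp add: feasible_def)
  interpret gr: semi_inner UNIV gramian by (rule semi_inner_gramian)
  have lg: "linear \<gamma>" by (rule feasible_linear[OF f])
  \<comment> \<open>\<open>K\<close> is the part of \<open>\<kappa>\<close> explained by the state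
    errors; \<open>\<kappa> - K\<close> is the variance of the fresh randomness.\<close>
  define K where "K = (\<Sum>i<r. (\<gamma> (l i))\<^sup>2)"
  let ?p = "\<lambda>x. \<Sum>i<r. \<sigma> x (l i) *\<^sub>R l i"
  have pl: "\<sigma> (?p x) (l j) = \<sigma> x (l j)" if "j < r" for x j
  proof -
    have "\<sigma> (?p x) (l j) = (\<Sum>i<r. \<sigma> x (l i) * (if i = j then 1 else 0))"
      using that orth by (simp add: sg.sum_left sg.bilinear)
    then show ?thesis using that by (simp add: if_distrib sum.delta cong: if_cong)
  qed
  have null: "\<sigma> (x - ?p x) (x - ?p x) = 0" for x
    unfolding parseval[of "x - ?p x" "x - ?p x"] by (simp add: sg.bilinear pl)
  show \<gamma>: "\<gamma> x = (\<Sum>i<r. \<sigma> x (l i) * \<gamma> (l i))" for x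
  proof -
    have "\<gamma> (x - ?p x) = 0" by (rule feasible_null[OF f null])
    moreover have "\<gamma> (x - ?p x) = \<gamma> x - \<gamma> (?p x)" by (rule linear_diff[OF lg])
    moreover have "\<gamma> (?p x) = (\<Sum>i<r. \<sigma> x (l i) * \<gamma> (l i))"
      by (simp add: linear_sum[OF lg] linear_cmul[OF lg])
    ultimately show ?thesis by simp
  qed
  have K_le: "K \<le> \<kappa>"
  proof -
    \<comment> \<open>\<open>?z\<close> represents \<open>\<gamma>\<close> with respect to
      \<open>\<sigma>\<close>; positivity at \<open>t = -1\<close> compares its norm with
      \<open>\<kappa>\<close>.\<close>
    let ?z = "\<Sum>i<r. \<gamma> (l i) *\<^sub>R l i"
    have zl: "\<sigma> ?z (l j) = \<gamma> (l j)" if "j < r" for j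
    proof -
      have "\<sigma> ?z (l j) = (\<Sum>i<r. \<gamma> (l i) * (if i = j then 1 else 0))"
        using that orth by (simp add: sg.sum_left sg.bilinear)
      then show ?thesis using that by (simp add: if_distrib sum.delta cong: if_cong)
    qed
    have "\<sigma> ?z ?z = K" unfolding parseval[of ?z ?z] by (simp add: zl K_def power2_eq_square)
    moreover have "\<gamma> ?z = K" unfolding \<gamma>[of ?z] by (simp add: zl K_def power2_eq_square)
    ultimately show ?thesis using feasible_psd[OF f, of ?z "-1"] by simp
  qed
  have K0: "0 \<le> K" by (simp add: K_def sum_nonneg)
  have \<gamma>K: "(\<gamma> x)\<^sup>2 \<le> K * \<sigma> x x" for x
  proof -
    have "(\<gamma> x)\<^sup>2 \<le> (\<Sum>i<r. (\<sigma> x (l i))\<^sup>2) * (\<Sum>i<r. (\<gamma> (l i))\<^sup>2)"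
      unfolding \<gamma>[of x] by (rule Cauchy_Schwarz_ineq_sum)
    then show ?thesis unfolding parseval[of x x] K_def by (simp add: power2_eq_square mult.commute)
  qed
  show "K = \<kappa>"
  proof (rule ccontr)
    assume "K \<noteq> \<kappa>"
    with K_le have less: "K < \<kappa>" by simp
    with K0 have k0: "0 < \<kappa>" by simp
    \<comment> \<open>On the kernel of \<open>\<sigma>\<close> the Riccati equality leaves
      \<open>(q + a\<^sup>2) * (\<kappa> - K) \<le> 0\<close>. So the kernel is invariant under
      \<open>\<Phi>\<close> and killed by \<open>G\<close>, and the Gramian vanishes on it, which
      lets a multiple of \<open>\<sigma>\<close> dominate the Gramian.\<close>
    have null_step: "G x = 0 \<and> \<sigma> (\<Phi> x) (\<Phi> x) = 0" if "\<sigma> x x = 0" for x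
    proof -
      define q a g where "q = \<sigma> (\<Phi> x) (\<Phi> x)" and "a = G x" and "g = \<gamma> (\<Phi> x)"
      have q0: "0 \<le> q" by (simp add: q_def sg.nonneg)
      have gq: "g\<^sup>2 \<le> K * q" unfolding g_def q_def by (rule \<gamma>K)
      have "(a - g)\<^sup>2 \<le> (1 + K) * (a\<^sup>2 + q)"
      proof (cases "K = 0")
        case True
        then show ?thesis using gq q0 by simp
      next
        case False
        then have Kp: "0 < K" using K0 by simp
        have "0 \<le> (K * a + g)\<^sup>2" by simp
        then have "0 \<le> K * (K * a\<^sup>2) + 2 * (K * (a * g)) + g\<^sup>2"
          by (simp add: power2_eq_square algebra_simps)
        also have "\<dots> \<le> K * (K * a\<^sup>2) + 2 * (K * (a * g)) + K * q" using gq by simp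
        also have "\<dots> = K * (K * a\<^sup>2 + 2 * (a * g) + q)" by (simp add: algebra_simps)
        finally have "0 \<le> K * a\<^sup>2 + 2 * (a * g) + q" using Kp by (simp add: zero_le_mult_iff)
        then show ?thesis using gq by (simp add: power2_eq_square algebra_simps)
      qed
      moreover have "0 = (q + a\<^sup>2) * (\<kappa> + 1) - (a - g)\<^sup>2"
        using eq[of x] that k0 by (simp add: q_def a_def g_def field_simps)
      ultimately have "(q + a\<^sup>2) * (\<kappa> - K) \<le> 0" by (simp add: algebra_simps)
      then have "q + a\<^sup>2 \<le> 0" using less by (simp add: mult_le_0_iff)
      then have "a\<^sup>2 = 0" "q = 0" using q0 zero_le_power2[of a] by linarith+
      then show ?thesis unfolding q_def a_def by simp
    qed
    have gr_null: "gramian x x = 0" if "\<sigma> x x = 0" for x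
    proof -
      have "\<sigma> ((\<Phi> ^^ j) x) ((\<Phi> ^^ j) x) = 0" for j
        by (induction j) (use that null_step in auto)
      then have "G ((\<Phi> ^^ j) x) = 0" for j using null_step by blast
      then show ?thesis by (simp add: gramian_def)
    qed
    define C where "C = real r * (\<Sum>i<r. gramian (l i) (l i))"
    have C0: "0 \<le> C" unfolding C_def by (intro mult_nonneg_nonneg sum_nonneg gr.nonneg) auto
    have dom: "gramian x x \<le> C * \<sigma> x x" for x
    proof -
      have n: "gramian y (x - ?p x) = 0" for y
        by (rule gr.null_right[OF UNIV_I UNIV_I gr_null[OF null]])
      have "gramian x x = gramian (?p x) x"
        using n[of x] gr.diff_right[of x "?p x" x] gr.sym[of x "?p x"] by simp
      also have "\<dots> = gramian (?p x) (?p x)"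
        using n[of "?p x"] gr.diff_right[of x "?p x" "?p x"] by simp
      also have "\<dots> \<le> real (card {..<r}) * (\<Sum>i<r. gramian (\<sigma> x (l i) *\<^sub>R l i) (\<sigma> x (l i) *\<^sub>R l i))"
        by (rule gr.sum_square_le) simp
      also have "\<dots> \<le> real r * (\<Sum>i<r. gramian (l i) (l i) * \<sigma> x x)"
      proof -
        have "gramian (\<sigma> x (l i) *\<^sub>R l i) (\<sigma> x (l i) *\<^sub>R l i) \<le> gramian (l i) (l i) * \<sigma> x x" if "i < r" for i
        proof -
          have "(\<sigma> x (l i))\<^sup>2 \<le> (\<Sum>i<r. (\<sigma> x (l i))\<^sup>2)"
            using that by (intro member_le_sum) auto
          then have "(\<sigma> x (l i))\<^sup>2 * gramian (l i) (l i) \<le> \<sigma> x x * gramian (l i) (l i)"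
            unfolding parseval[of x x] by (intro mult_right_mono gr.nonneg) (simp_all add: power2_eq_square)
          then show ?thesis by (simp add: gr.bilinear power2_eq_square mult_ac)
        qed
        then show ?thesis by (intro mult_mono sum_mono) (auto intro!: sum_nonneg gr.nonneg)
      qed
      finally show ?thesis by (simp add: C_def sum_distrib_left[symmetric] mult_ac)
    qed
    \<comment> \<open>Small enough that \<open>K \<le> p * \<kappa>\<close> survives when
      \<open>\<sigma>\<close> is lowered to \<open>p * \<sigma>\<close>. The summand 1 keeps the
      denominator positive when \<open>C\<close> is 0.\<close>
    define \<epsilon> where "\<epsilon> = (\<kappa> - K) / (\<kappa> * (C + 1))"
    have e0: "0 < \<epsilon>" unfolding \<epsilon>_def using less k0 C0 by simp
    define p where "p = 1 - \<epsilon> * C"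
    have pK: "K \<le> p * \<kappa>"
    proof -
      have "\<epsilon> * C * \<kappa> = (\<kappa> - K) * (C / (C + 1))" using k0 C0 by (simp add: \<epsilon>_def)
      also have "\<dots> \<le> (\<kappa> - K) * 1" using less C0 by (intro mult_left_mono) auto
      finally show ?thesis by (simp add: p_def algebra_simps)
    qed
    have p0: "0 \<le> p"
      using pK K0 k0 by (metis order.trans zero_le_mult_iff not_less)
    have low: "p * \<sigma> x x \<le> \<sigma> x x - \<epsilon> * gramian x x" for x
      using mult_left_mono[OF dom[of x], of \<epsilon>] e0 by (simp add: p_def algebra_simps)
    \<comment> \<open>By its Lyapunov equation the Gramian can be subtracted from
      \<open>\<sigma>\<close> without violating the Riccati inequality. The power released at
      \<open>H\<close> is spent on \<open>\<kappa>\<close>.\<close>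
    have "feasible P (\<lambda>x y. \<sigma> x y - \<epsilon> * gramian x y) \<gamma> (\<kappa> + \<epsilon> * gramian H H)"
      unfolding feasible_def
    proof (intro conjI allI lg)
      show "semi_inner UNIV (\<lambda>x y. \<sigma> x y - \<epsilon> * gramian x y)"
      proof
        show "\<sigma> (x + y) z - \<epsilon> * gramian (x + y) z = \<sigma> x z - \<epsilon> * gramian x z + (\<sigma> y z - \<epsilon> * gramian y z)" for x y z
          by (simp add: sg.bilinear gr.bilinear ring_distribs)
        show "\<sigma> (c *\<^sub>R x) y - \<epsilon> * gramian (c *\<^sub>R x) y = c * (\<sigma> x y - \<epsilon> * gramian x y)" for c x y
          by (simp add: sg.bilinear gr.bilinear ring_distribs)
        show "\<sigma> x y - \<epsilon> * gramian x y = \<sigma> y x - \<epsilon> * gramian y x" for x y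
          by (simp add: sg.sym[of x y] gr.sym[of x y])
        show "0 \<le> \<sigma> x x - \<epsilon> * gramian x x" for x
          using low[of x] mult_nonneg_nonneg[OF p0 sg.nonneg[OF UNIV_I, of x]] by simp
      qed (simp add: subspace_UNIV)
      fix x t lv
      show "0 \<le> \<sigma> x x - \<epsilon> * gramian x x + 2 * t * \<gamma> x + t\<^sup>2 * (\<kappa> + \<epsilon> * gramian H H)"
      proof -
        have "0 \<le> (\<gamma> x + t * \<kappa>)\<^sup>2" by simp
        also have "\<dots> = (\<gamma> x)\<^sup>2 + \<kappa> * (2 * t * \<gamma> x + t\<^sup>2 * \<kappa>)" by (simp add: power2_eq_square algebra_simps)
        also have "(\<gamma> x)\<^sup>2 \<le> (p * \<kappa>) * \<sigma> x x"
          using \<gamma>K[of x] mult_right_mono[OF pK sg.nonneg[OF UNIV_I, of x]] by simp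
        finally have "0 \<le> \<kappa> * (p * \<sigma> x x + 2 * t * \<gamma> x + t\<^sup>2 * \<kappa>)" by (simp add: algebra_simps)
        then have "0 \<le> p * \<sigma> x x + 2 * t * \<gamma> x + t\<^sup>2 * \<kappa>" using k0 by (simp add: zero_le_mult_iff)
        moreover have "0 \<le> t\<^sup>2 * (\<epsilon> * gramian H H)" using e0 gr.nonneg[of H] by simp
        ultimately show ?thesis using low[of x] by (simp add: distrib_left)
      qed
      have "0 \<le> (G x - lv)\<^sup>2 * (\<epsilon> * gramian H H)" using e0 gr.nonneg[of H] by simp
      moreover have "\<epsilon> * gramian x x = \<epsilon> * gramian (\<Phi> x) (\<Phi> x) + \<epsilon> * (G x)\<^sup>2"
        unfolding gramian_step[of x] by (simp add: distrib_left)
      moreover have "0 \<le> \<epsilon> * (G x)\<^sup>2" using e0 by simp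
      ultimately show "\<sigma> x x - \<epsilon> * gramian x x \<le> \<sigma> (\<Phi> x) (\<Phi> x) - \<epsilon> * gramian (\<Phi> x) (\<Phi> x) +
          2 * (G x - lv) * \<gamma> (\<Phi> x) + (G x - lv)\<^sup>2 * (\<kappa> + \<epsilon> * gramian H H) + lv\<^sup>2"
        using feasible_riccati[OF f, of x lv] by (simp add: distrib_left)
      show "\<sigma> H H - \<epsilon> * gramian H H - 2 * \<gamma> H + (\<kappa> + \<epsilon> * gramian H H) \<le> P"
        using feasible_power[OF f] by simp
    qed
    from opt[OF this] have "gramian H H \<le> 0" using e0 by (simp add: mult_le_0_iff)
    moreover have "0 < gramian H H"
      unfolding gramian_def using nontrivial
      by (intro suminf_pos2[where i=j0] summable_gramian) (auto simp: zero_less_mult_iff linorder_neq_iff)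
    ultimately show False by simp
  qed
qed

end

section \<open>Powers of stable matrices\<close>

lemma smult_mat_pow:
  fixes A :: "'a::comm_ring_1 Matrix.mat"
  assumes A: "A \<in> carrier_mat n n"
  shows "(c \<cdot>\<^sub>m A) ^\<^sub>m k = c ^ k \<cdot>\<^sub>m (A ^\<^sub>m k)"
proof (induction k)
  case 0
  show ?case using A by (intro eq_matI) auto
next
  case (Suc k)
  have p: "A ^\<^sub>m k \<in> carrier_mat n n" using A by (rule pow_carrier_mat)
  have "(c \<cdot>\<^sub>m A) ^\<^sub>m Suc k = c ^ k \<cdot>\<^sub>m (A ^\<^sub>m k * (c \<cdot>\<^sub>m A))"
    unfolding pow_mat.simps Suc by (rule mult_smult_assoc_mat[OF p smult_carrier_mat[OF A]])
  also have "\<dots> = c ^ k \<cdot>\<^sub>m (c \<cdot>\<^sub>m (A ^\<^sub>m k * A))"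
    using A p by (simp add: mult_smult_distrib[of _ n n])
  also have "\<dots> = c ^ Suc k \<cdot>\<^sub>m (A ^\<^sub>m Suc k)" by (intro eq_matI) auto
  finally show ?case .
qed

lemma eigenvalue_cmat_iff:
  assumes "F \<in> carrier_mat m m"
  shows "eigenvalue (cmat F) z \<longleftrightarrow>
    (\<exists>f. (\<exists>i<m. f i \<noteq> 0) \<and> (\<forall>i<m. (\<Sum>j<m. complex_of_real (F $$ (i, j)) * f j) = z * f i))" (is "?l = ?r")
proof
  assume ?l
  then obtain v where v: "v \<in> carrier_vec m" "v \<noteq> 0\<^sub>v m" "cmat F *\<^sub>v v = z \<cdot>\<^sub>v v"
    using assms unfolding eigenvalue_def eigenvector_def by auto
  show ?r
  proof (intro exI[of _ "\<lambda>i. v $ i"] conjI allI impI)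
    show "\<exists>i<m. v $ i \<noteq> 0"
    proof (rule ccontr)
      assume "\<not> (\<exists>i<m. v $ i \<noteq> 0)"
      then have "v = 0\<^sub>v m" using v(1) by (intro eq_vecI) auto
      then show False using v(2) by simp
    qed
    fix i assume i: "i < m"
    have "(cmat F *\<^sub>v v) $ i = z * v $ i" using v i by simp
    then show "(\<Sum>j<m. complex_of_real (F $$ (i, j)) * v $ j) = z * v $ i"
      using v(1) i assms by (simp add: scalar_prod_def atLeast0LessThan)
  qed
next
  assume ?r
  then obtain f where f: "\<exists>i<m. f i \<noteq> 0" "\<And>i. i < m \<Longrightarrow> (\<Sum>j<m. complex_of_real (F $$ (i, j)) * f j) = z * f i" by blast
  have "eigenvector (cmat F) (Matrix.vec m f) z"
    unfolding eigenvector_def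
  proof (intro conjI)
    obtain i where "i < m" "f i \<noteq> 0" using f by blast
    then show "Matrix.vec m f \<noteq> 0\<^sub>v (dim_row (cmat F))" using assms by (metis carrier_matD(1) index_map_mat(2) index_vec index_zero_vec(1))
    show "cmat F *\<^sub>v Matrix.vec m f = z \<cdot>\<^sub>v Matrix.vec m f"
      using assms f(2) by (intro eq_vecI) (simp_all add: scalar_prod_def atLeast0LessThan)
  qed (use assms in simp)
  then show ?l unfolding eigenvalue_def by blast
qed

lemma eigenvalue_cmat_transpose:
  assumes "F \<in> carrier_mat m m"
  shows "eigenvalue (cmat (transpose_mat F)) z \<longleftrightarrow> eigenvalue (cmat F) z"
proof -
  have "cmat (transpose_mat F) = transpose_mat (cmat F)" using assms by (intro eq_matI) auto
  then show ?thesis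
    using assms eigenvalue_root_char_poly[of "cmat F" m] eigenvalue_root_char_poly[of "transpose_mat (cmat F)" m]
    by (simp add: char_poly_transpose_mat[of "cmat F" m])
qed

text \<open>Division by a number \<open>\<theta>\<close> between the spectral radius and 1 gives a
  matrix of spectral radius below 1, whose powers are bounded.\<close>

lemma stable_mat_power_decay:
  assumes F: "F \<in> carrier_mat m m" and st: "stable_mat F"
  shows "\<exists>\<theta> c. 0 < \<theta> \<and> \<theta> < 1 \<and> 0 \<le> c \<and> (\<forall>k i j. i < m \<longrightarrow> j < m \<longrightarrow> \<bar>(F ^\<^sub>m k) $$ (i, j)\<bar> \<le> c * \<theta> ^ k)"
proof (cases "m = 0")
  \<comment> \<open>In dimension 0 the spectrum is empty and has no maximum.\<close>
  case True
  then show ?thesis by (intro exI[of _ "1/2"] exI[of _ 0]) simp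
next
  case False
  then have m: "m > 0" by simp
  have cF: "cmat F \<in> carrier_mat m m" using F by simp
  define s where "s = spectral_radius (cmat F)"
  obtain e0 where e0: "e0 \<in> spectrum (cmat F)" "s = cmod e0"
    using spectral_radius_mem_max(1)[OF cF m] unfolding s_def by (elim imageE)
  have s: "0 \<le> s" "s < 1" using e0 st by (simp_all add: stable_mat_def spectrum_def)
  define \<theta> where "\<theta> = (s + 1) / 2"
  have th: "0 < \<theta>" "\<theta> < 1" "s < \<theta>" using s by (simp_all add: \<theta>_def)
  define B where "B = complex_of_real (1 / \<theta>) \<cdot>\<^sub>m cmat F"
  have B: "B \<in> carrier_mat m m" using F by (simp add: B_def)
  have "spectral_radius B < 1"
  proof -
    obtain e where e: "e \<in> spectrum B" "spectral_radius B = cmod e"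
      using spectral_radius_mem_max(1)[OF B m] by (elim imageE)
    obtain v where v: "v \<in> carrier_vec m" "v \<noteq> 0\<^sub>v m" "B *\<^sub>v v = e \<cdot>\<^sub>v v"
      using e(1) B unfolding spectrum_def eigenvalue_def eigenvector_def by auto
    have "cmat F *\<^sub>v v = (complex_of_real \<theta> * e) \<cdot>\<^sub>v v"
    proof (rule eq_vecI)
      fix i assume "i < dim_vec ((complex_of_real \<theta> * e) \<cdot>\<^sub>v v)"
      then have i: "i < m" using v(1) by simp
      have "(B *\<^sub>v v) $ i = e * v $ i" using v i by simp
      then have "complex_of_real (1 / \<theta>) * (cmat F *\<^sub>v v) $ i = e * v $ i"
        using v(1) i F by (simp add: B_def scalar_prod_def sum_distrib_left mult.assoc)
      then show "(cmat F *\<^sub>v v) $ i = ((complex_of_real \<theta> * e) \<cdot>\<^sub>v v) $ i"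
        using v(1) i th by (simp add: field_simps)
    qed (use v(1) F in simp)
    then have "complex_of_real \<theta> * e \<in> spectrum (cmat F)"
      using v F unfolding spectrum_def eigenvalue_def eigenvector_def by auto
    then have "cmod (complex_of_real \<theta> * e) \<le> s"
      unfolding s_def by (intro spectral_radius_mem_max(2)[OF cF m]) (rule imageI)
    then have "\<theta> * cmod e \<le> s" using th by (simp add: norm_mult)
    then have "\<theta> * cmod e < \<theta> * 1" using th(3) by (simp del: mult_less_cancel_left_pos mult_less_cancel_left)
    then show ?thesis using th e(2) by (simp only: mult_less_cancel_left_pos)
  qed
  then obtain c where c: "\<And>k. norm_bound (B ^\<^sub>m k) c"
    using spectral_radius_jnf_norm_bound_less_1_upper_triangular[OF B] by blast
  have bound: "\<bar>(F ^\<^sub>m k) $$ (i, j)\<bar> \<le> c * \<theta> ^ k" if "i < m" "j < m" for k i j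
  proof -
    have pc: "F ^\<^sub>m k \<in> carrier_mat m m" using F by (rule pow_carrier_mat)
    have Bk: "B ^\<^sub>m k = complex_of_real (1 / \<theta>) ^ k \<cdot>\<^sub>m cmat (F ^\<^sub>m k)"
      unfolding B_def smult_mat_pow[OF cF] of_real_hom.mat_hom_pow[OF F] ..
    have "norm ((B ^\<^sub>m k) $$ (i, j)) \<le> c"
      using c[of k] B that unfolding norm_bound_def by (simp add: pow_mat_dim_square[OF B])
    also have "(B ^\<^sub>m k) $$ (i, j) = complex_of_real ((1 / \<theta>) ^ k * (F ^\<^sub>m k) $$ (i, j))"
      unfolding Bk using that carrier_matD[OF pc] by simp
    finally have "(1 / \<theta>) ^ k * \<bar>(F ^\<^sub>m k) $$ (i, j)\<bar> \<le> c"
      using th unfolding norm_of_real by (simp add: abs_mult)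
    then show ?thesis using th by (simp add: power_divide field_simps)
  qed
  have "0 \<le> c" using bound[OF m m, of 0] by simp
  then show ?thesis using th bound by blast
qed

lemma dual_map_pow:
  assumes F: "F \<in> carrier_mat m m" and j: "j < m"
  shows "(dual_map F ^^ k) x j = (\<Sum>i<m. x i * (F ^\<^sub>m k) $$ (i, j))"
  using j
proof (induction k arbitrary: j)
  case 0
  have "(\<Sum>i<m. x i * (F ^\<^sub>m 0) $$ (i, j)) = (\<Sum>i<m. if i = j then x i else 0)"
    using F 0 by (intro sum.cong refl) auto
  then show ?case using 0 by (simp add: sum.delta)
next
  case (Suc k)
  have pc: "F ^\<^sub>m k \<in> carrier_mat m m" using F by (rule pow_carrier_mat)
  have "(dual_map F ^^ Suc k) x j = (\<Sum>l<m. (\<Sum>i<m. x i * (F ^\<^sub>m k) $$ (i, l)) * F $$ (l, j))"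
  proof -
    have "(dual_map F ^^ Suc k) x j = (\<Sum>l<m. (dual_map F ^^ k) x l * F $$ (l, j))"
      using Suc(2) F by (simp add: dual_map_def)
    then show ?thesis by (simp add: Suc(1))
  qed
  also have "\<dots> = (\<Sum>l<m. \<Sum>i<m. x i * ((F ^\<^sub>m k) $$ (i, l) * F $$ (l, j)))"
    by (simp add: sum_distrib_right mult.assoc)
  also have "\<dots> = (\<Sum>i<m. \<Sum>l<m. x i * ((F ^\<^sub>m k) $$ (i, l) * F $$ (l, j)))" by (rule sum.swap)
  also have "\<dots> = (\<Sum>i<m. x i * (F ^\<^sub>m Suc k) $$ (i, j))"
    using F pc Suc(2) by (intro sum.cong refl) (simp add: scalar_prod_def sum_distrib_left atLeast0LessThan)
  finally show ?case .
qed

lemma scalar_prod_pow_dual: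
  assumes A: "A \<in> carrier_mat d d" and C: "C \<in> carrier_vec d" and x: "x \<in> carrier_vec d"
  shows "scalar_prod C ((A ^\<^sub>m k) *\<^sub>v x) = (\<Sum>j<d. (dual_map A ^^ k) (vec_fun C) j * x $ j)"
proof -
  have pc: "A ^\<^sub>m k \<in> carrier_mat d d" using A by (rule pow_carrier_mat)
  have "(\<Sum>j<d. (dual_map A ^^ k) (vec_fun C) j * x $ j) = (\<Sum>j<d. \<Sum>i<d. C $ i * ((A ^\<^sub>m k) $$ (i, j) * x $ j))"
    using C by (intro sum.cong refl) (simp add: dual_map_pow[OF A] vec_fun_def sum_distrib_right mult.assoc)
  also have "\<dots> = (\<Sum>i<d. \<Sum>j<d. C $ i * ((A ^\<^sub>m k) $$ (i, j) * x $ j))" by (rule sum.swap)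
  also have "\<dots> = scalar_prod C ((A ^\<^sub>m k) *\<^sub>v x)"
    using x carrier_matD[OF pc] by (simp add: scalar_prod_def sum_distrib_left atLeast0LessThan)
  finally show ?thesis ..
qed

lemma observable_iff:
  assumes A: "A \<in> carrier_mat d d" and C: "C \<in> carrier_vec d"
  shows "observable d A C \<longleftrightarrow>
    (\<forall>x. (\<forall>k. (\<Sum>j<d. (dual_map A ^^ k) (vec_fun C) j * x j) = 0) \<longrightarrow> (\<forall>j<d. x j = 0))"
proof
  assume o: "observable d A C"
  show "\<forall>x. (\<forall>k. (\<Sum>j<d. (dual_map A ^^ k) (vec_fun C) j * x j) = 0) \<longrightarrow> (\<forall>j<d. x j = 0)"
  proof (intro allI impI)
    fix x j assume 0: "\<forall>k. (\<Sum>j<d. (dual_map A ^^ k) (vec_fun C) j * x j) = 0" and j: "j < d"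
    have "Matrix.vec d x = 0\<^sub>v d"
      using o 0 unfolding observable_def by (simp add: scalar_prod_pow_dual[OF A C])
    then have "Matrix.vec d x $ j = 0\<^sub>v d $ j" by simp
    then show "x j = 0" using j by simp
  qed
next
  assume o: "\<forall>x. (\<forall>k. (\<Sum>j<d. (dual_map A ^^ k) (vec_fun C) j * x j) = 0) \<longrightarrow> (\<forall>j<d. x j = 0)"
  show "observable d A C"
    unfolding observable_def
  proof (intro ballI impI)
    fix x assume x: "x \<in> carrier_vec d" "\<forall>k. scalar_prod C ((A ^\<^sub>m k) *\<^sub>v x) = 0"
    from x(2)[unfolded scalar_prod_pow_dual[OF A C x(1)]]
    have "\<forall>j<d. x $ j = 0" by (rule o[THEN spec, THEN mp, of "\<lambda>j. x $ j"])
    then show "x = 0\<^sub>v d" using x(1) by (intro eq_vecI) auto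
  qed
qed

lemma dual_map_decay:
  assumes F: "F \<in> carrier_mat m m" and st: "stable_mat F"
  shows "\<exists>\<theta>. 0 < \<theta> \<and> \<theta> < 1 \<and> (\<forall>x. \<exists>c\<ge>0. \<forall>j. \<forall>i<m. \<bar>(dual_map F ^^ j) x i\<bar> \<le> c * \<theta> ^ j)"
proof -
  obtain \<theta> c where th: "0 < \<theta>" "\<theta> < 1" "0 \<le> c"
    and c: "\<And>k i j. i < m \<Longrightarrow> j < m \<Longrightarrow> \<bar>(F ^\<^sub>m k) $$ (i, j)\<bar> \<le> c * \<theta> ^ k"
    using stable_mat_power_decay[OF assms] by blast
  have "\<bar>(dual_map F ^^ j) x i\<bar> \<le> ((\<Sum>l<m. \<bar>x l\<bar>) * c) * \<theta> ^ j" if "i < m" for x j i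
  proof -
    have "\<bar>(dual_map F ^^ j) x i\<bar> \<le> (\<Sum>l<m. \<bar>x l * (F ^\<^sub>m j) $$ (l, i)\<bar>)"
      unfolding dual_map_pow[OF F that] by (rule sum_abs)
    also have "\<dots> \<le> (\<Sum>l<m. \<bar>x l\<bar> * (c * \<theta> ^ j))"
      unfolding abs_mult using c[OF _ that] by (intro sum_mono mult_left_mono) auto
    finally show ?thesis by (simp add: sum_distrib_right mult.assoc)
  qed
  moreover have "0 \<le> (\<Sum>l<m. \<bar>x l\<bar>) * c" for x :: "nat \<Rightarrow> real"
    using th by (intro mult_nonneg_nonneg sum_nonneg) auto
  ultimately show ?thesis using th by meson
qed

definition dual_mat :: "nat \<Rightarrow> ((nat \<Rightarrow> real) \<Rightarrow> nat \<Rightarrow> real) \<Rightarrow> rmat" where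
  "dual_mat r a = Matrix.mat r r (\<lambda>(i, j). a (unit_fun i) j)"

lemma dual_mat_carrier [simp]: "dual_mat r a \<in> carrier_mat r r"
  by (simp add: dual_mat_def)

lemma dual_map_dual_mat:
  assumes lin: "linear a" and cong: "\<And>x x'. (\<And>i. i < r \<Longrightarrow> x i = x' i) \<Longrightarrow> a x = a x'"
    and supp: "\<And>x j. r \<le> j \<Longrightarrow> a x j = 0"
  shows "dual_map (dual_mat r a) = a"
proof
  fix x
  have "(\<Sum>i<r. x i *\<^sub>R unit_fun i) k = x k" if "k < r" for k
    using that by (simp add: unit_fun_def if_distrib sum.delta cong: if_cong)
  then have "a x = a (\<Sum>i<r. x i *\<^sub>R unit_fun i)" by (intro cong) simp
  also have "\<dots> = (\<Sum>i<r. x i *\<^sub>R a (unit_fun i))"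
    by (simp only: linear_sum[OF lin] linear_cmul[OF lin])
  finally have e: "a x j = (\<Sum>i<r. x i * a (unit_fun i) j)" for j by simp
  show "dual_map (dual_mat r a) x = a x"
    by (rule ext) (simp add: dual_map_def dual_mat_def e[symmetric] supp not_less)
qed

section \<open>The encoder of an optimum\<close>

text \<open>The data of an optimum. \<open>f\<close> is the transposed state matrix of the channel;
  \<open>norm_k\<close> together with \<open>\<gamma>_expand\<close> says that the error of the
  noiseless output is a function of the state error alone.\<close>

locale optimal_system = dual_system m \<Phi> G H \<theta>
  for m \<Phi> G H \<theta> +
  fixes f :: "(nat \<Rightarrow> real) \<Rightarrow> nat \<Rightarrow> real" and P \<kappa> :: real and \<sigma> \<gamma> and r :: nat and l :: "nat \<Rightarrow> nat \<Rightarrow> real"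
  assumes feas: "feasible P \<sigma> \<gamma> \<kappa>"
    and riccati: "\<And>x. \<sigma> x x = \<sigma> (\<Phi> x) (\<Phi> x) + (G x)\<^sup>2 - (G x - \<gamma> (\<Phi> x))\<^sup>2 / (\<kappa> + 1)"
    and orth: "\<And>i j. i < r \<Longrightarrow> j < r \<Longrightarrow> \<sigma> (l i) (l j) = (if i = j then 1 else 0)"
    and parseval: "\<And>x y. \<sigma> x y = (\<Sum>i<r. \<sigma> x (l i) * \<sigma> y (l i))"
    and norm_k: "(\<Sum>i<r. (\<gamma> (l i))\<^sup>2) = \<kappa>"
    and \<gamma>_expand: "\<And>x. \<gamma> x = (\<Sum>i<r. \<sigma> x (l i) * \<gamma> (l i))"
    and f_eq: "\<And>x. f x = \<Phi> x + G x *\<^sub>R H"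
    and f_decay: "\<And>x. \<exists>c\<ge>0. \<forall>j. \<forall>i<m. \<bar>(f ^^ j) x i\<bar> \<le> c * \<theta> ^ j"
begin

sublocale sg: semi_inner UNIV \<sigma>
  using feas by (simp add: feasible_def)

lemma linear_\<gamma>: "linear \<gamma>"
  by (rule feasible_linear[OF feas])

lemma kappa_nonneg: "0 \<le> \<kappa>"
  by (rule feasible_kappa_nonneg[OF feas])

definition dot :: "(nat \<Rightarrow> real) \<Rightarrow> (nat \<Rightarrow> real) \<Rightarrow> real" where
  "dot x y = (\<Sum>i<r. x i * y i)"

sublocale dt: semi_inner UNIV dot
proof
  show "dot (x + y) z = dot x z + dot y z" for x y z by (simp add: dot_def distrib_right sum.distrib)
  show "dot (c *\<^sub>R x) y = c * dot x y" for c x y by (simp add: dot_def sum_distrib_left mult.assoc)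
  show "dot x y = dot y x" for x y by (simp add: dot_def mult.commute)
  show "0 \<le> dot x x" for x by (simp add: dot_def sum_nonneg)
qed (simp add: subspace_UNIV)

lemma dot_cong: "(\<And>i. i < r \<Longrightarrow> x i = x' i) \<Longrightarrow> dot x y = dot x' y"
  by (simp add: dot_def)

lemma dot_eq_0: "dot x x = 0 \<Longrightarrow> i < r \<Longrightarrow> x i = 0"
  using sum_nonneg_eq_0_iff[of "{..<r}" "\<lambda>i. x i * x i"] by (simp add: dot_def)

text \<open>\<open>E\<close> maps a functional of the channel state to its coordinates in an orthonormal system of \<open>\<sigma>\<close>. The map \<open>a\<close>
  below is the transposed encoder matrix and \<open>b\<close> is the inverse of the encoder matrix; \<open>C\<close> is
  the encoder output.\<close>

definition E :: "(nat \<Rightarrow> real) \<Rightarrow> nat \<Rightarrow> real" where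
  "E x = (\<lambda>i. if i < r then \<sigma> x (l i) else 0)"

definition k :: "nat \<Rightarrow> real" where
  "k = (\<lambda>i. if i < r then \<gamma> (l i) else 0)"

definition emb :: "(nat \<Rightarrow> real) \<Rightarrow> nat \<Rightarrow> real" where
  "emb z = (\<Sum>j<r. z j *\<^sub>R l j)"

text \<open>The channel input is the noiseless output minus the state seen through \<open>H\<close>;
  this is that difference in error coordinates.\<close>

definition C :: "nat \<Rightarrow> real" where
  "C = k - E H"

lemma linear_E: "linear E"
  by (rule linearI) (auto simp: E_def fun_eq_iff sg.bilinear)

lemma linear_emb: "linear emb"
  by (rule linearI) (simp_all add: emb_def scaleR_left_distrib sum.distrib scaleR_sum_right)

lemma dot_E: "dot (E x) (E y) = \<sigma> x y"
  unfolding parseval[of x y] by (simp add: dot_def E_def)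

lemma dot_k_E: "dot k (E x) = \<gamma> x"
  unfolding \<gamma>_expand[of x] by (simp add: dot_def E_def k_def mult.commute)

lemma dot_k_k: "dot k k = \<kappa>"
  using norm_k by (simp add: dot_def k_def power2_eq_square)

lemma E_emb: "i < r \<Longrightarrow> E (emb z) i = z i"
proof -
  assume i: "i < r"
  have "\<sigma> (emb z) (l i) = (\<Sum>j<r. z j * (if j = i then 1 else 0))"
    unfolding emb_def using i by (simp add: sg.sum_left sg.bilinear orth)
  also have "\<dots> = (\<Sum>j<r. if j = i then z j else 0)" by (intro sum.cong refl) simp
  also have "\<dots> = z i" using i by (simp add: sum.delta)
  finally show ?thesis using i by (simp add: E_def)
qed

lemma E_supp: "r \<le> i \<Longrightarrow> E x i = 0" and k_supp: "r \<le> i \<Longrightarrow> k i = 0" and C_supp: "r \<le> i \<Longrightarrow> C i = 0"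
  by (simp_all add: E_def k_def C_def)

lemma dot_E_emb: "dot (E (emb z)) y = dot z y"
  by (rule dot_cong) (rule E_emb)

lemma E_emb_supp: "(\<And>i. r \<le> i \<Longrightarrow> z i = 0) \<Longrightarrow> E (emb z) = z"
  by (rule ext) (metis E_emb E_supp not_le)

lemma E_cong:
  assumes "\<And>i. i < m \<Longrightarrow> x i = x' i"
  shows "E x = E x'"
proof -
  have "\<sigma> x y = \<sigma> x' y" for y by (rule feasible_trunc(1)[OF feas assms])
  then show ?thesis by (intro ext) (simp only: E_def)
qed

text \<open>Coordinates of the error of the next state before the current output is used: the old
  error through the zero dynamics plus the output error through \<open>G\<close>.\<close>

definition T :: "(nat \<Rightarrow> real) \<Rightarrow> nat \<Rightarrow> real" where
  "T x = E (\<Phi> x) + G x *\<^sub>R k"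

lemma linear_T: "linear T"
  by (rule linearI)
     (simp_all add: T_def lin linear_add[OF linear_E] linear_cmul[OF linear_E] scaleR_left_distrib scaleR_right_distrib)

lemma T_supp: "r \<le> i \<Longrightarrow> T x i = 0"
  by (simp add: T_def E_supp k_supp)

text \<open>The Riccati equality in coordinates. The subtracted term is the measurement update,
  since \<open>dot k (T x)\<close> is the covariance with an innovation of variance
  \<open>\<kappa> + 1\<close>.\<close>

lemma T_norm: "dot (T x) (T x) - (dot k (T x))\<^sup>2 / (\<kappa> + 1) = \<sigma> x x"
proof -
  define q g c where "q = \<sigma> (\<Phi> x) (\<Phi> x)" and "g = \<gamma> (\<Phi> x)" and "c = G x"
  have n: "dot (T x) (T x) = q + 2 * c * g + c\<^sup>2 * \<kappa>"
    unfolding T_def using dt.sym[of "E (\<Phi> x)" k]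
    by (simp add: dt.bilinear dot_E dot_k_E dot_k_k q_def g_def c_def power2_eq_square algebra_simps)
  have p: "dot k (T x) = g + c * \<kappa>"
    unfolding T_def by (simp add: dt.bilinear dot_k_E dot_k_k g_def c_def)
  have k1: "\<kappa> + 1 \<noteq> 0" using kappa_nonneg by simp
  have "(q + 2 * c * g + c\<^sup>2 * \<kappa>) * (\<kappa> + 1) - (g + c * \<kappa>)\<^sup>2 = (q + c\<^sup>2) * (\<kappa> + 1) - (c - g)\<^sup>2"
    by (simp add: power2_eq_square algebra_simps)
  then have "q + 2 * c * g + c\<^sup>2 * \<kappa> - (g + c * \<kappa>)\<^sup>2 / (\<kappa> + 1) = q + c\<^sup>2 - (c - g)\<^sup>2 / (\<kappa> + 1)"
    using k1 by (simp add: field_simps)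
  then show ?thesis unfolding n p riccati[of x] q_def g_def c_def by simp
qed

text \<open>Cauchy-Schwarz with \<open>dot k k = \<kappa>\<close>, which is less than
  \<open>\<kappa> + 1\<close>. Thus \<open>T\<close> descends to functionals modulo the kernel of
  \<open>\<sigma>\<close>.\<close>

lemma T_null: assumes "\<sigma> x x = 0" shows "T x = 0"
proof -
  have k1: "0 < \<kappa> + 1" using kappa_nonneg by simp
  have "dot (T x) (T x) * (\<kappa> + 1) = (dot k (T x))\<^sup>2"
    using T_norm[of x] assms k1 by (simp add: field_simps)
  also have "\<dots> \<le> dot k k * dot (T x) (T x)" by (rule dt.Cauchy_Schwarz) simp_all
  finally have "dot (T x) (T x) \<le> 0" by (simp add: dot_k_k algebra_simps)
  then have "dot (T x) (T x) = 0" using dt.nonneg[of "T x"] by simp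
  then show ?thesis using dot_eq_0 T_supp by (intro ext) (metis not_le zero_fun_apply)
qed

definition a :: "(nat \<Rightarrow> real) \<Rightarrow> nat \<Rightarrow> real" where
  "a z = T (emb z)"

text \<open>Sherman-Morrison: \<open>b\<close> is \<open>a\<close> followed by the inverse of the
  identity plus the rank-one form of \<open>k\<close>. In filtering terms, prediction followed by
  the measurement update.\<close>

definition b :: "(nat \<Rightarrow> real) \<Rightarrow> nat \<Rightarrow> real" where
  "b z = a z - (dot k (a z) / (\<kappa> + 1)) *\<^sub>R k"

lemma linear_a: "linear a"
  using linear_compose[OF linear_emb linear_T] by (simp add: a_def[abs_def] comp_def)

lemma linear_b: "linear b"
proof (rule linearI)
  show "b (x + y) = b x + b y" for x y
    by (simp add: b_def linear_add[OF linear_a] dt.bilinear add_divide_distrib scaleR_left_distrib)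
  show "b (c *\<^sub>R x) = c *\<^sub>R b x" for c x
    by (simp add: b_def linear_cmul[OF linear_a] dt.bilinear scaleR_right_diff_distrib)
qed

lemma a_supp: "r \<le> i \<Longrightarrow> a x i = 0" and b_supp: "r \<le> i \<Longrightarrow> b x i = 0"
  by (simp_all add: a_def b_def T_supp k_supp)

lemma emb_cong: "(\<And>i. i < r \<Longrightarrow> x i = x' i) \<Longrightarrow> emb x = emb x'"
  by (simp add: emb_def)

lemma a_cong: "(\<And>i. i < r \<Longrightarrow> x i = x' i) \<Longrightarrow> a x = a x'"
  unfolding a_def by (simp only: emb_cong[of x x'])

lemma b_cong: "(\<And>i. i < r \<Longrightarrow> x i = x' i) \<Longrightarrow> b x = b x'"
  unfolding b_def by (simp only: a_cong[of x x'])

lemma a_E: "a (E x) = E (\<Phi> x) + G x *\<^sub>R k"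
proof -
  define n where "n = x - emb (E x)"
  have "E n = E x - E (emb (E x))" unfolding n_def by (rule linear_diff[OF linear_E])
  also have "E (emb (E x)) = E x" by (rule E_emb_supp) (rule E_supp)
  finally have "E n = 0" by (simp only: diff_self)
  then have "dot (E n) (E n) = 0" by (simp only: dt.zero_left UNIV_I)
  then have "T n = 0" by (intro T_null) (simp only: dot_E)
  moreover have "T n = T x - T (emb (E x))" unfolding n_def by (rule linear_diff[OF linear_T])
  ultimately have "T (emb (E x)) = T x" by simp
  then show ?thesis by (simp only: a_def T_def)
qed

text \<open>Intertwines channel and encoder. It is the reason why the channel state follows the
  encoder state when driven by the encoder output.\<close>

lemma E_f: "E (f x) = a (E x) - G x *\<^sub>R C"
  by (simp add: a_E f_eq C_def linear_add[OF linear_E] linear_cmul[OF linear_E] scaleR_right_diff_distrib)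

lemma dot_k_b: "dot k (b z) = dot k (a z) / (\<kappa> + 1)"
proof -
  have "\<kappa> + 1 \<noteq> 0" using kappa_nonneg by simp
  then show ?thesis by (simp add: b_def dt.bilinear dot_k_k field_simps)
qed

lemma a_eq: "a z = b z + dot k (b z) *\<^sub>R k"
  unfolding dot_k_b by (simp add: b_def)

text \<open>Energy balance: what \<open>b\<close> loses in norm shows along \<open>k\<close>. It
  yields the expansion by the encoder matrix and the sums of squares that evaluate power and
  rate.\<close>

lemma b_norm: "dot (b z) (b z) + (dot k (b z))\<^sup>2 = dot z z"
proof -
  have k1: "\<kappa> + 1 \<noteq> 0" using kappa_nonneg by simp
  have "dot z z = dot (a z) (a z) - (dot k (a z))\<^sup>2 / (\<kappa> + 1)"
    unfolding a_def T_norm using dot_E_emb[of z "E (emb z)"] dot_E_emb[of z z] dt.sym[of z "E (emb z)"]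
    by (simp add: dot_E)
  also have "(dot k (a z))\<^sup>2 / (\<kappa> + 1) = (\<kappa> + 1) * (dot k (b z))\<^sup>2"
    using k1 by (simp add: dot_k_b power2_eq_square)
  also have "dot (a z) (a z) = dot (b z) (b z) + 2 * (dot k (b z))\<^sup>2 + \<kappa> * (dot k (b z))\<^sup>2"
    unfolding a_eq[of z] using dt.sym[of "b z" k]
    by (simp add: dt.bilinear dot_k_k power2_eq_square algebra_simps)
  finally show ?thesis by (simp add: algebra_simps)
qed

text \<open>Polarized energy balance, rewritten with \<open>a_eq\<close>; it exhibits
  \<open>b\<close> as the inverse of the adjoint of \<open>a\<close>.\<close>

lemma dot_a_b: "dot (a x) (b z) = dot x z"
proof -
  have "dot (b (x + z)) (b (x + z)) + (dot k (b (x + z)))\<^sup>2 = dot (x + z) (x + z)" by (rule b_norm)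
  then have "dot (b x) (b z) + dot k (b x) * dot k (b z) = dot x z"
    using b_norm[of x] b_norm[of z] dt.sym[of z x] dt.sym[of "b z" "b x"]
    by (simp add: linear_add[OF linear_b] dt.bilinear power2_eq_square algebra_simps)
  then show ?thesis unfolding a_eq[of x] by (simp add: dt.bilinear)
qed

text \<open>The channel state equals the encoder state up to the free response of the channel, which
  is stable even though the encoder is not.\<close>

lemma state_functional_a:
  "state_functional f G (\<lambda>s. (a ^^ s) C) t x = (a ^^ t) (E x) - E ((f ^^ t) x)"
proof (induction t arbitrary: x)
  case (Suc t)
  have lp: "linear (a ^^ t)"
  proof (induction t)
    case (Suc k)
    then show ?case using linear_compose[OF Suc linear_a] by (simp add: comp_def)
  qed (simp add: linear_ident)
  have "(a ^^ Suc t) (E x) = (a ^^ t) (E (f x) + G x *\<^sub>R C)"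
    unfolding E_f funpow_Suc_right by simp
  also have "\<dots> = (a ^^ t) (E (f x)) + G x *\<^sub>R (a ^^ t) C"
    by (simp add: linear_add[OF lp] linear_cmul[OF lp])
  finally show ?case using Suc[of "f x"] by (simp only: state_functional.simps funpow_Suc_right comp_def) (simp add: fun_eq_iff)
qed simp

abbreviation A :: rmat where "A \<equiv> dual_mat r a"

lemma dual_map_A: "dual_map A = a"
  by (rule dual_map_dual_mat[OF linear_a]) (rule a_cong a_supp, assumption)+

lemma dual_map_B: "dual_map (dual_mat r b) = b"
  by (rule dual_map_dual_mat[OF linear_b]) (rule b_cong b_supp, assumption)+

text \<open>The encoder matrix itself acting on column vectors, as opposed to its transpose
  \<open>a\<close>.\<close>

definition adj :: "(nat \<Rightarrow> real) \<Rightarrow> nat \<Rightarrow> real" where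
  "adj z = (\<lambda>i. if i < r then dot (a (unit_fun i)) z else 0)"

lemma expand_unit: "\<lbrakk>linear h; \<And>x x' :: nat \<Rightarrow> real. (\<And>i. i < r \<Longrightarrow> x i = x' i) \<Longrightarrow> h x = h x'\<rbrakk> \<Longrightarrow>
    h x = (\<Sum>i<r. x i *\<^sub>R h (unit_fun i))" for h :: "(nat \<Rightarrow> real) \<Rightarrow> 'c::real_vector"
proof -
  assume lin: "linear h" and cong: "\<And>x x' :: nat \<Rightarrow> real. (\<And>i. i < r \<Longrightarrow> x i = x' i) \<Longrightarrow> h x = h x'"
  have "(\<Sum>i<r. x i *\<^sub>R unit_fun i) k = x k" if "k < r" for k
    using that by (simp add: unit_fun_def if_distrib sum.delta cong: if_cong)
  then have "h x = h (\<Sum>i<r. x i *\<^sub>R unit_fun i)" by (intro cong) simp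
  then show ?thesis by (simp only: linear_sum[OF lin] linear_cmul[OF lin])
qed

lemma dot_adj: "dot (a u) z = dot u (adj z)"
proof -
  have "dot (a u) z = dot (\<Sum>i<r. u i *\<^sub>R a (unit_fun i)) z"
    by (simp only: expand_unit[OF linear_a a_cong, of u, symmetric])
  then show ?thesis by (simp add: dt.sum_left dt.bilinear) (simp add: dot_def[of u] adj_def)
qed

lemma AB: "A * transpose_mat (dual_mat r b) = 1\<^sub>m r"
proof (rule eq_matI)
  fix i j assume "i < dim_row (1\<^sub>m r)" "j < dim_col (1\<^sub>m r)"
  then have ij: "i < r" "j < r" by simp_all
  have "(A * transpose_mat (dual_mat r b)) $$ (i, j) = dot (a (unit_fun i)) (b (unit_fun j))"
    using ij by (simp add: dual_mat_def scalar_prod_def dot_def atLeast0LessThan)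
  also have "\<dots> = (\<Sum>l<r. if l = i then unit_fun j l else 0)"
    unfolding dot_a_b unfolding dot_def by (intro sum.cong refl) (simp add: unit_fun_def)
  finally show "(A * transpose_mat (dual_mat r b)) $$ (i, j) = 1\<^sub>m r $$ (i, j)"
    using ij by (simp add: unit_fun_def)
qed (simp_all add: dual_mat_def)

lemma b_adj: "i < r \<Longrightarrow> b (adj z) i = z i"
proof -
  assume i: "i < r"
  have BA: "transpose_mat (dual_mat r b) * A = 1\<^sub>m r"
    by (rule mat_mult_left_right_inverse[OF _ _ AB]) simp_all
  then have e: "(\<Sum>n<r. b (unit_fun n) i * a (unit_fun n) j) = (if i = j then 1 else 0)" if "j < r" for j
  proof -
    have "(transpose_mat (dual_mat r b) * A) $$ (i, j) = (\<Sum>n<r. b (unit_fun n) i * a (unit_fun n) j)"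
      using i that by (simp add: dual_mat_def scalar_prod_def atLeast0LessThan)
    then show ?thesis unfolding BA using i that by simp
  qed
  have "b (adj z) i = (\<Sum>n<r. adj z n *\<^sub>R b (unit_fun n)) i"
    by (simp only: expand_unit[OF linear_b b_cong, of "adj z", symmetric])
  also have "\<dots> = (\<Sum>n<r. \<Sum>j<r. z j * (b (unit_fun n) i * a (unit_fun n) j))"
    by (simp add: adj_def dot_def sum_distrib_left mult_ac)
  also have "\<dots> = (\<Sum>j<r. \<Sum>n<r. z j * (b (unit_fun n) i * a (unit_fun n) j))" by (rule sum.swap)
  also have "\<dots> = (\<Sum>j<r. if j = i then z j else 0)"
    unfolding sum_distrib_left[symmetric] by (intro sum.cong refl) (simp add: e)
  also have "\<dots> = z i" using i by simp
  finally show ?thesis .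
qed

lemma adj_norm: "dot (adj z) (adj z) = dot z z + (dot k z)\<^sup>2"
proof -
  have c: "dot (b (adj z)) y = dot z y" for y by (rule dot_cong) (rule b_adj)
  show ?thesis
    using b_norm[of "adj z"] c[of "b (adj z)"] c[of z] c[of k] dt.sym[of z "b (adj z)"] dt.sym[of k] by simp
qed

end

lemma decay_null:
  assumes "\<exists>c\<ge>0. \<forall>j. \<bar>f j\<bar> \<le> c * \<theta> ^ j" "0 < \<theta>" "\<theta> < 1"
  shows "f \<longlonglongrightarrow> (0 :: real)"
proof -
  obtain c where "\<And>j. \<bar>f j\<bar> \<le> c * \<theta> ^ j" using assms(1) by blast
  then show ?thesis by (rule geometric_null) fact+
qed

context optimal_system
begin

lemma E_decay: "\<exists>c\<ge>0. \<forall>j. \<bar>dot (E ((\<Phi> ^^ j) x)) z\<bar> \<le> c * \<theta> ^ j"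
  and E_f_decay: "\<exists>c\<ge>0. \<forall>j. \<bar>dot (E ((f ^^ j) x)) z\<bar> \<le> c * \<theta> ^ j"
proof -
  have lin: "linear (\<lambda>x. dot (E x) z)"
    by (rule linearI) (simp_all add: linear_add[OF linear_E] linear_cmul[OF linear_E] dt.bilinear)
  have cong: "dot (E x) z = dot (E x') z" if "\<And>i. i < m \<Longrightarrow> x i = x' i" for x x'
    using E_cong[of x x'] that by simp
  show "\<exists>c\<ge>0. \<forall>j. \<bar>dot (E ((\<Phi> ^^ j) x)) z\<bar> \<le> c * \<theta> ^ j"
    by (rule linear_functional_decay[OF lin cong \<Phi>_decay])
  show "\<exists>c\<ge>0. \<forall>j. \<bar>dot (E ((f ^^ j) x)) z\<bar> \<le> c * \<theta> ^ j"
    by (rule linear_functional_decay[OF lin cong f_decay])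
qed

text \<open>\<open>adj\<close> never shrinks a vector, so an eigenvalue in the closed disc would
  have modulus 1 and an eigenvector orthogonal to \<open>k\<close>. Against such a vector the
  encoder acts like the zero dynamics, where every orbit decays.\<close>

lemma eigenvalue_A:
  assumes "eigenvalue (cmat A) z"
  shows "1 < cmod z"
proof (rule ccontr)
  assume "\<not> 1 < cmod z"
  then have z1: "cmod z \<le> 1" by simp
  obtain h i0 where i0: "i0 < r" "h i0 \<noteq> 0"
    and h: "\<And>i. i < r \<Longrightarrow> (\<Sum>j<r. complex_of_real (A $$ (i, j)) * h j) = z * h i"
    using assms unfolding eigenvalue_cmat_iff[OF dual_mat_carrier] by blast
  \<comment> \<open>Real and imaginary part of the eigenvector; \<open>g\<close> below is the
    squared modulus of its pairing with \<open>E x\<close>.\<close>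
  define p q where "p i = (if i < r then Re (h i) else 0)" and "q i = (if i < r then Im (h i) else 0)" for i
  define c s where "c = Re z" and "s = Im z"
  have Ap: "adj p i = c * p i - s * q i" and Aq: "adj q i = c * q i + s * p i" if "i < r" for i
  proof -
    have "Re (\<Sum>j<r. complex_of_real (A $$ (i, j)) * h j) = adj p i"
      "Im (\<Sum>j<r. complex_of_real (A $$ (i, j)) * h j) = adj q i"
      using that by (simp_all add: adj_def dot_def p_def q_def dual_mat_def)
    then show "adj p i = c * p i - s * q i" "adj q i = c * q i + s * p i"
      unfolding h[OF that] using that by (simp_all add: p_def q_def c_def s_def)
  qed
  have Apd: "dot x (adj p) = c * dot x p - s * dot x q" for x
  proof -
    have "dot (adj p) x = dot (c *\<^sub>R p - s *\<^sub>R q) x" by (rule dot_cong) (simp add: Ap)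
    then show ?thesis by (simp add: dt.bilinear dt.sym[of x])
  qed
  have Aqd: "dot x (adj q) = c * dot x q + s * dot x p" for x
  proof -
    have "dot (adj q) x = dot (c *\<^sub>R q + s *\<^sub>R p) x" by (rule dot_cong) (simp add: Aq)
    then show ?thesis by (simp add: dt.bilinear dt.sym[of x])
  qed
  have cs: "c\<^sup>2 + s\<^sup>2 \<le> 1"
    using z1 by (simp add: c_def s_def cmod_def)
  let ?S = "dot p p + dot q q"
  have "(c\<^sup>2 + s\<^sup>2) * ?S = dot (adj p) (adj p) + dot (adj q) (adj q)"
  proof -
    have "dot (adj p) (adj p) = c * dot (adj p) p - s * dot (adj p) q" by (rule Apd)
    also have "dot (adj p) p = c * dot p p - s * dot p q" using Apd[of p] dt.sym[of p "adj p"] by simp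
    also have "dot (adj p) q = c * dot p q - s * dot q q"
      using Apd[of q] dt.sym[of q "adj p"] dt.sym[of q p] by simp
    finally have 1: "dot (adj p) (adj p) = c * (c * dot p p - s * dot p q) - s * (c * dot p q - s * dot q q)" .
    have "dot (adj q) (adj q) = c * dot (adj q) q + s * dot (adj q) p" by (rule Aqd)
    also have "dot (adj q) q = c * dot q q + s * dot p q" using Aqd[of q] dt.sym[of q "adj q"] dt.sym[of q p] by simp
    also have "dot (adj q) p = c * dot p q + s * dot p p" using Aqd[of p] dt.sym[of p "adj q"] by simp
    finally have 2: "dot (adj q) (adj q) = c * (c * dot q q + s * dot p q) + s * (c * dot p q + s * dot p p)" .
    show ?thesis unfolding 1 2 by (simp add: power2_eq_square algebra_simps)
  qed
  moreover have "(c\<^sup>2 + s\<^sup>2) * ?S \<le> 1 * ?S"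
    using cs by (intro mult_right_mono) (simp_all add: dt.nonneg)
  ultimately have "(dot k p)\<^sup>2 + (dot k q)\<^sup>2 \<le> 0" unfolding adj_norm by simp
  then have kp: "dot k p = 0" and kq: "dot k q = 0"
    using zero_le_power2[of "dot k p"] zero_le_power2[of "dot k q"] by (simp_all add: sum_power2_le_zero_iff)
  have pq: "0 < ?S"
  proof (rule ccontr)
    assume "\<not> 0 < ?S"
    then have "dot p p = 0" "dot q q = 0" using dt.nonneg[of p] dt.nonneg[of q] by simp_all
    then have "p i0 = 0" "q i0 = 0" using dot_eq_0 i0(1) by blast+
    then show False using i0 by (simp add: p_def q_def complex_eq_iff)
  qed
  with \<open>(c\<^sup>2 + s\<^sup>2) * ?S = _\<close> have cs1: "c\<^sup>2 + s\<^sup>2 = 1"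
    unfolding adj_norm kp kq by simp
  define g where "g x = (dot (E x) p)\<^sup>2 + (dot (E x) q)\<^sup>2" for x
  have step: "g (\<Phi> x) = g x" for x
  proof -
    have e: "dot (E (\<Phi> x)) y = dot (E x) (adj y) - G x * dot k y" for y
      using arg_cong[OF a_E[of x], of "\<lambda>v. dot v y"] dot_adj[of "E x" y] by (simp add: dt.bilinear)
    have "g (\<Phi> x) = (c * dot (E x) p - s * dot (E x) q)\<^sup>2 + (c * dot (E x) q + s * dot (E x) p)\<^sup>2"
      by (simp add: g_def e kp kq Apd Aqd)
    also have "\<dots> = (c\<^sup>2 + s\<^sup>2) * g x" by (simp add: g_def power2_eq_square algebra_simps)
    finally show ?thesis by (simp add: cs1)
  qed
  have "g x = 0" for x
  proof -
    have "g ((\<Phi> ^^ j) x) = g x" for j by (induction j) (simp_all add: step)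
    moreover have "(\<lambda>j. g ((\<Phi> ^^ j) x)) \<longlonglongrightarrow> 0\<^sup>2 + 0\<^sup>2"
    proof -
      have "(\<lambda>j. dot (E ((\<Phi> ^^ j) x)) y) \<longlonglongrightarrow> 0" for y
        by (rule decay_null[OF E_decay \<theta>])
      then show ?thesis unfolding g_def by (intro tendsto_intros)
    qed
    ultimately show "g x = 0" by (simp add: LIMSEQ_const_iff)
  qed
  from this[of "emb p"] this[of "emb q"] have "dot p p = 0" "dot q q = 0"
    by (simp_all add: g_def dot_E_emb sum_power2_eq_zero_iff)
  with pq show False by simp
qed

text \<open>The eigenvalues of \<open>b\<close> are reciprocals of eigenvalues of the encoder
  matrix.\<close>

lemma b_decay: "\<exists>\<theta>'. 0 < \<theta>' \<and> \<theta>' < 1 \<and> (\<forall>x. \<exists>c\<ge>0. \<forall>j. \<forall>i<r. \<bar>(b ^^ j) x i\<bar> \<le> c * \<theta>' ^ j)"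
proof -
  let ?B = "dual_mat r b"
  have "cmod z < 1" if ev: "eigenvalue (cmat ?B) z" for z
  proof -
    have "eigenvalue (cmat (transpose_mat ?B)) z"
      using ev eigenvalue_cmat_transpose[OF dual_mat_carrier] by simp
    then obtain v where v: "v \<in> carrier_vec r" "v \<noteq> 0\<^sub>v r" "cmat (transpose_mat ?B) *\<^sub>v v = z \<cdot>\<^sub>v v"
      unfolding eigenvalue_def eigenvector_def by (auto simp: dual_mat_def)
    have "cmat A * cmat (transpose_mat ?B) = 1\<^sub>m r"
    proof -
      have "cmat (A * transpose_mat ?B) = cmat A * cmat (transpose_mat ?B)"
        by (rule of_real_hom.mat_hom_mult[of _ r r _ r]) simp_all
      then show ?thesis unfolding AB of_real_hom.mat_hom_one ..
    qed
    then have "v = cmat A *\<^sub>v (cmat (transpose_mat ?B) *\<^sub>v v)"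
      using v(1) assoc_mult_mat_vec[of "cmat A" r r "cmat (transpose_mat ?B)" r v] by simp
    then have e: "v = z \<cdot>\<^sub>v (cmat A *\<^sub>v v)"
      unfolding v(3) using v(1) mult_mat_vec[of "cmat A" r r v z] by simp
    have z0: "z \<noteq> 0"
    proof
      assume "z = 0"
      with e have "v = 0 \<cdot>\<^sub>v (cmat A *\<^sub>v v)" by simp
      then have "v = 0\<^sub>v r" by (intro eq_vecI) (metis carrier_vecD dim_mult_mat_vec index_smult_vec(1) index_smult_vec(2) index_zero_vec mult_zero_left v(1), use v(1) in simp)
      with v(2) show False by simp
    qed
    have "(1 / z) \<cdot>\<^sub>v v = (1 / z) \<cdot>\<^sub>v (z \<cdot>\<^sub>v (cmat A *\<^sub>v v))" using e by simp
    then have "cmat A *\<^sub>v v = (1 / z) \<cdot>\<^sub>v v" using z0 by (simp add: smult_smult_assoc)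
    then have "eigenvalue (cmat A) (1 / z)"
      using v unfolding eigenvalue_def eigenvector_def by (auto simp: dual_mat_def)
    from eigenvalue_A[OF this] show ?thesis using z0 by (simp add: norm_divide divide_simps)
  qed
  then have "stable_mat ?B" by (simp add: stable_mat_def)
  from dual_map_decay[OF dual_mat_carrier this] show ?thesis unfolding dual_map_B .
qed

text \<open>If the signal generated by \<open>x\<close> vanishes, the pairing of its orbit under
  \<open>adj\<close> with any \<open>E y\<close> reduces to the decaying free response of the
  channel. But the orbit does not shrink and \<open>E\<close> reaches all coordinates.\<close>

lemma observable_C:
  assumes "\<And>t. dot ((a ^^ t) C) x = 0" and i: "i < r"
  shows "x i = 0"
proof -
  have ap: "dot ((a ^^ t) u) y = dot u ((adj ^^ t) y)" for t u y
  proof (induction t arbitrary: u)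
    case (Suc t)
    have "dot ((a ^^ Suc t) u) y = dot ((a ^^ t) (a u)) y" by (simp only: funpow_Suc_right comp_def)
    also have "\<dots> = dot u (adj ((adj ^^ t) y))" unfolding Suc by (rule dot_adj)
    finally show ?case by simp
  qed simp
  have grow: "dot x x \<le> dot ((adj ^^ t) x) ((adj ^^ t) x)" for t
    by (induction t) (auto simp: adj_norm intro: order.trans)
  have e: "dot (E y) ((adj ^^ t) x) = dot (E ((f ^^ t) y)) x" for t y
  proof -
    have "dot (state_functional f G (\<lambda>s. (a ^^ s) C) t y) x = 0"
      unfolding state_functional_sum by (simp add: dt.sum_left dt.bilinear assms(1))
    then show ?thesis unfolding state_functional_a dt.diff_left[OF UNIV_I UNIV_I UNIV_I] ap by simp
  qed
  have "(\<lambda>t. (adj ^^ t) x j) \<longlonglongrightarrow> 0" if "j < r" for j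
  proof -
    have "dot (unit_fun j) y = y j" for y
      using that by (simp add: dot_def unit_fun_def if_distrib[of "\<lambda>c. c * _"] cong: if_cong)
    moreover have "dot (unit_fun j) y = dot (E (emb (unit_fun j))) y" for y by (rule dot_E_emb[symmetric])
    ultimately have "(adj ^^ t) x j = dot (E ((f ^^ t) (emb (unit_fun j)))) x" for t
      unfolding e[symmetric] by simp
    then show ?thesis using decay_null[OF E_f_decay[of "emb (unit_fun j)" x] \<theta>] by simp
  qed
  then have "(\<lambda>t. dot ((adj ^^ t) x) ((adj ^^ t) x)) \<longlonglongrightarrow> (\<Sum>i<r. 0 * 0)"
    unfolding dot_def by (intro tendsto_intros) auto
  then have "dot x x \<le> 0"
    using grow by (intro LIMSEQ_le_const[of "\<lambda>t. dot ((adj ^^ t) x) ((adj ^^ t) x)"]) auto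
  then have "dot x x = 0" using dt.nonneg[of x] by simp
  then show ?thesis using dot_eq_0 i by blast
qed

lemma vec_fun_C: "vec_fun (Matrix.vec r C) = C"
  by (rule ext) (simp add: vec_fun_def C_supp)

lemma observable_A: "observable r A (Matrix.vec r C)"
  unfolding observable_iff[OF dual_mat_carrier vec_carrier] vec_fun_C dual_map_A
proof (intro allI impI)
  fix x j assume 0: "\<forall>t. (\<Sum>j<r. (a ^^ t) C j * x j) = 0" and j: "j < r"
  have "dot ((a ^^ t) C) x = 0" for t unfolding dot_def by (rule spec[OF 0])
  then show "x j = 0" using j by (rule observable_C)
qed

end

section \<open>Causality of the coding structure\<close>

lemma state_functional_mem:
  assumes "subspace V" "\<And>s. s < t \<Longrightarrow> u s \<in> V"
  shows "state_functional \<Phi> g u t x \<in> V"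
  unfolding state_functional_sum using assms by (intro subspace_sum subspace_scale) auto

lemma encoder_signal_span: "encoder_signal n A C t \<in> span (message ` {..n})"
  unfolding encoder_signal_def by (intro span_sum span_scale span_base) auto

lemma coding_structure_iff:
  assumes dims: "state_space_dims m F G H"
    and A: "A \<in> carrier_mat (n + 1) (n + 1)" and C: "C \<in> carrier_vec (n + 1)"
  shows "coding_structure F G H n A C g u y \<longleftrightarrow>
    (\<forall>t. u t = encoder_signal n A C t + (\<Sum>j<t. g t j *\<^sub>R y j)) \<and>
    (\<forall>t. y t = state_functional (dual_map F) (dual_vec G) u t (vec_fun H) + u t + noise t)"
proof -
  have y: "y = channel_output F G H u \<longleftrightarrow>
      (\<forall>t. y t = state_functional (dual_map F) (dual_vec G) u t (vec_fun H) + u t + noise t)"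
    unfolding fun_eq_iff[of y] channel_output_eq[OF dims] ..
  have u: "(\<exists>r r_hat :: process.
        (\<forall>t \<omega>. r t \<omega> = scalar_prod C (encoder_state n A \<omega> t)) \<and>
        (\<forall>t \<omega>. - r_hat t \<omega> = (\<Sum>j<t. g t j * y j \<omega>)) \<and>
        (\<forall>t \<omega>. u t \<omega> = r t \<omega> - r_hat t \<omega>)) \<longleftrightarrow>
      (\<forall>t. u t = encoder_signal n A C t + (\<Sum>j<t. g t j *\<^sub>R y j))" (is "?L \<longleftrightarrow> ?R")
  proof
    assume ?L
    then obtain r r_hat :: process where r: "\<And>t \<omega>. r t \<omega> = scalar_prod C (encoder_state n A \<omega> t)"
        "\<And>t \<omega>. - r_hat t \<omega> = (\<Sum>j<t. g t j * y j \<omega>)" "\<And>t \<omega>. u t \<omega> = r t \<omega> - r_hat t \<omega>"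
      by blast
    have "u t \<omega> = (encoder_signal n A C t + (\<Sum>j<t. g t j *\<^sub>R y j)) \<omega>" for t \<omega>
      using r(2)[of t \<omega>] unfolding r(3)[of t \<omega>] r(1) encoder_signal_eq[OF A C] by simp
    then show ?R by (simp add: fun_eq_iff)
  next
    assume R: ?R
    have "u t \<omega> = scalar_prod C (encoder_state n A \<omega> t) - - (\<Sum>j<t. g t j * y j \<omega>)" for t \<omega>
      unfolding R[rule_format, of t] encoder_signal_eq[OF A C] by simp
    then show ?L
      apply -
      apply (rule exI[of _ "\<lambda>t \<omega>. scalar_prod C (encoder_state n A \<omega> t)"])
      apply (rule exI[of _ "\<lambda>t \<omega>. - (\<Sum>j<t. g t j * y j \<omega>)"])
      by simp
  qed
  show ?thesis unfolding coding_structure_def y u by blast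
qed

context
  fixes \<Phi> :: "'x \<Rightarrow> 'x" and G :: "'x \<Rightarrow> real" and H :: 'x and n :: nat and r u y :: process
    and g :: "nat \<Rightarrow> nat \<Rightarrow> real"
  assumes r: "\<And>t. r t \<in> span (message ` {..n})"
    and u: "\<And>t. u t = r t + (\<Sum>j<t. g t j *\<^sub>R y j)"
    and y: "\<And>t. y t = state_functional \<Phi> G u t H + u t + noise t"
begin

lemma coding_causal:
  shows "u t \<in> span (range message \<union> noise ` {..<t})"
    and "state_functional \<Phi> G u t H + u t \<in> span (range message \<union> noise ` {..<t})"
    and "y t \<in> span (range message \<union> noise ` {..t})"
proof -
  let ?V = "\<lambda>t. span (range message \<union> noise ` {..<t})"
  have mono: "?V s \<subseteq> ?V t" if "s \<le> t" for s t
    using that by (intro span_mono) auto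
  have "span (message ` {..n}) \<subseteq> ?V t" for t by (intro span_mono) auto
  then have rV: "r t \<in> ?V t" for t using r by blast
  have nV: "noise t \<in> ?V (Suc t)" for t by (intro span_base) auto
  have *: "u t \<in> ?V t \<and> state_functional \<Phi> G u t H + u t \<in> ?V t \<and> y t \<in> ?V (Suc t)"
  proof (induction t rule: less_induct)
    case (less t)
    have us: "u s \<in> ?V t" if "s < t" for s using less[OF that] mono[of s t] that by auto
    have ys: "y s \<in> ?V t" if "s < t" for s using less[OF that] mono[of "Suc s" t] that by auto
    have 1: "u t \<in> ?V t"
      unfolding u[of t] using rV ys by (intro span_add span_sum span_scale) auto
    have 2: "state_functional \<Phi> G u t H + u t \<in> ?V t"
      by (intro span_add state_functional_mem us 1) (auto simp: subspace_span)
    have 3: "y t \<in> ?V (Suc t)"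
      unfolding y[of t] by (intro span_add[OF _ nV] subsetD[OF mono 2]) simp
    show ?case using 1 2 3 by blast
  qed
  from * show "u t \<in> ?V t" "state_functional \<Phi> G u t H + u t \<in> ?V t" by blast+
  from * show "y t \<in> span (range message \<union> noise ` {..t})" by (simp add: lessThan_Suc_atMost)
qed

lemma coding_mem: "u t \<in> coordinate_space" "y t \<in> coordinate_space"
  "state_functional \<Phi> G u t H + u t \<in> coordinate_space"
proof -
  have "span (range message \<union> noise ` I) \<subseteq> coordinate_space" for I
    by (rule span_minimal) (auto simp: coord.sub)
  then show "u t \<in> coordinate_space" "y t \<in> coordinate_space"
    "state_functional \<Phi> G u t H + u t \<in> coordinate_space"
    using coding_causal by blast+
qed

lemma coding_noisy_output:
  "noisy_output coordinate_space cov (\<lambda>t. state_functional \<Phi> G u t H + u t) noise"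
proof
  fix s t :: nat assume st: "s \<le> t"
  have "span (range message \<union> noise ` {..<s}) \<subseteq> {Z \<in> coordinate_space. cov (noise t) Z = 0}"
  proof (rule span_minimal)
    show "range message \<union> noise ` {..<s} \<subseteq> {Z \<in> coordinate_space. cov (noise t) Z = 0}"
      using st by auto
    show "subspace {Z \<in> coordinate_space. cov (noise t) Z = 0}"
      by (auto simp: subspace_def coord.bilinear)
  qed
  then show "cov (noise t) (state_functional \<Phi> G u s H + u s) = 0"
    using coding_causal(2)[of s] by blast
qed (simp_all add: coding_mem)

lemma coding_information_innovation:
  "coding_information n y T = (\<Sum>t\<le>T. 1 / 2 * log 2 (innovation_var cov y t))"
proof (rule coding_information_eq[OF coding_noisy_output])
  let ?v = "\<lambda>t. \<Sum>j<t. g t j *\<^sub>R y j"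
  have v: "?v s \<in> span (y ` {..<t})" if "s \<le> t" for s t
    using that by (intro span_sum span_scale span_base) auto
  show "state_functional \<Phi> G u t H + u t =
      (state_functional \<Phi> G r t H + r t) + (state_functional \<Phi> G ?v t H + ?v t)" for t
  proof -
    have "state_functional \<Phi> G u t H = state_functional \<Phi> G (\<lambda>t. r t + ?v t) t H"
      by (rule arg_cong[of _ _ "\<lambda>u. state_functional \<Phi> G u t H"]) (rule ext, rule u)
    then show ?thesis unfolding state_functional_add u[of t] by simp
  qed
  show "state_functional \<Phi> G r t H + r t \<in> span (message ` {..n})" for t
    by (intro span_add state_functional_mem r) (simp add: subspace_span)
  show "state_functional \<Phi> G ?v t H + ?v t \<in> span (y ` {..<t})" for t
    by (intro span_add state_functional_mem v) (simp_all add: subspace_span)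
  show "y t = state_functional \<Phi> G u t H + u t + noise t" for t by (rule y)
qed simp

end

lemma average_power_eq:
  assumes "\<And>t. integrable gauss_space (\<lambda>\<omega>. (u t \<omega>)\<^sup>2)"
  shows "average_power u T = (\<Sum>t\<le>T. cov (u t) (u t)) / real (T + 1)"
  unfolding average_power_def cov_def using assms
  by (simp add: Bochner_Integration.integral_sum power2_eq_square)

lemma average_power_coordinate:
  assumes "\<And>t. u t \<in> coordinate_space"
  shows "average_power u T = (\<Sum>t\<le>T. cov (u t) (u t)) / real (T + 1)"
  using assms
  by (intro average_power_eq expectation_centered_square(2) gaussian_subspaceD(2)[OF gaussian_coordinate_space]) auto

text \<open>Feedback changes the outputs by a unitriangular transformation and hence not the space
  they span.\<close>

lemma span_unitriangular:
  fixes y z :: "nat \<Rightarrow> 'a::real_vector"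
  assumes "\<And>t. y t - z t \<in> span (z ` {..<t})"
  shows "span (y ` {..<t}) = span (z ` {..<t})"
proof (induction t)
  case (Suc t)
  have "span (y ` {..<Suc t}) \<subseteq> span (z ` {..<Suc t})" if IH: "span (y ` {..<t}) = span (z ` {..<t})"
    and d: "y t - z t \<in> span (z ` {..<t})" for y z :: "nat \<Rightarrow> 'a"
  proof (rule span_minimal[OF _ subspace_span], rule image_subsetI)
    fix s assume "s \<in> {..<Suc t}"
    then consider "s < t" | "s = t" by (auto simp: less_Suc_eq)
    then show "y s \<in> span (z ` {..<Suc t})"
    proof cases
      case 1
      have "y s \<in> span (y ` {..<t})" using 1 by (intro span_base) auto
      moreover have "span (z ` {..<t}) \<subseteq> span (z ` {..<Suc t})" by (intro span_mono) auto
      ultimately show ?thesis using IH by blast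
    next
      case 2
      have "span (z ` {..<t}) \<subseteq> span (z ` {..<Suc t})" by (intro span_mono) auto
      then have "y t - z t \<in> span (z ` {..<Suc t})" using d by blast
      moreover have "z t \<in> span (z ` {..<Suc t})" by (intro span_base) auto
      ultimately have "(y t - z t) + z t \<in> span (z ` {..<Suc t})" by (rule span_add)
      then show ?thesis using 2 by simp
    qed
  qed note step = this
  have "z t - y t \<in> span (y ` {..<t})"
    using span_neg[OF assms[of t]] unfolding Suc by simp
  then show ?case using step[OF Suc assms] step[OF Suc[symmetric]] by blast
qed simp

section \<open>Converse\<close>

text \<open>Jensen's inequality via the tangent of \<open>ln\<close> at \<open>1 + k\<close>; the
  linear terms sum to zero because \<open>k\<close> is the mean.\<close>

lemma sum_log_le:
  fixes \<kappa> :: "nat \<Rightarrow> real"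
  assumes "\<And>t. 0 \<le> \<kappa> t"
  shows "(\<Sum>t\<le>T. log 2 (1 + \<kappa> t)) \<le> real (T + 1) * log 2 (1 + (\<Sum>t\<le>T. \<kappa> t) / real (T + 1))"
proof -
  define k where "k = (\<Sum>t\<le>T. \<kappa> t) / real (T + 1)"
  have k: "0 \<le> k" unfolding k_def using assms by (intro divide_nonneg_nonneg sum_nonneg) auto
  have "ln (1 + \<kappa> t) \<le> ln (1 + k) + (\<kappa> t - k) / (1 + k)" for t
  proof -
    have "ln ((1 + \<kappa> t) / (1 + k)) \<le> (1 + \<kappa> t) / (1 + k) - 1"
      using assms[of t] k by (intro ln_le_minus_one) simp
    moreover have "(1 + \<kappa> t) / (1 + k) - 1 = (\<kappa> t - k) / (1 + k)" using k by (simp add: field_simps)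
    moreover have "ln ((1 + \<kappa> t) / (1 + k)) = ln (1 + \<kappa> t) - ln (1 + k)" using assms[of t] k by (simp add: ln_div)
    ultimately show ?thesis by linarith
  qed
  then have "(\<Sum>t\<le>T. ln (1 + \<kappa> t)) \<le> (\<Sum>t\<le>T. ln (1 + k) + (\<kappa> t - k) / (1 + k))"
    by (intro sum_mono)
  also have "\<dots> = real (T + 1) * ln (1 + k) + ((\<Sum>t\<le>T. \<kappa> t) - real (T + 1) * k) / (1 + k)"
    by (simp add: sum.distrib sum_divide_distrib[symmetric] sum_subtractf)
  also have "real (T + 1) * k = (\<Sum>t\<le>T. \<kappa> t)" by (simp add: k_def)
  finally have "(\<Sum>t\<le>T. ln (1 + \<kappa> t)) / ln 2 \<le> real (T + 1) * ln (1 + k) / ln 2"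
    by (intro divide_right_mono) simp_all
  then show ?thesis by (simp add: log_def sum_divide_distrib[symmetric] k_def)
qed

context dual_system
begin

context
  fixes S :: "'a::real_vector set" and B w N u
  assumes no: "noisy_output S B w N"
    and u: "\<And>t. u t = w t - state_functional \<Phi> G w t H"
begin

interpretation noisy_output S B w N by (rule no)

abbreviation "st \<equiv> state_functional \<Phi> G w"

lemma st_mem: "st t x \<in> S"
  by (rule state_functional_mem[OF sub]) simp

lemma linear_st: "linear (st t)"
  by (rule linear_state_functional[OF linear_\<Phi> linear_G])

text \<open>The optimal error is at most that of the filter with an arbitrary gain \<open>l\<close>:
  \<open>Z\<close> combines the old predictions of \<open>X\<close> and \<open>w t\<close> with
  \<open>l\<close> times the innovation.\<close>

lemma error_step:
  "B (R (Suc t) (st (Suc t) x)) (R (Suc t) (st (Suc t) x)) \<le>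
    B (R t (st t (\<Phi> x))) (R t (st t (\<Phi> x))) + 2 * (G x - l) * B (R t (st t (\<Phi> x))) (R t (w t)) +
    (G x - l)\<^sup>2 * B (R t (w t)) (R t (w t)) + l\<^sup>2"
proof -
  define X where "X = st t (\<Phi> x)"
  have X: "X \<in> S" unfolding X_def by (rule st_mem)
  have wN': "B (w s) (N t) = 0" if "s \<le> t" for s using N_orth_w[OF that] sym[of "w s"] by simp
  have XN: "B X (N t) = 0"
    unfolding X_def state_functional_sum by (simp add: sum_left bilinear wN')
  have wN: "B (w t) (N t) = 0" by (simp add: wN')
  define Z where "Z = (X - R t X) + G x *\<^sub>R (w t - R t (w t)) + l *\<^sub>R R t (y t)"
  have mono: "span (y ` {..<t}) \<subseteq> span (y ` {..<Suc t})" by (intro span_mono) auto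
  have Ry: "R t (y t) \<in> span (y ` {..<Suc t})" by (rule innovation_span)
  have "Z \<in> span (y ` {..<Suc t})"
    unfolding Z_def by (intro span_add span_scale subsetD[OF mono] diff_residual_span Ry)
  then have "B (R (Suc t) (X + G x *\<^sub>R w t)) (R (Suc t) (X + G x *\<^sub>R w t)) \<le>
      B ((X + G x *\<^sub>R w t) - Z) ((X + G x *\<^sub>R w t) - Z)"
    using X by (intro residual_minimal) simp_all
  also have "(X + G x *\<^sub>R w t) - Z = R t X + (G x - l) *\<^sub>R R t (w t) - l *\<^sub>R R t (N t)"
    unfolding Z_def innovation_eq by (simp add: algebra_simps)
  also have "B \<dots> \<dots> = B (R t X) (R t X) + 2 * (G x - l) * B (R t X) (R t (w t)) +
      (G x - l)\<^sup>2 * B (R t (w t)) (R t (w t)) + l\<^sup>2 * B (R t (N t)) (R t (N t))"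
    using X B_residual_N[OF X] B_residual_N[of "w t" t] XN wN
      B_residual_right[OF X, of "N t" t] B_residual_right[of "w t" "N t" t]
      sym[of "R t (N t)" "R t X"] sym[of "R t (N t)" "R t (w t)"] sym[of "R t (w t)" "R t X"]
    by (simp add: bilinear power2_eq_square algebra_simps)
  also have "B (R t (N t)) (R t (N t)) \<le> 1"
    using residual_minimal[of "N t" 0 t] by (simp add: span_zero)
  finally show ?thesis by (simp add: X_def mult_left_mono)
qed

definition "avg T h = (\<Sum>t\<le>T. h t) / real (T + 1)" for h :: "nat \<Rightarrow> real"

lemma avg_mono: "(\<And>t. h t \<le> h' t) \<Longrightarrow> avg T h \<le> avg T h'"
  by (simp add: avg_def divide_right_mono sum_mono)

lemma avg_linear: "avg T (\<lambda>t. h t + h' t) = avg T h + avg T h'" "avg T (\<lambda>t. h t - h' t) = avg T h - avg T h'"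
  "avg T (\<lambda>t. c * h t) = c * avg T h"
  by (simp_all add: avg_def sum.distrib sum_subtractf sum_distrib_left add_divide_distrib diff_divide_distrib)

lemma avg_const: "avg T (\<lambda>t. c) = c"
  by (simp add: avg_def)

text \<open>Every condition holds for the errors at each time and is linear in their covariances, so
  it passes to the mean over a finite horizon.\<close>

lemma average_feasible:
  "feasible (avg T (\<lambda>t. B (u t) (u t)))
    (\<lambda>x x'. avg T (\<lambda>t. B (R t (st t x)) (R t (st t x'))))
    (\<lambda>x. avg T (\<lambda>t. B (R t (st t x)) (R t (w t))))
    (avg T (\<lambda>t. B (R t (y t)) (R t (y t)) - 1))"
  unfolding feasible_def
proof (intro conjI allI)
  note sl = linear_add[OF linear_st] linear_cmul[OF linear_st] residual_add residual_scale st_mem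
  show "semi_inner UNIV (\<lambda>x x'. avg T (\<lambda>t. B (R t (st t x)) (R t (st t x'))))"
  proof
    show "avg T (\<lambda>t. B (R t (st t (x + x'))) (R t (st t z))) =
        avg T (\<lambda>t. B (R t (st t x)) (R t (st t z))) + avg T (\<lambda>t. B (R t (st t x')) (R t (st t z)))" for x x' z
      unfolding avg_linear[symmetric] by (simp add: sl bilinear)
    show "avg T (\<lambda>t. B (R t (st t (c *\<^sub>R x))) (R t (st t z))) = c * avg T (\<lambda>t. B (R t (st t x)) (R t (st t z)))" for c x z
      unfolding avg_linear[symmetric] by (simp add: sl bilinear)
    show "avg T (\<lambda>t. B (R t (st t x)) (R t (st t z))) = avg T (\<lambda>t. B (R t (st t z)) (R t (st t x)))" for x z
      by (rule arg_cong[of _ _ "avg T"]) (rule ext, rule sym)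
    show "0 \<le> avg T (\<lambda>t. B (R t (st t x)) (R t (st t x)))" for x
      unfolding avg_def by (intro divide_nonneg_nonneg sum_nonneg nonneg) (simp_all add: st_mem)
  qed (simp add: subspace_UNIV)
  show "linear (\<lambda>x. avg T (\<lambda>t. B (R t (st t x)) (R t (w t))))"
    by (rule linearI) (simp_all add: avg_linear[symmetric] sl bilinear)
  have \<kappa>: "B (R t (y t)) (R t (y t)) - 1 = B (R t (w t)) (R t (w t))" for t
    by (simp add: innovation_var_eq)
  fix x c l
  have "0 \<le> B (R t (st t x)) (R t (st t x)) + 2 * c * B (R t (st t x)) (R t (w t)) +
      c\<^sup>2 * (B (R t (y t)) (R t (y t)) - 1)" for t
  proof -
    have "0 \<le> B (R t (st t x) + c *\<^sub>R R t (w t)) (R t (st t x) + c *\<^sub>R R t (w t))"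
      by (rule nonneg) (simp add: st_mem)
    then show ?thesis
      unfolding \<kappa> using sym[of "R t (w t)" "R t (st t x)"]
      by (simp add: bilinear st_mem power2_eq_square algebra_simps)
  qed
  then have "avg T (\<lambda>t. 0) \<le> avg T (\<lambda>t. B (R t (st t x)) (R t (st t x)) + 2 * c * B (R t (st t x)) (R t (w t)) +
      c\<^sup>2 * (B (R t (y t)) (R t (y t)) - 1))" by (rule avg_mono)
  then show "0 \<le> avg T (\<lambda>t. B (R t (st t x)) (R t (st t x))) + 2 * c * avg T (\<lambda>t. B (R t (st t x)) (R t (w t))) +
      c\<^sup>2 * avg T (\<lambda>t. B (R t (y t)) (R t (y t)) - 1)"
    unfolding avg_linear(1) avg_linear(3) avg_const .
  \<comment> \<open>The state error is 0 at time 0 and its final variance is nonnegative, so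
    shifting the time by one can only increase the sum.\<close>
  have "(\<Sum>t\<le>T. B (R t (st t x)) (R t (st t x))) \<le> (\<Sum>t\<le>T. B (R (Suc t) (st (Suc t) x)) (R (Suc t) (st (Suc t) x)))"
  proof -
    let ?h = "\<lambda>t. B (R t (st t x)) (R t (st t x))"
    have "(\<Sum>t\<le>T. ?h t) + ?h (Suc T) = ?h 0 + (\<Sum>t\<le>T. ?h (Suc t))"
      using sum.atMost_Suc[of ?h T] sum.atMost_Suc_shift[of ?h T] by simp
    moreover have "?h 0 = 0" by (simp add: bilinear)
    moreover have "0 \<le> ?h (Suc T)" by (rule nonneg) (rule residual_mem[OF st_mem])
    ultimately show ?thesis by simp
  qed
  then have "avg T (\<lambda>t. B (R t (st t x)) (R t (st t x))) \<le>
      avg T (\<lambda>t. B (R (Suc t) (st (Suc t) x)) (R (Suc t) (st (Suc t) x)))"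
    unfolding avg_def by (intro divide_right_mono) simp_all
  also have "\<dots> \<le> avg T (\<lambda>t. B (R t (st t (\<Phi> x))) (R t (st t (\<Phi> x))) +
      2 * (G x - l) * B (R t (st t (\<Phi> x))) (R t (w t)) + (G x - l)\<^sup>2 * (B (R t (y t)) (R t (y t)) - 1) + l\<^sup>2)"
    unfolding \<kappa> by (rule avg_mono) (rule error_step)
  finally show "avg T (\<lambda>t. B (R t (st t x)) (R t (st t x))) \<le> avg T (\<lambda>t. B (R t (st t (\<Phi> x))) (R t (st t (\<Phi> x)))) +
      2 * (G x - l) * avg T (\<lambda>t. B (R t (st t (\<Phi> x))) (R t (w t))) +
      (G x - l)\<^sup>2 * avg T (\<lambda>t. B (R t (y t)) (R t (y t)) - 1) + l\<^sup>2"
    unfolding avg_linear(1) avg_linear(3) avg_const .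
  \<comment> \<open>The unpredictable part of an input costs no more power than the input.\<close>
  have "B (R t (st t H)) (R t (st t H)) - 2 * B (R t (st t H)) (R t (w t)) + (B (R t (y t)) (R t (y t)) - 1)
      \<le> B (u t) (u t)" for t
  proof -
    have uS: "u t \<in> S" unfolding u by (simp add: st_mem)
    have "B (R t (u t)) (R t (u t)) \<le> B (u t - 0) (u t - 0)"
      by (rule residual_minimal[OF uS]) (simp add: span_zero)
    moreover have "R t (u t) = R t (w t) - R t (st t H)" unfolding u by (simp add: residual_diff st_mem)
    ultimately show ?thesis
      unfolding \<kappa> using sym[of "R t (w t)" "R t (st t H)"] by (simp add: bilinear st_mem)
  qed
  then have "avg T (\<lambda>t. B (R t (st t H)) (R t (st t H)) - 2 * B (R t (st t H)) (R t (w t)) +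
      (B (R t (y t)) (R t (y t)) - 1)) \<le> avg T (\<lambda>t. B (u t) (u t))" by (rule avg_mono)
  then show "avg T (\<lambda>t. B (R t (st t H)) (R t (st t H))) - 2 * avg T (\<lambda>t. B (R t (st t H)) (R t (w t))) +
      avg T (\<lambda>t. B (R t (y t)) (R t (y t)) - 1) \<le> avg T (\<lambda>t. B (u t) (u t))"
    unfolding avg_linear(1) avg_linear(2) avg_linear(3) .
qed

text \<open>The factor \<open>max 1\<close> covers horizons whose average power \<open>p\<close>
  exceeds \<open>P\<close>: scaling the triple by \<open>P / p\<close> makes it comparable with the
  optimum.\<close>

lemma rate_le:
  assumes opt: "\<And>\<sigma> \<gamma> \<kappa>'. feasible P \<sigma> \<gamma> \<kappa>' \<Longrightarrow> \<kappa>' \<le> \<kappa>" and P: "0 < P"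
  shows "(\<Sum>t\<le>T. 1 / 2 * log 2 (B (R t (y t)) (R t (y t)))) / real (T + 1) \<le>
    1 / 2 * log 2 (1 + \<kappa> * max 1 ((\<Sum>t\<le>T. B (u t) (u t)) / real (T + 1) / P))"
proof -
  define p where "p = avg T (\<lambda>t. B (u t) (u t))"
  define k where "k = avg T (\<lambda>t. B (R t (y t)) (R t (y t)) - 1)"
  have f: "\<exists>\<sigma> \<gamma>. feasible p \<sigma> \<gamma> k" unfolding p_def k_def using average_feasible by blast
  have k0: "0 \<le> \<kappa>" using opt[OF feasible_white[of P]] P by simp
  have "k \<le> \<kappa> * max 1 (p / P)"
  proof (cases "p \<le> P")
    case True
    have "k \<le> \<kappa>" using f feasible_mono[OF _ True] opt by blast
    also have "\<dots> \<le> \<kappa> * max 1 (p / P)" using k0 by (simp add: mult_le_cancel_left1)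
    finally show ?thesis .
  next
    case False
    then have a: "0 \<le> P / p" "P / p \<le> 1" "P / p * p = P" using P by simp_all
    obtain \<sigma> \<gamma> where "feasible p \<sigma> \<gamma> k" using f by blast
    from feasible_scale[OF this a(1,2)] have "P / p * k \<le> \<kappa>" unfolding a(3) by (rule opt)
    then have "k \<le> \<kappa> * (p / P)" using P False by (simp add: field_simps)
    also have "\<dots> \<le> \<kappa> * max 1 (p / P)" using k0 by (intro mult_left_mono) auto
    finally show ?thesis .
  qed
  have r1: "0 \<le> B (R t (y t)) (R t (y t)) - 1" for t using innovation_var_ge_1[of t] by simp
  have kn: "0 \<le> k" unfolding k_def avg_def by (intro divide_nonneg_nonneg sum_nonneg r1) simp
  have "(\<Sum>t\<le>T. log 2 (1 + (B (R t (y t)) (R t (y t)) - 1))) \<le> real (T + 1) * log 2 (1 + k)"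
    unfolding k_def avg_def by (rule sum_log_le[OF r1])
  then have "(\<Sum>t\<le>T. log 2 (B (R t (y t)) (R t (y t)))) / real (T + 1) \<le> log 2 (1 + k)"
    by (simp add: field_simps)
  also have "\<dots> \<le> log 2 (1 + \<kappa> * max 1 (p / P))"
    using \<open>k \<le> _\<close> kn by simp
  finally have "1 / 2 * ((\<Sum>t\<le>T. log 2 (B (R t (y t)) (R t (y t)))) / real (T + 1)) \<le>
      1 / 2 * log 2 (1 + \<kappa> * max 1 (p / P))" by (rule mult_left_mono) simp
  then show ?thesis unfolding p_def avg_def sum_distrib_left[symmetric] times_divide_eq_right .
qed

lemma rate_limit_le:
  assumes opt: "\<And>\<sigma> \<gamma> \<kappa>'. feasible P \<sigma> \<gamma> \<kappa>' \<Longrightarrow> \<kappa>' \<le> \<kappa>" and P: "0 < P"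
    and p: "(\<lambda>T. (\<Sum>t\<le>T. B (u t) (u t)) / real (T + 1)) \<longlonglongrightarrow> p" "p \<le> P"
    and Rt: "(\<lambda>T. ereal ((\<Sum>t\<le>T. 1 / 2 * log 2 (B (R t (y t)) (R t (y t)))) / real (T + 1))) \<longlonglongrightarrow> Rt"
  shows "Rt \<le> ereal (1 / 2 * log 2 (1 + \<kappa>))"
proof -
  have k0: "0 \<le> \<kappa>" using opt[OF feasible_white[of P]] P by simp
  have m: "max 1 (p / P) = 1" using p(2) P by (simp add: max_def)
  have "(\<lambda>T. 1 / 2 * log 2 (1 + \<kappa> * max 1 ((\<Sum>t\<le>T. B (u t) (u t)) / real (T + 1) / P))) \<longlonglongrightarrow>
      1 / 2 * log 2 (1 + \<kappa> * max 1 (p / P))"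
    using p P k0 by (intro tendsto_intros) (auto simp: m)
  then have "(\<lambda>T. ereal (1 / 2 * log 2 (1 + \<kappa> * max 1 ((\<Sum>t\<le>T. B (u t) (u t)) / real (T + 1) / P)))) \<longlonglongrightarrow>
      ereal (1 / 2 * log 2 (1 + \<kappa>))" unfolding m by (simp only: mult_1_right lim_ereal)
  from LIMSEQ_le[OF Rt this] show ?thesis using rate_le[OF opt P] by auto
qed

end

end

section \<open>Achievability\<close>

lemma cesaro_mean:
  fixes x :: "nat \<Rightarrow> real"
  assumes "x \<longlonglongrightarrow> L"
  shows "(\<lambda>T. (\<Sum>t\<le>T. x t) / real (T + 1)) \<longlonglongrightarrow> L"
proof (rule LIMSEQ_I)
  fix e :: real assume e: "0 < e"
  obtain N where N: "\<And>t. N \<le> t \<Longrightarrow> \<bar>x t - L\<bar> < e / 2"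
    using LIMSEQ_D[OF assms, of "e / 2"] e by auto
  define M where "M = (\<Sum>t<N. \<bar>x t - L\<bar>)"
  have M0: "0 \<le> M" by (simp add: M_def sum_nonneg)
  obtain N' :: nat where N': "2 * M / e < real N'" using reals_Archimedean2 by blast
  have "norm ((\<Sum>t\<le>T. x t) / real (T + 1) - L) < e" if T: "max N N' \<le> T" for T
  proof -
    have "(\<Sum>t\<le>T. x t) / real (T + 1) - L = (\<Sum>t\<le>T. x t - L) / real (T + 1)"
      by (simp add: sum_subtractf field_simps)
    then have "\<bar>(\<Sum>t\<le>T. x t) / real (T + 1) - L\<bar> \<le> (\<Sum>t\<le>T. \<bar>x t - L\<bar>) / real (T + 1)"
      by (simp add: abs_divide divide_right_mono sum_abs)
    also have "(\<Sum>t\<le>T. \<bar>x t - L\<bar>) \<le> M + (\<Sum>t\<in>{N..T}. \<bar>x t - L\<bar>)"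
    proof -
      have "{..T} = {..<N} \<union> {N..T}" using T by auto
      then show ?thesis unfolding M_def by (simp add: sum.union_disjoint ivl_disj_int)
    qed
    also have "(\<Sum>t\<in>{N..T}. \<bar>x t - L\<bar>) \<le> (\<Sum>t\<in>{N..T}. e / 2)"
      using N by (intro sum_mono) (auto intro: less_imp_le)
    also have "\<dots> \<le> real (T + 1) * (e / 2)" using e by (simp add: mult_right_mono)
    finally have "\<bar>(\<Sum>t\<le>T. x t) / real (T + 1) - L\<bar> \<le> (M + real (T + 1) * (e / 2)) / real (T + 1)"
      by (simp add: divide_right_mono)
    also have "\<dots> < e"
    proof -
      have "2 * M / e < real (T + 1)" using N' T by simp
      then have "M < real (T + 1) * (e / 2)" using e by (simp add: field_simps)
      then show ?thesis by (simp add: field_simps)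
    qed
    finally show ?thesis by simp
  qed
  then show "\<exists>no. \<forall>n\<ge>no. norm ((\<Sum>t\<le>n. x t) / real (n + 1) - L) < e" by blast
qed

text \<open>Driving the zero dynamics with the noiseless output reproduces the channel state, so the
  channel is inverted causally.\<close>

lemma inverse_filter:
  assumes "linear f" "linear G" and f: "\<And>x. f x = \<Phi> x + G x *\<^sub>R H"
  shows "state_functional \<Phi> G (\<lambda>t. state_functional f G u t H + u t) t x = state_functional f G u t x"
proof (induction t arbitrary: x)
  case (Suc t)
  note lin = linear_state_functional[OF assms(1,2), of u t]
  have "state_functional f G u t (f x) = state_functional f G u t (\<Phi> x) + G x *\<^sub>R state_functional f G u t H"
    by (simp only: f linear_add[OF lin] linear_cmul[OF lin])
  then show ?case by (simp add: Suc scaleR_right_distrib)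
qed simp

text \<open>Regress \<open>u t\<close> on the past inputs and outputs; the residual is Gaussian and
  orthogonal to that past, hence an admissible \<open>\<xi> t\<close>.\<close>

lemma causal_feedback_input:
  assumes dims: "state_space_dims m F G H"
    and u: "\<And>t. u t \<in> coordinate_space" "\<And>s t. s \<le> t \<Longrightarrow> cov (noise t) (u s) = 0"
    and y: "\<And>t. y t = state_functional (dual_map F) (dual_vec G) u t (vec_fun H) + u t + noise t"
  shows "\<exists>\<gamma> \<eta> \<xi>. feedback_input F G H \<gamma> \<eta> \<xi> u y"
proof -
  let ?s = "\<lambda>t. state_functional (dual_map F) (dual_vec G) u t (vec_fun H)"
  have yS: "y t \<in> coordinate_space" for t
    unfolding y by (intro coord.mem u noise_mem state_functional_mem coord.sub)
  have Ns: "cov (noise t) (?s s) = 0" if "s \<le> t" for s t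
    unfolding state_functional_sum using that u by (simp add: coord.sum_right coord.bilinear)
  have Ny: "cov (noise t) (y s) = 0" if "s < t" for s t
    unfolding y using that Ns[of s t] u
    by (simp add: coord.bilinear state_functional_mem coord.sub)
  \<comment> \<open>Inputs and outputs are interleaved, so that one projection serves both pasts;
    the first \<open>2 * t\<close> entries cover exactly the times before \<open>t\<close>.\<close>
  define z where "z j = (if even j then u (j div 2) else y (j div 2))" for j
  interpret z: residual_family coordinate_space cov z
    by unfold_locales (simp add: z_def u yS)
  have z_image: "z ` {..<2 * t} \<subseteq> u ` {..<t} \<union> y ` {..<t}" for t
    by (rule image_subsetI) (simp add: z_def)
  define \<xi> where "\<xi> t = residual cov z (2 * t) (u t)" for t
  have "u t - \<xi> t \<in> span (u ` {..<t} \<union> y ` {..<t})" for t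
    unfolding \<xi>_def by (rule subsetD[OF span_mono[OF z_image] z.diff_residual_span])
  then have ab: "\<exists>a b. u t - \<xi> t = (\<Sum>j<t. a j *\<^sub>R u j) + (\<Sum>j<t. b j *\<^sub>R y j)" for t
    by (rule ex_span_two_families)
  have "\<forall>t. \<exists>p. u t - \<xi> t = (\<Sum>j<t. fst p j *\<^sub>R u j) + (\<Sum>j<t. snd p j *\<^sub>R y j)"
  proof
    fix t
    obtain a b where "u t - \<xi> t = (\<Sum>j<t. a j *\<^sub>R u j) + (\<Sum>j<t. b j *\<^sub>R y j)" using ab by blast
    then show "\<exists>p. u t - \<xi> t = (\<Sum>j<t. fst p j *\<^sub>R u j) + (\<Sum>j<t. snd p j *\<^sub>R y j)"
      by (intro exI[of _ "(a, b)"]) (simp only: fst_conv snd_conv)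
  qed
  from choice[OF this] obtain p where
    "\<And>t. u t - \<xi> t = (\<Sum>j<t. fst (p t) j *\<^sub>R u j) + (\<Sum>j<t. snd (p t) j *\<^sub>R y j)" by blast
  then have p: "u t = (\<Sum>j<t. fst (p t) j *\<^sub>R u j) + (\<Sum>j<t. snd (p t) j *\<^sub>R y j) + \<xi> t" for t
    unfolding diff_eq_eq .
  have \<xi>S: "\<xi> t \<in> coordinate_space" for t unfolding \<xi>_def by (rule z.residual_mem[OF u(1)])
  have \<xi>u: "cov (\<xi> t) (u s) = 0" and \<xi>y: "cov (\<xi> t) (y s) = 0" if "s < t" for s t
  proof -
    have "2 * s < 2 * t" "2 * s + 1 < 2 * t" using that by simp_all
    then have "cov (\<xi> t) (z (2 * s)) = 0" "cov (\<xi> t) (z (2 * s + 1)) = 0"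
      unfolding \<xi>_def by (simp_all only: z.residual_orth[OF u(1)])
    then show "cov (\<xi> t) (u s) = 0" "cov (\<xi> t) (y s) = 0" by (simp_all add: z_def)
  qed
  have "feedback_input F G H (\<lambda>t. fst (p t)) (\<lambda>t. snd (p t)) \<xi> u y"
    unfolding feedback_input_def
  proof (intro conjI allI)
    show "y = channel_output F G H u" by (rule ext) (simp only: y channel_output_eq[OF dims])
    show "u t \<omega> = (\<Sum>j<t. fst (p t) j * u j \<omega>) + (\<Sum>j<t. snd (p t) j * y j \<omega>) + \<xi> t \<omega>" for t \<omega>
      using fun_cong[OF p[of t], of \<omega>] by simp
    show "centered_gaussian (\<xi> t)" for t
      by (rule gaussian_subspaceD(2)[OF gaussian_coordinate_space \<xi>S])
    show "independent borel (\<xi> t) (stacked_space {..<t} \<Otimes>\<^sub>M stacked_space {..<t})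
        (\<lambda>\<omega>. (stacked u {..<t} \<omega>, stacked y {..<t} \<omega>))" for t
      by (rule gaussian_pair_independent[OF gaussian_coordinate_space]) (simp_all add: \<xi>S u yS \<xi>u \<xi>y)
    show "independent borel (noise t) (stacked_space {..t} \<Otimes>\<^sub>M stacked_space {..<t})
        (\<lambda>\<omega>. (stacked u {..t} \<omega>, stacked y {..<t} \<omega>))" for t
      by (rule gaussian_pair_independent[OF gaussian_coordinate_space]) (simp_all add: u yS Ny)
  qed
  then show ?thesis by blast
qed

section \<open>The coding scheme of an optimum\<close>

context optimal_system
begin

lemma linear_a_pow: "linear (a ^^ t)"
proof (induction t)
  case (Suc k)
  then show ?case using linear_compose[OF Suc linear_a] by (simp add: comp_def)
qed (simp add: linear_ident)

lemma linear_f: "linear f"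
  by (rule linearI) (simp_all add: f_eq lin scaleR_left_distrib scaleR_right_distrib)

definition D :: "(nat \<Rightarrow> real) \<Rightarrow> (nat + nat \<Rightarrow> real) \<Rightarrow> real" where
  "D x = (\<Sum>i<r. x i *\<^sub>R message i)"

lemma linear_D: "linear D"
  by (rule linearI) (simp_all add: D_def scaleR_left_distrib sum.distrib scaleR_sum_right)

lemma D_mem [simp, intro]: "D x \<in> coordinate_space"
  unfolding D_def by (intro coord.mem message_mem)

lemma cov_D_noise [simp]: "cov (D x) (noise t) = 0" "cov (noise t) (D x) = 0"
  unfolding D_def by (simp_all add: coord.sum_left coord.sum_right coord.bilinear)

lemma cov_D: "cov (D x) (D y) = dot x y"
proof -
  have "cov (D x) (D y) = (\<Sum>i<r. y i * x i)"
    unfolding D_def by (simp add: coord.sum_left coord.sum_right coord.bilinear if_distrib cong: if_cong)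
  also have "\<dots> = (\<Sum>i<r. x i * y i)" by (simp only: mult.commute)
  finally show ?thesis unfolding dot_def .
qed

lemma state_functional_D: "state_functional f G (\<lambda>s. D (h s)) t x = D (state_functional f G h t x)"
  unfolding state_functional_sum by (simp only: linear_sum[OF linear_D] linear_cmul[OF linear_D])

text \<open>The channel output without feedback is \<open>plain\<close>; feeding it back through the filter \<open>tap\<close> removes
  the unstable part of the encoder signal from the channel input.\<close>

definition d :: "nat \<Rightarrow> nat \<Rightarrow> real" where
  "d t = (a ^^ t) k - E ((f ^^ t) H)"

definition plain :: process where
  "plain t = D (d t) + noise t"

definition tap :: "nat \<Rightarrow> real" where
  "tap j = - dot k ((b ^^ j) C)"

definition feed :: process where
  "feed t = (\<Sum>s<t. tap (t - s) *\<^sub>R plain s)"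

definition inp :: process where
  "inp t = D ((a ^^ t) C) + feed t"

definition outp :: process where
  "outp t = state_functional f G inp t H + inp t + noise t"

lemma plain_eq: "plain t = state_functional f G (\<lambda>s. D ((a ^^ s) C)) t H + D ((a ^^ t) C) + noise t"
proof -
  have "(a ^^ t) (E H) + (a ^^ t) C = (a ^^ t) k"
    unfolding linear_add[OF linear_a_pow, symmetric] C_def by simp
  then have "d t = ((a ^^ t) (E H) - E ((f ^^ t) H)) + (a ^^ t) C"
    unfolding d_def by (simp add: algebra_simps)
  then show ?thesis
    unfolding plain_def state_functional_D state_functional_a by (simp only: linear_add[OF linear_D])
qed

lemma plain_mem [simp, intro]: "plain t \<in> coordinate_space"
  unfolding plain_def by (intro coord.mem D_mem noise_mem)

lemma feed_span: "s \<le> t \<Longrightarrow> feed s \<in> span (plain ` {..<t})"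
  unfolding feed_def by (intro span_sum span_scale span_base) auto

lemma outp_diff: "outp t - plain t \<in> span (plain ` {..<t})"
proof -
  have "state_functional f G inp t H = state_functional f G (\<lambda>s. D ((a ^^ s) C) + feed s) t H"
    by (rule arg_cong[of _ _ "\<lambda>u. state_functional f G u t H"]) (rule ext, rule inp_def)
  then have "outp t - plain t = state_functional f G feed t H + feed t"
    unfolding outp_def plain_eq inp_def[of t] state_functional_add by simp
  also have "\<dots> \<in> span (plain ` {..<t})"
    by (intro span_add state_functional_mem feed_span) (simp_all add: subspace_span)
  finally show ?thesis .
qed

lemma outp_span: "span (outp ` {..<t}) = span (plain ` {..<t})"
  by (rule span_unitriangular[OF outp_diff])

lemma ex_feedback_gain: "\<exists>g. \<forall>t. inp t = D ((a ^^ t) C) + (\<Sum>j<t. g t j *\<^sub>R outp j)"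
proof -
  have "\<forall>t. \<exists>g. feed t = (\<Sum>j<t. g j *\<^sub>R outp j)"
    using feed_span[OF order.refl] unfolding outp_span[symmetric] by (blast intro: ex_span_image_lessThan)
  from choice[OF this] obtain g where g: "\<And>t. feed t = (\<Sum>j<t. g t j *\<^sub>R outp j)" by blast
  show ?thesis unfolding inp_def by (intro exI[of _ g] allI) (simp only: g)
qed

text \<open>Iterates \<open>a_eq\<close>: a power of the unstable \<open>a\<close> splits into a
  power of the stable \<open>b\<close> and multiples of \<open>(a ^^ s) k\<close>, the unstable
  parts of earlier outputs. The taps are chosen to cancel the latter.\<close>

lemma a_expand: "(a ^^ t) x = (b ^^ t) x + (\<Sum>s<t. dot k ((b ^^ (t - s)) x) *\<^sub>R (a ^^ s) k)"
proof (induction t arbitrary: x)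
  case (Suc t)
  have "(a ^^ Suc t) x = (a ^^ t) (b x + dot k (b x) *\<^sub>R k)"
    unfolding a_eq[symmetric] by (simp only: funpow_Suc_right comp_def)
  also have "\<dots> = (a ^^ t) (b x) + dot k (b x) *\<^sub>R (a ^^ t) k"
    by (simp only: linear_add[OF linear_a_pow] linear_cmul[OF linear_a_pow])
  also have "(a ^^ t) (b x) = (b ^^ Suc t) x + (\<Sum>s<t. dot k ((b ^^ (Suc t - s)) x) *\<^sub>R (a ^^ s) k)"
  proof -
    have "(b ^^ (t - s)) (b x) = (b ^^ (Suc t - s)) x" if "s \<in> {..<t}" for s
      using that by (simp only: Suc_diff_le less_imp_le lessThan_iff funpow_Suc_right comp_def)
    then show ?thesis unfolding Suc[of "b x"] by (simp only: funpow_Suc_right comp_def cong: sum.cong)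
  qed
  moreover have "(b ^^ (Suc t - t)) x = b x" by (simp add: Suc_diff_le)
  ultimately show ?case by (simp only: sum.lessThan_Suc add.assoc)
qed simp

text \<open>Message content left in the input after the cancellation. It tends to 0, so the input
  becomes a moving average of the noise.\<close>

definition e :: "nat \<Rightarrow> nat \<Rightarrow> real" where
  "e t = (b ^^ t) C - (\<Sum>s<t. tap (t - s) *\<^sub>R E ((f ^^ s) H))"

lemma inp_eq: "inp t = D (e t) + (\<Sum>s<t. tap (t - s) *\<^sub>R noise s)"
proof -
  have "(a ^^ t) C + (\<Sum>s<t. tap (t - s) *\<^sub>R (a ^^ s) k) = (b ^^ t) C"
    unfolding a_expand[of t C] by (simp add: tap_def sum_negf)
  then have "e t = (a ^^ t) C + (\<Sum>s<t. tap (t - s) *\<^sub>R d s)"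
    by (simp add: e_def d_def scaleR_right_diff_distrib sum_subtractf algebra_simps)
  then have "D (e t) = D ((a ^^ t) C) + (\<Sum>s<t. tap (t - s) *\<^sub>R D (d s))"
    by (simp only: linear_add[OF linear_D] linear_sum[OF linear_D] linear_cmul[OF linear_D])
  then show ?thesis by (simp add: inp_def feed_def plain_def scaleR_right_distrib sum.distrib)
qed

text \<open>The energy balance summed over time. For \<open>C\<close> it evaluates the limiting
  power, for \<open>k\<close> the limiting innovation variance.\<close>

lemma b_telescope: "(\<Sum>s<t. (dot k ((b ^^ (t - s)) x))\<^sup>2) = dot x x - dot ((b ^^ t) x) ((b ^^ t) x)"
proof (induction t arbitrary: x)
  case (Suc t)
  have "(\<Sum>s<Suc t. (dot k ((b ^^ (Suc t - s)) x))\<^sup>2) = (\<Sum>s<t. (dot k ((b ^^ (t - s)) (b x)))\<^sup>2) + (dot k (b x))\<^sup>2"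
    by (simp add: Suc_diff_le funpow_Suc_right del: funpow.simps(2) cong: sum.cong_simp)
  also have "\<dots> = dot (b x) (b x) - dot ((b ^^ Suc t) x) ((b ^^ Suc t) x) + (dot k (b x))\<^sup>2"
    unfolding Suc by (simp only: funpow_Suc_right comp_def)
  finally show ?case using b_norm[of x] by simp
qed simp

lemma dot_a_b_pow: "s \<le> t \<Longrightarrow> dot ((a ^^ s) x) ((b ^^ t) z) = dot x ((b ^^ (t - s)) z)"
proof (induction s arbitrary: t)
  case (Suc s)
  then obtain t' where t: "t = Suc t'" by (cases t) auto
  then show ?case using Suc by (simp add: dot_a_b)
qed simp

text \<open>A test variable \<open>Z\<close> orthogonal to the past outputs bounds the innovation
  variance from below by \<open>2 * cov Z (plain t) - cov Z Z\<close>. The vector \<open>x\<close>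
  is left free and later set to \<open>(b ^^ t) k\<close>.\<close>

lemma innovation_lower:
  "1 + 2 * dot (d t) x - dot x x - (\<Sum>s<t. (dot (d s) x)\<^sup>2) \<le> innovation_var cov outp t"
proof -
  interpret p: residual_family coordinate_space cov plain by unfold_locales simp
  have omem: "outp t \<in> coordinate_space" for t
  proof -
    have "(outp t - plain t) + plain t \<in> coordinate_space"
      by (intro coord.mem p.span_y_mem[OF outp_diff] plain_mem)
    then show ?thesis by simp
  qed
  have eq: "innovation_var cov plain t = innovation_var cov outp t"
    by (rule coord.innovation_var_cong[OF plain_mem omem outp_span[symmetric] plain_mem outp_diff])
  \<comment> \<open>The noise coefficients are fitted so that the contribution of \<open>D x\<close>
    to each earlier \<open>plain s\<close> is cancelled.\<close>
  define Z where "Z = noise t + D x - (\<Sum>s<t. dot (d s) x *\<^sub>R noise s)"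
  have Z: "Z \<in> coordinate_space" unfolding Z_def by (intro coord.mem noise_mem D_mem)
  have sn: "cov (\<Sum>s<t. dot (d s) x *\<^sub>R noise s) (noise s') = (if s' < t then dot (d s') x else 0)" for s'
    by (simp add: coord.sum_left coord.bilinear if_distrib cong: if_cong)
  have sD: "cov (\<Sum>s<t. dot (d s) x *\<^sub>R noise s) (D z) = 0" for z
    by (simp add: coord.sum_left coord.bilinear)
  have Zn: "cov Z (noise s) = (if s = t then 1 else 0) - (if s < t then dot (d s) x else 0)" for s
    unfolding Z_def using sn[of s] by (simp add: coord.bilinear)
  have ZD: "cov Z (D z) = dot x z" for z
    unfolding Z_def using sD[of z] by (simp add: coord.bilinear cov_D)
  have Zp: "cov Z (plain s) = (if s = t then 1 else 0) + (if s < t then 0 else dot x (d s))" for s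
    unfolding plain_def using Z Zn[of s] ZD[of "d s"] dt.sym[of x "d s"] by (simp add: coord.bilinear)
  have ZZ: "cov Z Z = 1 + dot x x + (\<Sum>s<t. (dot (d s) x)\<^sup>2)"
  proof -
    have "cov Z Z = cov Z (noise t) + cov Z (D x) - (\<Sum>s<t. dot (d s) x * cov Z (noise s))"
      using Z by (subst (2) Z_def) (simp add: coord.bilinear coord.sum_right)
    also have "(\<Sum>s<t. dot (d s) x * cov Z (noise s)) = - (\<Sum>s<t. (dot (d s) x)\<^sup>2)"
      unfolding sum_negf[symmetric] by (intro sum.cong refl) (simp add: Zn power2_eq_square)
    finally show ?thesis by (simp add: Zn ZD)
  qed
  have "span (plain ` {..<t}) \<subseteq> {X \<in> coordinate_space. cov Z X = 0}"
  proof (rule span_minimal)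
    show "plain ` {..<t} \<subseteq> {X \<in> coordinate_space. cov Z X = 0}" by (auto simp: Zp)
    show "subspace {X \<in> coordinate_space. cov Z X = 0}" using Z by (auto simp: subspace_def coord.bilinear)
  qed
  then have "cov Z (plain t - p.R t (plain t)) = 0" using p.diff_residual_span by blast
  then have ZR: "cov Z (p.R t (plain t)) = 1 + dot x (d t)"
    using Z by (simp add: coord.bilinear Zp)
  have "0 \<le> cov (p.R t (plain t) - Z) (p.R t (plain t) - Z)"
    using Z by (intro coord.nonneg coord.mem p.residual_mem plain_mem)
  then have "2 * cov Z (p.R t (plain t)) - cov Z Z \<le> innovation_var cov plain t"
    using Z coord.sym[of "p.R t (plain t)" Z] by (simp add: coord.bilinear)
  then show ?thesis unfolding eq ZR ZZ using dt.sym[of x "d t"] by simp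
qed

lemma cov_inp:
  "cov (inp t) (inp (t + q)) = dot (e t) (e (t + q)) + (\<Sum>j<t. tap (Suc j) * tap (Suc j + q))"
proof -
  have s: "cov (\<Sum>s<t. c s *\<^sub>R noise s) (\<Sum>s<t + q. c' s *\<^sub>R noise s) = (\<Sum>s<t. c s * c' s)" for c c'
  proof -
    have "cov (\<Sum>s<t. c s *\<^sub>R noise s) (\<Sum>s<t + q. c' s *\<^sub>R noise s) =
        (\<Sum>s<t + q. if s < t then c s * c' s else 0)"
      by (simp add: coord.sum_left coord.sum_right coord.bilinear if_distrib mult.commute cong: if_cong)
    also have "\<dots> = (\<Sum>s<t. c s * c' s)" by (rule sum.mono_neutral_cong_right) auto
    finally show ?thesis .
  qed
  have D: "cov (\<Sum>s<n. c s *\<^sub>R noise s) (D z) = 0" "cov (D z) (\<Sum>s<n. c s *\<^sub>R noise s) = 0" for n z and c :: "nat \<Rightarrow> real"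
    by (simp_all add: coord.sum_left coord.sum_right coord.bilinear)
  have "cov (inp t) (inp (t + q)) = dot (e t) (e (t + q)) + (\<Sum>s<t. tap (t - s) * tap (t + q - s))"
    unfolding inp_eq by (simp add: coord.bilinear cov_D D s)
  also have "(\<Sum>s<t. tap (t - s) * tap (t + q - s)) = (\<Sum>j<t. tap (Suc j) * tap (Suc j + q))"
  proof -
    have "(\<Sum>s<t. tap (t - s) * tap (t + q - s)) = (\<Sum>s<t. tap (Suc (t - Suc s)) * tap (Suc (t - Suc s) + q))"
    proof (rule sum.cong[OF refl])
      fix s assume "s \<in> {..<t}"
      then have "t - s = Suc (t - Suc s)" "t + q - s = Suc (t - Suc s) + q" by auto
      then show "tap (t - s) * tap (t + q - s) = tap (Suc (t - Suc s)) * tap (Suc (t - Suc s) + q)" by simp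
    qed
    then show ?thesis using sum.nat_diff_reindex[of "\<lambda>j. tap (Suc j) * tap (Suc j + q)" t] by simp
  qed
  finally show ?thesis .
qed

end

section \<open>Convergence of power and innovations\<close>

lemma uniform_decay:
  fixes z :: "nat \<Rightarrow> nat \<Rightarrow> real"
  assumes "\<And>i. i < r \<Longrightarrow> \<exists>c\<ge>0. \<forall>j. \<bar>z j i\<bar> \<le> c * \<theta> ^ j" and "0 < \<theta>"
  shows "\<exists>c\<ge>0. \<forall>j. \<forall>i<r. \<bar>z j i\<bar> \<le> c * \<theta> ^ j"
proof -
  have "\<forall>i. \<exists>c. i < r \<longrightarrow> 0 \<le> c \<and> (\<forall>j. \<bar>z j i\<bar> \<le> c * \<theta> ^ j)" using assms(1) by blast
  from choice[OF this] obtain c where c: "\<And>i. i < r \<Longrightarrow> 0 \<le> c i" "\<And>i j. i < r \<Longrightarrow> \<bar>z j i\<bar> \<le> c i * \<theta> ^ j"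
    by blast
  have "\<bar>z j i\<bar> \<le> (\<Sum>i<r. c i) * \<theta> ^ j" if "i < r" for i j
  proof -
    have "c i \<le> (\<Sum>i<r. c i)" using that c(1) by (intro member_le_sum) auto
    then have "c i * \<theta> ^ j \<le> (\<Sum>i<r. c i) * \<theta> ^ j" using assms(2) by (intro mult_right_mono) auto
    then show ?thesis using c(2)[OF that, of j] by simp
  qed
  moreover have "0 \<le> (\<Sum>i<r. c i)" using c(1) by (intro sum_nonneg) auto
  ultimately show ?thesis by blast
qed

lemma decay_weaken:
  assumes "\<exists>c\<ge>0. \<forall>j. \<forall>i<r. \<bar>z j i\<bar> \<le> c * \<theta> ^ j" and "0 < \<theta>" "\<theta> \<le> \<theta>'"
  shows "\<exists>c\<ge>0. \<forall>j :: nat. \<forall>i<(r :: nat). \<bar>z j i :: real\<bar> \<le> c * \<theta>' ^ j"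
proof -
  obtain c where c: "0 \<le> c" "\<And>i j. i < r \<Longrightarrow> \<bar>z j i\<bar> \<le> c * \<theta> ^ j" using assms(1) by blast
  have "\<bar>z j i\<bar> \<le> c * \<theta>' ^ j" if "i < r" for i j
  proof -
    have "c * \<theta> ^ j \<le> c * \<theta>' ^ j" using c(1) assms by (intro mult_left_mono power_mono) auto
    then show ?thesis using c(2)[OF that, of j] by simp
  qed
  then show ?thesis using c(1) by blast
qed

lemma times_power_null: "0 < \<theta> \<Longrightarrow> \<theta> < 1 \<Longrightarrow> (\<lambda>n. real n * \<theta> ^ n) \<longlonglongrightarrow> 0" for \<theta> :: real
  using powser_times_n_limit_0[of \<theta>] by simp

context optimal_system
begin

lemma common_decay:
  "\<exists>\<theta>' c. 0 < \<theta>' \<and> \<theta>' < 1 \<and> 0 \<le> c \<and>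
    (\<forall>j. \<bar>tap j\<bar> \<le> c * \<theta>' ^ j \<and>
      (\<forall>i<r. \<bar>(b ^^ j) C i\<bar> \<le> c * \<theta>' ^ j \<and> \<bar>(b ^^ j) k i\<bar> \<le> c * \<theta>' ^ j \<and> \<bar>E ((f ^^ j) H) i\<bar> \<le> c * \<theta>' ^ j))"
proof -
  obtain \<theta>b where tb: "0 < \<theta>b" "\<theta>b < 1"
    and b: "\<And>x. \<exists>c\<ge>0. \<forall>j. \<forall>i<r. \<bar>(b ^^ j) x i\<bar> \<le> c * \<theta>b ^ j" using b_decay by blast
  define \<theta>' where "\<theta>' = max \<theta> \<theta>b"
  have t': "0 < \<theta>'" "\<theta>' < 1" "\<theta>b \<le> \<theta>'" "\<theta> \<le> \<theta>'" using tb \<theta> by (auto simp: \<theta>'_def)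
  have b': "\<exists>c\<ge>0. \<forall>j. \<forall>i<r. \<bar>(b ^^ j) x i\<bar> \<le> c * \<theta>' ^ j" for x
    by (rule decay_weaken[OF b tb(1) t'(3)])
  have lin: "linear (dot k)" by (rule linearI) (simp_all add: dt.bilinear)
  have "\<exists>c\<ge>0. \<forall>j. \<bar>dot k ((b ^^ j) C)\<bar> \<le> c * \<theta>' ^ j"
    by (rule linear_functional_decay[OF lin _ b']) (simp add: dot_def)
  then obtain c1 where c1: "0 \<le> c1" "\<And>j. \<bar>tap j\<bar> \<le> c1 * \<theta>' ^ j" by (auto simp: tap_def)
  obtain c2 where c2: "0 \<le> c2" "\<And>i j. i < r \<Longrightarrow> \<bar>(b ^^ j) C i\<bar> \<le> c2 * \<theta>' ^ j" using b' by blast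
  obtain c3 where c3: "0 \<le> c3" "\<And>i j. i < r \<Longrightarrow> \<bar>(b ^^ j) k i\<bar> \<le> c3 * \<theta>' ^ j" using b' by blast
  have Ei: "\<exists>c\<ge>0. \<forall>j. \<bar>E ((f ^^ j) H) i\<bar> \<le> c * \<theta> ^ j" if "i < r" for i
  proof -
    have "dot y (unit_fun i) = y i" for y
      using that by (simp add: dot_def unit_fun_def if_distrib[of "\<lambda>c. _ * c"] cong: if_cong)
    then show ?thesis using E_f_decay[of H "unit_fun i"] by simp
  qed
  have "\<exists>c\<ge>0. \<forall>j. \<forall>i<r. \<bar>E ((f ^^ j) H) i\<bar> \<le> c * \<theta> ^ j"
    by (rule uniform_decay[OF Ei \<theta>(1)])
  then have "\<exists>c\<ge>0. \<forall>j. \<forall>i<r. \<bar>E ((f ^^ j) H) i\<bar> \<le> c * \<theta>' ^ j"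
    by (rule decay_weaken) (rule \<theta>(1), rule t'(4))
  then obtain c4 where c4: "0 \<le> c4" "\<And>i j. i < r \<Longrightarrow> \<bar>E ((f ^^ j) H) i\<bar> \<le> c4 * \<theta>' ^ j" by blast
  define c where "c = max (max c1 c2) (max c3 c4)"
  have up: "x \<le> c * \<theta>' ^ j" if "x \<le> c' * \<theta>' ^ j" "c' \<le> c" for x c' j
  proof -
    have "c' * \<theta>' ^ j \<le> c * \<theta>' ^ j" using that(2) t' by (intro mult_right_mono) auto
    then show ?thesis using that(1) by simp
  qed
  have cc: "c1 \<le> c" "c2 \<le> c" "c3 \<le> c" "c4 \<le> c" by (simp_all add: c_def)
  have "0 \<le> c" using c1(1) cc(1) by simp
  moreover have "\<bar>tap j\<bar> \<le> c * \<theta>' ^ j" for j by (rule up[OF c1(2) cc(1)])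
  moreover have "\<bar>(b ^^ j) C i\<bar> \<le> c * \<theta>' ^ j" if "i < r" for i j by (rule up[OF c2(2)[OF that] cc(2)])
  moreover have "\<bar>(b ^^ j) k i\<bar> \<le> c * \<theta>' ^ j" if "i < r" for i j by (rule up[OF c3(2)[OF that] cc(3)])
  moreover have "\<bar>E ((f ^^ j) H) i\<bar> \<le> c * \<theta>' ^ j" if "i < r" for i j by (rule up[OF c4(2)[OF that] cc(4)])
  ultimately show ?thesis using t'(1,2) by blast
qed

text \<open>The sum is a convolution of two geometric sequences of the same ratio, whence the factor
  \<open>real t\<close>.\<close>

lemma e_tendsto: assumes i: "i < r" shows "(\<lambda>t. e t i) \<longlonglongrightarrow> 0"
proof -
  obtain \<theta>' c where t': "0 < \<theta>'" "\<theta>' < 1" and c: "0 \<le> c"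
    and tap: "\<And>j. \<bar>tap j\<bar> \<le> c * \<theta>' ^ j"
    and C: "\<And>j. \<bar>(b ^^ j) C i\<bar> \<le> c * \<theta>' ^ j" and E: "\<And>j. \<bar>E ((f ^^ j) H) i\<bar> \<le> c * \<theta>' ^ j"
    using common_decay i by blast
  have "\<bar>e t i\<bar> \<le> c * \<theta>' ^ t + c * c * (real t * \<theta>' ^ t)" for t
  proof -
    have "\<bar>e t i\<bar> \<le> \<bar>(b ^^ t) C i\<bar> + \<bar>\<Sum>s<t. tap (t - s) * E ((f ^^ s) H) i\<bar>"
      unfolding e_def by simp
    also have "\<bar>\<Sum>s<t. tap (t - s) * E ((f ^^ s) H) i\<bar> \<le> (\<Sum>s<t. c * c * \<theta>' ^ t)"
    proof (rule order.trans[OF sum_abs sum_mono])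
      fix s assume "s \<in> {..<t}"
      then have "\<theta>' ^ (t - s) * \<theta>' ^ s = \<theta>' ^ t" by (simp add: power_add[symmetric])
      moreover have "\<bar>tap (t - s)\<bar> * \<bar>E ((f ^^ s) H) i\<bar> \<le> (c * \<theta>' ^ (t - s)) * (c * \<theta>' ^ s)"
        using tap E c t' by (intro mult_mono) auto
      ultimately show "\<bar>tap (t - s) * E ((f ^^ s) H) i\<bar> \<le> c * c * \<theta>' ^ t"
        by (simp add: abs_mult mult_ac)
    qed
    finally show ?thesis using C[of t] by (simp add: mult_ac)
  qed
  moreover have "(\<lambda>t. c * \<theta>' ^ t + c * c * (real t * \<theta>' ^ t)) \<longlonglongrightarrow> c * 0 + c * c * 0"
    using t' by (intro tendsto_intros LIMSEQ_power_zero times_power_null) simp_all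
  ultimately show ?thesis by (intro Lim_null_comparison[of "\<lambda>t. e t i"]) auto
qed

lemma summable_tap: "summable (\<lambda>j. tap (Suc j) * tap (Suc j + q))"
proof -
  obtain \<theta>' c where t': "0 < \<theta>'" "\<theta>' < 1" and c: "0 \<le> c" and tap: "\<And>j. \<bar>tap j\<bar> \<le> c * \<theta>' ^ j"
    using common_decay by blast
  have "norm (tap (Suc j) * tap (Suc j + q)) \<le> c * c * \<theta>' ^ j" for j
  proof -
    have "\<bar>tap (Suc j)\<bar> * \<bar>tap (Suc j + q)\<bar> \<le> (c * \<theta>' ^ Suc j) * (c * \<theta>' ^ (Suc j + q))"
      by (intro mult_mono tap) (use c t' in auto)
    also have "\<dots> = c * c * (\<theta>' ^ j * \<theta>' ^ (Suc (Suc j) + q))" by (simp add: power_add mult_ac)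
    also have "\<dots> \<le> c * c * (\<theta>' ^ j * 1)"
      using c t' by (intro mult_left_mono power_le_one) auto
    finally show ?thesis by (simp add: abs_mult)
  qed
  moreover have "summable (\<lambda>j. c * c * \<theta>' ^ j)"
    using t' by (intro summable_mult summable_geometric) simp
  ultimately show ?thesis by (rule summable_comparison_test'[rotated])
qed

lemma cov_inp_tendsto:
  "(\<lambda>t. cov (inp t) (inp (t + q))) \<longlonglongrightarrow> (\<Sum>j. tap (Suc j) * tap (Suc j + q))"
proof -
  have "(\<lambda>t. dot (e t) (e (t + q))) \<longlonglongrightarrow> (\<Sum>i<r. 0 * 0)"
    unfolding dot_def by (intro tendsto_intros) (auto intro: e_tendsto LIMSEQ_ignore_initial_segment)
  from tendsto_add[OF this summable_LIMSEQ[OF summable_tap[of q]]]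
  show ?thesis unfolding cov_inp by simp
qed

lemma dot_C_C: "dot C C \<le> P"
proof -
  have "dot C C = \<kappa> - 2 * \<gamma> H + \<sigma> H H"
    unfolding C_def using dt.sym[of "E H" k] by (simp add: dt.bilinear dot_k_k dot_k_E dot_E)
  then show ?thesis using feasible_power[OF feas] by simp
qed

text \<open>After \<open>e t\<close> has died out, the power is the sum of the squared taps, which
  telescopes to \<open>dot C C\<close>.\<close>

lemma inp_power: "(\<lambda>t. cov (inp t) (inp t)) \<longlonglongrightarrow> dot C C"
proof -
  obtain \<theta>' c where t': "0 < \<theta>'" "\<theta>' < 1" and C: "\<And>i j. i < r \<Longrightarrow> \<bar>(b ^^ j) C i\<bar> \<le> c * \<theta>' ^ j"
    using common_decay by blast
  have "(\<lambda>t. (b ^^ t) C i) \<longlonglongrightarrow> 0" if "i < r" for i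
    by (rule geometric_null[OF C[OF that] t'])
  then have "(\<lambda>t. dot ((b ^^ t) C) ((b ^^ t) C)) \<longlonglongrightarrow> (\<Sum>i<r. 0 * 0)"
    unfolding dot_def by (intro tendsto_intros) auto
  then have b0: "(\<lambda>t. dot C C - dot ((b ^^ t) C) ((b ^^ t) C)) \<longlonglongrightarrow> dot C C"
    using tendsto_diff[OF tendsto_const[of "dot C C"]] by fastforce
  have "(\<Sum>j<t. tap (Suc j) * tap (Suc j)) = dot C C - dot ((b ^^ t) C) ((b ^^ t) C)" for t
  proof -
    have "(\<Sum>j<t. tap (Suc j) * tap (Suc j)) = (\<Sum>s<t. tap (Suc (t - Suc s)) * tap (Suc (t - Suc s)))"
      by (rule sum.nat_diff_reindex[symmetric])
    also have "\<dots> = (\<Sum>s<t. (dot k ((b ^^ (t - s)) C))\<^sup>2)"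
    proof (rule sum.cong[OF refl])
      fix s assume "s \<in> {..<t}"
      then have "Suc (t - Suc s) = t - s" by auto
      then show "tap (Suc (t - Suc s)) * tap (Suc (t - Suc s)) = (dot k ((b ^^ (t - s)) C))\<^sup>2"
        by (simp only: tap_def power2_eq_square minus_mult_minus)
    qed
    finally show ?thesis by (simp only: b_telescope)
  qed
  then have "(\<lambda>t. \<Sum>j<t. tap (Suc j) * tap (Suc j)) \<longlonglongrightarrow> dot C C" using b0 by simp
  then have "(\<Sum>j. tap (Suc j) * tap (Suc j + 0)) = dot C C"
    using LIMSEQ_unique[OF summable_LIMSEQ[OF summable_tap[of 0]]] by simp
  then show ?thesis using cov_inp_tendsto[of 0] by simp
qed

text \<open>For \<open>x = (b ^^ t) k\<close> the pairing with \<open>d s\<close> is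
  \<open>h (t - s)\<close> up to \<open>w s t\<close>, of order \<open>\<theta>' ^ t\<close>.
  Without these errors \<open>b_telescope\<close> makes the bound exactly
  \<open>1 + \<kappa>\<close>; there are about \<open>t\<close> of them.\<close>

lemma innovation_lower_tendsto:
  "\<exists>L. (\<forall>t. L t \<le> innovation_var cov outp t) \<and> L \<longlonglongrightarrow> 1 + \<kappa>"
proof -
  obtain \<theta>' c where t': "0 < \<theta>'" "\<theta>' < 1" and c: "0 \<le> c"
    and K: "\<And>i j. i < r \<Longrightarrow> \<bar>(b ^^ j) k i\<bar> \<le> c * \<theta>' ^ j"
    and EH: "\<And>i j. i < r \<Longrightarrow> \<bar>E ((f ^^ j) H) i\<bar> \<le> c * \<theta>' ^ j"
    using common_decay by blast
  have p1: "\<theta>' ^ j \<le> 1" for j using t' by (intro power_le_one) auto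
  define M where "M = real r * (c * c)"
  have M0: "0 \<le> M" using c by (simp add: M_def)
  define w where "w s t = dot (E ((f ^^ s) H)) ((b ^^ t) k)" for s t
  define h where "h j = dot k ((b ^^ j) k)" for j
  have w: "\<bar>w s t\<bar> \<le> M * \<theta>' ^ t" for s t
  proof -
    have "\<bar>w s t\<bar> \<le> (\<Sum>i<r. \<bar>E ((f ^^ s) H) i * (b ^^ t) k i\<bar>)"
      unfolding w_def dot_def by (rule sum_abs)
    also have "\<dots> \<le> (\<Sum>i<r. c * (c * \<theta>' ^ t))"
    proof (rule sum_mono)
      fix i assume "i \<in> {..<r}"
      then have i: "i < r" by simp
      have "\<bar>E ((f ^^ s) H) i\<bar> \<le> c" using EH[OF i, of s] mult_left_mono[OF p1 c, of s] by simp
      then show "\<bar>E ((f ^^ s) H) i * (b ^^ t) k i\<bar> \<le> c * (c * \<theta>' ^ t)"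
        unfolding abs_mult using K[OF i] c t' by (intro mult_mono) auto
    qed
    finally show ?thesis by (simp add: M_def mult_ac)
  qed
  have h: "\<bar>h j\<bar> \<le> (\<Sum>i<r. \<bar>k i\<bar> * c)" for j
  proof -
    have "\<bar>h j\<bar> \<le> (\<Sum>i<r. \<bar>k i * (b ^^ j) k i\<bar>)" unfolding h_def dot_def by (rule sum_abs)
    also have "\<dots> \<le> (\<Sum>i<r. \<bar>k i\<bar> * c)"
    proof (rule sum_mono)
      fix i assume "i \<in> {..<r}"
      then have "\<bar>(b ^^ j) k i\<bar> \<le> c" using K[of i j] mult_left_mono[OF p1 c, of j] by simp
      then show "\<bar>k i * (b ^^ j) k i\<bar> \<le> \<bar>k i\<bar> * c" unfolding abs_mult by (intro mult_left_mono) auto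
    qed
    finally show ?thesis .
  qed
  define h0 where "h0 = (\<Sum>i<r. \<bar>k i\<bar> * c)"
  define N where "N = 2 * h0 * M + M * M"
  have h0: "0 \<le> h0" unfolding h0_def using c by (intro sum_nonneg) auto
  define L where "L t = 1 + \<kappa> - 2 * (M * \<theta>' ^ t) - N * (real t * \<theta>' ^ t)" for t
  have "L t \<le> innovation_var cov outp t" for t
  proof -
    let ?x = "(b ^^ t) k"
    have d: "dot (d s) ?x = h (t - s) - w s t" if "s \<le> t" for s
      unfolding d_def by (simp add: dt.bilinear dot_a_b_pow[OF that] h_def w_def)
    have sq: "(h j - w s t)\<^sup>2 \<le> (h j)\<^sup>2 + N * \<theta>' ^ t" for j s
    proof -
      have "(h j - w s t)\<^sup>2 = (h j)\<^sup>2 - 2 * (h j * w s t) + (w s t)\<^sup>2"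
        by (simp add: power2_eq_square algebra_simps)
      moreover have "\<bar>h j * w s t\<bar> \<le> h0 * (M * \<theta>' ^ t)"
        unfolding abs_mult using h[of j] w[of s t] h0 by (intro mult_mono) (auto simp: h0_def)
      moreover have "(w s t)\<^sup>2 \<le> M * M * \<theta>' ^ t"
      proof -
        have "\<bar>w s t\<bar> * \<bar>w s t\<bar> \<le> (M * \<theta>' ^ t) * (M * 1)"
          using w[of s t] M0 mult_left_mono[OF p1[of t] M0] t' by (intro mult_mono) auto
        then show ?thesis by (simp add: power2_eq_square mult_ac flip: abs_mult)
      qed
      ultimately show ?thesis by (simp add: N_def algebra_simps abs_le_iff)
    qed
    have "(\<Sum>s<t. (dot (d s) ?x)\<^sup>2) \<le> (\<Sum>s<t. (h (t - s))\<^sup>2 + N * \<theta>' ^ t)"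
      using sq by (intro sum_mono) (simp add: d)
    also have "\<dots> = \<kappa> - dot ?x ?x + N * (real t * \<theta>' ^ t)"
      using b_telescope[of t k] by (simp add: sum.distrib h_def dot_k_k mult_ac)
    finally have "1 + 2 * dot (d t) ?x - \<kappa> - N * (real t * \<theta>' ^ t) \<le> innovation_var cov outp t"
      using innovation_lower[of t ?x] by simp
    moreover have "dot (d t) ?x = \<kappa> - w t t" using d[of t] by (simp add: h_def dot_k_k)
    moreover have "w t t \<le> M * \<theta>' ^ t" using w[of t t] by simp
    ultimately show ?thesis by (simp add: L_def)
  qed
  moreover have "L \<longlonglongrightarrow> 1 + \<kappa> - 2 * (M * 0) - N * 0"
    unfolding L_def using t' by (intro tendsto_intros LIMSEQ_power_zero times_power_null) simp_all
  ultimately show ?thesis by auto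
qed

end

section \<open>Both capacities are at most the optimal rate\<close>

context dual_system
begin

context
  fixes F :: rmat and Gv Hv :: rvec and P \<kappa> :: real
  assumes dims: "state_space_dims m F Gv Hv"
    and G_eq: "G = dual_vec Gv" and H_eq: "H = vec_fun Hv"
    and F_eq: "\<And>x. dual_map F x = \<Phi> x + G x *\<^sub>R H"
    and opt: "\<And>\<sigma> \<gamma> \<kappa>'. feasible P \<sigma> \<gamma> \<kappa>' \<Longrightarrow> \<kappa>' \<le> \<kappa>" and P: "0 < P"
begin

lemma input_eq:
  "u t = state_functional (dual_map F) G u t H + u t -
    state_functional \<Phi> G (\<lambda>t. state_functional (dual_map F) G u t H + u t) t H"
  unfolding inverse_filter[OF linear_dual_map linear_G F_eq] by simp

lemma coding_capacity_le: "coding_capacity F Gv Hv P n \<le> ereal (1 / 2 * log 2 (1 + \<kappa>))"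
  unfolding coding_capacity_def
proof (rule Sup_least, clarify)
  fix Rt A C g u y
  assume adm: "admissible_encoder F n A C" and cs: "coding_structure F Gv Hv n A C g u y"
    and pc: "power_constraint P u" and Rt: "(\<lambda>T. ereal (1 / real (T + 1) * coding_information n y T)) \<longlonglongrightarrow> Rt"
  have AC: "A \<in> carrier_mat (n + 1) (n + 1)" "C \<in> carrier_vec (n + 1)" using adm by (simp_all add: admissible_encoder_def)
  let ?w = "\<lambda>t. state_functional (dual_map F) G u t H + u t"
  have u: "u t = encoder_signal n A C t + (\<Sum>j<t. g t j *\<^sub>R y j)"
    and y: "y t = ?w t + noise t" for t
    using cs unfolding coding_structure_iff[OF dims AC] G_eq H_eq by blast+
  note no = coding_noisy_output[OF encoder_signal_span u y]
  have yy: "noisy_output.y ?w noise = y" by (rule ext) (simp only: noisy_output.y_def[OF no] y)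
  have uS: "u t \<in> coordinate_space" for t by (rule coding_mem(1)[OF encoder_signal_span u y])
  obtain p where p: "p \<le> P" "average_power u \<longlonglongrightarrow> p" using pc by (auto simp: power_constraint_def)
  show "Rt \<le> ereal (1 / 2 * log 2 (1 + \<kappa>))"
  proof (rule rate_limit_le[OF no input_eq opt P _ p(1)])
    show "(\<lambda>T. (\<Sum>t\<le>T. cov (u t) (u t)) / real (T + 1)) \<longlonglongrightarrow> p"
      using p(2) unfolding average_power_coordinate[OF uS, abs_def] .
    show "(\<lambda>T. ereal ((\<Sum>t\<le>T. 1 / 2 * log 2 (innovation_var cov (noisy_output.y ?w noise) t)) / real (T + 1))) \<longlonglongrightarrow> Rt"
      using Rt unfolding yy coding_information_innovation[OF encoder_signal_span u y] by simp
  qed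
qed

lemma feedback_capacity_le: "feedback_capacity F Gv Hv P \<le> ereal (1 / 2 * log 2 (1 + \<kappa>))"
  unfolding feedback_capacity_def
proof (rule Sup_least, clarify)
  fix Rt \<gamma> \<eta> \<xi> u y
  assume fb: "feedback_input F Gv Hv \<gamma> \<eta> \<xi> u y" and pc: "power_constraint P u"
    and Rt: "(\<lambda>T. ereal (1 / real (T + 1) * directed_information u y T)) \<longlonglongrightarrow> Rt"
  let ?w = "\<lambda>t. state_functional (dual_map F) G u t H + u t"
  note fg = feedback_gaussian[OF dims fb, folded G_eq H_eq]
  note no = fg(2)
  have yy: "noisy_output.y ?w noise = y" by (rule ext) (simp only: noisy_output.y_def[OF no] fg(3))
  have uS: "u t \<in> span (range u \<union> range y)" for t by (rule span_base) simp
  have ap: "average_power u T = (\<Sum>t\<le>T. cov (u t) (u t)) / real (T + 1)" for T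
    by (intro average_power_eq expectation_centered_square(2) gaussian_subspaceD(2)[OF fg(1)] uS)
  obtain p where p: "p \<le> P" "average_power u \<longlonglongrightarrow> p" using pc by (auto simp: power_constraint_def)
  show "Rt \<le> ereal (1 / 2 * log 2 (1 + \<kappa>))"
  proof (rule rate_limit_le[OF no input_eq opt P _ p(1)])
    show "(\<lambda>T. (\<Sum>t\<le>T. cov (u t) (u t)) / real (T + 1)) \<longlonglongrightarrow> p"
      using p(2) unfolding ap[abs_def] .
    show "(\<lambda>T. ereal ((\<Sum>t\<le>T. 1 / 2 * log 2 (innovation_var cov (noisy_output.y ?w noise) t)) / real (T + 1))) \<longlonglongrightarrow> Rt"
      using Rt unfolding yy fg(4) by simp
  qed
qed

end

end

section \<open>Both capacities are at least the optimal rate\<close>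

context optimal_system
begin

context
  fixes F :: rmat and Gv Hv :: rvec and n :: nat
  assumes dims: "state_space_dims m F Gv Hv"
    and G_eq: "G = dual_vec Gv" and H_eq: "H = vec_fun Hv" and F_eq: "f = dual_map F"
    and st: "stable_mat F" and n: "r = n + 1"
    and opt: "\<And>\<sigma> \<gamma> \<kappa>'. feasible P \<sigma> \<gamma> \<kappa>' \<Longrightarrow> \<kappa>' \<le> \<kappa>" and P: "0 < P"
begin

lemma D_encoder: "encoder_signal n A (Matrix.vec r C) t = D ((a ^^ t) C)"
  unfolding encoder_signal_def D_def n[symmetric] dual_map_A vec_fun_C ..

lemma D_span: "D ((a ^^ t) C) \<in> span (message ` {..n})"
  unfolding D_encoder[symmetric] by (rule encoder_signal_span)

lemma scheme_noisy_output: "noisy_output coordinate_space cov (\<lambda>t. state_functional f G inp t H + inp t) noise"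
  and inp_mem: "inp t \<in> coordinate_space"
proof -
  obtain g where g: "\<And>t. inp t = D ((a ^^ t) C) + (\<Sum>j<t. g t j *\<^sub>R outp j)" using ex_feedback_gain by blast
  show "noisy_output coordinate_space cov (\<lambda>t. state_functional f G inp t H + inp t) noise"
    by (rule coding_noisy_output[OF D_span g outp_def])
  show "inp t \<in> coordinate_space" by (rule coding_mem(1)[OF D_span g outp_def])
qed

lemma scheme_power: "average_power inp \<longlonglongrightarrow> dot C C"
  unfolding average_power_coordinate[OF inp_mem, abs_def] by (rule cesaro_mean[OF inp_power])

lemma scheme_power_constraint: "power_constraint P inp"
  using scheme_power dot_C_C by (auto simp: power_constraint_def)

text \<open>Squeezed between the lower bound on the innovations and the converse applied to the
  scheme itself, which takes the place of an upper estimate of the innovations.\<close>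

lemma scheme_rate:
  "(\<lambda>T. (\<Sum>t\<le>T. 1 / 2 * log 2 (innovation_var cov outp t)) / real (T + 1)) \<longlonglongrightarrow> 1 / 2 * log 2 (1 + \<kappa>)"
proof -
  let ?w = "\<lambda>t. state_functional f G inp t H + inp t"
  interpret no: noisy_output coordinate_space cov ?w noise by (rule scheme_noisy_output)
  have yy: "no.y = outp" by (rule ext) (simp only: no.y_def outp_def)
  have u: "inp t = ?w t - state_functional \<Phi> G ?w t H" for t
    unfolding inverse_filter[OF linear_f linear_G f_eq] by simp
  obtain L where L: "\<And>t. L t \<le> innovation_var cov outp t" "L \<longlonglongrightarrow> 1 + \<kappa>" using innovation_lower_tendsto by blast
  have k0: "0 \<le> \<kappa>" by (rule kappa_nonneg)
  \<comment> \<open>\<open>L t\<close> may be negative for small \<open>t\<close>. Cutting at 1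
    keeps the logarithms meaningful and is harmless, since innovation variances are at least
    1.\<close>
  have "(\<lambda>t. 1 / 2 * log 2 (max 1 (L t))) \<longlonglongrightarrow> 1 / 2 * log 2 (max 1 (1 + \<kappa>))"
    using k0 by (intro tendsto_intros L(2)) auto
  then have lower: "(\<lambda>T. (\<Sum>t\<le>T. 1 / 2 * log 2 (max 1 (L t))) / real (T + 1)) \<longlonglongrightarrow> 1 / 2 * log 2 (1 + \<kappa>)"
    using k0 by (intro cesaro_mean) simp
  have pow: "(\<lambda>T. (\<Sum>t\<le>T. cov (inp t) (inp t)) / real (T + 1)) \<longlonglongrightarrow> dot C C" by (rule cesaro_mean[OF inp_power])
  have mx: "max 1 (dot C C / P) = 1" using dot_C_C P by (simp add: max_def)
  have "(\<lambda>T. 1 / 2 * log 2 (1 + \<kappa> * max 1 ((\<Sum>t\<le>T. cov (inp t) (inp t)) / real (T + 1) / P))) \<longlonglongrightarrow>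
      1 / 2 * log 2 (1 + \<kappa> * max 1 (dot C C / P))"
    using P k0 by (intro tendsto_intros pow) (auto simp: mx)
  then have upper: "(\<lambda>T. 1 / 2 * log 2 (1 + \<kappa> * max 1 ((\<Sum>t\<le>T. cov (inp t) (inp t)) / real (T + 1) / P))) \<longlonglongrightarrow>
      1 / 2 * log 2 (1 + \<kappa>)" unfolding mx by simp
  show ?thesis
  proof (rule tendsto_sandwich[OF _ _ lower upper])
    show "\<forall>\<^sub>F T in sequentially. (\<Sum>t\<le>T. 1 / 2 * log 2 (max 1 (L t))) / real (T + 1) \<le>
        (\<Sum>t\<le>T. 1 / 2 * log 2 (innovation_var cov outp t)) / real (T + 1)"
    proof (intro always_eventually allI divide_right_mono sum_mono mult_left_mono)
      fix t
      have "max 1 (L t) \<le> innovation_var cov outp t"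
        using L(1)[of t] no.innovation_var_ge_1[of t] unfolding yy by simp
      then show "log 2 (max 1 (L t)) \<le> log 2 (innovation_var cov outp t)" by simp
    qed simp_all
    show "\<forall>\<^sub>F T in sequentially. (\<Sum>t\<le>T. 1 / 2 * log 2 (innovation_var cov outp t)) / real (T + 1) \<le>
        1 / 2 * log 2 (1 + \<kappa> * max 1 ((\<Sum>t\<le>T. cov (inp t) (inp t)) / real (T + 1) / P))"
      by (intro always_eventually allI rate_le[OF scheme_noisy_output u opt P, unfolded yy])
  qed
qed

lemma coding_capacity_ge: "ereal (1 / 2 * log 2 (1 + \<kappa>)) \<le> coding_capacity F Gv Hv P n"
  unfolding coding_capacity_def
proof (rule Sup_upper, rule CollectI)
  obtain g where g: "\<And>t. inp t = D ((a ^^ t) C) + (\<Sum>j<t. g t j *\<^sub>R outp j)" using ex_feedback_gain by blast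
  have AC: "A \<in> carrier_mat (n + 1) (n + 1)" "Matrix.vec r C \<in> carrier_vec (n + 1)"
    using dual_mat_carrier[of r a] unfolding n by simp_all
  have "admissible_encoder F n A (Matrix.vec r C)"
    unfolding admissible_encoder_def
  proof (intro conjI AC allI impI)
    show "observable (n + 1) A (Matrix.vec r C)" using observable_A unfolding n .
    fix z assume z: "eigenvalue (cmat A) z"
    have "1 < cmod z" by (rule eigenvalue_A[OF z])
    then show "cmod z \<noteq> 1" by simp
    show "\<not> eigenvalue (cmat F) z" using \<open>1 < cmod z\<close> st by (auto simp: stable_mat_def)
  qed
  moreover have "coding_structure F Gv Hv n A (Matrix.vec r C) g inp outp"
    unfolding coding_structure_iff[OF dims AC] D_encoder G_eq[symmetric] H_eq[symmetric] F_eq[symmetric]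
    using g outp_def by blast
  moreover have "(\<lambda>T. ereal (1 / real (T + 1) * coding_information n outp T)) \<longlonglongrightarrow> ereal (1 / 2 * log 2 (1 + \<kappa>))"
    using scheme_rate unfolding coding_information_innovation[OF D_span g outp_def] by simp
  ultimately show "\<exists>A C g u y. admissible_encoder F n A C \<and> coding_structure F Gv Hv n A C g u y \<and>
      power_constraint P u \<and> (\<lambda>T. ereal (1 / real (T + 1) * coding_information n y T)) \<longlonglongrightarrow> ereal (1 / 2 * log 2 (1 + \<kappa>))"
    using scheme_power_constraint by blast
qed

text \<open>The coding scheme itself is a feedback input: the message is absorbed by the past
  signals and the regression residuals, and its autocovariances converge.\<close>

lemma feedback_capacity_ge: "ereal (1 / 2 * log 2 (1 + \<kappa>)) \<le> feedback_capacity F Gv Hv P"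
  unfolding feedback_capacity_def
proof (rule Sup_upper, rule CollectI)
  obtain g where g: "\<And>t. inp t = D ((a ^^ t) C) + (\<Sum>j<t. g t j *\<^sub>R outp j)" using ex_feedback_gain by blast
  have cn: "cov (noise t) (inp s) = 0" if "s \<le> t" for s t
    unfolding inp_eq using that by (simp add: coord.bilinear coord.sum_right)
  have outp: "outp t = state_functional (dual_map F) (dual_vec Gv) inp t (vec_fun Hv) + inp t + noise t" for t
    using outp_def[of t] unfolding G_eq H_eq F_eq .
  obtain \<gamma>' \<eta> \<xi> where fb: "feedback_input F Gv Hv \<gamma>' \<eta> \<xi> inp outp"
    using causal_feedback_input[OF dims inp_mem cn outp] by blast
  have "convergent (\<lambda>t. \<integral>\<omega>. inp t \<omega> * inp (t + q) \<omega> \<partial>gauss_space)" for q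
    using cov_inp_tendsto[of q] unfolding cov_def convergent_def by blast
  then have "asymptotically_stationary inp" by (simp add: asymptotically_stationary_def)
  moreover have "(\<lambda>T. ereal (1 / real (T + 1) * directed_information inp outp T)) \<longlonglongrightarrow> ereal (1 / 2 * log 2 (1 + \<kappa>))"
    using scheme_rate unfolding feedback_gaussian(4)[OF dims fb] by simp
  ultimately show "\<exists>\<gamma> \<eta> \<xi> u y. feedback_input F Gv Hv \<gamma> \<eta> \<xi> u y \<and> asymptotically_stationary u \<and>
      power_constraint P u \<and> (\<lambda>T. ereal (1 / real (T + 1) * directed_information u y T)) \<longlonglongrightarrow> ereal (1 / 2 * log 2 (1 + \<kappa>))"
    using fb scheme_power_constraint by blast
qed

end

end

section \<open>The zero dynamics of the channel\<close>

text \<open>Entrywise equations for the resolvent applied to \<open>G\<close>, with uniqueness, in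
  place of the matrix inverse inside \<open>state_space_tf\<close>.\<close>

lemma resolvent:
  assumes F: "F \<in> carrier_mat m m" and G: "G \<in> carrier_vec m" and z: "\<not> eigenvalue (cmat F) z"
  shows "\<exists>x\<in>carrier_vec m. state_space_tf m F G H z = scalar_prod (cvec H) x + 1 \<and>
    (\<forall>i<m. z * x $ i - (\<Sum>j<m. complex_of_real (F $$ (i, j)) * x $ j) = complex_of_real (G $ i)) \<and>
    (\<forall>v\<in>carrier_vec m. \<forall>c. (\<forall>i<m. z * v $ i - (\<Sum>j<m. complex_of_real (F $$ (i, j)) * v $ j) = c * complex_of_real (G $ i)) \<longrightarrow> v = c \<cdot>\<^sub>v x)"
proof -
  define M where "M = z \<cdot>\<^sub>m 1\<^sub>m m - cmat F"
  have M: "M \<in> carrier_mat m m" using F by (simp add: M_def minus_carrier_mat)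
  have cG: "cvec G \<in> carrier_vec m" using G by simp
  have Mv: "(M *\<^sub>v v) $ i = z * v $ i - (\<Sum>j<m. complex_of_real (F $$ (i, j)) * v $ j)"
    if "v \<in> carrier_vec m" "i < m" for v i
  proof -
    have "(M *\<^sub>v v) $ i = (\<Sum>j<m. M $$ (i, j) * v $ j)"
      using that M by (simp add: scalar_prod_def atLeast0LessThan)
    also have "\<dots> = (\<Sum>j<m. (if j = i then z * v $ j else 0) - complex_of_real (F $$ (i, j)) * v $ j)"
      using that F by (intro sum.cong refl) (simp add: M_def ring_distribs)
    finally show ?thesis using that by (simp add: sum_subtractf)
  qed
  have "det M \<noteq> 0"
  proof -
    have "det (char_matrix (cmat F) z) \<noteq> 0" using z eigenvalue_det[of "cmat F" m z] F by simp
    moreover have "M = - char_matrix (cmat F) z"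
      using F unfolding M_def char_matrix_def by (intro eq_matI) auto
    moreover have "char_matrix (cmat F) z \<in> carrier_mat m m" using F by simp
    ultimately show ?thesis using det_0_negate[of "char_matrix (cmat F) z" m] by simp
  qed
  then have unit: "M \<in> Units (ring_mat TYPE(complex) m ())" by (rule det_non_zero_imp_unit[OF M])
  obtain B where B: "mat_inverse M = Some B"
    using mat_inverse(1)[OF M, of "()"] unit by (cases "mat_inverse M") auto
  have inv: "M * B = 1\<^sub>m m" "B * M = 1\<^sub>m m" "B \<in> carrier_mat m m" using mat_inverse(2)[OF M B] by auto
  define x where "x = B *\<^sub>v cvec G"
  have x: "x \<in> carrier_vec m" using inv(3) cG by (simp add: x_def)
  have "state_space_tf m F G H z = scalar_prod (cvec H) x + 1"
    by (simp add: state_space_tf_def M_def[symmetric] B x_def)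
  moreover have "M *\<^sub>v x = cvec G"
    unfolding x_def using assoc_mult_mat_vec[OF M inv(3) cG] inv(1) cG by simp
  then have "z * x $ i - (\<Sum>j<m. complex_of_real (F $$ (i, j)) * x $ j) = complex_of_real (G $ i)" if "i < m" for i
    using Mv[OF x that] G that by simp
  moreover have "v = c \<cdot>\<^sub>v x"
    if v: "v \<in> carrier_vec m" and e: "\<forall>i<m. z * v $ i - (\<Sum>j<m. complex_of_real (F $$ (i, j)) * v $ j) = c * complex_of_real (G $ i)"
    for v c
  proof -
    have "M *\<^sub>v v = c \<cdot>\<^sub>v cvec G" using e Mv[OF v] G M v by (intro eq_vecI) auto
    then have "B *\<^sub>v (M *\<^sub>v v) = B *\<^sub>v (c \<cdot>\<^sub>v cvec G)" by simp
    then show ?thesis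
      using assoc_mult_mat_vec[OF inv(3) M v] inv(2) v mult_mat_vec[OF inv(3) cG, of c] by (simp add: x_def)
  qed
  ultimately show ?thesis using x by blast
qed

lemma zero_dynamics_mat:
  assumes "state_space_dims m F G H"
  defines "M \<equiv> Matrix.mat m m (\<lambda>(i, j). F $$ (i, j) - G $ i * H $ j)"
  shows "dual_map M x = dual_map F x - dual_vec G x *\<^sub>R vec_fun H"
  using assms
  by (auto simp: fun_eq_iff dual_map_def dual_vec_def vec_fun_def state_space_dims_def algebra_simps sum_subtractf sum_distrib_left)

text \<open>An eigenvalue of the zero dynamics outside the open disc is not one of \<open>F\<close>
  and would be a zero of the transfer function \<open>den / num\<close>; but \<open>den\<close> has
  all its roots inside the disc.\<close>

lemma zero_dynamics_stable:
  assumes mp: "stable_min_phase num den" and re: "realizes m F G H den num" and st: "stable_mat F"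
  shows "stable_mat (Matrix.mat m m (\<lambda>(i, j). F $$ (i, j) - G $ i * H $ j))" (is "stable_mat ?M")
  unfolding stable_mat_def
proof (intro allI impI, rule ccontr)
  fix z assume ev: "eigenvalue (cmat ?M) z" and "\<not> cmod z < 1"
  then have z1: "1 \<le> cmod z" by simp
  have FGH: "F \<in> carrier_mat m m" "G \<in> carrier_vec m" "H \<in> carrier_vec m"
    using re by (auto simp: realizes_def state_space_dims_def)
  have nF: "\<not> eigenvalue (cmat F) z" using st z1 by (auto simp: stable_mat_def)
  have num: "cpoly num z \<noteq> 0" and den: "cpoly den z \<noteq> 0" using mp z1 by (auto simp: stable_min_phase_def)
  obtain x where x: "x \<in> carrier_vec m" "state_space_tf m F G H z = scalar_prod (cvec H) x + 1"
    and uniq: "\<And>v c. v \<in> carrier_vec m \<Longrightarrow> (\<forall>i<m. z * v $ i - (\<Sum>j<m. complex_of_real (F $$ (i, j)) * v $ j) = c * complex_of_real (G $ i)) \<Longrightarrow> v = c \<cdot>\<^sub>v x"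
    using resolvent[OF FGH(1,2) nF, of H] by blast
  have "?M \<in> carrier_mat m m" by simp
  from ev[unfolded eigenvalue_cmat_iff[OF this]] obtain h where h0: "\<exists>i<m. h i \<noteq> 0"
    and h: "\<And>i. i < m \<Longrightarrow> (\<Sum>j<m. complex_of_real (?M $$ (i, j)) * h j) = z * h i" by blast
  define v where "v = Matrix.vec m h"
  \<comment> \<open>The output of the eigenvector. The eigenvector solves the resolvent equation
    with input \<open>- \<zeta>\<close>, which forces the pairing of \<open>H\<close> with
    \<open>x\<close> to be -1.\<close>
  define \<zeta> where "\<zeta> = (\<Sum>j<m. complex_of_real (H $ j) * h j)"
  have veq: "v = (- \<zeta>) \<cdot>\<^sub>v x"
  proof (rule uniq)
    show "v \<in> carrier_vec m" by (simp add: v_def)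
    show "\<forall>i<m. z * v $ i - (\<Sum>j<m. complex_of_real (F $$ (i, j)) * v $ j) = - \<zeta> * complex_of_real (G $ i)"
    proof (intro allI impI)
      fix i assume i: "i < m"
      have "z * h i = (\<Sum>j<m. complex_of_real (F $$ (i, j)) * h j - complex_of_real (G $ i) * (complex_of_real (H $ j) * h j))"
        unfolding h[OF i, symmetric] using i by (intro sum.cong refl) (simp add: algebra_simps)
      also have "\<dots> = (\<Sum>j<m. complex_of_real (F $$ (i, j)) * h j) - complex_of_real (G $ i) * \<zeta>"
        by (simp add: sum_subtractf sum_distrib_left \<zeta>_def)
      finally show "z * v $ i - (\<Sum>j<m. complex_of_real (F $$ (i, j)) * v $ j) = - \<zeta> * complex_of_real (G $ i)"
        using i by (simp add: v_def)
    qed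
  qed
  have vi: "h i = - \<zeta> * x $ i" if "i < m" for i
  proof -
    have "v $ i = - \<zeta> * x $ i" unfolding veq using that x(1) by simp
    then show ?thesis using that by (simp add: v_def)
  qed
  have \<zeta>0: "\<zeta> \<noteq> 0" using h0 vi by auto
  have Hx: "scalar_prod (cvec H) x = (\<Sum>j<m. complex_of_real (H $ j) * x $ j)"
    using x(1) FGH by (simp add: scalar_prod_def atLeast0LessThan)
  have "\<zeta> = - \<zeta> * scalar_prod (cvec H) x"
    unfolding Hx sum_distrib_left by (subst \<zeta>_def) (intro sum.cong refl, simp add: vi)
  then have "state_space_tf m F G H z = 0" using \<zeta>0 unfolding x(2) by (simp add: algebra_simps) (metis add.commute add_eq_0_iff mult_cancel_left2 mult_minus_right)
  moreover have "state_space_tf m F G H z = rational_tf den num z"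
    using re nF num by (simp add: realizes_def)
  ultimately show False using num den by (simp add: rational_tf_def)
qed

lemma realizes_zero:
  "realizes 0 (0\<^sub>m 0 0) (0\<^sub>v 0) (0\<^sub>v 0) p p"
  unfolding realizes_def state_space_dims_def
  by (simp add: state_space_tf_def rational_tf_def scalar_prod_def)

text \<open>If all Markov parameters vanished, the transfer function would be 1 off the open disc,
  so \<open>den = num\<close>, which has a realization of dimension 0.\<close>

lemma minimal_realization_nontrivial:
  assumes mp: "stable_min_phase num den" and mr: "minimal_realization m F G H den num"
    and st: "stable_mat F" and m: "1 \<le> m"
  shows "\<exists>j. dual_vec G ((dual_map F ^^ j) (vec_fun H)) \<noteq> 0"
proof (rule ccontr)
  assume "\<not> ?thesis"
  then have G0: "dual_vec G ((dual_map F ^^ j) (vec_fun H)) = 0" for j by simp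
  have re: "realizes m F G H den num" using mr by (simp add: minimal_realization_def)
  have FGH: "F \<in> carrier_mat m m" "G \<in> carrier_vec m" "H \<in> carrier_vec m"
    using re by (auto simp: realizes_def state_space_dims_def)
  obtain \<theta> c where th: "0 < \<theta>" "\<theta> < 1" and c: "\<And>j i. i < m \<Longrightarrow> \<bar>(dual_map F ^^ j) (vec_fun H) i\<bar> \<le> c * \<theta> ^ j"
    using dual_map_decay[OF FGH(1) st] by blast
  have eq: "cpoly den z = cpoly num z" if z1: "1 \<le> cmod z" for z
  proof -
    have nF: "\<not> eigenvalue (cmat F) z" using st z1 by (auto simp: stable_mat_def)
    have num: "cpoly num z \<noteq> 0" using mp z1 by (auto simp: stable_min_phase_def)
    obtain x where x: "x \<in> carrier_vec m" "state_space_tf m F G H z = scalar_prod (cvec H) x + 1"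
      and xe: "\<And>i. i < m \<Longrightarrow> z * x $ i - (\<Sum>j<m. complex_of_real (F $$ (i, j)) * x $ j) = complex_of_real (G $ i)"
      using resolvent[OF FGH(1,2) nF, of H] by blast
    \<comment> \<open>\<open>p j\<close> is the row \<open>H\<close> times the \<open>j\<close>-th
      power of \<open>F\<close>, paired with the resolvent vector. Vanishing Markov parameters
      multiply it by \<open>z\<close> at each step, so it cannot shrink, while stability of
      \<open>F\<close> makes it decay.\<close>
    define p where "p j = (\<Sum>i<m. complex_of_real ((dual_map F ^^ j) (vec_fun H) i) * x $ i)" for j
    have step: "p (Suc j) = z * p j" for j
    proof -
      let ?h = "(dual_map F ^^ j) (vec_fun H)"
      have "p (Suc j) = (\<Sum>i<m. \<Sum>l<m. complex_of_real (?h l) * (complex_of_real (F $$ (l, i)) * x $ i))"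
        unfolding p_def using FGH(1) by (intro sum.cong refl) (simp add: dual_map_def sum_distrib_right mult.assoc)
      also have "\<dots> = (\<Sum>l<m. \<Sum>i<m. complex_of_real (?h l) * (complex_of_real (F $$ (l, i)) * x $ i))" by (rule sum.swap)
      also have "\<dots> = (\<Sum>l<m. z * (complex_of_real (?h l) * x $ l) - complex_of_real (?h l * G $ l))"
      proof (rule sum.cong[OF refl])
        fix l assume "l \<in> {..<m}"
        then have s: "(\<Sum>i<m. complex_of_real (F $$ (l, i)) * x $ i) = z * x $ l - complex_of_real (G $ l)"
          using xe[of l] by (simp add: algebra_simps)
        then show "(\<Sum>i<m. complex_of_real (?h l) * (complex_of_real (F $$ (l, i)) * x $ i)) =
            z * (complex_of_real (?h l) * x $ l) - complex_of_real (?h l * G $ l)"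
          unfolding sum_distrib_left[symmetric] s by (simp add: algebra_simps)
      qed
      also have "\<dots> = z * p j - complex_of_real (dual_vec G ?h)"
        using FGH(2) by (simp add: sum_subtractf sum_distrib_left p_def dual_vec_def)
      finally show ?thesis by (simp add: G0)
    qed
    have pj: "p j = z ^ j * p 0" for j by (induction j) (simp_all add: step)
    have "cmod (p 0) \<le> cmod (p j)" for j
    proof -
      have "1 * cmod (p 0) \<le> cmod z ^ j * cmod (p 0)" using z1 by (intro mult_right_mono one_le_power) auto
      then show ?thesis unfolding pj[of j] by (simp add: norm_mult norm_power)
    qed
    moreover have "p \<longlonglongrightarrow> (\<Sum>i<m. complex_of_real 0 * x $ i)"
      unfolding p_def using th by (intro tendsto_intros geometric_null[OF c]) auto
    then have "(\<lambda>j. cmod (p j)) \<longlonglongrightarrow> 0" using tendsto_norm_zero by simp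
    ultimately have "cmod (p 0) \<le> 0" by (intro LIMSEQ_le_const[of "\<lambda>j. cmod (p j)"]) auto
    moreover have "scalar_prod (cvec H) x = p 0"
      using x(1) FGH by (simp add: scalar_prod_def atLeast0LessThan p_def vec_fun_def)
    ultimately have "state_space_tf m F G H z = 1" unfolding x(2) by simp
    moreover have "state_space_tf m F G H z = rational_tf den num z"
      using re nF num by (simp add: realizes_def)
    ultimately show ?thesis using num by (simp add: rational_tf_def)
  qed
  have "den = num"
  proof (rule ccontr)
    define q where "q = map_poly complex_of_real den - map_poly complex_of_real num"
    assume "den \<noteq> num"
    then obtain i where "coeff den i \<noteq> coeff num i" by (auto simp: poly_eq_iff)
    then have "coeff q i \<noteq> 0" by (simp add: q_def coeff_map_poly)
    then have "q \<noteq> 0" by auto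
    then have "finite {z. poly q z = 0}" by (rule poly_roots_finite)
    moreover have "complex_of_real ` {1..} \<subseteq> {z. poly q z = 0}"
    proof (rule image_subsetI)
      fix a :: real assume "a \<in> {1..}"
      then have "cpoly den (complex_of_real a) = cpoly num (complex_of_real a)" by (intro eq) simp
      then show "complex_of_real a \<in> {z. poly q z = 0}" by (simp add: q_def)
    qed
    ultimately have "finite (complex_of_real ` {1..})" by (rule finite_subset[rotated])
    then have "finite {1::real..}" by (rule finite_imageD) (simp add: inj_on_def)
    then show False by (simp add: infinite_Ici)
  qed
  then have "m \<le> 0" using mr realizes_zero[of num] unfolding minimal_realization_def by blast
  then show False using m by simp
qed

section \<open>Adding a stable mode to the encoder\<close>

text \<open>A single \<open>\<rho> t\<close> may be of order \<open>T + 1\<close>, but the tail sums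
  of \<open>x\<close> are small; the finitely many remaining terms are divided by
  \<open>T + 1\<close>.\<close>

lemma summable_times_cesaro_bounded:
  fixes x \<rho> :: "nat \<Rightarrow> real"
  assumes x: "summable x" "\<And>t. 0 \<le> x t" and \<rho>: "\<And>t. 0 \<le> \<rho> t" "\<And>T. (\<Sum>t\<le>T. \<rho> t) \<le> K * real (T + 1)"
  shows "(\<lambda>T. (\<Sum>t\<le>T. x t * \<rho> t) / real (T + 1)) \<longlonglongrightarrow> 0"
proof (rule LIMSEQ_I)
  fix e :: real assume e: "0 < e"
  have K0: "0 \<le> K" using \<rho>(1)[of 0] \<rho>(2)[of 0] by simp
  define e' where "e' = e / (2 * (K + 1))"
  have e': "0 < e'" using e K0 by (simp add: e'_def)
  obtain M where M: "\<And>m n. M \<le> m \<Longrightarrow> norm (\<Sum>t=m..<n. x t) < e'"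
    using x(1)[unfolded summable_Cauchy] e' by blast
  define B where "B = (\<Sum>t<M. x t * \<rho> t)"
  have B0: "0 \<le> B" unfolding B_def using x(2) \<rho>(1) by (intro sum_nonneg mult_nonneg_nonneg)
  obtain N' :: nat where N': "2 * B / e < real N'" using reals_Archimedean2 by blast
  have "norm ((\<Sum>t\<le>T. x t * \<rho> t) / real (T + 1) - 0) < e" if T: "max M N' \<le> T" for T
  proof -
    have "{..T} = {..<M} \<union> {M..<Suc T}" using T by auto
    then have "(\<Sum>t\<le>T. x t * \<rho> t) = B + (\<Sum>t=M..<Suc T. x t * \<rho> t)"
      unfolding B_def by (simp add: sum.union_disjoint ivl_disj_int)
    also have "(\<Sum>t=M..<Suc T. x t * \<rho> t) \<le> (\<Sum>t=M..<Suc T. x t * (K * real (T + 1)))"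
    proof (intro sum_mono mult_left_mono x(2))
      fix t assume "t \<in> {M..<Suc T}"
      then have "\<rho> t \<le> (\<Sum>t\<le>T. \<rho> t)" using \<rho>(1) by (intro member_le_sum) auto
      then show "\<rho> t \<le> K * real (T + 1)" using \<rho>(2)[of T] by simp
    qed
    also have "\<dots> = (\<Sum>t=M..<Suc T. x t) * (K * real (T + 1))" by (rule sum_distrib_right[symmetric])
    also have "\<dots> \<le> e' * (K * real (T + 1))"
      using M[of M "Suc T"] K0 by (intro mult_right_mono) auto
    finally have "(\<Sum>t\<le>T. x t * \<rho> t) \<le> B + e' * K * real (T + 1)" by (simp add: mult.assoc)
    then have "(\<Sum>t\<le>T. x t * \<rho> t) / real (T + 1) \<le> (B + e' * K * real (T + 1)) / real (T + 1)"
      by (rule divide_right_mono) simp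
    also have "\<dots> = B / real (T + 1) + e' * K" by (simp add: add_divide_distrib)
    finally have "(\<Sum>t\<le>T. x t * \<rho> t) / real (T + 1) \<le> B / real (T + 1) + e' * K" .
    moreover have "B / real (T + 1) < e / 2"
    proof -
      have "2 * B / e < real (T + 1)" using N' T by simp
      then show ?thesis using e by (simp add: field_simps)
    qed
    moreover have "e' * K \<le> e / 2"
    proof -
      have "e' * K = e / 2 * (K / (K + 1))" using K0 by (simp add: e'_def)
      also have "\<dots> \<le> e / 2 * 1" using K0 e by (intro mult_left_mono) auto
      finally show ?thesis by simp
    qed
    moreover have "0 \<le> (\<Sum>t\<le>T. x t * \<rho> t) / real (T + 1)"
      using x(2) \<rho>(1) by (intro divide_nonneg_nonneg sum_nonneg mult_nonneg_nonneg) auto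
    ultimately show ?thesis unfolding real_norm_def diff_0_right by linarith
  qed
  then show "\<exists>no. \<forall>T\<ge>no. norm ((\<Sum>t\<le>T. x t * \<rho> t) / real (T + 1) - 0) < e" by blast
qed

lemma causal_span:
  fixes v z :: "nat \<Rightarrow> 'a::real_vector"
  assumes "\<And>s. v s \<in> span (z ` {..<s})"
  shows "state_functional \<Phi> g v t x + v t \<in> span (z ` {..<t})"
proof -
  have "v s \<in> span (z ` {..<t})" if "s \<le> t" for s
    by (rule subsetD[OF span_mono assms]) (use that in auto)
  then show ?thesis by (intro span_add state_functional_mem) (simp_all add: subspace_span)
qed

text \<open>A given scheme split into message part \<open>r\<close> and feedback part
  \<open>v\<close>, and the eigenvalue \<open>a\<close> of the mode to be added. Its stability makes
  the channel response \<open>q\<close> square summable.\<close>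

locale added_mode = dual_system m \<Phi> G H \<theta>
  for m \<Phi> G H \<theta> +
  fixes f :: "(nat \<Rightarrow> real) \<Rightarrow> nat \<Rightarrow> real" and n :: nat and r v u y :: process and a :: real
  assumes f_eq: "\<And>x. f x = \<Phi> x + G x *\<^sub>R H"
    and f_decay: "\<And>x. \<exists>c\<ge>0. \<forall>j. \<forall>i<m. \<bar>(f ^^ j) x i\<bar> \<le> c * \<theta> ^ j"
    and r: "\<And>t. r t \<in> span (message ` {..n})"
    and v: "\<And>t. v t \<in> span (y ` {..<t})"
    and u: "\<And>t. u t = r t + v t"
    and y: "\<And>t. y t = state_functional f G u t H + u t + noise t"
    and a: "0 < a" "a < 1"
begin

abbreviation W where "W \<equiv> message (Suc n)"

definition q :: "nat \<Rightarrow> real" where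
  "q t = state_functional f G (\<lambda>s. a ^ s) t H + a ^ t"

definition pl :: process where
  "pl t = state_functional f G r t H + r t + noise t"

definition pl' :: process where
  "pl' t = pl t + q t *\<^sub>R W"

definition r' :: process where
  "r' t = r t + a ^ t *\<^sub>R W"

text \<open>Test variable whose covariance with an earlier \<open>pl s\<close> is
  \<open>q s\<close>. It reads off how much of \<open>W\<close> a combination of the modified
  outputs picks up.\<close>

definition z :: process where
  "z t = (\<Sum>s<t. q s *\<^sub>R noise s)"

definition V :: "nat \<Rightarrow> ((nat + nat \<Rightarrow> real) \<Rightarrow> real) set" where
  "V t = span (message ` {..n} \<union> noise ` {..<t})"

lemma V_mono: "s \<le> t \<Longrightarrow> V s \<subseteq> V t"
  unfolding V_def by (intro span_mono) auto

lemma subspace_V: "subspace (V t)"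
  by (simp add: V_def subspace_span)

lemma V_orth:
  assumes "X \<in> V t"
  shows "X \<in> coordinate_space" "cov X W = 0" "t \<le> s \<Longrightarrow> cov X (noise s) = 0" "cov W X = 0" "t \<le> s \<Longrightarrow> cov (noise s) X = 0"
proof -
  have "V t \<subseteq> {X \<in> coordinate_space. cov X W = 0 \<and> (\<forall>s\<ge>t. cov X (noise s) = 0)}"
    unfolding V_def
  proof (rule span_minimal)
    show "subspace {X \<in> coordinate_space. cov X W = 0 \<and> (\<forall>s\<ge>t. cov X (noise s) = 0)}"
      by (auto simp: subspace_def coord.bilinear)
  qed auto
  then have *: "X \<in> coordinate_space \<and> cov X W = 0 \<and> (\<forall>s\<ge>t. cov X (noise s) = 0)" using assms by blast
  then show "X \<in> coordinate_space" "cov X W = 0" "t \<le> s \<Longrightarrow> cov X (noise s) = 0" "cov W X = 0" "t \<le> s \<Longrightarrow> cov (noise s) X = 0"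
    by (auto simp: coord.sym[of W] coord.sym[of "noise s"])
qed

lemma message_part: "state_functional f G r t H + r t \<in> V 0" and r_V: "r t \<in> V s"
proof -
  show "r t \<in> V s" using r[of t] span_mono[of "message ` {..n}" "message ` {..n} \<union> noise ` {..<s}"] unfolding V_def by blast
  have "r s \<in> V 0" for s using r[of s] by (simp add: V_def)
  then show "state_functional f G r t H + r t \<in> V 0"
    by (intro subspace_add[OF subspace_V] state_functional_mem[OF subspace_V])
qed

lemma pl_V: "pl t \<in> V (Suc t)"
proof -
  have "noise t \<in> V (Suc t)" unfolding V_def by (intro span_base) auto
  then show ?thesis
    unfolding pl_def by (intro subspace_add[OF subspace_V subsetD[OF V_mono message_part]]) simp_all
qed

lemma pl_mem [simp, intro]: "pl t \<in> coordinate_space"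
  by (rule V_orth(1)[OF pl_V])

lemma pl'_mem [simp, intro]: "pl' t \<in> coordinate_space"
  unfolding pl'_def by (intro coord.mem pl_mem message_mem)

lemma pl'_eq: "pl' t = state_functional f G r' t H + r' t + noise t"
proof -
  have W: "state_functional f G (\<lambda>s. a ^ s *\<^sub>R W) t H = state_functional f G (\<lambda>s. a ^ s) t H *\<^sub>R W"
    unfolding state_functional_sum by (simp add: scaleR_sum_left)
  have "state_functional f G r' t H = state_functional f G r t H + state_functional f G (\<lambda>s. a ^ s *\<^sub>R W) t H"
    unfolding state_functional_add[symmetric] by (rule arg_cong[of _ _ "\<lambda>u. state_functional f G u t H"]) (rule ext, rule r'_def)
  then show ?thesis unfolding pl'_def pl_def q_def W r'_def[of t] by (simp add: scaleR_left_distrib)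
qed

sublocale p: residual_family coordinate_space cov pl by unfold_locales simp
sublocale p': residual_family coordinate_space cov pl' by unfold_locales simp

lemma z_mem [simp, intro]: "z t \<in> coordinate_space"
  unfolding z_def by (intro coord.mem noise_mem)

lemma cov_z_noise: "cov (z t) (noise s) = (if s < t then q s else 0)"
  unfolding z_def by (simp add: coord.sum_left coord.bilinear if_distrib cong: if_cong)

lemma cov_z_V0: "X \<in> V 0 \<Longrightarrow> cov (z t) X = 0"
  unfolding z_def using V_orth(1)[of X 0] V_orth(5)[of X 0] by (simp add: coord.sum_left coord.bilinear)

lemma cov_z_pl: "cov (z t) (pl s) = (if s < t then q s else 0)"
  unfolding pl_def using V_orth(1)[OF message_part[of s]] cov_z_V0[OF message_part[of s]]
  by (simp only: coord.add_right noise_mem z_mem cov_z_noise add_0)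

lemma cov_z_z: "cov (z t) (z t) = (\<Sum>s<t. (q s)\<^sup>2)"
  by (subst (2) z_def) (simp add: coord.sum_right coord.bilinear cov_z_noise power2_eq_square)

lemma pl_residual_V:
  assumes "X \<in> V t" "T \<le> t"
  shows "p.R T X \<in> V t"
proof -
  have "pl s \<in> V t" if "s < T" for s using V_mono[of "Suc s" t] pl_V[of s] that assms(2) by auto
  then have "span (pl ` {..<T}) \<subseteq> V t" by (intro span_minimal subspace_V) auto
  then have "X - p.R T X \<in> V t" using p.diff_residual_span by blast
  from subspace_diff[OF subspace_V assms(1) this] show ?thesis by simp
qed

lemma cov_plus_W: "X \<in> V t \<Longrightarrow> cov (X + x *\<^sub>R W) (X + x *\<^sub>R W) = cov X X + x\<^sup>2"
  using V_orth(1,2,4)[of X t] by (simp add: coord.bilinear power2_eq_square)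

text \<open>\<open>W\<close> is orthogonal to the old scheme, and each prediction error of the new
  one is an old prediction error plus a multiple of \<open>W\<close>.\<close>

lemma residual_added_lower:
  assumes X: "X \<in> V t" "T \<le> t"
  shows "cov (p.R T X) (p.R T X) \<le> cov (p'.R T (X + x *\<^sub>R W)) (p'.R T (X + x *\<^sub>R W))"
proof -
  obtain \<beta> where \<beta>: "X + x *\<^sub>R W - p'.R T (X + x *\<^sub>R W) = (\<Sum>s<T. \<beta> s *\<^sub>R pl' s)"
    using p'.diff_residual_span by (rule in_span_image_lessThan)
  define Y where "Y = (\<Sum>s<T. \<beta> s *\<^sub>R pl s)"
  have "(\<Sum>s<T. \<beta> s *\<^sub>R pl' s) = Y + (\<Sum>s<T. \<beta> s * q s) *\<^sub>R W"
    by (simp add: Y_def pl'_def scaleR_right_distrib sum.distrib scaleR_sum_left)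
  then have eq: "p'.R T (X + x *\<^sub>R W) = (X - Y) + (x - (\<Sum>s<T. \<beta> s * q s)) *\<^sub>R W"
    using \<beta> by (simp add: algebra_simps)
  have "pl s \<in> V t" if "s < T" for s using V_mono[of "Suc s" t] pl_V[of s] that X(2) by auto
  then have YV: "Y \<in> V t" unfolding Y_def by (intro subspace_sum[OF subspace_V] subspace_scale[OF subspace_V]) auto
  have "cov (p.R T X) (p.R T X) \<le> cov (X - Y) (X - Y)"
    unfolding Y_def by (intro p.residual_minimal V_orth(1)[OF X(1)] sum_in_span_lessThan)
  then show ?thesis
    unfolding eq cov_plus_W[OF subspace_diff[OF subspace_V X(1) YV]] by (rule add_increasing2[OF zero_le_power2])
qed

text \<open>The old prediction coefficients are applied to the new outputs; the excess is the square
  of the coefficient of \<open>W\<close> left over.\<close>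

lemma residual_added_upper:
  assumes X: "X \<in> V t" "T \<le> t"
  shows "cov (p'.R T (X + x *\<^sub>R W)) (p'.R T (X + x *\<^sub>R W)) \<le>
    cov (p.R T X) (p.R T X) + (x - cov (z T) (X - p.R T X))\<^sup>2"
proof -
  have XS: "X \<in> coordinate_space" by (rule V_orth(1)[OF X(1)])
  obtain \<alpha> where \<alpha>: "X - p.R T X = (\<Sum>s<T. \<alpha> s *\<^sub>R pl s)"
    using p.diff_residual_span by (rule in_span_image_lessThan)
  have zX: "cov (z T) (X - p.R T X) = (\<Sum>s<T. \<alpha> s * q s)"
    unfolding \<alpha> by (simp add: coord.sum_right coord.bilinear cov_z_pl)
  have RV: "p.R T X \<in> V t" by (rule pl_residual_V[OF X])
  let ?Z = "\<Sum>s<T. \<alpha> s *\<^sub>R pl' s"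
  have "?Z = (X - p.R T X) + (\<Sum>s<T. \<alpha> s * q s) *\<^sub>R W"
    unfolding \<alpha> by (simp add: pl'_def scaleR_right_distrib sum.distrib scaleR_sum_left)
  then have eq: "X + x *\<^sub>R W - ?Z = p.R T X + (x - cov (z T) (X - p.R T X)) *\<^sub>R W"
    unfolding zX by (simp add: algebra_simps)
  have "cov (p'.R T (X + x *\<^sub>R W)) (p'.R T (X + x *\<^sub>R W)) \<le> cov (X + x *\<^sub>R W - ?Z) (X + x *\<^sub>R W - ?Z)"
    by (intro p'.residual_minimal coord.mem XS message_mem sum_in_span_lessThan)
  also have "\<dots> = cov (p.R T X) (p.R T X) + (x - cov (z T) (X - p.R T X))\<^sup>2"
    unfolding eq by (rule cov_plus_W[OF RV])
  finally show ?thesis .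
qed

end

section \<open>Effect of the added mode on innovations and input\<close>

context added_mode
begin

lemma linear_f: "linear f"
  by (rule linearI) (simp_all add: f_eq lin scaleR_left_distrib scaleR_right_distrib)

lemma pl_noisy: "noisy_output coordinate_space cov (\<lambda>t. state_functional f G r t H + r t) noise"
proof
  show "state_functional f G r t H + r t \<in> coordinate_space" for t by (rule V_orth(1)[OF message_part])
  show "cov (noise t) (state_functional f G r s H + r s) = 0" for s t by (rule V_orth(5)[OF message_part]) simp
qed simp_all

lemma pl'_noisy: "noisy_output coordinate_space cov (\<lambda>t. state_functional f G r' t H + r' t) noise"
proof
  have e: "state_functional f G r' t H + r' t = pl' t - noise t" for t by (simp add: pl'_eq)
  show "state_functional f G r' t H + r' t \<in> coordinate_space" for t
    unfolding e by (intro coord.mem pl'_mem noise_mem)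
  have "cov (noise t) (state_functional f G r s H + r s) = 0" for s t by (rule V_orth(5)[OF message_part]) simp
  moreover have "state_functional f G r' s H + r' s = (state_functional f G r s H + r s) + q s *\<^sub>R W" for s
    unfolding e pl'_def pl_def by simp
  ultimately show "cov (noise t) (state_functional f G r' s H + r' s) = 0" for s t
    using V_orth(1)[OF message_part[of s]] by (simp only:) (simp only: coord.add_right coord.scale_right noise_mem message_mem coord.mem cov_noise_message mult_zero_right add_0)
qed simp_all

definition rho :: "nat \<Rightarrow> real" where "rho t = innovation_var cov pl t"
definition rho' :: "nat \<Rightarrow> real" where "rho' t = innovation_var cov pl' t"

lemma rho_ge_1: "1 \<le> rho t"
proof -
  have "noisy_output.y (\<lambda>t. state_functional f G r t H + r t) noise = pl"
    by (rule ext) (simp only: noisy_output.y_def[OF pl_noisy] pl_def)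
  then show ?thesis using noisy_output.innovation_var_ge_1[OF pl_noisy, of t] by (simp only: rho_def)
qed

lemma rho'_ge_1: "1 \<le> rho' t"
proof -
  have "noisy_output.y (\<lambda>t. state_functional f G r' t H + r' t) noise = pl'"
    by (rule ext) (simp only: noisy_output.y_def[OF pl'_noisy] pl'_eq)
  then show ?thesis using noisy_output.innovation_var_ge_1[OF pl'_noisy, of t] by (simp only: rho'_def)
qed

lemma y_pl: "y t - pl t \<in> span (y ` {..<t})"
proof -
  have "state_functional f G u t H = state_functional f G r t H + state_functional f G v t H"
    unfolding state_functional_add[symmetric] by (rule arg_cong[of _ _ "\<lambda>u. state_functional f G u t H"]) (rule ext, rule u)
  then have "y t - pl t = state_functional f G v t H + v t"
    unfolding y[of t] pl_def u[of t] by simp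
  then show ?thesis using causal_span[OF v] by simp
qed

lemma span_pl: "span (pl ` {..<t}) = span (y ` {..<t})"
proof (rule span_unitriangular)
  show "pl t - y t \<in> span (y ` {..<t})" for t using span_neg[OF y_pl[of t]] by simp
qed

lemma y_mem [simp, intro]: "y t \<in> coordinate_space"
proof -
  have "y t - pl t \<in> coordinate_space" by (rule p.span_y_mem) (rule y_pl[folded span_pl])
  then have "(y t - pl t) + pl t \<in> coordinate_space" by (rule coord.mem(2)[OF _ pl_mem])
  then show ?thesis by simp
qed

lemma innovation_y: "innovation_var cov y t = rho t"
  unfolding rho_def
  by (rule coord.innovation_var_cong[OF pl_mem y_mem span_pl pl_mem y_pl[folded span_pl], symmetric])

definition eps :: process where "eps t = p.R t (pl t)"

lemma eps_mem [simp, intro]: "eps t \<in> coordinate_space"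
  unfolding eps_def by (intro p.residual_mem pl_mem)

lemma eps_V: "eps t \<in> V (Suc t)"
  unfolding eps_def by (intro pl_residual_V pl_V) simp

text \<open>The coefficient of \<open>W\<close> left in the current output when it is predicted with
  the old coefficients.\<close>

definition cc :: "nat \<Rightarrow> real" where "cc t = cov (z (Suc t)) (eps t)"

lemma cov_z_V:
  assumes X: "X \<in> V t" and "t \<le> T"
  shows "cov (z T) X = cov (z t) X"
  using assms(2)
proof (induction T rule: dec_induct)
  case (step T)
  have e: "z (Suc T) = z T + q T *\<^sub>R noise T" by (simp add: z_def)
  have "cov (z (Suc T)) X = cov (z T) X + q T * cov (noise T) X"
    unfolding e using V_orth(1)[OF X] by (simp only: coord.add_left coord.scale_left z_mem noise_mem coord.mem)
  then show ?case using step.IH V_orth(5)[OF X step.hyps(1)] by simp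
qed simp

lemma cov_z_eps: "t < T \<Longrightarrow> cov (z T) (eps t) = cc t"
  unfolding cc_def by (rule cov_z_V[OF eps_V]) simp

text \<open>The convolution of two geometric sequences brings a factor \<open>t\<close>, which is
  absorbed by passing to the square root \<open>\<nu>\<close> of the ratio.\<close>

lemma summable_q: "summable (\<lambda>t. (q t)\<^sup>2)"
proof -
  obtain c where c: "0 \<le> c" "\<And>j. \<bar>G ((f ^^ j) H)\<bar> \<le> c * \<theta> ^ j"
    using linear_functional_decay[OF linear_G G_cong f_decay] by blast
  define \<theta>' where "\<theta>' = max \<theta> a"
  define \<nu> where "\<nu> = sqrt \<theta>'"
  have t': "0 < \<theta>'" "\<theta>' < 1" "\<theta> \<le> \<theta>'" "a \<le> \<theta>'" using \<theta> a by (auto simp: \<theta>'_def)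
  have nu: "0 < \<nu>" "\<nu> < 1" "\<theta>' = \<nu> * \<nu>" using t' by (auto simp: \<nu>_def)
  have q: "\<bar>q t\<bar> \<le> (c / \<theta>') * (real t * \<theta>' ^ t) + \<theta>' ^ t" for t
  proof -
    have "\<bar>state_functional f G (\<lambda>s. a ^ s) t H\<bar> \<le> (\<Sum>s<t. (c / \<theta>') * \<theta>' ^ t)"
      unfolding state_functional_sum
    proof (rule order.trans[OF sum_abs sum_mono])
      fix s assume s: "s \<in> {..<t}"
      have "\<bar>G ((f ^^ (t - 1 - s)) H)\<bar> * a ^ s \<le> (c * \<theta>' ^ (t - 1 - s)) * \<theta>' ^ s"
      proof (intro mult_mono)
        show "\<bar>G ((f ^^ (t - 1 - s)) H)\<bar> \<le> c * \<theta>' ^ (t - 1 - s)"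
          by (rule order.trans[OF c(2)]) (intro mult_left_mono power_mono c(1), use \<theta> t' in auto)
        show "a ^ s \<le> \<theta>' ^ s" using a t' by (intro power_mono) auto
      qed (use c(1) t' a in auto)
      also have "\<dots> = c / \<theta>' * \<theta>' ^ t"
      proof -
        have "\<theta>' ^ t = \<theta>' * (\<theta>' ^ (t - 1 - s) * \<theta>' ^ s)"
          using s unfolding power_Suc[symmetric] power_add[symmetric] by simp
        then show ?thesis using t' by simp
      qed
      finally show "\<bar>G ((f ^^ (t - 1 - s)) H) *\<^sub>R a ^ s\<bar> \<le> c / \<theta>' * \<theta>' ^ t"
        using a by (simp add: abs_mult)
    qed
    moreover have "a ^ t \<le> \<theta>' ^ t" using a t' by (intro power_mono) auto
    ultimately show ?thesis unfolding q_def using a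
      by (intro order.trans[OF abs_triangle_ineq add_mono]) (simp_all add: mult_ac)
  qed
  have "Bseq (\<lambda>t. real t * \<nu> ^ t)"
    using times_power_null[OF nu(1,2)] by (intro convergent_imp_Bseq convergentI)
  then obtain K where K: "0 < K" "\<And>t. \<bar>real t * \<nu> ^ t\<bar> \<le> K" unfolding Bseq_def by auto
  define L where "L = (c / \<theta>') * K + 1"
  have qL: "\<bar>q t\<bar> \<le> L * \<nu> ^ t" for t
  proof -
    have "(c / \<theta>') * (real t * \<theta>' ^ t) = (c / \<theta>') * (real t * \<nu> ^ t) * \<nu> ^ t"
      unfolding nu(3) power_mult_distrib by simp
    also have "\<dots> \<le> (c / \<theta>') * K * \<nu> ^ t"
      using K(2)[of t] c(1) t' nu by (intro mult_right_mono mult_left_mono) auto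
    finally have "(c / \<theta>') * (real t * \<theta>' ^ t) \<le> (c / \<theta>') * K * \<nu> ^ t" .
    moreover have "\<theta>' ^ t \<le> \<nu> ^ t * 1"
      unfolding nu(3) power_mult_distrib using nu by (intro mult_left_mono power_le_one) auto
    ultimately show ?thesis using q[of t] by (simp add: L_def distrib_right)
  qed
  have "norm ((q t)\<^sup>2) \<le> L\<^sup>2 * (\<nu>\<^sup>2) ^ t" for t
  proof -
    have "\<bar>q t\<bar>\<^sup>2 \<le> (L * \<nu> ^ t)\<^sup>2" by (rule power_mono[OF qL]) simp
    then show ?thesis by (simp add: power_mult_distrib power2_eq_square mult_ac)
  qed
  moreover have "summable (\<lambda>t. L\<^sup>2 * (\<nu>\<^sup>2) ^ t)"
    using nu t' by (intro summable_mult summable_geometric) (simp add: power2_eq_square)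
  ultimately show ?thesis by (rule summable_comparison_test'[rotated])
qed

definition xx :: "nat \<Rightarrow> real" where "xx t = (cc t)\<^sup>2 / rho t"

lemma xx_nonneg: "0 \<le> xx t"
  unfolding xx_def using rho_ge_1[of t] by simp

text \<open>Bessel's inequality for \<open>z T\<close> along the old innovations, with a bound
  uniform in \<open>T\<close>.\<close>

lemma summable_xx: "summable xx"
proof (rule summableI_nonneg_bounded[OF xx_nonneg])
  fix T
  have "(\<Sum>s<T. (cov (z T) (p.R s (pl s)))\<^sup>2 / cov (p.R s (pl s)) (p.R s (pl s))) \<le> cov (z T) (z T)"
    by (rule p.Bessel[OF z_mem])
  then have "(\<Sum>s<T. xx s) \<le> (\<Sum>s<T. (q s)\<^sup>2)"
    unfolding cov_z_z by (simp add: xx_def rho_def eps_def[symmetric] cov_z_eps)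
  also have "\<dots> \<le> (\<Sum>s. (q s)\<^sup>2)" by (rule sum_le_suminf[OF summable_q]) simp_all
  finally show "(\<Sum>s<T. xx s) \<le> (\<Sum>s. (q s)\<^sup>2)" .
qed

lemma rho_le_rho': "rho t \<le> rho' t"
  unfolding rho_def rho'_def pl'_def[of t] by (rule residual_added_lower[OF pl_V]) simp

text \<open>The coefficient left over is \<open>cc t\<close> because the current noise enters its
  innovation with weight 1.\<close>

lemma rho'_le: "rho' t \<le> rho t * (1 + xx t)"
proof -
  have "cov (noise t) (pl t - eps t) = 0"
  proof -
    have "span (pl ` {..<t}) \<subseteq> V t"
      by (intro span_minimal subspace_V image_subsetI subsetD[OF V_mono pl_V]) simp
    then have "pl t - eps t \<in> V t" unfolding eps_def using p.diff_residual_span by blast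
    then show ?thesis by (rule V_orth(5)) simp
  qed
  moreover have "cov (noise t) (pl t) = 1"
    unfolding pl_def using V_orth(1,5)[OF message_part[of t]] by (simp only: coord.add_right noise_mem cov_noise refl if_True)
  ultimately have ne: "cov (noise t) (eps t) = 1" by (simp add: coord.bilinear)
  have "z (Suc t) = z t + q t *\<^sub>R noise t" by (simp add: z_def)
  then have "cc t = cov (z t) (eps t) + q t" unfolding cc_def by (simp add: coord.bilinear ne)
  then have "q t - cov (z t) (pl t - eps t) = cc t" by (simp add: coord.bilinear cov_z_pl)
  moreover have "rho' t \<le> rho t + (q t - cov (z t) (pl t - eps t))\<^sup>2"
    unfolding rho_def rho'_def pl'_def[of t] eps_def by (rule residual_added_upper[OF pl_V]) simp
  ultimately have "rho' t \<le> rho t + (cc t)\<^sup>2" by simp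
  also have "\<dots> = rho t * (1 + xx t)" using rho_ge_1[of t] by (simp add: xx_def field_simps)
  finally show ?thesis .
qed

text \<open>\<open>nn\<close> is the noise seen through the inverse of the channel filter; subtracting it from the innovation
  gives the part of the encoder signal that the receiver cannot predict.\<close>

definition nn :: process where
  "nn t = noise t - state_functional \<Phi> G noise t H"

lemma nn_mem [simp, intro]: "nn t \<in> coordinate_space"
  unfolding nn_def by (intro coord.mem noise_mem state_functional_mem coord.sub)

text \<open>Inverting the channel writes \<open>r t\<close> as the current output minus filtered
  noise minus a function of past outputs, and the last part has no residual.\<close>

lemma cov_residual_r:
  assumes X: "X \<in> coordinate_space"
  shows "cov X (p.R t (r t)) = cov X (eps t) - cov X (p.R t (nn t))"
proof -
  let ?w = "\<lambda>t. state_functional f G r t H + r t"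
  let ?s = "state_functional \<Phi> G pl t H"
  have "?s = state_functional \<Phi> G ?w t H + state_functional \<Phi> G noise t H"
    unfolding state_functional_add[symmetric]
    by (rule arg_cong[of _ _ "\<lambda>u. state_functional \<Phi> G u t H"]) (rule ext, simp only: pl_def)
  then have "r t = (pl t - nn t) - ?s"
    unfolding inverse_filter[OF linear_f linear_G f_eq] by (simp add: pl_def nn_def)
  moreover have ss: "?s \<in> span (pl ` {..<t})" by (rule state_functional_span)
  ultimately have "p.R t (r t) = eps t - p.R t (nn t) - p.R t ?s"
    using p.span_y_mem[OF ss] by (simp add: p.residual_diff eps_def)
  moreover have "cov X (p.R t ?s) = 0" using p.residual_in_span_left[OF ss X] coord.sym by simp
  ultimately show ?thesis using X p.span_y_mem[OF ss] by (simp add: coord.bilinear)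
qed

text \<open>The inverse filter undoes the channel response \<open>q\<close> and returns the mode
  itself.\<close>

lemma cov_z_nn: "cov (z (Suc t)) (nn t) = a ^ t"
proof -
  have "cov (z (Suc t)) (state_functional \<Phi> G noise t H) = state_functional \<Phi> G q t H"
    unfolding state_functional_sum by (simp add: coord.sum_right coord.bilinear cov_z_noise)
  moreover have "state_functional \<Phi> G q t H = state_functional f G (\<lambda>s. a ^ s) t H"
    unfolding q_def by (rule inverse_filter[OF linear_f linear_G f_eq])
  ultimately show ?thesis
    unfolding nn_def by (simp add: coord.bilinear cov_z_noise state_functional_mem coord.sub q_def)
qed

text \<open>Covariance of the projections of \<open>z (Suc t)\<close> and \<open>nn t\<close> onto
  the past innovations. Together with \<open>cc t\<close> it is the coefficient of \<open>W\<close>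
  left in the input.\<close>

definition leak :: "nat \<Rightarrow> real" where
  "leak t = (\<Sum>s<t. cc s * cov (nn t) (eps s) / rho s)"

lemma residual_r'_upper:
  "cov (p'.R t (r' t)) (p'.R t (r' t)) \<le> cov (p.R t (r t)) (p.R t (r t)) + (cc t + leak t)\<^sup>2"
proof -
  have rS: "r t \<in> coordinate_space" by (rule V_orth(1)[OF r_V[of t 0]])
  have "cov (z (Suc t)) (p.R t (nn t)) = cov (p.R t (z (Suc t))) (p.R t (nn t))"
    by (rule p.B_residual_left[symmetric]) simp_all
  also have "\<dots> = a ^ t - leak t"
    unfolding p.B_residual_expand[OF z_mem nn_mem] cov_z_nn leak_def
    by (simp add: eps_def[symmetric] rho_def cov_z_eps)
  finally have "cov (z t) (p.R t (r t)) = cc t - (a ^ t - leak t)"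
    using cov_z_V[OF pl_residual_V[OF r_V order.refl, of t], of "Suc t"] cov_residual_r[OF z_mem, of "Suc t" t]
    by (simp add: cc_def)
  moreover have "cov (z t) (r t) = 0" by (rule cov_z_V0[OF r_V])
  ultimately have "a ^ t - cov (z t) (r t - p.R t (r t)) = cc t + leak t"
    using rS by (simp add: coord.bilinear)
  then show ?thesis
    using residual_added_upper[where X="r t" and t=t and T=t and x="a ^ t", OF r_V order.refl] by (simp add: r'_def)
qed

lemma residual_r'_lower:
  "cov (p.R t (r t)) (p.R t (r t)) \<le> cov (p'.R t (r' t)) (p'.R t (r' t))"
  unfolding r'_def by (rule residual_added_lower[OF r_V order.refl])

end

context added_mode
begin

lemma cov_nn_noise: "cov (nn t) (noise s) = (if s = t then 1 else 0) - (if s < t then G ((\<Phi> ^^ (t - 1 - s)) H) else 0)"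
proof -
  have "cov (state_functional \<Phi> G noise t H) (noise s) = (if s < t then G ((\<Phi> ^^ (t - 1 - s)) H) else 0)"
    unfolding state_functional_sum by (simp add: coord.sum_left coord.bilinear if_distrib cong: if_cong)
  then show ?thesis unfolding nn_def by (simp add: coord.bilinear state_functional_mem coord.sub)
qed

text \<open>A fixed noise coordinate enters \<open>nn t\<close> with a weight that decays along the
  zero dynamics; messages do not enter.\<close>

lemma cov_nn_null: "X \<in> coordinate_space \<Longrightarrow> (\<lambda>t. cov (nn t) X) \<longlonglongrightarrow> 0"
proof -
  assume X: "X \<in> coordinate_space"
  have nG: "(\<lambda>t. G ((\<Phi> ^^ t) H)) \<longlonglongrightarrow> 0" by (rule decay_null[OF G_decay \<theta>])
  have noise: "(\<lambda>t. cov (nn t) (noise s)) \<longlonglongrightarrow> 0" for s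
  proof (rule LIMSEQ_offset)
    have "cov (nn (t + Suc s)) (noise s) = - G ((\<Phi> ^^ t) H)" for t by (simp add: cov_nn_noise)
    then show "(\<lambda>t. cov (nn (t + Suc s)) (noise s)) \<longlonglongrightarrow> 0" using tendsto_minus[OF nG] by simp
  qed
  have "cov (nn t) (message s) = 0" for s t
    unfolding nn_def state_functional_sum
    by (simp add: coord.sum_left coord.bilinear)
  then have message: "(\<lambda>t. cov (nn t) (message s)) \<longlonglongrightarrow> 0" for s by simp
  have "coordinate_space \<subseteq> {X \<in> coordinate_space. (\<lambda>t. cov (nn t) X) \<longlonglongrightarrow> 0}"
    unfolding coordinate_space_def
  proof (rule span_minimal)
    show "range coordinate \<subseteq> {X \<in> span (range coordinate). (\<lambda>t. cov (nn t) X) \<longlonglongrightarrow> 0}"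
    proof (rule image_subsetI)
      fix i
      have "(\<lambda>t. cov (nn t) (coordinate i)) \<longlonglongrightarrow> 0"
        using noise message by (cases i) (simp_all add: noise_coordinate message_coordinate)
      then show "coordinate i \<in> {X \<in> span (range coordinate). (\<lambda>t. cov (nn t) X) \<longlonglongrightarrow> 0}"
        by (simp add: span_base)
    qed
    show "subspace {X \<in> span (range coordinate). (\<lambda>t. cov (nn t) X) \<longlonglongrightarrow> 0}"
      unfolding coordinate_space_def[symmetric]
    proof (rule subspaceI)
      show "0 \<in> {X \<in> coordinate_space. (\<lambda>t. cov (nn t) X) \<longlonglongrightarrow> 0}" by (simp add: coord.bilinear)
      show "X + Y \<in> {X \<in> coordinate_space. (\<lambda>t. cov (nn t) X) \<longlonglongrightarrow> 0}"
        if "X \<in> {X \<in> coordinate_space. (\<lambda>t. cov (nn t) X) \<longlonglongrightarrow> 0}" "Y \<in> {X \<in> coordinate_space. (\<lambda>t. cov (nn t) X) \<longlonglongrightarrow> 0}" for X Y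
        using that tendsto_add[of "\<lambda>t. cov (nn t) X" 0 sequentially "\<lambda>t. cov (nn t) Y" 0] by (simp add: coord.add_right)
      show "c *\<^sub>R X \<in> {X \<in> coordinate_space. (\<lambda>t. cov (nn t) X) \<longlonglongrightarrow> 0}"
        if "X \<in> {X \<in> coordinate_space. (\<lambda>t. cov (nn t) X) \<longlonglongrightarrow> 0}" for c X
        using that tendsto_mult_right_zero[of "\<lambda>t. cov (nn t) X" sequentially c] by (simp add: coord.scale_right)
    qed
  qed
  then show ?thesis using X by blast
qed

lemma cov_nn_nn: "cov (nn t) (nn t) \<le> 1 + gramian H H"
proof -
  have "cov (nn t) (state_functional \<Phi> G noise t H) = - (\<Sum>s<t. (G ((\<Phi> ^^ (t - 1 - s)) H))\<^sup>2)"
    unfolding state_functional_sum by (simp add: coord.sum_right coord.bilinear cov_nn_noise sum_negf power2_eq_square)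
  then have "cov (nn t) (nn t) = 1 + (\<Sum>s<t. (G ((\<Phi> ^^ (t - 1 - s)) H))\<^sup>2)"
    by (subst (2) nn_def) (simp add: coord.bilinear state_functional_mem coord.sub cov_nn_noise)
  also have "(\<Sum>s<t. (G ((\<Phi> ^^ (t - 1 - s)) H))\<^sup>2) = (\<Sum>j<t. G ((\<Phi> ^^ j) H) * G ((\<Phi> ^^ j) H))"
    using sum.nat_diff_reindex[of "\<lambda>j. (G ((\<Phi> ^^ j) H))\<^sup>2" t] by (simp add: power2_eq_square)
  also have "\<dots> \<le> gramian H H"
    unfolding gramian_def by (rule sum_le_suminf[OF summable_gramian]) simp_all
  finally show ?thesis by simp
qed

text \<open>Finitely many terms vanish because \<open>nn t\<close> decorrelates from any fixed
  variable. Cauchy-Schwarz controls the rest by a tail of \<open>xx\<close> times the Bessel bound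
  for \<open>nn t\<close>, uniform in \<open>t\<close>.\<close>

lemma leak_null: "leak \<longlonglongrightarrow> 0"
proof (rule LIMSEQ_I)
  fix e :: real assume e: "0 < e"
  interpret gr: semi_inner UNIV gramian by (rule semi_inner_gramian)
  define N where "N = 1 + gramian H H"
  have N: "1 \<le> N" unfolding N_def using gr.nonneg[of H] by simp
  define e' where "e' = (e / 2)\<^sup>2 / N"
  have e': "0 < e'" using e N by (simp add: e'_def)
  obtain M where M: "\<And>m n. M \<le> m \<Longrightarrow> norm (\<Sum>s=m..<n. xx s) < e'"
    using summable_xx[unfolded summable_Cauchy] e' by blast
  let ?h = "\<lambda>s t. cc s * cov (nn t) (eps s) / rho s"
  have "(\<lambda>t. \<Sum>s<M. cc s * cov (nn t) (eps s) / rho s) \<longlonglongrightarrow> (\<Sum>s<M. cc s * 0 / rho s)"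
    by (intro tendsto_intros cov_nn_null eps_mem) (use rho_ge_1 in \<open>metis not_one_le_zero\<close>)
  then obtain N0 where N0: "\<And>t. N0 \<le> t \<Longrightarrow> \<bar>\<Sum>s<M. ?h s t\<bar> < e / 2"
    using LIMSEQ_D[of "\<lambda>t. \<Sum>s<M. ?h s t" 0 "e / 2"] e by auto
  have "norm (leak t - 0) < e" if t: "max M N0 \<le> t" for t
  proof -
    have "{..<t} = {..<M} \<union> {M..<t}" using t by auto
    then have split: "leak t = (\<Sum>s<M. ?h s t) + (\<Sum>s=M..<t. ?h s t)"
      unfolding leak_def by (simp add: sum.union_disjoint ivl_disj_int)
    have r0: "0 \<le> rho s" for s using rho_ge_1[of s] by simp
    have "(\<Sum>s=M..<t. ?h s t)\<^sup>2 = (\<Sum>s=M..<t. (cc s / sqrt (rho s)) * (cov (nn t) (eps s) / sqrt (rho s)))\<^sup>2"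
      by (simp add: r0)
    also have "\<dots> \<le> (\<Sum>s=M..<t. (cc s / sqrt (rho s))\<^sup>2) * (\<Sum>s=M..<t. (cov (nn t) (eps s) / sqrt (rho s))\<^sup>2)"
      by (rule Cauchy_Schwarz_ineq_sum)
    also have "(\<Sum>s=M..<t. (cc s / sqrt (rho s))\<^sup>2) = (\<Sum>s=M..<t. xx s)"
      by (intro sum.cong refl) (simp add: xx_def power_divide r0)
    also have "(\<Sum>s=M..<t. (cov (nn t) (eps s) / sqrt (rho s))\<^sup>2) = (\<Sum>s=M..<t. (cov (nn t) (eps s))\<^sup>2 / rho s)"
      by (intro sum.cong refl) (simp add: power_divide r0)
    also have "(\<Sum>s=M..<t. xx s) * (\<Sum>s=M..<t. (cov (nn t) (eps s))\<^sup>2 / rho s) \<le> (\<Sum>s=M..<t. xx s) * N"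
    proof (intro mult_left_mono sum_nonneg xx_nonneg)
      have "(\<Sum>s=M..<t. (cov (nn t) (eps s))\<^sup>2 / rho s) \<le> (\<Sum>s<t. (cov (nn t) (eps s))\<^sup>2 / rho s)"
        by (intro sum_mono2) (auto intro!: divide_nonneg_nonneg r0)
      also have "\<dots> \<le> cov (nn t) (nn t)"
        using p.Bessel[OF nn_mem, of t t] by (simp add: rho_def eps_def)
      also have "\<dots> \<le> N" unfolding N_def by (rule cov_nn_nn)
      finally show "(\<Sum>s=M..<t. (cov (nn t) (eps s))\<^sup>2 / rho s) \<le> N" .
    qed
    also have "\<dots> < e' * N"
      using M[of M t] N by (intro mult_strict_right_mono) auto
    also have "\<dots> = (e / 2)\<^sup>2" using N by (simp add: e'_def)
    finally have "\<bar>\<Sum>s=M..<t. ?h s t\<bar>\<^sup>2 < (e / 2)\<^sup>2" unfolding power2_abs .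
    then have "\<bar>\<Sum>s=M..<t. ?h s t\<bar> < e / 2" by (rule power2_less_imp_less) (use e in simp)
    then show ?thesis using N0[of t] t unfolding split by simp
  qed
  then show "\<exists>no. \<forall>t\<ge>no. norm (leak t - 0) < e" by blast
qed

lemma u_mem [simp, intro]: "u t \<in> coordinate_space"
proof -
  have "v t \<in> coordinate_space" by (rule p.span_y_mem[where t=t]) (simp only: span_pl v)
  then show ?thesis unfolding u[of t] using V_orth(1)[OF r_V[of t 0]] by simp
qed

lemma ex_gain: "\<exists>g. \<forall>t. u t = r t + (\<Sum>j<t. g t j *\<^sub>R y j)"
proof -
  have "\<forall>t. \<exists>g. v t = (\<Sum>j<t. g j *\<^sub>R y j)" using v by (blast intro: ex_span_image_lessThan)
  from choice[OF this] obtain g where g: "\<And>t. v t = (\<Sum>j<t. g t j *\<^sub>R y j)" by blast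
  show ?thesis by (intro exI[of _ g] allI) (simp only: u g)
qed

text \<open>Single innovation variances need not be bounded; their means are, by the bound on
  \<open>\<kappa>\<close> applied to the averaged triple.\<close>

lemma rho_cesaro_bounded:
  assumes "(\<lambda>T. (\<Sum>t\<le>T. cov (u t) (u t)) / real (T + 1)) \<longlonglongrightarrow> P"
  shows "\<exists>K. \<forall>T. (\<Sum>t\<le>T. rho t) \<le> K * real (T + 1)"
proof -
  let ?w = "\<lambda>t. state_functional f G u t H + u t"
  obtain g where g: "\<And>t. u t = r t + (\<Sum>j<t. g t j *\<^sub>R y j)" using ex_gain by blast
  have no: "noisy_output coordinate_space cov ?w noise" by (rule coding_noisy_output[OF r g y])
  have yy: "noisy_output.y ?w noise = y" by (rule ext) (simp only: noisy_output.y_def[OF no] y)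
  have ueq: "u t = ?w t - state_functional \<Phi> G ?w t H" for t
    unfolding inverse_filter[OF linear_f linear_G f_eq] by simp
  obtain K where K: "\<And>T. \<bar>(\<Sum>t\<le>T. cov (u t) (u t)) / real (T + 1)\<bar> \<le> K"
    using convergent_imp_Bseq[OF convergentI[OF assms]] unfolding Bseq_def by auto
  have "(\<Sum>t\<le>T. rho t) \<le> (1 + 2 * K + 2 * gramian H H) * real (T + 1)" for T
  proof -
    have "(\<Sum>t\<le>T. rho t - 1) / real (T + 1) \<le> 2 * ((\<Sum>t\<le>T. cov (u t) (u t)) / real (T + 1)) + 2 * gramian H H"
      using feasible_kappa_le[OF average_feasible[OF no ueq, of T]]
      unfolding avg_def[OF no ueq] yy innovation_y .
    also have "\<dots> \<le> 2 * K + 2 * gramian H H" using K[of T] by linarith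
    finally have "(\<Sum>t\<le>T. rho t - 1) \<le> (2 * K + 2 * gramian H H) * real (T + 1)"
      by (simp only: pos_divide_le_eq of_nat_0_less_iff zero_less_Suc Suc_eq_plus1[symmetric])
    moreover have "(\<Sum>t\<le>T. rho t - 1) = (\<Sum>t\<le>T. rho t) - real (T + 1)" by (simp add: sum_subtractf)
    ultimately show ?thesis by (simp add: algebra_simps)
  qed
  then show ?thesis by blast
qed

lemma excess_cesaro_null:
  assumes "(\<lambda>T. (\<Sum>t\<le>T. cov (u t) (u t)) / real (T + 1)) \<longlonglongrightarrow> P"
  shows "(\<lambda>T. (\<Sum>t\<le>T. (cc t + leak t)\<^sup>2) / real (T + 1)) \<longlonglongrightarrow> 0"
proof -
  obtain K where K: "\<And>T. (\<Sum>t\<le>T. rho t) \<le> K * real (T + 1)" using rho_cesaro_bounded[OF assms] by blast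
  have r0: "0 \<le> rho t" for t using rho_ge_1[of t] by simp
  have c2: "xx t * rho t = (cc t)\<^sup>2" for t using rho_ge_1[of t] by (simp add: xx_def)
  have A: "(\<lambda>T. (\<Sum>t\<le>T. (cc t)\<^sup>2) / real (T + 1)) \<longlonglongrightarrow> 0"
    unfolding c2[symmetric] by (rule summable_times_cesaro_bounded[OF summable_xx xx_nonneg r0 K])
  have B: "(\<lambda>T. (\<Sum>t\<le>T. (leak t)\<^sup>2) / real (T + 1)) \<longlonglongrightarrow> 0"
    using cesaro_mean[OF tendsto_power[OF leak_null, of 2]] by simp
  have upper: "(\<lambda>T. 2 * ((\<Sum>t\<le>T. (cc t)\<^sup>2) / real (T + 1)) + 2 * ((\<Sum>t\<le>T. (leak t)\<^sup>2) / real (T + 1))) \<longlonglongrightarrow> 0"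
    using tendsto_add[OF tendsto_mult_right_zero[OF A, of 2] tendsto_mult_right_zero[OF B, of 2]] by simp
  have "(cc t + leak t)\<^sup>2 \<le> 2 * (cc t)\<^sup>2 + 2 * (leak t)\<^sup>2" for t
    using zero_le_power2[of "cc t - leak t"] by (simp add: power2_eq_square algebra_simps)
  then have "(\<Sum>t\<le>T. (cc t + leak t)\<^sup>2) / real (T + 1) \<le> (\<Sum>t\<le>T. 2 * (cc t)\<^sup>2 + 2 * (leak t)\<^sup>2) / real (T + 1)" for T
    by (intro divide_right_mono sum_mono) simp_all
  moreover have "(\<Sum>t\<le>T. 2 * (cc t)\<^sup>2 + 2 * (leak t)\<^sup>2) / real (T + 1) =
      2 * ((\<Sum>t\<le>T. (cc t)\<^sup>2) / real (T + 1)) + 2 * ((\<Sum>t\<le>T. (leak t)\<^sup>2) / real (T + 1))" for T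
    by (simp add: sum.distrib sum_distrib_left[symmetric] add_divide_distrib)
  ultimately have le: "(\<Sum>t\<le>T. (cc t + leak t)\<^sup>2) / real (T + 1) \<le>
      2 * ((\<Sum>t\<le>T. (cc t)\<^sup>2) / real (T + 1)) + 2 * ((\<Sum>t\<le>T. (leak t)\<^sup>2) / real (T + 1))" for T
    by simp
  have ge: "0 \<le> (\<Sum>t\<le>T. (cc t + leak t)\<^sup>2) / real (T + 1)" for T
    by (intro divide_nonneg_nonneg sum_nonneg) simp_all
  show ?thesis
    by (rule tendsto_sandwich[OF always_eventually[OF allI[OF ge]] always_eventually[OF allI[OF le]] tendsto_const upper])
qed

end

section \<open>The scheme with one more message coordinate\<close>

context added_mode
begin

text \<open>The residual of the new encoder signal is the cheapest input that conveys it. The predictable part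
  \<open>ext\<close> carries no information; it only tops up the power to that of the given scheme, whose
  average is known to converge.\<close>

definition beta :: "nat \<Rightarrow> real" where
  "beta t = cov (u t) (u t) - cov (p.R t (r t)) (p.R t (r t))"

primrec ext :: process where
  "ext 0 = 0"
| "ext (Suc s) = sqrt (beta (Suc s) / rho' s) *\<^sub>R p'.R s (pl' s)"

definition up :: process where "up t = p'.R t (r' t) + ext t"

definition yp :: process where "yp t = state_functional f G up t H + up t + noise t"

lemma r_mem [simp, intro]: "r t \<in> coordinate_space"
  by (rule V_orth(1)[OF r_V[of t 0]])

lemma r'_mem [simp, intro]: "r' t \<in> coordinate_space"
  unfolding r'_def by (intro coord.mem r_mem message_mem)

lemma beta_nonneg: "0 \<le> beta t"
proof -
  have "- v t \<in> span (pl ` {..<t})" unfolding span_pl by (rule span_neg[OF v])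
  from p.residual_minimal[OF r_mem this, of t] show ?thesis by (simp add: beta_def u)
qed

text \<open>Nothing is fed back at time 0, so there is no power to top up; this agrees with
  \<open>ext 0 = 0\<close>.\<close>

lemma beta_0: "beta 0 = 0"
  using v[of 0] by (simp add: beta_def u)

lemma ext_span: "ext t \<in> span (pl' ` {..<t})"
  by (cases t) (simp_all add: span_zero span_scale p'.innovation_span)

text \<open>The top-up scales the latest innovation, a function of past outputs whose variance
  \<open>rho' s\<close> is known and at least 1.\<close>

lemma cov_ext: "cov (ext t) (ext t) = beta t"
proof (cases t)
  case 0
  then show ?thesis by (simp add: beta_0 coord.bilinear)
next
  case (Suc s)
  have "cov (ext t) (ext t) = sqrt (beta t / rho' s) * (sqrt (beta t / rho' s) * rho' s)"
    unfolding Suc by (simp add: coord.bilinear rho'_def)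
  then show ?thesis using rho'_ge_1[of s] beta_nonneg[of t] by (simp add: mult.assoc[symmetric])
qed

lemma cov_up: "cov (up t) (up t) = cov (p'.R t (r' t)) (p'.R t (r' t)) + beta t"
  unfolding up_def using p'.Pythagoras[OF r'_mem ext_span] by (simp only: cov_ext)

lemma cov_up_bounds: "cov (u t) (u t) \<le> cov (up t) (up t)" "cov (up t) (up t) \<le> cov (u t) (u t) + (cc t + leak t)\<^sup>2"
  unfolding cov_up beta_def using residual_r'_lower[of t] residual_r'_upper[of t] by simp_all

lemma up_power:
  assumes P: "(\<lambda>T. (\<Sum>t\<le>T. cov (u t) (u t)) / real (T + 1)) \<longlonglongrightarrow> P"
  shows "(\<lambda>T. (\<Sum>t\<le>T. cov (up t) (up t)) / real (T + 1)) \<longlonglongrightarrow> P"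
proof -
  have upper: "(\<lambda>T. (\<Sum>t\<le>T. cov (u t) (u t)) / real (T + 1) + (\<Sum>t\<le>T. (cc t + leak t)\<^sup>2) / real (T + 1)) \<longlonglongrightarrow> P"
    using tendsto_add[OF P excess_cesaro_null[OF P]] by simp
  have ge: "(\<Sum>t\<le>T. cov (u t) (u t)) / real (T + 1) \<le> (\<Sum>t\<le>T. cov (up t) (up t)) / real (T + 1)" for T
    by (intro divide_right_mono sum_mono cov_up_bounds) simp
  have le: "(\<Sum>t\<le>T. cov (up t) (up t)) / real (T + 1) \<le>
      (\<Sum>t\<le>T. cov (u t) (u t)) / real (T + 1) + (\<Sum>t\<le>T. (cc t + leak t)\<^sup>2) / real (T + 1)" for T
    unfolding add_divide_distrib[symmetric] sum.distrib[symmetric]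
    by (intro divide_right_mono sum_mono cov_up_bounds) simp
  show ?thesis
    by (rule tendsto_sandwich[OF always_eventually[OF allI[OF ge]] always_eventually[OF allI[OF le]] P upper])
qed

lemma up_r'_span: "up t - r' t \<in> span (pl' ` {..<t})"
proof -
  have "ext t - (r' t - p'.R t (r' t)) \<in> span (pl' ` {..<t})"
    by (rule span_diff[OF ext_span p'.diff_residual_span])
  then show ?thesis by (simp add: up_def algebra_simps)
qed

lemma yp_pl'_span: "yp t - pl' t \<in> span (pl' ` {..<t})"
proof -
  let ?v = "\<lambda>t. up t - r' t"
  have "state_functional f G up t H = state_functional f G (\<lambda>t. r' t + ?v t) t H" by simp
  then have "yp t - pl' t = state_functional f G ?v t H + ?v t"
    unfolding yp_def pl'_eq state_functional_add by simp
  then show ?thesis using causal_span[of ?v pl', OF up_r'_span] by simp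
qed

lemma span_yp: "span (yp ` {..<t}) = span (pl' ` {..<t})"
  by (rule span_unitriangular[OF yp_pl'_span])

lemma innovation_yp: "innovation_var cov yp t = rho' t"
proof -
  have "yp t \<in> coordinate_space" for t
  proof -
    have "(yp t - pl' t) + pl' t \<in> coordinate_space" by (intro coord.mem(2) p'.span_y_mem[OF yp_pl'_span] pl'_mem)
    then show ?thesis by simp
  qed
  then show ?thesis unfolding rho'_def
    by (intro coord.innovation_var_cong[OF pl'_mem _ span_yp[symmetric] pl'_mem yp_pl'_span, symmetric])
qed

lemma ex_gain': "\<exists>g. \<forall>t. up t = r' t + (\<Sum>j<t. g t j *\<^sub>R yp j)"
proof -
  have "\<forall>t. \<exists>g. up t - r' t = (\<Sum>j<t. g j *\<^sub>R yp j)"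
    using up_r'_span unfolding span_yp[symmetric] by (blast intro: ex_span_image_lessThan)
  from choice[OF this] obtain g where g: "\<And>t. up t - r' t = (\<Sum>j<t. g t j *\<^sub>R yp j)" by blast
  show ?thesis by (intro exI[of _ g] allI) (simp add: g[symmetric])
qed

text \<open>By \<open>ln (1 + x) \<le> x\<close> the gain at time \<open>t\<close> is at most
  \<open>xx t / ln 2\<close>, a null sequence.\<close>

lemma information_cesaro:
  "(\<lambda>T. ((\<Sum>t\<le>T. 1 / 2 * log 2 (rho' t)) - (\<Sum>t\<le>T. 1 / 2 * log 2 (rho t))) / real (T + 1)) \<longlonglongrightarrow> 0"
proof -
  have d: "0 \<le> 1 / 2 * log 2 (rho' t) - 1 / 2 * log 2 (rho t)"
    "1 / 2 * log 2 (rho' t) - 1 / 2 * log 2 (rho t) \<le> xx t / ln 2" for t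
  proof -
    have r: "0 < rho t" "0 < rho' t" using rho_ge_1[of t] rho'_ge_1[of t] by simp_all
    show "0 \<le> 1 / 2 * log 2 (rho' t) - 1 / 2 * log 2 (rho t)" using rho_le_rho'[of t] r by simp
    have "ln (rho' t) \<le> ln (rho t * (1 + xx t))" using rho'_le[of t] r by simp
    also have "\<dots> = ln (rho t) + ln (1 + xx t)" using r xx_nonneg[of t] by (simp add: ln_mult)
    also have "ln (1 + xx t) \<le> xx t" using xx_nonneg by (rule ln_add_one_self_le_self)
    finally have "(ln (rho' t) - ln (rho t)) / ln 2 \<le> xx t / ln 2" by (intro divide_right_mono) simp_all
    moreover have "0 \<le> xx t / ln 2" using xx_nonneg[of t] by simp
    ultimately show "1 / 2 * log 2 (rho' t) - 1 / 2 * log 2 (rho t) \<le> xx t / ln 2"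
      unfolding log_def diff_divide_distrib by linarith
  qed
  have "(\<lambda>t. xx t / ln 2) \<longlonglongrightarrow> 0"
    using tendsto_divide[OF summable_LIMSEQ_zero[OF summable_xx] tendsto_const, of "ln 2"] by simp
  from cesaro_mean[OF this] have upper: "(\<lambda>T. (\<Sum>t\<le>T. xx t / ln 2) / real (T + 1)) \<longlonglongrightarrow> 0" .
  have ge: "0 \<le> ((\<Sum>t\<le>T. 1 / 2 * log 2 (rho' t)) - (\<Sum>t\<le>T. 1 / 2 * log 2 (rho t))) / real (T + 1)" for T
    unfolding sum_subtractf[symmetric] using d by (intro divide_nonneg_nonneg sum_nonneg) simp_all
  have le: "((\<Sum>t\<le>T. 1 / 2 * log 2 (rho' t)) - (\<Sum>t\<le>T. 1 / 2 * log 2 (rho t))) / real (T + 1) \<le>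
      (\<Sum>t\<le>T. xx t / ln 2) / real (T + 1)" for T
    unfolding sum_subtractf[symmetric] using d by (intro divide_right_mono sum_mono) simp_all
  show ?thesis
    by (rule tendsto_sandwich[OF always_eventually[OF allI[OF ge]] always_eventually[OF allI[OF le]] tendsto_const upper])
qed

lemma r'_span: "r' t \<in> span (message ` {..Suc n})"
proof -
  have "r t \<in> span (message ` {..Suc n})"
    by (rule subsetD[OF span_mono r]) auto
  moreover have "W \<in> span (message ` {..Suc n})" by (rule span_base) simp
  ultimately show ?thesis unfolding r'_def by (intro span_add span_scale)
qed

lemma up_mem [simp, intro]: "up t \<in> coordinate_space"
  unfolding up_def by (intro coord.mem(2) p'.residual_mem r'_mem p'.span_y_mem[OF ext_span])

lemma information_limit:
  assumes "(\<lambda>T. ereal (1 / real (T + 1) * coding_information n y T)) \<longlonglongrightarrow> Rt"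
  shows "(\<lambda>T. ereal (1 / real (T + 1) * coding_information (Suc n) yp T)) \<longlonglongrightarrow> Rt"
proof -
  obtain g where g: "\<And>t. u t = r t + (\<Sum>j<t. g t j *\<^sub>R y j)" using ex_gain by blast
  obtain g' where g': "\<And>t. up t = r' t + (\<Sum>j<t. g' t j *\<^sub>R yp j)" using ex_gain' by blast
  have i: "coding_information n y T = (\<Sum>t\<le>T. 1 / 2 * log 2 (rho t))" for T
    unfolding coding_information_innovation[OF r g y] innovation_y ..
  have i': "coding_information (Suc n) yp T = (\<Sum>t\<le>T. 1 / 2 * log 2 (rho' t))" for T
    unfolding coding_information_innovation[OF r'_span g' yp_def] innovation_yp ..
  \<comment> \<open>\<open>Rt\<close> is an extended real and may be infinite here, so a real null
    sequence is added instead of comparing differences.\<close>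
  have "(\<lambda>T. ereal (1 / real (T + 1) * coding_information n y T) +
      ereal ((coding_information (Suc n) yp T - coding_information n y T) / real (T + 1))) \<longlonglongrightarrow> Rt + ereal 0"
    using information_cesaro unfolding i[symmetric] i'[symmetric]
    by (intro tendsto_add_ereal_general1[OF _ assms]) simp_all
  then show ?thesis by (simp add: diff_divide_distrib)
qed

end

section \<open>The enlarged encoder\<close>

definition add_mode_mat :: "nat \<Rightarrow> rmat \<Rightarrow> real \<Rightarrow> rmat" where
  "add_mode_mat d A a = Matrix.mat (Suc d) (Suc d) (\<lambda>(i, j). if i < d \<and> j < d then A $$ (i, j) else if i = j then a else 0)"

definition add_mode_vec :: "nat \<Rightarrow> rvec \<Rightarrow> rvec" where
  "add_mode_vec d C = Matrix.vec (Suc d) (\<lambda>i. if i < d then C $ i else 1)"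

lemma add_mode_carrier [simp]: "add_mode_mat d A a \<in> carrier_mat (Suc d) (Suc d)" "add_mode_vec d C \<in> carrier_vec (Suc d)"
  by (simp_all add: add_mode_mat_def add_mode_vec_def)

lemma add_mode_dual:
  assumes A: "A \<in> carrier_mat d d" and C: "C \<in> carrier_vec d"
  shows "(dual_map (add_mode_mat d A a) ^^ t) (vec_fun (add_mode_vec d C)) i =
    (if i < d then (dual_map A ^^ t) (vec_fun C) i else if i = d then a ^ t else 0)"
proof (induction t arbitrary: i)
  case 0
  show ?case using C by (simp add: vec_fun_def add_mode_vec_def)
next
  case (Suc t)
  let ?h = "(dual_map (add_mode_mat d A a) ^^ t) (vec_fun (add_mode_vec d C))"
  have "(dual_map (add_mode_mat d A a) ^^ Suc t) (vec_fun (add_mode_vec d C)) i =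
      (if i < Suc d then (\<Sum>l<d. ?h l * add_mode_mat d A a $$ (l, i)) + ?h d * add_mode_mat d A a $$ (d, i) else 0)"
    by (simp add: dual_map_def add_mode_mat_def)
  also have "\<dots> = (if i < d then (dual_map A ^^ Suc t) (vec_fun C) i else if i = d then a ^ Suc t else 0)"
    unfolding Suc using A by (simp add: add_mode_mat_def dual_map_def mult.commute less_Suc_eq)
  finally show ?case .
qed

lemma add_mode_signal:
  assumes A: "A \<in> carrier_mat (n + 1) (n + 1)" and C: "C \<in> carrier_vec (n + 1)"
  shows "encoder_signal (Suc n) (add_mode_mat (n + 1) A a) (add_mode_vec (n + 1) C) t =
    encoder_signal n A C t + a ^ t *\<^sub>R message (Suc n)"
proof -
  have "encoder_signal (Suc n) (add_mode_mat (n + 1) A a) (add_mode_vec (n + 1) C) t =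
      (\<Sum>i<Suc (n + 1). (if i < n + 1 then (dual_map A ^^ t) (vec_fun C) i else if i = n + 1 then a ^ t else 0) *\<^sub>R message i)"
    unfolding encoder_signal_def add_mode_dual[OF A C] by simp
  also have "\<dots> = encoder_signal n A C t + a ^ t *\<^sub>R message (Suc n)"
    unfolding sum.lessThan_Suc[of _ "n + 1"] encoder_signal_def by simp
  finally show ?thesis .
qed

lemma add_mode_eigenvalue:
  assumes A: "A \<in> carrier_mat d d" and ev: "eigenvalue (cmat (add_mode_mat d A a)) z"
  shows "eigenvalue (cmat A) z \<or> z = complex_of_real a"
proof -
  obtain f where f0: "\<exists>i<Suc d. f i \<noteq> 0"
    and f: "\<And>i. i < Suc d \<Longrightarrow> (\<Sum>j<Suc d. complex_of_real (add_mode_mat d A a $$ (i, j)) * f j) = z * f i"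
    using ev unfolding eigenvalue_cmat_iff[OF add_mode_carrier(1)] by blast
  have 1: "(\<Sum>j<d. complex_of_real (A $$ (i, j)) * f j) = z * f i" if "i < d" for i
    using f[of i] that by (simp add: add_mode_mat_def)
  have 2: "complex_of_real a * f d = z * f d" using f[of d] by (simp add: add_mode_mat_def)
  show ?thesis
  proof (cases "\<exists>i<d. f i \<noteq> 0")
    case True
    then show ?thesis using 1 unfolding eigenvalue_cmat_iff[OF A] by blast
  next
    case False
    then have "f d \<noteq> 0" using f0 by (auto simp: less_Suc_eq)
    then show ?thesis using 2 by simp
  qed
qed

text \<open>Subtracting \<open>a\<close> times the outputs from the outputs one step later
  eliminates the new mode. Observability of the old pair then leaves an eigenvector of
  \<open>A\<close> for \<open>a\<close>, which is excluded unless the old part is zero.\<close>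

lemma add_mode_observable:
  assumes A: "A \<in> carrier_mat d d" and C: "C \<in> carrier_vec d" and o: "observable d A C"
    and na: "\<not> eigenvalue (cmat A) (complex_of_real a)"
  shows "observable (Suc d) (add_mode_mat d A a) (add_mode_vec d C)"
  unfolding observable_iff[OF add_mode_carrier]
proof (rule allI, rule impI)
  fix x assume "\<forall>k. (\<Sum>j<Suc d. (dual_map (add_mode_mat d A a) ^^ k) (vec_fun (add_mode_vec d C)) j * x j) = 0"
  then have x: "(\<Sum>j<d. (dual_map A ^^ k) (vec_fun C) j * x j) + a ^ k * x d = 0" for k
    unfolding add_mode_dual[OF A C] by simp
  \<comment> \<open>The old part of \<open>x\<close> under \<open>A\<close> minus \<open>a\<close>
    times itself.\<close>
  define w where "w l = (\<Sum>j<d. A $$ (l, j) * x j) - a * x l" for l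
  have "(\<Sum>l<d. (dual_map A ^^ k) (vec_fun C) l * w l) = 0" for k
  proof -
    let ?h = "(dual_map A ^^ k) (vec_fun C)"
    have "(\<Sum>j<d. (dual_map A ^^ Suc k) (vec_fun C) j * x j) = (\<Sum>j<d. \<Sum>l<d. ?h l * (A $$ (l, j) * x j))"
      using A by (intro sum.cong refl) (simp add: dual_map_def sum_distrib_right mult.assoc)
    also have "\<dots> = (\<Sum>l<d. \<Sum>j<d. ?h l * (A $$ (l, j) * x j))" by (rule sum.swap)
    also have "\<dots> = (\<Sum>l<d. ?h l * (w l + a * x l))" by (simp add: w_def sum_distrib_left)
    also have "\<dots> = (\<Sum>l<d. ?h l * w l) + a * (\<Sum>l<d. ?h l * x l)"
      by (simp add: distrib_left distrib_right sum.distrib sum_distrib_left mult_ac)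
    finally have "- (a ^ Suc k * x d) = (\<Sum>l<d. ?h l * w l) + a * (- (a ^ k * x d))"
      using x[of "Suc k"] x[of k] by (simp only: eq_neg_iff_add_eq_0[symmetric])
    then show ?thesis by simp
  qed
  then have w: "w l = 0" if "l < d" for l using o that unfolding observable_iff[OF A C] by blast
  have x0: "x j = 0" if "j < d" for j
  proof (rule ccontr)
    assume "x j \<noteq> 0"
    have "eigenvalue (cmat A) (complex_of_real a)"
      unfolding eigenvalue_cmat_iff[OF A]
    proof (intro exI[of _ "\<lambda>j. complex_of_real (x j)"] conjI allI impI)
      show "\<exists>i<d. complex_of_real (x i) \<noteq> 0" using \<open>x j \<noteq> 0\<close> that by auto
      fix i assume "i < d"
      then have "(\<Sum>j<d. A $$ (i, j) * x j) = a * x i" using w[of i] by (simp add: w_def)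
      from arg_cong[OF this, of complex_of_real]
      show "(\<Sum>j<d. complex_of_real (A $$ (i, j)) * complex_of_real (x j)) = complex_of_real a * complex_of_real (x i)" by simp
    qed
    then show False using na by simp
  qed
  moreover have "x d = 0" using x[of 0] x0 by simp
  ultimately show "\<forall>j<Suc d. x j = 0" by (simp add: less_Suc_eq)
qed

lemma finite_eigenvalues: "A \<in> carrier_mat d d \<Longrightarrow> finite {z. eigenvalue (cmat A) z}"
  using card_finite_spectrum(1)[of "cmat A" d] by (simp add: spectrum_def)

lemma ex_fresh_mode:
  assumes A: "A \<in> carrier_mat d d" and F: "F \<in> carrier_mat m m"
  shows "\<exists>a. 0 < a \<and> a < 1 \<and> \<not> eigenvalue (cmat A) (complex_of_real a) \<and> \<not> eigenvalue (cmat F) (complex_of_real a)"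
proof (rule ccontr)
  assume "\<not> ?thesis"
  then have "complex_of_real ` {0<..<1} \<subseteq> {z. eigenvalue (cmat A) z} \<union> {z. eigenvalue (cmat F) z}" by auto
  then have "finite (complex_of_real ` {0<..<1})"
    by (rule finite_subset) (simp add: finite_eigenvalues[OF A] finite_eigenvalues[OF F])
  then have "finite {0<..<1::real}" by (rule finite_imageD) (simp add: inj_on_def)
  then show False by (simp add: infinite_Ioo)
qed

lemma (in dual_system) coding_capacity_Suc:
  assumes dims: "state_space_dims m F Gv Hv"
    and G_eq: "G = dual_vec Gv" and H_eq: "H = vec_fun Hv"
    and F_eq: "\<And>x. dual_map F x = \<Phi> x + G x *\<^sub>R H"
    and F_decay: "\<And>x. \<exists>c\<ge>0. \<forall>j. \<forall>i<m. \<bar>(dual_map F ^^ j) x i\<bar> \<le> c * \<theta> ^ j"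
  shows "coding_capacity F Gv Hv P n \<le> coding_capacity F Gv Hv P (Suc n)"
  unfolding coding_capacity_def[of _ _ _ _ n]
proof (rule Sup_least, clarify)
  fix Rt A C g u y
  assume adm: "admissible_encoder F n A C" and cs: "coding_structure F Gv Hv n A C g u y"
    and pc: "power_constraint P u" and Rt: "(\<lambda>T. ereal (1 / real (T + 1) * coding_information n y T)) \<longlonglongrightarrow> Rt"
  have AC: "A \<in> carrier_mat (n + 1) (n + 1)" "C \<in> carrier_vec (n + 1)" and ob: "observable (n + 1) A C"
    and ev: "\<And>z. eigenvalue (cmat A) z \<Longrightarrow> cmod z \<noteq> 1 \<and> \<not> eigenvalue (cmat F) z"
    using adm by (simp_all add: admissible_encoder_def)
  have F: "F \<in> carrier_mat m m" using dims by (simp add: state_space_dims_def)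
  obtain a where a_pos: "0 < a" and a_less: "a < 1" and nA: "\<not> eigenvalue (cmat A) (complex_of_real a)" and nF: "\<not> eigenvalue (cmat F) (complex_of_real a)"
    using ex_fresh_mode[OF AC(1) F] by blast
  let ?A = "add_mode_mat (n + 1) A a" and ?C = "add_mode_vec (n + 1) C"
  have u: "u t = encoder_signal n A C t + (\<Sum>j<t. g t j *\<^sub>R y j)"
    and y: "y t = state_functional (dual_map F) G u t H + u t + noise t" for t
    using cs unfolding coding_structure_iff[OF dims AC] G_eq H_eq by blast+
  interpret added_mode m \<Phi> G H \<theta> "dual_map F" n "encoder_signal n A C" "\<lambda>t. \<Sum>j<t. g t j *\<^sub>R y j" u y a
    by unfold_locales (rule F_eq F_decay encoder_signal_span sum_in_span_lessThan u y a_pos a_less)+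
  have ACc: "?A \<in> carrier_mat (Suc n + 1) (Suc n + 1)" "?C \<in> carrier_vec (Suc n + 1)"
    using add_mode_carrier[of "n + 1"] by simp_all
  have "admissible_encoder F (Suc n) ?A ?C"
    unfolding admissible_encoder_def
  proof (intro conjI ACc allI impI)
    show "observable (Suc n + 1) ?A ?C" using add_mode_observable[OF AC ob nA] by simp
    fix z assume "eigenvalue (cmat ?A) z"
    then consider "eigenvalue (cmat A) z" | "z = complex_of_real a" using add_mode_eigenvalue[OF AC(1)] by blast
    then have "cmod z \<noteq> 1 \<and> \<not> eigenvalue (cmat F) z"
    proof cases
      case 1
      then show ?thesis by (rule ev)
    next
      case 2
      then show ?thesis using a_pos a_less nF by simp
    qed
    then show "cmod z \<noteq> 1" "\<not> eigenvalue (cmat F) z" by simp_all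
  qed
  moreover obtain g' where g': "\<And>t. up t = r' t + (\<Sum>j<t. g' t j *\<^sub>R yp j)" using ex_gain' by blast
  have er: "encoder_signal (Suc n) ?A ?C t = r' t" for t unfolding add_mode_signal[OF AC] r'_def ..
  have "coding_structure F Gv Hv (Suc n) ?A ?C g' up yp"
    unfolding coding_structure_iff[OF dims ACc] G_eq[symmetric] H_eq[symmetric] er
    by (intro conjI allI g' yp_def)
  moreover have "power_constraint P up"
  proof -
    obtain p where p: "p \<le> P" "average_power u \<longlonglongrightarrow> p" using pc by (auto simp: power_constraint_def)
    then have "average_power up \<longlonglongrightarrow> p"
      using up_power unfolding average_power_coordinate[OF u_mem, abs_def] average_power_coordinate[OF up_mem, abs_def] by blast
    then show ?thesis using p(1) by (auto simp: power_constraint_def)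
  qed
  moreover have "(\<lambda>T. ereal (1 / real (T + 1) * coding_information (Suc n) yp T)) \<longlonglongrightarrow> Rt" by (rule information_limit[OF Rt])
  ultimately show "Rt \<le> coding_capacity F Gv Hv P (Suc n)"
    unfolding coding_capacity_def by (intro Sup_upper) blast
qed

section \<open>Equality of the capacities\<close>

lemma dual_system_channel:
  assumes mp: "stable_min_phase num den" and re: "realizes m F G H den num" and st: "stable_mat F"
  shows "\<exists>\<Phi> \<theta>. dual_system m \<Phi> (dual_vec G) \<theta> \<and> (\<forall>x. dual_map F x = \<Phi> x + dual_vec G x *\<^sub>R vec_fun H) \<and>
    (\<forall>x. \<exists>c\<ge>0. \<forall>j. \<forall>i<m. \<bar>(dual_map F ^^ j) x i\<bar> \<le> c * \<theta> ^ j)"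
proof -
  have dims: "state_space_dims m F G H" using re by (simp add: realizes_def)
  then have F: "F \<in> carrier_mat m m" and G: "G \<in> carrier_vec m" by (simp_all add: state_space_dims_def)
  define M where "M = Matrix.mat m m (\<lambda>(i, j). F $$ (i, j) - G $ i * H $ j)"
  have M: "M \<in> carrier_mat m m" by (simp add: M_def)
  have F_eq: "dual_map F x = dual_map M x + dual_vec G x *\<^sub>R vec_fun H" for x
    unfolding M_def zero_dynamics_mat[OF dims] by simp
  have "stable_mat M" unfolding M_def by (rule zero_dynamics_stable[OF mp re st])
  then obtain \<theta>1 where t1: "0 < \<theta>1" "\<theta>1 < 1"
    and d1: "\<And>x. \<exists>c\<ge>0. \<forall>j. \<forall>i<m. \<bar>(dual_map M ^^ j) x i\<bar> \<le> c * \<theta>1 ^ j"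
    using dual_map_decay[OF M] by blast
  obtain \<theta>2 where t2: "0 < \<theta>2" "\<theta>2 < 1"
    and d2: "\<And>x. \<exists>c\<ge>0. \<forall>j. \<forall>i<m. \<bar>(dual_map F ^^ j) x i\<bar> \<le> c * \<theta>2 ^ j"
    using dual_map_decay[OF F st] by blast
  define \<theta> where "\<theta> = max \<theta>1 \<theta>2"
  have "dual_system m (dual_map M) (dual_vec G) \<theta>"
  proof (rule dual_system.intro)
    show "linear (dual_map M)" by (rule linear_dual_map)
    show "linear (dual_vec G)" by (rule linear_dual_vec)
    show "dual_map M x = dual_map M x'" if "\<And>i. i < m \<Longrightarrow> x i = x' i" for x x'
      using that M by (simp add: dual_map_def fun_eq_iff)
    show "dual_vec G x = dual_vec G x'" if "\<And>i. i < m \<Longrightarrow> x i = x' i" for x x'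
      using that G by (simp add: dual_vec_def)
    show "0 < \<theta>" "\<theta> < 1" using t1 t2 by (simp_all add: \<theta>_def)
    show "\<exists>c\<ge>0. \<forall>j. \<forall>i<m. \<bar>(dual_map M ^^ j) x i\<bar> \<le> c * \<theta> ^ j" for x
      by (rule decay_weaken[OF d1 t1(1)]) (simp add: \<theta>_def)
  qed
  moreover have "\<exists>c\<ge>0. \<forall>j. \<forall>i<m. \<bar>(dual_map F ^^ j) x i\<bar> \<le> c * \<theta> ^ j" for x
    by (rule decay_weaken[OF d2 t2(1)]) (simp add: \<theta>_def)
  ultimately show ?thesis using F_eq by blast
qed

lemma (in dual_system) capacity_attained:
  assumes dims: "state_space_dims m F Gv Hv"
    and G_eq: "G = dual_vec Gv" and H_eq: "H = vec_fun Hv"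
    and F_eq: "\<And>x. dual_map F x = \<Phi> x + G x *\<^sub>R H"
    and F_decay: "\<And>x. \<exists>c\<ge>0. \<forall>j. \<forall>i<m. \<bar>(dual_map F ^^ j) x i\<bar> \<le> c * \<theta> ^ j"
    and st: "stable_mat F" and P: "0 < P"
    and nontrivial: "G ((dual_map F ^^ j0) H) \<noteq> 0"
  shows "\<exists>n<m. feedback_capacity F Gv Hv P \<le> coding_capacity F Gv Hv P n \<and>
    (\<forall>n. coding_capacity F Gv Hv P n \<le> feedback_capacity F Gv Hv P)"
proof -
  from exists_optimum[OF less_imp_le[OF P]] obtain \<sigma> \<gamma> \<kappa> where
    optimum: "feasible P \<sigma> \<gamma> \<kappa> \<and> (\<forall>\<sigma>' \<gamma>' \<kappa>'. feasible P \<sigma>' \<gamma>' \<kappa>' \<longrightarrow> \<kappa>' \<le> \<kappa>) \<and>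
      (\<forall>\<sigma>' \<gamma>'. feasible P \<sigma>' \<gamma>' \<kappa> \<longrightarrow> trace_form \<sigma>' \<le> trace_form \<sigma>)" by (elim exE)
  have f: "feasible P \<sigma> \<gamma> \<kappa>" by (rule conjunct1[OF optimum])
  have opt: "\<kappa>' \<le> \<kappa>" if "feasible P \<sigma>' \<gamma>' \<kappa>'" for \<sigma>' \<gamma>' \<kappa>'
    by (rule conjunct1[OF conjunct2[OF optimum], rule_format, OF that])
  have tr: "trace_form \<sigma>' \<le> trace_form \<sigma>" if "feasible P \<sigma>' \<gamma>' \<kappa>" for \<sigma>' \<gamma>'
    by (rule conjunct2[OF conjunct2[OF optimum], rule_format, OF that])
  have sg: "semi_inner UNIV \<sigma>" using f by (simp add: feasible_def)
  have eq: "\<sigma> x x = \<sigma> (\<Phi> x) (\<Phi> x) + (G x)\<^sup>2 - (G x - \<gamma> (\<Phi> x))\<^sup>2 / (\<kappa> + 1)" for x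
    by (rule optimum_riccati_eq[OF f opt tr])
  have "\<exists>r\<le>m. \<exists>l. (\<forall>i<r. \<forall>j<r. \<sigma> (l i) (l j) = (if i = j then 1 else 0)) \<and>
      (\<forall>x y. \<sigma> x y = (\<Sum>i<r. \<sigma> x (l i) * \<sigma> y (l i)))"
    by (rule orthonormal_system[OF sg feasible_tail_null[OF f]])
  then obtain r l where r: "r \<le> m"
    and ons: "\<forall>i<r. \<forall>j<r. \<sigma> (l i) (l j) = (if i = j then 1 else 0)" "\<forall>x y. \<sigma> x y = (\<Sum>i<r. \<sigma> x (l i) * \<sigma> y (l i))"
    by (elim exE conjE) (rule that)
  have orth: "\<sigma> (l i) (l j) = (if i = j then 1 else 0)" if "i < r" "j < r" for i j
    by (rule ons(1)[rule_format, OF that])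
  have pars: "\<sigma> x y = (\<Sum>i<r. \<sigma> x (l i) * \<sigma> y (l i))" for x y
    by (rule ons(2)[rule_format])
  \<comment> \<open>State matrix and zero dynamics differ only by the feedback of \<open>G\<close>
    through \<open>H\<close>. If \<open>G\<close> vanished on the whole orbit of \<open>H\<close>
    under \<open>\<Phi>\<close>, both orbits would coincide.\<close>
  have "\<exists>j. G ((\<Phi> ^^ j) H) \<noteq> 0"
  proof (rule ccontr)
    assume "\<not> ?thesis"
    then have 0: "G ((\<Phi> ^^ j) H) = 0" for j by blast
    have "(dual_map F ^^ j) H = (\<Phi> ^^ j) H" for j
    proof (induction j)
      case (Suc j)
      have "dual_map F ((\<Phi> ^^ j) H) = \<Phi> ((\<Phi> ^^ j) H)" unfolding F_eq 0 by simp
      then show ?case by (simp only: funpow.simps(2) comp_def Suc)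
    qed simp
    then show False using nontrivial 0 by simp
  qed
  then obtain j where j: "G ((\<Phi> ^^ j) H) \<noteq> 0" ..
  have nf1: "(\<Sum>i<r. (\<gamma> (l i))\<^sup>2) = \<kappa>"
    by (rule optimum_no_fresh_noise(1)[OF f opt eq orth pars j])
  have nf2: "\<gamma> x = (\<Sum>i<r. \<sigma> x (l i) * \<gamma> (l i))" for x
    by (rule optimum_no_fresh_noise(2)[OF f opt eq orth pars j])
  have os: "optimal_system m \<Phi> G H \<theta> (dual_map F) P \<kappa> \<sigma> \<gamma> r l"
    by (rule optimal_system.intro[OF dual_system_axioms optimal_system_axioms.intro[OF f eq orth pars nf1 nf2 F_eq F_decay]])
  \<comment> \<open>A positive \<open>\<kappa>\<close> forces \<open>r \<ge> 1\<close>; encoders are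
    indexed by their dimension minus one, hence \<open>r - 1 < m\<close>.\<close>
  have "0 < \<kappa>" using opt[OF feasible_white[OF less_imp_le[OF P]]] P by simp
  then have "r \<noteq> 0" using nf1 by (cases r) simp_all
  then have r1: "r = (r - 1) + 1" and rm: "r - 1 < m" using r by simp_all
  have fb: "feedback_capacity F Gv Hv P = ereal (1 / 2 * log 2 (1 + \<kappa>))"
    by (rule antisym[OF feedback_capacity_le[OF dims G_eq H_eq F_eq opt P]
          optimal_system.feedback_capacity_ge[OF os dims G_eq H_eq refl st r1 opt P]])
  show ?thesis
    unfolding fb
  proof (intro exI[of _ "r - 1"] conjI rm allI)
    show "ereal (1 / 2 * log 2 (1 + \<kappa>)) \<le> coding_capacity F Gv Hv P (r - 1)"
      by (rule optimal_system.coding_capacity_ge[OF os dims G_eq H_eq refl st r1 opt P])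
    show "coding_capacity F Gv Hv P n \<le> ereal (1 / 2 * log 2 (1 + \<kappa>))" for n
      by (rule coding_capacity_le[OF dims G_eq H_eq F_eq opt P])
  qed
qed

theorem proposition8:
  fixes num den :: "real poly"
    and m :: nat and F :: "real Matrix.mat" and G H :: "real Matrix.vec"
    and P :: real
  assumes "stable_min_phase num den"
    and "(rational_tf num den \<longlongrightarrow> 1) at_infinity"
    and "minimal_realization m F G H den num"
    and "stable_mat F"
    and "P > 0"
  shows "mono (coding_capacity F G H P) \<and>
    (m \<ge> 1 \<longrightarrow> (\<forall>n\<ge>m - 1. coding_capacity F G H P n = feedback_capacity F G H P))"
proof -
  have re: "realizes m F G H den num" using assms(3) by (simp add: minimal_realization_def)
  then have dims: "state_space_dims m F G H" by (simp add: realizes_def)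
  obtain \<Phi> \<theta> where ds: "dual_system m \<Phi> (dual_vec G) \<theta>"
    and F_eq: "\<And>x. dual_map F x = \<Phi> x + dual_vec G x *\<^sub>R vec_fun H"
    and decay: "\<And>x. \<exists>c\<ge>0. \<forall>j. \<forall>i<m. \<bar>(dual_map F ^^ j) x i\<bar> \<le> c * \<theta> ^ j"
    using dual_system_channel[OF assms(1) re assms(4)] by blast
  have mono: "mono (coding_capacity F G H P)"
    unfolding mono_iff_le_Suc
    by (intro allI dual_system.coding_capacity_Suc[OF ds dims refl refl F_eq decay])
  have "coding_capacity F G H P n = feedback_capacity F G H P" if m: "1 \<le> m" and n: "m - 1 \<le> n" for n
  proof -
    obtain j where "dual_vec G ((dual_map F ^^ j) (vec_fun H)) \<noteq> 0"
      using minimal_realization_nontrivial[OF assms(1,3,4) m] by blast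
    from dual_system.capacity_attained[OF ds dims refl refl F_eq decay assms(4,5) this]
    obtain n0 where n0: "n0 < m" "feedback_capacity F G H P \<le> coding_capacity F G H P n0"
      and le: "\<And>n. coding_capacity F G H P n \<le> feedback_capacity F G H P" by blast
    have "coding_capacity F G H P n0 \<le> coding_capacity F G H P n" using n0(1) n by (intro monoD[OF mono]) simp
    then show ?thesis by (rule antisym[OF le order.trans[OF n0(2)]])
  qed
  then show ?thesis using mono by blast
qed

end
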